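(* Let $n\ge 1$ be odd and $l\ge 0$ an integer, and consider the differential equation $$y'''(z)-(\alpha\wp(z;\tau)+B)y'(z)+\beta\wp'(z;\tau)y(z)=0 \qquad (\mathrm{E})$$ with $\alpha=n^2+3nl+3l^2+3l+2n$, $\beta=(l-1)(n+l)(n+2l+2)/2$ and $B\in\mathbb{C}$. Then there is a polynomial $P_{n,l}(B)$ (depending on $\tau$) of degree $\frac{n+1}{2}$ in $B$ such that $0$ is an apparent singularity of (E) if and only if $P_{n,l}(B)=0$. In this case: (1) If $l$ is odd, then the monodromy of (E) cannot be unitary. (2) If $l$ is even, then the monodromy group of (E) is the Klein four-group $K_4$, and so the monodromy is unitary. Finally, the polynomial $P_{n,l}(B)$ has $\frac{n+1}{2}$ distinct roots except for at most $\lceil\frac{n^2-1}{24}\rceil$ values of $\tau$ modulo $SL(2,\mathbb{Z})$.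
   Context: Here $\tau\in\mathbb{H}=\{\tau\in\mathbb{C}:\operatorname{Im}\tau>0\}$, $\omega_1=1$, $\omega_2=\tau$, $E_\tau=\mathbb{C}/(\mathbb{Z}+\mathbb{Z}\tau)$, and $\wp(z)=\wp(z;\tau)$ is the Weierstrass $\wp$-function with periods $1,\tau$. The local exponents of (E) at $z=0$ are the three distinct integers $-n-l,\ 1-l,\ n+2l+2$. The singularity $0$ is called apparent if no solution of (E) has a logarithmic singularity at $0$; equivalently, all solutions are single-valued and meromorphic near $0$ (and hence meromorphic in $\mathbb{C}$). In that case, given a basis $(y_0,y_1,y_2)$ of solutions, the monodromy matrices $N_1,N_2\in SL(3,\mathbb{C})$ are defined by $(y_0,y_1,y_2)(z+\omega_j)=(y_0,y_1,y_2)(z)N_j$, $j=1,2$; they commute, and the monodromy group is the group generated by $N_1,N_2$ (well defined up to conjugation). The monodromy is called unitary if there is a basis of solutions for which the monodromy group is contained in the unitary group, i.e. $N_1,N_2\in SU(3)$. (If $0$ is not apparent, the monodromy is not unitary.) $\lceil a\rceil=\min\{b\in\mathbb{Z}: b\ge a\}$. "Modulo $SL(2,\mathbb{Z})$" refers to the action of $SL(2,\mathbb{Z})$ on $\mathbb{H}$ by Möbius transformations. *)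

theory Defs
  imports
    "HOL-Complex_Analysis.Complex_Analysis"
    "HOL-Computational_Algebra.Polynomial"
    "HOL-Algebra.Generated_Groups"
    "HOL-Algebra.Elementary_Groups"
begin

definition lattice :: "complex \<Rightarrow> complex set" where
  "lattice \<tau> = {of_int a + of_int b * \<tau> | a b. True}"

text \<open>The values at lattice points are meaningless (division by zero) and are never used.\<close>
definition wp :: "complex \<Rightarrow> complex \<Rightarrow> complex" where
  "wp \<tau> z = 1 / z\<^sup>2 + (\<Sum>\<^sub>\<infinity>w\<in>lattice \<tau> - {0}. 1 / (z - w)\<^sup>2 - 1 / w\<^sup>2)"

definition alpha :: "nat \<Rightarrow> nat \<Rightarrow> complex" where
  "alpha n l = of_nat (n\<^sup>2 + 3 * n * l + 3 * l\<^sup>2 + 3 * l + 2 * n)"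

definition beta :: "nat \<Rightarrow> nat \<Rightarrow> complex" where
  "beta n l = (of_nat l - 1) * of_nat (n + l) * of_nat (n + 2 * l + 2) / 2"

text \<open>Here \<open>S\<close> is meant to be an open set free of lattice points.\<close>
definition solution_on ::
  "complex \<Rightarrow> nat \<Rightarrow> nat \<Rightarrow> complex \<Rightarrow> complex set \<Rightarrow> (complex \<Rightarrow> complex) \<Rightarrow> bool" where
  "solution_on \<tau> n l B S y \<longleftrightarrow>
     y holomorphic_on S \<and>
     (\<forall>z\<in>S. (deriv ^^ 3) y z - (alpha n l * wp \<tau> z + B) * deriv y z
             + beta n l * deriv (wp \<tau>) z * y z = 0)"

text \<open>
  All solutions near \<open>0\<close> are single-valued and meromorphic. The (a priori multivalued) solutions
  on a punctured disc free of nonzero lattice points are represented by their branches on the disc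
  slit along the nonpositive real axis; every local solution extends to that simply connected
  domain.
\<close>
definition apparent :: "complex \<Rightarrow> nat \<Rightarrow> nat \<Rightarrow> complex \<Rightarrow> bool" where
  "apparent \<tau> n l B \<longleftrightarrow>
     (\<exists>r>0. ball 0 r \<inter> lattice \<tau> = {0} \<and>
        (\<forall>y. solution_on \<tau> n l B (ball 0 r - \<real>\<^sub>\<le>\<^sub>0) y \<longrightarrow>
           (\<exists>f. f meromorphic_on ball 0 r \<and> (\<forall>z\<in>ball 0 r - \<real>\<^sub>\<le>\<^sub>0. f z = y z))))"

definition global_solution ::
  "complex \<Rightarrow> nat \<Rightarrow> nat \<Rightarrow> complex \<Rightarrow> (complex \<Rightarrow> complex) \<Rightarrow> bool" where
  "global_solution \<tau> n l B y \<longleftrightarrow> y meromorphic_on UNIV \<and> solution_on \<tau> n l B (- lattice \<tau>) y"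

text \<open>
  Since the values of a meromorphic function at its poles are arbitrary, solutions are compared
  outside the lattice only.
\<close>
definition solution_basis ::
  "complex \<Rightarrow> nat \<Rightarrow> nat \<Rightarrow> complex \<Rightarrow> (3 \<Rightarrow> complex \<Rightarrow> complex) \<Rightarrow> bool" where
  "solution_basis \<tau> n l B y \<longleftrightarrow>
     (\<forall>k. global_solution \<tau> n l B (y k)) \<and>
     (\<forall>c. (\<forall>z\<in>- lattice \<tau>. (\<Sum>k\<in>UNIV. c k * y k z) = 0) \<longrightarrow> (\<forall>k. c k = 0)) \<and>
     (\<forall>f. global_solution \<tau> n l B f \<longrightarrow>
        (\<exists>c. \<forall>z\<in>- lattice \<tau>. f z = (\<Sum>k\<in>UNIV. c k * y k z)))"

text \<open>\<open>(y\<^sub>0, y\<^sub>1, y\<^sub>2)(z + \<omega>) = (y\<^sub>0, y\<^sub>1, y\<^sub>2)(z) N\<close>, with row vectors.\<close>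
definition monodromy_matrix ::
  "complex \<Rightarrow> (3 \<Rightarrow> complex \<Rightarrow> complex) \<Rightarrow> complex \<Rightarrow> complex^3^3 \<Rightarrow> bool" where
  "monodromy_matrix \<tau> y \<omega> N \<longleftrightarrow>
     (\<forall>z\<in>- lattice \<tau>. (\<chi> k. y k (z + \<omega>)) = (\<chi> k. y k z) v* N)"

definition monodromy_matrices ::
  "complex \<Rightarrow> nat \<Rightarrow> nat \<Rightarrow> complex \<Rightarrow> complex^3^3 \<Rightarrow> complex^3^3 \<Rightarrow> bool" where
  "monodromy_matrices \<tau> n l B N1 N2 \<longleftrightarrow>
     apparent \<tau> n l B \<and>
     (\<exists>y. solution_basis \<tau> n l B y \<and>
          monodromy_matrix \<tau> y 1 N1 \<and> monodromy_matrix \<tau> y \<tau> N2)"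

definition SL3 :: "(complex^3^3) monoid" where
  "SL3 = \<lparr>carrier = {A. det A = 1}, mult = (**), one = mat 1\<rparr>"

definition SU3 :: "(complex^3^3) set" where
  "SU3 = {A. (\<chi> i j. cnj (A $ j $ i)) ** A = mat 1 \<and> det A = 1}"

definition monodromy_group :: "complex^3^3 \<Rightarrow> complex^3^3 \<Rightarrow> (complex^3^3) monoid" where
  "monodromy_group N1 N2 = SL3\<lparr>carrier := generate SL3 {N1, N2}\<rparr>"

definition unitary_monodromy :: "complex \<Rightarrow> nat \<Rightarrow> nat \<Rightarrow> complex \<Rightarrow> bool" where
  "unitary_monodromy \<tau> n l B \<longleftrightarrow>
     (\<exists>N1 N2. monodromy_matrices \<tau> n l B N1 N2 \<and> carrier (monodromy_group N1 N2) \<subseteq> SU3)"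

definition K4 :: "(int \<times> int) monoid" where
  "K4 = integer_mod_group 2 \<times>\<times> integer_mod_group 2"

text \<open>
  The monodromy group is defined only up to conjugation: every choice of basis is required to give
  a copy of the Klein four-group, and the first conjunct ensures that a choice exists.
\<close>
definition monodromy_group_is_K4 :: "complex \<Rightarrow> nat \<Rightarrow> nat \<Rightarrow> complex \<Rightarrow> bool" where
  "monodromy_group_is_K4 \<tau> n l B \<longleftrightarrow>
     (\<exists>N1 N2. monodromy_matrices \<tau> n l B N1 N2) \<and>
     (\<forall>N1 N2. monodromy_matrices \<tau> n l B N1 N2 \<longrightarrow>
        {N1, N2} \<subseteq> carrier SL3 \<and> monodromy_group N1 N2 \<cong> K4)"

definition SL2Z_equiv :: "(complex \<times> complex) set" where
  "SL2Z_equiv = {(\<tau>, \<tau>'). Im \<tau> > 0 \<and> Im \<tau>' > 0 \<and>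
     (\<exists>a b c d :: int. a * d - b * c = 1 \<and>
        \<tau>' = (of_int a * \<tau> + of_int b) / (of_int c * \<tau> + of_int d))}"

end

theory Submission
  imports Defs "Subresultants.Subresultant_Gcd" "HOL-Computational_Algebra.Field_as_Ring"
    "HOL-Computational_Algebra.Fundamental_Theorem_Algebra"
begin

text \<open>
  The Frobenius recursion started at the lowest exponent \<open>-n - l\<close> meets its only obstruction after
  \<open>(n + 1) / 2\<close> steps, at the exponent \<open>1 - l\<close>; that obstruction, as a function of \<open>B\<close>, is the polynomial.
  When it vanishes, the principal part of the Frobenius series is realised by derivatives of a
  function with a single pole per period cell and a sign character as multiplier (\<open>\<wp>\<close> itself for the
  trivial character). Linear algebra removes the remaining poles of the left-hand side of the equation,
  which then vanishes by Liouville's theorem.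

  For even \<open>l\<close> the three nontrivial sign characters of the lattice yield a basis of solutions, whence the
  Klein four-group. For odd \<open>l\<close> the trivial character yields two even elliptic solutions, which reduce the
  equation to quadratures; an odd solution has doubly periodic modulus if the monodromy is unitary,
  although it vanishes at the origin.

  The polynomial is weighted homogeneous in \<open>B\<close> and the Laurent coefficients \<open>u\<close>, \<open>v\<close> of \<open>\<wp>\<close>, so its
  discriminant has weight \<open>(n\<^sup>2 - 1) / 4\<close> when \<open>u\<close> and \<open>v\<close> have weights 2 and 3. It is not identically zero,
  as the degeneration of \<open>\<wp>\<close> to the cosecant shows, so it vanishes for at most
  \<open>\<lceil>(n\<^sup>2 - 1) / 24\<rceil>\<close> values of the invariant \<open>v\<^sup>2 / u\<^sup>3\<close>, which separates lattices up to homothety.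
\<close>

no_notation vec_index (infixl \<open>$\<close> 100)
no_notation index_mat (infixl \<open>$$\<close> 100)
hide_const (open) Determinant.det Matrix.mat module.smult Coset.order
notation fls_nth (infixl \<open>$$\<close> 75)
notation vec_nth (infixl \<open>$h\<close> 90)

section \<open>The Frobenius polynomial\<close>

text \<open>The obstacle is the third exponent: a root of the polynomial removes the logarithm
  between \<open>- n - l\<close> and \<open>1 - l\<close>, but says nothing about a resonance at
  \<open>n + 2 * l + 2\<close>, which for even \<open>l\<close> has the parity of the other two.
  Instead of continuing the formal series, global solutions are found by counting. The Frobenius
  recursion kills the poles of the left-hand side of order above \<open>l\<close>, parity kills
  every second order, and the remaining orders 2, 4, ..., l (\<open>l\<close> even) or 1, 3, ..., l
  (\<open>l\<close> odd) face the free poles of order below \<open>l\<close>. For even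
  \<open>l\<close> the Frobenius part is the one unknown in excess. For odd \<open>l\<close> order 1
  is a residue and vanishes by integration by parts; with the constant function as an additional
  unknown this gives an excess of two, hence two solutions. The ceiling in the last bound is due to
  the class \<open>u = 0\<close>: a polynomial of weight e has degree at most e / 6 in
  \<open>v^2 / u^3\<close>, and it vanishes at \<open>u = 0\<close> only if its degree is strictly
  smaller.\<close>

definition indicial :: "nat \<Rightarrow> nat \<Rightarrow> complex \<Rightarrow> complex" where
  "indicial n l t = t * (t - 1) * (t - 2) - alpha n l * t - 2 * beta n l"

lemma indicial_factor:
  "indicial n l t = (t + of_nat n + of_nat l) * (t - 1 + of_nat l) * (t - of_nat n - 2 * of_nat l - 2)"
  unfolding indicial_def alpha_def beta_def by (simp add: field_simps power2_eq_square)

lemma indicial_eq_0_iff: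
  "indicial n l (of_int k) = 0 \<longleftrightarrow> k = - int (n + l) \<or> k = 1 - int l \<or> k = int (n + 2 * l + 2)"
proof -
  have "indicial n l (of_int k) =
    of_int ((k + int (n + l)) * (k - (1 - int l)) * (k - int (n + 2 * l + 2)))"
    unfolding indicial_factor by (simp add: algebra_simps)
  thus ?thesis by (simp only: of_int_eq_0_iff) auto
qed

text \<open>Taylor coefficients of \<open>\<wp> - 1 / z^2\<close> in powers of \<open>z^2\<close>,
  read off from \<open>\<wp>'' = 6 * \<wp>^2 - c\<close>. The denominator vanishes exactly at
  \<open>k = 2\<close>, which leaves \<open>v\<close> free; \<open>u\<close> is free because it
  absorbs the constant \<open>c\<close>.\<close>

fun wpc :: "complex \<Rightarrow> complex \<Rightarrow> nat \<Rightarrow> complex" where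
  "wpc u v k = (if k = 0 then 0 else if k = 1 then u else if k = 2 then v
     else 6 * (\<Sum>i<k. wpc u v i * wpc u v (k - 1 - i)) / (of_nat (2 * k) * (of_nat (2 * k) - 1) - 12))"

declare wpc.simps [simp del]

lemma wpc_0 [simp]: "wpc u v 0 = 0" and wpc_1 [simp]: "wpc u v (Suc 0) = u"
  and wpc_2: "wpc u v 2 = v"
  by (simp_all add: wpc.simps[of u v 0] wpc.simps[of u v "Suc 0"] wpc.simps[of u v 2])

text \<open>The recursion is weighted homogeneous: with weight \<open>k + 1\<close> for coefficient
  \<open>k\<close>, the product of coefficients \<open>i\<close> and \<open>k - 1 - i\<close> has
  weight \<open>(i + 1) + (k - i) = k + 1\<close>.\<close>

lemma wpc_scale: "wpc (m\<^sup>2 * u) (m ^ 3 * v) k = m ^ (k + 1) * wpc u v k"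
proof (induction k rule: less_induct)
  case (less k)
  have "wpc (m\<^sup>2 * u) (m ^ 3 * v) i * wpc (m\<^sup>2 * u) (m ^ 3 * v) (k - 1 - i)
      = m ^ (k + 1) * (wpc u v i * wpc u v (k - 1 - i))" if "i < k" for i
  proof -
    have "m ^ (k + 1) = m ^ (i + 1) * m ^ (k - 1 - i + 1)"
      using that by (subst power_add [symmetric]) simp
    moreover have "k - 1 - i < k" using that by simp
    ultimately show ?thesis by (simp only: less[OF that] less[OF \<open>k - 1 - i < k\<close>]) (simp only: mult_ac)
  qed
  hence "(\<Sum>i<k. wpc (m\<^sup>2 * u) (m ^ 3 * v) i * wpc (m\<^sup>2 * u) (m ^ 3 * v) (k - 1 - i))
      = m ^ (k + 1) * (\<Sum>i<k. wpc u v i * wpc u v (k - 1 - i))"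
    by (simp add: sum_distrib_left)
  thus ?case
    by (simp add: wpc.simps[of _ _ k] power2_eq_square power3_eq_cube)
qed

definition wpF :: "complex \<Rightarrow> complex \<Rightarrow> complex fls" where
  "wpF u v = fls_X_inv\<^sup>2 + fps_to_fls (Abs_fps (\<lambda>m. if even m then wpc u v (m div 2) else 0))"

definition Dop :: "nat \<Rightarrow> nat \<Rightarrow> complex \<Rightarrow> complex fls \<Rightarrow> complex fls \<Rightarrow> complex fls" where
  "Dop n l B A Y = fls_deriv (fls_deriv (fls_deriv Y))
     - (fls_const (alpha n l) * A + fls_const B) * fls_deriv Y
     + fls_const (beta n l) * fls_deriv A * Y"

lemma Dop_add: "Dop n l B A (Y + Z) = Dop n l B A Y + Dop n l B A Z"
  by (simp add: Dop_def algebra_simps)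

lemma Dop_cmult: "Dop n l B A (fls_const c * Y) = fls_const c * Dop n l B A Y"
  by (simp add: Dop_def algebra_simps)

lemma Dop_0 [simp]: "Dop n l B A 0 = 0"
  by (simp add: Dop_def)

lemma Dop_sum: "Dop n l B A (\<Sum>i\<in>I. fls_const (c i) * Y i) = (\<Sum>i\<in>I. fls_const (c i) * Dop n l B A (Y i))"
  by (induction I rule: infinite_finite_induct) (simp_all add: Dop_add Dop_cmult)

lemma fls_X_inv_power_times_nth: "(fls_X_inv ^ m * f) $$ k = f $$ (k + int m)"
  for f :: "'a :: field fls"
  by (simp add: fls_X_inv_power_times_conv_shift)

text \<open>\<open>s\<close> is any lower bound for the support, not necessarily the subdegree, so
  the formula survives the vanishing of leading coefficients.\<close>

lemma fps_to_fls_times_nth: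
  fixes f :: "'a :: field fls"
  assumes "\<And>j. j < s \<Longrightarrow> f $$ j = 0"
  shows "(fps_to_fls H * f) $$ (s + int k) = (\<Sum>i\<le>k. fps_nth H i * f $$ (s + int k - int i))"
proof -
  define g where "g = Abs_fps (\<lambda>i. f $$ (s + int i))"
  have f: "f = fls_shift (-s) (fps_to_fls g)"
    by (rule fls_eqI) (auto simp: g_def assms)
  have "(fps_to_fls H * f) $$ (s + int k) = fps_nth (H * g) k"
    by (subst f) (simp add: fls_times_both_shifted_simp fls_shifted_times_simps flip: fls_times_fps_to_fls)
  also have "\<dots> = (\<Sum>i\<le>k. fps_nth H i * f $$ (s + int k - int i))"
    unfolding fps_mult_nth atMost_atLeast0
    by (intro sum.cong) (auto simp: g_def of_nat_diff algebra_simps)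
  finally show ?thesis .
qed

lemma fps_to_fls_times_nth_eq_0:
  fixes f :: "'a :: field fls"
  assumes "\<And>j. j < s \<Longrightarrow> f $$ j = 0" "k < s"
  shows "(fps_to_fls H * f) $$ k = 0"
proof -
  have "(fps_to_fls H * f) $$ (k + int 0) = (\<Sum>i\<le>0. fps_nth H i * f $$ (k + int 0 - int i))"
    by (rule fps_to_fls_times_nth) (use assms in auto)
  thus ?thesis using assms by simp
qed

lemma sum_atMost_even:
  fixes f :: "nat \<Rightarrow> 'a :: comm_monoid_add"
  assumes "\<And>i. odd i \<Longrightarrow> f i = 0"
  shows "(\<Sum>i\<le>2 * k. f i) = (\<Sum>i\<le>k. f (2 * i))"
  by (induction k) (use assms in \<open>simp_all add: add.assoc\<close>)

text \<open>The Frobenius recursion. Since \<open>wpF\<close> has only even powers, an index is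
  coupled only to indices of its own parity. The \<open>z^(-2)\<close> part of \<open>wpF\<close>
  joins the third derivative to form the indicial polynomial, \<open>B\<close> couples to the
  preceding index, and the Taylor part to all earlier ones.\<close>

lemma Dop_nth:
  fixes Y :: "complex fls"
  assumes Y: "\<forall>k<s. Y $$ k = 0"
  shows "Dop n l B (wpF u v) Y $$ (s + 2 * int j - 3) =
     indicial n l (of_int s + 2 * of_nat j) * Y $$ (s + 2 * int j)
     - B * (of_int s + 2 * of_nat j - 2) * Y $$ (s + 2 * int j - 2)
     - (\<Sum>i<j. wpc u v (j - 1 - i) * (alpha n l * (of_int s + 2 * of_nat i) - 2 * of_nat (j - 1 - i) * beta n l)
          * Y $$ (s + 2 * int i))"
proof -
  define H where "H = Abs_fps (\<lambda>m. if even m then wpc u v (m div 2) else 0)"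
  define k where "k = s + 2 * int j"
  have A: "wpF u v = fls_X_inv\<^sup>2 + fps_to_fls H" by (simp add: wpF_def H_def)
  have A': "fls_deriv (wpF u v) = - 2 * fls_X_inv ^ 3 + fps_to_fls (fps_deriv H)"
    by (simp add: A fls_deriv_fps_to_fls power2_eq_square power3_eq_cube algebra_simps)
  have Y': "fls_deriv Y $$ i = 0" if "i < s - 1" for i
    using Y that by simp
  have 1: "fls_deriv (fls_deriv (fls_deriv Y)) $$ (k - 3) = of_int k * (of_int k - 1) * (of_int k - 2) * Y $$ k"
    by (simp add: algebra_simps)
  have 2: "(fls_X_inv\<^sup>2 * fls_deriv Y) $$ (k - 3) = of_int k * Y $$ k"
    by (subst fls_X_inv_power_times_nth) (simp add: algebra_simps)
  have 3: "fls_deriv Y $$ (k - 3) = (of_int k - 2) * Y $$ (k - 2)"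
    by (simp add: algebra_simps)
  have 4: "(fls_X_inv ^ 3 * Y) $$ (k - 3) = Y $$ k"
    by (subst fls_X_inv_power_times_nth) simp
  have E: "alpha n l * (fps_to_fls H * fls_deriv Y) $$ (k - 3)
      - beta n l * (fps_to_fls (fps_deriv H) * Y) $$ (k - 3)
      = (\<Sum>i<j. wpc u v (j - 1 - i) * (alpha n l * (of_int s + 2 * of_nat i) - 2 * of_nat (j - 1 - i) * beta n l)
          * Y $$ (s + 2 * int i))"
  proof (cases j)
    case 0
    have "(fps_to_fls H * fls_deriv Y) $$ (k - 3) = 0"
      by (rule fps_to_fls_times_nth_eq_0[where s = "s - 1"]) (use Y' in \<open>auto simp: k_def 0\<close>)
    moreover have "(fps_to_fls (fps_deriv H) * Y) $$ (k - 3) = 0"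
      by (rule fps_to_fls_times_nth_eq_0[where s = s]) (use Y in \<open>auto simp: k_def 0\<close>)
    ultimately show ?thesis using 0 by simp
  next
    case (Suc m)
    have k3: "k - 3 = (s - 1) + int (2 * m)" by (simp add: k_def Suc)
    have e1: "(fps_to_fls H * fls_deriv Y) $$ (k - 3) =
        (\<Sum>i\<le>2 * m. fps_nth H i * ((of_int k - 2 - of_nat i) * Y $$ (k - 2 - int i)))"
    proof -
      have "(fps_to_fls H * fls_deriv Y) $$ (k - 3) =
        (\<Sum>i\<le>2 * m. fps_nth H i * fls_deriv Y $$ ((s - 1) + int (2 * m) - int i))"
        unfolding k3 by (rule fps_to_fls_times_nth) (use Y' in auto)
      also have "\<dots> = (\<Sum>i\<le>2 * m. fps_nth H i * ((of_int k - 2 - of_nat i) * Y $$ (k - 2 - int i)))"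
        unfolding k3[symmetric] by (intro sum.cong) (auto simp: algebra_simps)
      finally show ?thesis .
    qed
    have e2: "(fps_to_fls (fps_deriv H) * Y) $$ (k - 3) =
        (\<Sum>i\<le>2 * m. fps_nth H i * (of_nat i * Y $$ (k - 2 - int i)))"
    \<comment> \<open>A shift of the index turns the coefficients of \<open>fps_deriv H\<close> into
      \<open>of_nat i * fps_nth H i\<close>, with a zero term at \<open>i = 0\<close>, so that the
      two convolutions can be merged. The truncated \<open>2 * m - 1\<close> makes
      \<open>m = 0\<close> a case of its own.\<close>
    proof (cases m)
      case 0
      have "(fps_to_fls (fps_deriv H) * Y) $$ (k - 3) = 0"
        by (rule fps_to_fls_times_nth_eq_0[where s = s]) (use Y Suc 0 in \<open>auto simp: k_def\<close>)
      thus ?thesis by (simp add: 0)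
    next
      case (Suc m')
      have k3': "k - 3 = s + int (2 * m - 1)" using k3 Suc by simp
      have "(fps_to_fls (fps_deriv H) * Y) $$ (k - 3) =
        (\<Sum>i\<le>2 * m - 1. fps_nth (fps_deriv H) i * Y $$ (s + int (2 * m - 1) - int i))"
        unfolding k3' by (rule fps_to_fls_times_nth) (use Y in auto)
      also have "\<dots> = (\<Sum>i\<le>2 * m - 1. fps_nth H (Suc i) * (of_nat (Suc i) * Y $$ (k - 2 - int (Suc i))))"
        unfolding k3'[symmetric] by (intro sum.cong) (auto simp: algebra_simps)
      also have "\<dots> = (\<Sum>i\<le>Suc (2 * m - 1). fps_nth H i * (of_nat i * Y $$ (k - 2 - int i)))"
        by (subst sum.atMost_Suc_shift) simp
      also have "Suc (2 * m - 1) = 2 * m" using Suc by simp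
      finally show ?thesis .
    qed
    have "alpha n l * (fps_to_fls H * fls_deriv Y) $$ (k - 3)
      - beta n l * (fps_to_fls (fps_deriv H) * Y) $$ (k - 3)
      = (\<Sum>i\<le>2 * m. fps_nth H i * (alpha n l * (of_int k - 2 - of_nat i) - of_nat i * beta n l) * Y $$ (k - 2 - int i))"
      unfolding e1 e2 sum_distrib_left sum_subtractf[symmetric]
      by (intro sum.cong) (auto simp: algebra_simps)
    also have "\<dots> = (\<Sum>i\<le>m. wpc u v i * (alpha n l * (of_int k - 2 - 2 * of_nat i) - 2 * of_nat i * beta n l) * Y $$ (k - 2 - 2 * int i))"
      by (subst sum_atMost_even) (auto simp: H_def)
    also have "\<dots> = (\<Sum>i\<le>m. wpc u v (m - i) * (alpha n l * (of_int s + 2 * of_nat i) - 2 * of_nat (m - i) * beta n l)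
          * Y $$ (s + 2 * int i))"
      by (rule sum.reindex_bij_witness[of _ "\<lambda>i. m - i" "\<lambda>i. m - i"])
        (auto simp: k_def Suc of_nat_diff algebra_simps)
    also have "\<dots> = (\<Sum>i<j. wpc u v (j - 1 - i) * (alpha n l * (of_int s + 2 * of_nat i) - 2 * of_nat (j - 1 - i) * beta n l)
          * Y $$ (s + 2 * int i))"
      unfolding Suc by (simp add: lessThan_Suc_atMost)
    finally show ?thesis .
  qed
  have "Dop n l B (wpF u v) Y $$ (k - 3) =
     fls_deriv (fls_deriv (fls_deriv Y)) $$ (k - 3)
     - (alpha n l * (fls_X_inv\<^sup>2 * fls_deriv Y) $$ (k - 3) + B * fls_deriv Y $$ (k - 3))
     - 2 * beta n l * (fls_X_inv ^ 3 * Y) $$ (k - 3)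
     - (alpha n l * (fps_to_fls H * fls_deriv Y) $$ (k - 3)
        - beta n l * (fps_to_fls (fps_deriv H) * Y) $$ (k - 3))"
  proof -
    have "Dop n l B (wpF u v) Y = fls_deriv (fls_deriv (fls_deriv Y))
      - (fls_const (alpha n l) * (fls_X_inv\<^sup>2 * fls_deriv Y) + fls_const B * fls_deriv Y)
      - fls_const (2 * beta n l) * (fls_X_inv ^ 3 * Y)
      - (fls_const (alpha n l) * (fps_to_fls H * fls_deriv Y)
        - fls_const (beta n l) * (fps_to_fls (fps_deriv H) * Y))"
      unfolding Dop_def A' unfolding A
      by (simp add: algebra_simps flip: fls_const_mult_const)
    thus ?thesis by simp
  qed
  thus ?thesis unfolding E 1 2 3 4 unfolding k_def indicial_def
    by (simp add: algebra_simps)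
qed

lemma Dop_nth_leading:
  assumes "\<forall>k<s. Y $$ k = 0"
  shows "Dop n l B (wpF u v) Y $$ (s - 3) = indicial n l (of_int s) * Y $$ s"
  using Dop_nth[OF assms, where n=n and l=l and B=B and u=u and v=v and j=0] assms by simp

lemma Dop_nth_eq_0:
  assumes "\<forall>k<s. Y $$ k = 0" "k < s - 3"
  shows "Dop n l B (wpF u v) Y $$ k = 0"
proof -
  have "Dop n l B (wpF u v) Y $$ ((k + 3) - 3) = indicial n l (of_int (k + 3)) * Y $$ (k + 3)"
    by (rule Dop_nth_leading) (use assms in auto)
  thus ?thesis using assms by simp
qed

lemma fls_zero_below_subdegree: "k < fls_subdegree Y \<Longrightarrow> Y $$ k = 0"
  by (rule fls_eq0_below_subdegree)

lemma exponent_of_solution: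
  assumes "Dop n l B (wpF u v) Y = 0" "Y \<noteq> 0"
  shows "fls_subdegree Y \<in> {- int (n + l), 1 - int l, int (n + 2 * l + 2)}"
proof -
  have "indicial n l (of_int (fls_subdegree Y)) * Y $$ fls_subdegree Y = 0"
    using Dop_nth_leading[where s = "fls_subdegree Y" and Y=Y and n=n and l=l and B=B and u=u and v=v] assms(1) by simp
  moreover have "Y $$ fls_subdegree Y \<noteq> 0" using assms(2) by simp
  ultimately show ?thesis by (simp add: indicial_eq_0_iff)
qed

text \<open>The lowest term of a nonzero formal solution sits at one of the three exponents.
  Solutions are compared through these three coefficients throughout.\<close>

lemma solution_eq_0I:
  assumes "Dop n l B (wpF u v) Y = 0"
    and "Y $$ (- int (n + l)) = 0" "Y $$ (1 - int l) = 0" "Y $$ int (n + 2 * l + 2) = 0"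
  shows "Y = 0"
  using exponent_of_solution[OF assms(1)] assms(2-4) nth_fls_subdegree_zero_iff[of Y] by fastforce

text \<open>Coefficients of the Frobenius series at \<open>- n - l\<close>, normalised to start with
  1 and kept as polynomials in \<open>B\<close>. They are meaningful only for
  \<open>j < (n + 1) div 2\<close>; for odd \<open>n\<close>, division by zero makes the value at
  the resonance 0.\<close>

fun frobc :: "nat \<Rightarrow> nat \<Rightarrow> complex \<Rightarrow> complex \<Rightarrow> nat \<Rightarrow> complex poly" where
  "frobc n l u v j = (if j = 0 then 1 else
     smult (1 / indicial n l (2 * of_nat j - of_nat (n + l)))
      ([:0, 2 * of_nat j - of_nat (n + l) - 2:] * frobc n l u v (j - 1)
       + (\<Sum>i<j. smult (wpc u v (j - 1 - i) *
            (alpha n l * (2 * of_nat i - of_nat (n + l)) - 2 * of_nat (j - 1 - i) * beta n l))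
           (frobc n l u v i))))"

declare frobc.simps [simp del]

definition frob_rhs :: "nat \<Rightarrow> nat \<Rightarrow> complex \<Rightarrow> complex \<Rightarrow> nat \<Rightarrow> complex poly" where
  "frob_rhs n l u v j = [:0, 2 * of_nat j - of_nat (n + l) - 2:] * frobc n l u v (j - 1)
       + (\<Sum>i<j. smult (wpc u v (j - 1 - i) *
            (alpha n l * (2 * of_nat i - of_nat (n + l)) - 2 * of_nat (j - 1 - i) * beta n l))
           (frobc n l u v i))"

definition frobP :: "nat \<Rightarrow> nat \<Rightarrow> complex \<Rightarrow> complex \<Rightarrow> complex poly" where
  "frobP n l u v = frob_rhs n l u v ((n + 1) div 2)"

lemma frobc_0 [simp]: "frobc n l u v 0 = 1"
  by (simp add: frobc.simps)

lemma frobc_rec: "j > 0 \<Longrightarrow>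
    frobc n l u v j = smult (1 / indicial n l (2 * of_nat j - of_nat (n + l))) (frob_rhs n l u v j)"
  unfolding frob_rhs_def by (subst frobc.simps) simp

lemma indicial_nz:
  assumes "0 < j" "j < (n + 1) div 2"
  shows "indicial n l (2 * of_nat j - of_nat (n + l)) \<noteq> 0"
proof -
  have "2 * of_nat j - of_nat (n + l) = (of_int (2 * int j - int (n + l)) :: complex)" by simp
  thus ?thesis using assms by (simp only: indicial_eq_0_iff) auto
qed

text \<open>Only the summand with \<open>B\<close> raises the degree. Its factor
  \<open>2 * j - (n + l) - 2\<close> is at most \<open>- l - 1\<close> in this range, hence never
  zero.\<close>

lemma degree_frob_rhs:
  assumes "odd n" "0 < j" "j \<le> (n + 1) div 2" "\<And>i. i < j \<Longrightarrow> degree (frobc n l u v i) = i"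
  shows "degree (frob_rhs n l u v j) = j"
proof -
  define c where "c = (2 * of_nat j - of_nat (n + l) - 2 :: complex)"
  have "c = of_int (2 * int j - int (n + l) - 2)" by (simp add: c_def)
  moreover have "2 * int j - int (n + l) - 2 \<noteq> 0" using assms(1,3) by (auto elim!: oddE)
  ultimately have c: "c \<noteq> 0" by (simp only: of_int_eq_0_iff not_False_eq_True)
  have "frobc n l u v (j - 1) \<noteq> 0"
  proof (cases "j = 1")
    case False
    hence "degree (frobc n l u v (j - 1)) \<noteq> 0" using assms(2) assms(4)[of "j - 1"] by linarith
    thus ?thesis by (metis degree_0)
  qed simp
  hence 1: "degree ([:0, c:] * frobc n l u v (j - 1)) = j"
    using assms(4)[of "j - 1"] assms(2) c by (subst degree_mult_eq) auto
  have 2: "degree (\<Sum>i<j. smult (wpc u v (j - 1 - i) *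
            (alpha n l * (2 * of_nat i - of_nat (n + l)) - 2 * of_nat (j - 1 - i) * beta n l))
           (frobc n l u v i)) \<le> j - 1"
    by (rule degree_sum_le) (use assms(4) in \<open>auto intro!: order.trans[OF degree_smult_le]\<close>)
  show ?thesis unfolding frob_rhs_def c_def[symmetric]
    using 1 2 assms(2) by (subst degree_add_eq_left) auto
qed

lemma degree_frobc:
  assumes "odd n" "j < (n + 1) div 2"
  shows "degree (frobc n l u v j) = j"
  using assms(2)
proof (induction j rule: less_induct)
  case (less j)
  show ?case
  proof (cases "j = 0")
    case False
    have "degree (frob_rhs n l u v j) = j"
      by (rule degree_frob_rhs[OF assms(1)]) (use False less.prems in simp, use less.prems in simp, rule less.IH, use less.prems in auto)
    thus ?thesis using indicial_nz[of j n l] False less.prems by (simp add: frobc_rec)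
  qed simp
qed

lemma degree_frobP:
  assumes "odd n"
  shows "degree (frobP n l u v) = (n + 1) div 2"
  unfolding frobP_def
proof (rule degree_frob_rhs)
  show "0 < (n + 1) div 2" using odd_pos[OF assms] by simp
qed (use assms degree_frobc in auto)

lemma poly_frob_rhs:
  assumes "j > 0" "s = - int (n + l)"
  shows "poly (frob_rhs n l u v j) B = B * (of_int s + 2 * of_nat j - 2) * poly (frobc n l u v (j - 1)) B
     + (\<Sum>i<j. wpc u v (j - 1 - i) * (alpha n l * (of_int s + 2 * of_nat i) - 2 * of_nat (j - 1 - i) * beta n l)
          * poly (frobc n l u v i) B)"
  unfolding frob_rhs_def assms(2) by (simp add: poly_sum algebra_simps)

lemma frob_rhs_combination:
  assumes "j > 0" "s = - int (n + l)" and y: "\<And>i. i < j \<Longrightarrow> y i = poly (frobc n l u v i) B * c"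
  shows "B * (of_int s + 2 * of_nat j - 2) * y (j - 1)
     + (\<Sum>i<j. wpc u v (j - 1 - i) * (alpha n l * (of_int s + 2 * of_nat i) - 2 * of_nat (j - 1 - i) * beta n l)
          * y i) = poly (frob_rhs n l u v j) B * c"
proof -
  have "(\<Sum>i<j. wpc u v (j - 1 - i) * (alpha n l * (of_int s + 2 * of_nat i) - 2 * of_nat (j - 1 - i) * beta n l)
          * y i) =
      (\<Sum>i<j. wpc u v (j - 1 - i) * (alpha n l * (of_int s + 2 * of_nat i) - 2 * of_nat (j - 1 - i) * beta n l)
          * poly (frobc n l u v i) B) * c"
    unfolding sum_distrib_right by (rule sum.cong) (simp_all only: y lessThan_iff mult.assoc)
  moreover have "y (j - 1) = poly (frobc n l u v (j - 1)) B * c" using y assms(1) by simp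
  ultimately show ?thesis
    by (simp only: poly_frob_rhs[OF assms(1,2)] distrib_right mult.assoc)
qed

lemma Dop_nth_pos:
  assumes Y: "\<forall>k<s. Y $$ k = 0" and "j > 0"
  shows "Dop n l B (wpF u v) Y $$ (s + 2 * int j - 3) =
     indicial n l (of_int s + 2 * of_nat j) * Y $$ (s + 2 * int j)
     - (B * (of_int s + 2 * of_nat j - 2) * Y $$ (s + 2 * int (j - 1))
     + (\<Sum>i<j. wpc u v (j - 1 - i) * (alpha n l * (of_int s + 2 * of_nat i) - 2 * of_nat (j - 1 - i) * beta n l)
          * Y $$ (s + 2 * int i)))"
proof -
  have e: "s + 2 * int (j - 1) = s + 2 * int j - 2" using \<open>j > 0\<close> by simp
  show ?thesis by (simp only: Dop_nth[OF Y] e diff_diff_eq)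
qed

lemma frobenius_coeffs:
  assumes Y: "\<forall>k<s. Y $$ k = 0" and s: "s = - int (n + l)"
    and D: "\<And>j. 0 < j \<Longrightarrow> j < (n + 1) div 2 \<Longrightarrow> Dop n l B (wpF u v) Y $$ (s + 2 * int j - 3) = 0"
    and j: "j < (n + 1) div 2"
  shows "Y $$ (s + 2 * int j) = poly (frobc n l u v j) B * Y $$ s"
  using j
proof (induction j rule: less_induct)
  case (less j)
  show ?case
  proof (cases "j = 0")
    case False
    have sj: "of_int s + 2 * of_nat j = (2 * of_nat j - of_nat (n + l) :: complex)" by (simp add: s)
    have I: "indicial n l (of_int s + 2 * of_nat j) \<noteq> 0"
      unfolding sj by (rule indicial_nz) (use False less.prems in auto)
    have "indicial n l (of_int s + 2 * of_nat j) * Y $$ (s + 2 * int j) =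
       B * (of_int s + 2 * of_nat j - 2) * Y $$ (s + 2 * int (j - 1))
       + (\<Sum>i<j. wpc u v (j - 1 - i) * (alpha n l * (of_int s + 2 * of_nat i) - 2 * of_nat (j - 1 - i) * beta n l)
          * Y $$ (s + 2 * int i))"
      using D[of j] False less.prems Dop_nth_pos[OF Y, of j n l B u v] by simp
    also have "\<dots> = poly (frob_rhs n l u v j) B * Y $$ s"
    proof (rule frob_rhs_combination[where y = "\<lambda>i. Y $$ (s + 2 * int i)"])
      show "0 < j" using False by simp
      show "Y $$ (s + 2 * int i) = poly (frobc n l u v i) B * Y $$ s" if "i < j" for i
        using that less.prems by (intro less.IH) auto
    qed (rule s)
    finally have "Y $$ (s + 2 * int j) = poly (frob_rhs n l u v j) B * Y $$ s / indicial n l (of_int s + 2 * of_nat j)"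
      using I by (simp add: field_simps)
    thus ?thesis unfolding sj using False by (simp add: frobc_rec)
  qed (simp)
qed

text \<open>At the resonance the unknown coefficient is multiplied by \<open>indicial\<close> at
  \<open>1 - l\<close>, which is zero, so the equation there becomes a condition on the earlier
  coefficients alone.\<close>

lemma frobenius_necessary:
  assumes Y: "\<forall>k<s. Y $$ k = 0" "Y $$ s \<noteq> 0" and s: "s = - int (n + l)" and "odd n"
    and D: "Dop n l B (wpF u v) Y = 0"
  shows "poly (frobP n l u v) B = 0"
proof -
  define d where "d = (n + 1) div 2"
  have d: "d > 0" "2 * d = n + 1" using \<open>odd n\<close> by (auto simp: d_def elim: oddE)
  have c: "Y $$ (s + 2 * int j) = poly (frobc n l u v j) B * Y $$ s" if "j < d" for j
    by (rule frobenius_coeffs) (use assms that in \<open>auto simp: d_def\<close>)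
  have I: "indicial n l (of_int s + 2 * of_nat d) = 0"
  proof -
    have "s + 2 * int d = 1 - int l" using d s by simp
    moreover have "of_int s + 2 * of_nat d = (of_int (s + 2 * int d) :: complex)" by simp
    ultimately have "of_int s + 2 * of_nat d = (of_int (1 - int l) :: complex)" by (simp only:)
    thus ?thesis by (simp only: indicial_eq_0_iff) simp
  qed
  have "B * (of_int s + 2 * of_nat d - 2) * Y $$ (s + 2 * int (d - 1))
       + (\<Sum>i<d. wpc u v (d - 1 - i) * (alpha n l * (of_int s + 2 * of_nat i) - 2 * of_nat (d - 1 - i) * beta n l)
          * Y $$ (s + 2 * int i)) = poly (frob_rhs n l u v d) B * Y $$ s"
  proof (rule frob_rhs_combination[where y = "\<lambda>i. Y $$ (s + 2 * int i)"])
    show "Y $$ (s + 2 * int i) = poly (frobc n l u v i) B * Y $$ s" if "i < d" for i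
      using c that .
  qed (use d s in auto)
  hence "poly (frob_rhs n l u v d) B * Y $$ s = 0"
    using Dop_nth_pos[OF Y(1) d(1), of n l B u v] unfolding D I by simp
  thus ?thesis using Y(2) by (simp add: frobP_def d_def)
qed

text \<open>Only the coefficients below the resonance are prescribed. The one at
  \<open>1 - l\<close> is multiplied by zero and may be arbitrary, so it is enough to realise the
  poles of order above \<open>l\<close>.\<close>

lemma frobenius_sufficient:
  assumes Y: "\<forall>k<s. Y $$ k = 0" and s: "s = - int (n + l)" and "odd n"
    and c: "\<And>j. j < (n + 1) div 2 \<Longrightarrow> Y $$ (s + 2 * int j) = poly (frobc n l u v j) B"
    and P: "poly (frobP n l u v) B = 0" and j: "j \<le> (n + 1) div 2"
  shows "Dop n l B (wpF u v) Y $$ (s + 2 * int j - 3) = 0"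
proof (cases "j = 0")
  case True
  have "indicial n l (of_int s) = 0"
    unfolding indicial_eq_0_iff s by simp
  thus ?thesis using Dop_nth_leading[OF Y, where n=n and l=l and B=B and u=u and v=v] True by simp
next
  case False
  have "indicial n l (of_int s + 2 * of_nat j) * Y $$ (s + 2 * int j) = poly (frob_rhs n l u v j) B"
  proof (cases "j = (n + 1) div 2")
    case True
    have "s + 2 * int j = 1 - int l" using True \<open>odd n\<close> s by (auto elim!: oddE)
    moreover have "of_int s + 2 * of_nat j = (of_int (s + 2 * int j) :: complex)" by simp
    ultimately have "of_int s + 2 * of_nat j = (of_int (1 - int l) :: complex)" by (simp only:)
    hence "indicial n l (of_int s + 2 * of_nat j) = 0"
      by (simp only: indicial_eq_0_iff) simp
    thus ?thesis using P True by (simp add: frobP_def)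
  next
    case jd: False
    have sj: "of_int s + 2 * of_nat j = (2 * of_nat j - of_nat (n + l) :: complex)" by (simp add: s)
    have I: "indicial n l (of_int s + 2 * of_nat j) \<noteq> 0"
      unfolding sj by (rule indicial_nz) (use False jd j in auto)
    have "Y $$ (s + 2 * int j) = poly (frob_rhs n l u v j) B / indicial n l (of_int s + 2 * of_nat j)"
      unfolding sj using c[of j] j jd False by (simp add: frobc_rec)
    thus ?thesis using I by simp
  qed
  moreover have "B * (of_int s + 2 * of_nat j - 2) * Y $$ (s + 2 * int (j - 1))
     + (\<Sum>i<j. wpc u v (j - 1 - i) * (alpha n l * (of_int s + 2 * of_nat i) - 2 * of_nat (j - 1 - i) * beta n l)
          * Y $$ (s + 2 * int i)) = poly (frob_rhs n l u v j) B * 1"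
    by (rule frob_rhs_combination[where y = "\<lambda>i. Y $$ (s + 2 * int i)"]) (use c j False s in auto)
  ultimately show ?thesis
    using Dop_nth_pos[OF Y, of j n l B u v] False by simp
qed

lemma frob_rhs_scale:
  assumes "j > 0"
    and IH: "\<And>i. i < j \<Longrightarrow> poly (frobc n l (m\<^sup>2 * u) (m ^ 3 * v) i) (m * B) = m ^ i * poly (frobc n l u v i) B"
  shows "poly (frob_rhs n l (m\<^sup>2 * u) (m ^ 3 * v) j) (m * B) = m ^ j * poly (frob_rhs n l u v j) B"
proof -
  have 1: "m * poly (frobc n l (m\<^sup>2 * u) (m ^ 3 * v) (j - 1)) (m * B) = m ^ j * poly (frobc n l u v (j - 1)) B"
    using IH[of "j - 1"] assms(1) by (cases j) auto
  have 2: "wpc (m\<^sup>2 * u) (m ^ 3 * v) (j - 1 - i) * poly (frobc n l (m\<^sup>2 * u) (m ^ 3 * v) i) (m * B)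
    = m ^ j * (wpc u v (j - 1 - i) * poly (frobc n l u v i) B)" if "i < j" for i
  proof -
    have "m ^ j = m ^ (j - 1 - i + 1) * m ^ i" using that by (subst power_add [symmetric]) simp
    thus ?thesis unfolding IH[OF that] wpc_scale by (simp only: mult_ac)
  qed
  have "poly (frob_rhs n l (m\<^sup>2 * u) (m ^ 3 * v) j) (m * B) =
     B * (2 * of_nat j - of_nat (n + l) - 2) * (m * poly (frobc n l (m\<^sup>2 * u) (m ^ 3 * v) (j - 1)) (m * B))
     + (\<Sum>i<j. (alpha n l * (2 * of_nat i - of_nat (n + l)) - 2 * of_nat (j - 1 - i) * beta n l) *
         (wpc (m\<^sup>2 * u) (m ^ 3 * v) (j - 1 - i) * poly (frobc n l (m\<^sup>2 * u) (m ^ 3 * v) i) (m * B)))"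
    unfolding frob_rhs_def by (simp add: poly_sum mult_ac)
  also have "\<dots> = B * (2 * of_nat j - of_nat (n + l) - 2) * (m ^ j * poly (frobc n l u v (j - 1)) B)
     + (\<Sum>i<j. (alpha n l * (2 * of_nat i - of_nat (n + l)) - 2 * of_nat (j - 1 - i) * beta n l) *
         (m ^ j * (wpc u v (j - 1 - i) * poly (frobc n l u v i) B)))"
    unfolding 1 using 2 by simp
  also have "\<dots> = m ^ j * poly (frob_rhs n l u v j) B"
    unfolding frob_rhs_def by (simp add: poly_sum algebra_simps sum_distrib_left)
  finally show ?thesis .
qed

lemma frobc_scale:
  "poly (frobc n l (m\<^sup>2 * u) (m ^ 3 * v) j) (m * B) = m ^ j * poly (frobc n l u v j) B"
proof (induction j rule: less_induct)
  case (less j)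
  show ?case
  proof (cases "j = 0")
    case False
    hence "poly (frob_rhs n l (m\<^sup>2 * u) (m ^ 3 * v) j) (m * B) = m ^ j * poly (frob_rhs n l u v j) B"
      using less.IH by (intro frob_rhs_scale) auto
    thus ?thesis using False by (simp add: frobc_rec del: power_Suc)
  qed simp
qed

lemma frobP_scale:
  assumes "odd n"
  shows "poly (frobP n l (m\<^sup>2 * u) (m ^ 3 * v)) (m * B) = m ^ ((n + 1) div 2) * poly (frobP n l u v) B"
  unfolding frobP_def using odd_pos[OF assms] by (intro frob_rhs_scale frobc_scale) simp

section \<open>The cosecant degeneration\<close>

text \<open>The differential equation forces the odd coefficients to vanish.\<close>
lemma wpF_unique:
  assumes A: "\<And>k. k < -2 \<Longrightarrow> A $$ k = 0" "A $$ (-2) = 1"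
    and ode: "fls_deriv (fls_deriv A) = 6 * A\<^sup>2 - fls_const c"
  shows "A = wpF (A $$ 2) (A $$ 4)" "c = 10 * A $$ 2"
proof -
  have sub: "fls_subdegree A = -2"
    by (rule fls_subdegree_eqI) (use A in auto)
  have conv: "of_int k * (of_int k - 1) * A $$ k =
      12 * A $$ k + 6 * (\<Sum>i=-1..k-1. A $$ i * A $$ (k - 2 - i)) - (if k = 2 then c else 0)"
    if "k \<ge> -1" for k
  proof -
    have "of_int k * (of_int k - 1) * A $$ k = fls_deriv (fls_deriv A) $$ (k - 2)"
      by (simp add: algebra_simps)
    also have "\<dots> = 6 * (A * A) $$ (k - 2) - (if k = 2 then c else 0)"
      unfolding ode by (simp add: power2_eq_square)
    also have "(A * A) $$ (k - 2) = (\<Sum>i=-2..k. A $$ i * A $$ (k - 2 - i))"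
      by (simp add: fls_times_nth(2) sub)
    also have "{-2..k} = {-2, k} \<union> {-1..k-1}" using that by auto
    also have "(\<Sum>i\<in>{-2, k} \<union> {-1..k-1}. A $$ i * A $$ (k - 2 - i))
       = 2 * A $$ k + (\<Sum>i=-1..k-1. A $$ i * A $$ (k - 2 - i))"
    proof (subst sum.union_disjoint)
      show "(\<Sum>i\<in>{-2, k}. A $$ i * A $$ (k - 2 - i)) + (\<Sum>i=-1..k-1. A $$ i * A $$ (k - 2 - i))
         = 2 * A $$ k + (\<Sum>i=-1..k-1. A $$ i * A $$ (k - 2 - i))"
        using that by (simp add: A(2))
    qed (use that in auto)
    finally show ?thesis by (simp add: algebra_simps)
  qed
  define a where "a k = (if odd k \<or> k \<le> 0 then 0 else wpc (A $$ 2) (A $$ 4) (nat (k div 2)))" for k :: int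
  have coeff: "A $$ (int m - 1) = a (int m - 1)" for m
  proof (induction m rule: less_induct)
    case (less m)
    define k where "k = int m - 1"
    have IH: "A $$ i = a i" if "-1 \<le> i" "i < k" for i
      using less[of "nat (i + 1)"] that by (simp add: k_def)
    have S: "(\<Sum>i=-1..k-1. A $$ i * A $$ (k - 2 - i)) = (\<Sum>i=-1..k-1. a i * a (k - 2 - i))"
      by (rule sum.cong) (use IH in auto)
    have k: "k \<ge> -1" by (simp add: k_def)
    have "k = 0 \<or> k = 2 \<or> k = 4 \<or> k \<ge> 6" if "even k" using k that by presburger
    then consider "odd k" | "k = 0" | "k = 2" | "k = 4" | "even k" "k \<ge> 6" by blast
    hence "A $$ k = a k"
    proof cases
      case 1
      hence k2: "k \<noteq> 2" by auto
      \<comment> \<open>For odd \<open>k\<close> the indices \<open>i\<close> and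
        \<open>k - 2 - i\<close> have different parity, so one of the two values of \<open>a\<close>
        is zero.\<close>
      have z: "(\<Sum>i=-1..k-1. a i * a (k - 2 - i)) = 0"
        by (rule sum.neutral) (use 1 in \<open>auto simp: a_def\<close>)
      have "of_int k * (of_int k - 1) * A $$ k = 12 * A $$ k"
        using conv[OF k] k2 by (simp only: S z if_False mult_zero_right add_0_right diff_zero)
      hence "(of_int k * (of_int k - 1) - 12) * A $$ k = 0"
        by (simp only: left_diff_distrib diff_self)
      \<comment> \<open>The factor vanishes only at 4 and -3, and neither is an odd number at or
        above -1; this forces the odd coefficients to be zero.\<close>
      moreover have "of_int k * (of_int k - 1) - 12 = (of_int ((k - 4) * (k + 3)) :: complex)"
        by (simp add: algebra_simps)
      moreover have "(k - 4) * (k + 3) \<noteq> 0" using 1 k by auto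
      ultimately have "A $$ k = 0" by (metis mult_eq_0_iff of_int_eq_0_iff)
      thus ?thesis using 1 by (simp add: a_def)
    next
      case 2
      have "{-1..-1::int} = {-1}" by auto
      thus ?thesis using conv[OF k] 2 unfolding S by (simp add: a_def)
    next
      case 3
      thus ?thesis by (simp add: a_def)
    next
      case 4
      thus ?thesis by (simp add: a_def wpc_2)
    next
      case 5
      define h where "h = nat (k div 2)"
      have h: "k = 2 * int h" "h \<ge> 3" using 5 by (auto simp: h_def)
      have "(\<Sum>i=-1..k-1. a i * a (k - 2 - i)) = (\<Sum>i\<in>(\<lambda>i. 2 * int i) ` {..<h}. a i * a (k - 2 - i))"
      proof (rule sum.mono_neutral_right)
        show "\<forall>i\<in>{-1..k-1} - (\<lambda>i. 2 * int i) ` {..<h}. a i * a (k - 2 - i) = 0"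
        proof
          fix i assume i: "i \<in> {-1..k-1} - (\<lambda>i. 2 * int i) ` {..<h}"
          have "odd i"
          proof
            assume "even i"
            hence "i = 2 * int (nat (i div 2))" "nat (i div 2) < h" using i h by auto
            thus False using i by blast
          qed
          thus "a i * a (k - 2 - i) = 0" by (simp add: a_def)
        qed
      qed (use h in auto)
      also have "\<dots> = (\<Sum>i<h. a (2 * int i) * a (k - 2 - 2 * int i))"
        by (subst sum.reindex) (auto simp: inj_on_def)
      also have "\<dots> = (\<Sum>i<h. wpc (A $$ 2) (A $$ 4) i * wpc (A $$ 2) (A $$ 4) (h - 1 - i))"
      proof (rule sum.cong)
        fix i assume "i \<in> {..<h}"
        hence idx: "k - 2 - 2 * int i = 2 * int (h - 1 - i)" using h by auto
        have "a (2 * int m) = wpc (A $$ 2) (A $$ 4) m" for m by (simp add: a_def)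
        thus "a (2 * int i) * a (k - 2 - 2 * int i) = wpc (A $$ 2) (A $$ 4) i * wpc (A $$ 2) (A $$ 4) (h - 1 - i)"
          by (simp only: idx)
      qed simp
      finally have sm: "(\<Sum>i=-1..k-1. a i * a (k - 2 - i)) =
        (\<Sum>i<h. wpc (A $$ 2) (A $$ 4) i * wpc (A $$ 2) (A $$ 4) (h - 1 - i))" .
      have k2: "k \<noteq> 2" using h by simp
      have e: "(of_int k * (of_int k - 1) - 12) * A $$ k =
          6 * (\<Sum>i<h. wpc (A $$ 2) (A $$ 4) i * wpc (A $$ 2) (A $$ 4) (h - 1 - i))"
        using conv[OF k] k2 by (simp only: S sm left_diff_distrib if_False diff_zero add_diff_cancel_left')
      have "of_int k * (of_int k - 1) - 12 = (of_int ((k - 4) * (k + 3)) :: complex)"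
        by (simp add: algebra_simps)
      moreover have "(k - 4) * (k + 3) \<noteq> 0" using h by auto
      ultimately have nz: "of_int k * (of_int k - 1) - 12 \<noteq> (0 :: complex)"
        by (metis of_int_eq_0_iff)
      have "a k = wpc (A $$ 2) (A $$ 4) h" using h by (simp add: a_def)
      also have "\<dots> = 6 * (\<Sum>i<h. wpc (A $$ 2) (A $$ 4) i * wpc (A $$ 2) (A $$ 4) (h - 1 - i)) / (of_int k * (of_int k - 1) - 12)"
        using h by (simp add: wpc.simps[of _ _ h])
      also have "\<dots> = A $$ k" using e nz by (metis nonzero_mult_div_cancel_left)
      finally show ?thesis ..
    qed
    thus ?case by (simp add: k_def)
  qed
  have coeff': "A $$ k = a k" if "k \<ge> -1" for k
    using coeff[of "nat (k + 1)"] that by simp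
  show "A = wpF (A $$ 2) (A $$ 4)"
  proof (rule fls_eqI)
    fix k
    have X: "(fls_X_inv\<^sup>2 :: complex fls) $$ k = (if k = -2 then 1 else 0)"
      by (simp add: fls_X_inv_power_nth)
    consider "k < -2" | "k = -2" | "k = -1" | "k \<ge> 0" by linarith
    thus "A $$ k = wpF (A $$ 2) (A $$ 4) $$ k"
    proof cases
      case 4
      have "even (nat k) \<longleftrightarrow> even k" using 4 by (simp add: even_nat_iff)
      moreover have "nat (k div 2) = nat k div 2" using 4 by (simp add: nat_div_distrib)
      moreover have "k = 0" if "even k" "k \<le> 0" using 4 that by simp
      ultimately show ?thesis using 4 coeff'[of k] by (auto simp: wpF_def X a_def)
    qed (use A coeff'[of k] in \<open>simp_all add: wpF_def X a_def\<close>)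
  qed
  have "{-1..1::int} = {-1, 0, 1}" by auto
  hence "(\<Sum>i=-1..1. A $$ i * A $$ (- i)) = 0"
    by (simp add: coeff' a_def)
  thus "c = 10 * A $$ 2"
    using conv[of 2] by (simp add: algebra_simps)
qed

lemma fls_power_nth_simple_pole:
  fixes S :: "complex fls"
  assumes "fls_subdegree S = -1" "S $$ (-1) = 1"
  shows "k < - int p \<Longrightarrow> (S ^ p) $$ k = 0" "(S ^ p) $$ (- int p) = 1"
proof -
  have sub: "fls_subdegree (S ^ p) = - int p"
    using fls_subdegree_pow[of S p] assms by simp
  show "k < - int p \<Longrightarrow> (S ^ p) $$ k = 0" by (rule fls_eq0_below_subdegree) (simp add: sub)
  show "(S ^ p) $$ (- int p) = 1" using fls_pow_base[of S p] assms by (simp add: sub)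
qed

text \<open>The cosecant degeneration: here the operator acts on the powers of \<open>S = 1 / sin z\<close> by a two-term
  rule, which makes the roots of the Frobenius polynomial explicit.\<close>
lemma frobP_degenerate:
  assumes "odd n"
  obtains u v where "u \<noteq> 0"
    "\<And>i. i < (n + 1) div 2 \<Longrightarrow> poly (frobP n l u v) (alpha n l / 3 - (of_nat (l + 1 + 2 * i))\<^sup>2) = 0"
proof -
  define X :: "complex fls" where "X = fps_to_fls (fps_sin 1)"
  define C :: "complex fls" where "C = fps_to_fls (fps_cos 1)"
  define S where "S = inverse X"
  define t :: "complex fls" where "t = fls_const (1/3)"
  \<comment> \<open>\<open>1 / sin^2 z - 1 / 3\<close> is the limit of \<open>\<wp>\<close> as one
    period tends to infinity, up to homothety; subtracting 1/3 removes the constant term.\<close>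
  define A where "A = S\<^sup>2 - t"
  have X': "fls_deriv X = C" by (simp add: X_def C_def fls_deriv_fps_to_fls fps_sin_deriv)
  have C': "fls_deriv C = - X" 
  proof -
    have "fps_deriv (fps_cos 1) = - fps_sin (1 :: complex)" by (simp add: fps_cos_deriv fps_eq_iff)
    thus ?thesis by (simp add: X_def C_def fls_deriv_fps_to_fls fps_to_fls_uminus)
  qed
  have "fps_sin 1 \<noteq> (0 :: complex fps)"
    by (metis fps_sin_nth_1 fps_zero_nth one_neq_zero)
  hence X0: "X \<noteq> 0" by (simp add: X_def)
  have XS: "X * S = 1" using X0 by (simp add: S_def)
  have XC: "C\<^sup>2 + X\<^sup>2 = 1"
    unfolding X_def C_def using fps_sin_cos_sum_of_squares[of "1 :: complex"]
    by (metis fps_to_fls_plus fps_to_fls_power fps_one_to_fls)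
  have "subdegree (fps_sin (1 :: complex)) = 1"
    by (rule subdegreeI) (auto simp: less_Suc_eq)
  hence subX: "fls_subdegree X = 1" by (simp add: X_def fls_subdegree_fls_to_fps)
  have X1: "X $$ 1 = 1" by (simp add: X_def)
  have subS: "fls_subdegree S = -1" using X0 subX by (simp add: S_def fls_inverse_subdegree)
  have S1: "S $$ (-1) = 1"
    using fls_times_base[of X S] XS X1 subX subS by simp
  have S': "fls_deriv S = - C * S\<^sup>2"
  proof -
    have "fls_deriv (X * S) = 0" by (simp add: XS)
    hence "X * fls_deriv S + C * S = 0" by (simp add: X')
    moreover have "X * S * fls_deriv S + C * S * S = S * (X * fls_deriv S + C * S)" by (simp add: algebra_simps)
    ultimately have "X * S * fls_deriv S + C * S * S = 0" by simp
    thus ?thesis unfolding XS by (simp add: power2_eq_square eq_neg_iff_add_eq_0 mult.assoc)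
  qed
  have D1: "fls_deriv (S ^ p) = - of_nat p * C * S ^ (p + 1)" for p
  proof (cases p)
    case (Suc m)
    have "fls_deriv (S ^ p) = of_nat p * S ^ (p - 1) * fls_deriv S" by (rule fls_deriv_power)
    also have "\<dots> = of_nat p * S ^ m * (- C * S\<^sup>2)" unfolding S' by (simp add: Suc)
    also have "\<dots> = - of_nat p * C * (S ^ m * S\<^sup>2)" by (simp only: mult_minus_left mult_minus_right mult_ac)
    also have "S ^ m * S\<^sup>2 = S ^ (p + 1)" by (simp add: Suc power2_eq_square)
    finally show ?thesis .
  qed simp
  have XSp: "X * S ^ (p + 1) = S ^ p" for p using XS by (simp add: mult.assoc[symmetric])
  have CSp: "C * C * S ^ (p + 2) = S ^ (p + 2) - S ^ p" for p
  proof -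
    have "X * X * S ^ (p + 2) = X * (X * S ^ (p + 1 + 1))" by (simp only: mult.assoc add.assoc one_add_one)
    hence "X * X * S ^ (p + 2) = S ^ p" by (simp only: XSp)
    moreover have "(C * C + X * X) * S ^ (p + 2) = S ^ (p + 2)"
      using XC by (simp only: power2_eq_square mult_1)
    ultimately show ?thesis by (simp only: distrib_right) (simp only: eq_diff_eq)
  qed
  have D2: "fls_deriv (fls_deriv (S ^ p)) = of_nat (p * (p + 1)) * S ^ (p + 2) - of_nat (p * p) * S ^ p" for p
  proof -
    have "fls_deriv (fls_deriv (S ^ p)) = of_nat p * (X * S ^ (p + 1)) + of_nat p * of_nat (p + 1) * (C * C * S ^ (p + 2))"
      unfolding D1 by (simp only: fls_deriv_mult fls_deriv_neg fls_deriv_of_nat C' D1) (simp add: algebra_simps)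
    thus ?thesis unfolding XSp CSp by (simp add: algebra_simps)
  qed
  have D3: "fls_deriv (fls_deriv (fls_deriv (S ^ p))) =
      C * S ^ (p + 1) * (of_nat (p * p * p) - of_nat (p * (p + 1) * (p + 2)) * S\<^sup>2)" for p
    unfolding D2 by (simp only: fls_deriv_mult fls_deriv_sub fls_deriv_of_nat D1)
      (simp add: algebra_simps power2_eq_square)
  have A': "fls_deriv A = - 2 * C * S ^ 3"
    using D1[of 2] by (simp add: A_def t_def numeral_3_eq_3)
  have t: "3 * t = 1" by (simp add: t_def fls_eq_iff)
  have ode: "fls_deriv (fls_deriv A) = 6 * A\<^sup>2 - fls_const (2/3)"
  proof -
    have "fls_deriv (fls_deriv A) = 6 * S ^ 4 - 4 * S\<^sup>2"
      using D2[of 2] by (simp add: A_def t_def numeral_eq_Suc)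
    moreover have "fls_const (2/3) = 2 * t" by (simp add: t_def fls_eq_iff)
    moreover have "6 * A\<^sup>2 - 2 * t = 6 * S ^ 4 - 4 * S\<^sup>2" 
    proof -
      have "6 * A\<^sup>2 - 2 * t = 6 * S ^ 4 - 4 * (3 * t) * S\<^sup>2 + 2 * t * (3 * t) - 2 * t"
        unfolding A_def by (simp add: power2_eq_square power4_eq_xxxx algebra_simps)
      thus ?thesis unfolding t by simp
    qed
    ultimately show ?thesis by simp
  qed
  define u v where "u = A $$ 2" and "v = A $$ 4"
  have A0: "A $$ k = 0" if "k < -2" for k
    using fls_power_nth_simple_pole(1)[OF subS S1, of k 2] that by (simp add: A_def t_def)
  have A2: "A $$ (-2) = 1"
    using fls_power_nth_simple_pole(2)[OF subS S1, of 2] by (simp add: A_def t_def)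
  have A: "A = wpF u v" and u: "u \<noteq> 0"
    using wpF_unique[OF A0 A2 ode] by (auto simp: u_def v_def)
  define W where "W = alpha n l / 3"
  have DS: "Dop n l B A (S ^ p) = C * S ^ (p + 1) *
      (fls_const (indicial n l (- of_nat p)) * S\<^sup>2 + fls_const (of_nat p * ((of_nat p)\<^sup>2 - W + B)))" for p B
  proof -
    have e1: "fls_const (indicial n l (- of_nat p)) = - of_nat (p * (p + 1) * (p + 2))
       + fls_const (alpha n l) * of_nat p - 2 * fls_const (beta n l)"
      by (simp add: indicial_def fls_eq_iff fls_of_nat algebra_simps)
    have e2: "fls_const (of_nat p * ((of_nat p)\<^sup>2 - W + B)) = of_nat (p * p * p) - of_nat p * fls_const (alpha n l) * t + of_nat p * fls_const B"
      by (simp add: W_def t_def fls_eq_iff fls_of_nat algebra_simps power2_eq_square)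
    show ?thesis unfolding Dop_def
      by (simp only: D3 A' e1 e2, simp only: D1 A_def)
        (simp add: algebra_simps power2_eq_square power3_eq_cube)
  qed
  define d where "d = (n + 1) div 2"
  have d: "d > 0" "2 * d = n + 1" using assms by (auto simp: d_def elim!: oddE)
  have root: "poly (frobP n l u v) (W - (of_nat (l + 1 + 2 * i))\<^sup>2) = 0" if "i < d" for i
  proof -
    \<comment> \<open>At this \<open>B\<close> the lower term in the image of
      \<open>S ^ (l + 1 + 2 * i)\<close> vanishes, so the chain of powers \<open>n + l\<close>,
      \<open>n + l - 2\<close>, ... terminates there and a finite sum is an exact solution.\<close>
    define B where "B = W - (of_nat (l + 1 + 2 * i))\<^sup>2"
    define p where "p j = n + l - 2 * j" for j
    define g where "g j = of_nat (p j) * ((of_nat (p j))\<^sup>2 - W + B)" for j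
    define I where "I j = indicial n l (- of_nat (p j))" for j
    define x where "x = rec_nat 1 (\<lambda>j xj. - xj * g j / I (Suc j))"
    have x: "x 0 = 1" "x (Suc j) = - x j * g j / I (Suc j)" for j by (simp_all add: x_def)
    have I: "I j = 0 \<longleftrightarrow> j = 0" if "j < d" for j
    proof -
      have "- of_nat (p j) = (of_int (2 * int j - int (n + l)) :: complex)"
        using that d by (simp add: p_def of_nat_diff)
      thus ?thesis unfolding I_def using that d by (simp only: indicial_eq_0_iff) auto
    qed
    define j0 where "j0 = d - 1 - i"
    have pj0: "p j0 = l + 1 + 2 * i" using that d by (simp add: p_def j0_def)
    have g0: "g j0 = 0" by (simp add: g_def pj0 B_def)
    have xz: "x j = 0" if "j > j0" for j
      using that by (induction j) (auto simp: x less_Suc_eq g0)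
    \<comment> \<open>The last lower term has to vanish as well: either the chain stops exactly at
      the power \<open>l + 1\<close>, which is \<open>i = 0\<close>, or it stopped earlier and
      \<open>x (d - 1)\<close> is zero.\<close>
    have gx: "x (d - 1) * g (d - 1) = 0"
      using g0 xz[of "d - 1"] that d by (cases "i = 0") (auto simp: j0_def)
    define Y where "Y = (\<Sum>j<d. fls_const (x j) * S ^ p j)"
    \<comment> \<open>The lower term for \<open>j\<close> cancels the upper term for
      \<open>Suc j\<close>; written as differences of \<open>T\<close> the sum telescopes, and
      \<open>T 0\<close> is zero because \<open>- n - l\<close> is an exponent.\<close>
    define T where "T j = (if j < d then fls_const (x j * I j) * C * S ^ (p j + 3) else 0)" for j
    have "Dop n l B A Y = (\<Sum>j<d. fls_const (x j) * Dop n l B A (S ^ p j))"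
      unfolding Y_def by (rule Dop_sum)
    also have "\<dots> = (\<Sum>j<d. T j - T (Suc j))"
    proof (rule sum.cong)
      fix j assume j: "j \<in> {..<d}"
      have "fls_const (x j) * Dop n l B A (S ^ p j) = T j + fls_const (x j * g j) * C * S ^ (p j + 1)"
        unfolding DS I_def[symmetric] g_def[symmetric] using j
        by (simp add: T_def algebra_simps power2_eq_square numeral_3_eq_3 flip: fls_const_mult_const)
      also have "fls_const (x j * g j) * C * S ^ (p j + 1) = - T (Suc j)"
      proof (cases "Suc j < d")
        case True
        have "x j * g j = - (x (Suc j) * I (Suc j))" using I[OF True] by (simp add: x)
        moreover have pj: "p (Suc j) + 3 = p j + 1" using True d by (simp add: p_def)
        have "T (Suc j) = fls_const (x (Suc j) * I (Suc j)) * C * S ^ (p j + 1)"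
          using True by (simp only: T_def pj if_True)
        ultimately show ?thesis by simp
      next
        case False
        hence "j = d - 1" using j by auto
        thus ?thesis using gx False by (simp add: T_def)
      qed
      finally show "fls_const (x j) * Dop n l B A (S ^ p j) = T j - T (Suc j)" by simp
    qed simp
    also have "\<dots> = T 0 - T d" by (rule sum_lessThan_telescope')
    also have "\<dots> = 0" using I[of 0] d by (simp add: T_def)
    finally have DY: "Dop n l B (wpF u v) Y = 0" by (simp add: A)
    define s where "s = - int (n + l)"
    have Yk: "Y $$ k = 0" if "k < s" for k
    proof -
      have "(S ^ p j) $$ k = 0" for j
        by (rule fls_power_nth_simple_pole(1)[OF subS S1]) (use that in \<open>simp add: p_def s_def\<close>)
      thus ?thesis by (simp add: Y_def fls_nth_sum)
    qed
    have "Y $$ s = (\<Sum>j<d. if j = 0 then 1 else 0)"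
      unfolding Y_def fls_nth_sum
    proof (rule sum.cong)
      fix j assume j: "j \<in> {..<d}"
      have "(S ^ p 0) $$ s = 1"
        using fls_power_nth_simple_pole(2)[OF subS S1, of "p 0"] by (simp add: s_def p_def)
      moreover have "(S ^ p j) $$ s = 0" if "j \<noteq> 0"
        by (rule fls_power_nth_simple_pole(1)[OF subS S1]) (use j that d in \<open>simp add: p_def s_def\<close>)
      ultimately show "(fls_const (x j) * S ^ p j) $$ s = (if j = 0 then 1 else 0)"
        by (simp add: x)
    qed simp
    hence "Y $$ s \<noteq> 0" using d by simp
    thus ?thesis unfolding B_def[symmetric] using Yk
      by (intro frobenius_necessary[OF _ _ s_def assms DY]) auto
  qed
  show thesis
    by (rule that[OF u]) (use root in \<open>simp add: d_def W_def\<close>)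
qed

section \<open>The discriminant\<close>

definition disc :: "nat \<Rightarrow> nat \<Rightarrow> complex \<Rightarrow> complex \<Rightarrow> complex" where
  "disc n l u v = resultant (frobP n l u v) (pderiv (frobP n l u v))"

lemma degree_complex_poly_eq_sum_order:
  fixes p :: "complex poly"
  assumes "p \<noteq> 0"
  shows "degree p = (\<Sum>z | poly p z = 0. order z p)"
proof -
  have fin: "finite {z. poly p z = 0}" using assms by (rule poly_roots_finite)
  have "degree p = degree (smult (lead_coeff p) (\<Prod>z | poly p z = 0. [:-z, 1:] ^ order z p))"
    by (simp only: complex_poly_decompose)
  also have "\<dots> = degree (\<Prod>z | poly p z = 0. [:-z, 1:] ^ order z p)"
    using assms by simp
  also have "\<dots> = (\<Sum>z | poly p z = 0. degree ([:-z, 1:] ^ order z p))"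
    by (rule degree_prod_eq_sum_degree) simp
  also have "\<dots> = (\<Sum>z | poly p z = 0. order z p)"
    by (intro sum.cong refl degree_linear_power)
  finally show ?thesis .
qed

lemma resultant_pderiv_eq_0_iff:
  fixes p :: "complex poly"
  assumes "degree p > 0"
  shows "resultant p (pderiv p) = 0 \<longleftrightarrow> card {z. poly p z = 0} \<noteq> degree p"
proof -
  have p0: "p \<noteq> 0" using assms by auto
  have fin: "finite {z. poly p z = 0}" using p0 by (rule poly_roots_finite)
  have der: "pderiv ([:-z, 1:] * q) = [:-z, 1:] * pderiv q + q" for z :: complex and q
    by (subst pderiv_mult) (simp add: pderiv_pCons)
  have "resultant p (pderiv p) = 0 \<longleftrightarrow> degree (gcd p (pderiv p)) \<noteq> 0"
    by (rule resultant_0_gcd)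
  also have "\<dots> \<longleftrightarrow> (\<exists>z. poly p z = 0 \<and> poly (pderiv p) z = 0)"
  proof
    assume "degree (gcd p (pderiv p)) \<noteq> 0"
    hence "\<not> constant (poly (gcd p (pderiv p)))" by (simp add: constant_degree)
    then obtain z where "poly (gcd p (pderiv p)) z = 0"
      using fundamental_theorem_of_algebra by blast
    hence "[:-z, 1:] dvd gcd p (pderiv p)" by (simp add: poly_eq_0_iff_dvd)
    thus "\<exists>z. poly p z = 0 \<and> poly (pderiv p) z = 0"
      by (auto simp: poly_eq_0_iff_dvd)
  next
    assume "\<exists>z. poly p z = 0 \<and> poly (pderiv p) z = 0"
    then obtain z where "[:-z, 1:] dvd gcd p (pderiv p)" by (auto simp: poly_eq_0_iff_dvd)
    moreover have "gcd p (pderiv p) \<noteq> 0" using p0 by simp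
    ultimately have "degree [:-z, 1:] \<le> degree (gcd p (pderiv p))" by (rule dvd_imp_degree_le)
    thus "degree (gcd p (pderiv p)) \<noteq> 0" by simp
  qed
  also have "\<dots> \<longleftrightarrow> card {z. poly p z = 0} \<noteq> degree p"
  proof
    assume "\<exists>z. poly p z = 0 \<and> poly (pderiv p) z = 0"
    then obtain z where z: "poly p z = 0" "poly (pderiv p) z = 0" by blast
    from z(1) obtain q where q: "p = [:-z, 1:] * q" unfolding poly_eq_0_iff_dvd by (rule dvdE)
    have "poly q z = 0" using z(2) unfolding q der by simp
    hence sub: "{z. poly p z = 0} \<subseteq> {z. poly q z = 0}" unfolding q poly_mult by auto
    have q0: "q \<noteq> 0" using p0 q by auto
    have "card {z. poly p z = 0} \<le> card {z. poly q z = 0}"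
      by (rule card_mono[OF poly_roots_finite[OF q0] sub])
    also have "\<dots> \<le> degree q" by (rule card_poly_roots_bound[OF q0])
    also have "degree q < degree p" unfolding q by (subst degree_mult_eq[OF _ q0]) simp_all
    finally show "card {z. poly p z = 0} \<noteq> degree p" by simp
  next
    assume c: "card {z. poly p z = 0} \<noteq> degree p"
    have "\<exists>z. poly p z = 0 \<and> order z p \<noteq> 1"
    proof (rule ccontr)
      assume "\<not> ?thesis"
      hence "(\<Sum>z | poly p z = 0. order z p) = (\<Sum>z | poly p z = 0. 1)"
        by (intro sum.cong) auto
      thus False using c degree_complex_poly_eq_sum_order[OF p0] by simp
    qed
    then obtain z where z: "poly p z = 0" "order z p \<noteq> 1" by blast
    moreover have "order z p \<noteq> 0" using z(1) p0 unfolding order_root by blast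
    ultimately have "2 \<le> order z p" by linarith
    hence "[:-z, 1:] ^ 2 dvd p" by (simp only: order_divides simp_thms)
    then obtain q where q: "p = [:-z, 1:] ^ 2 * q" by (rule dvdE)
    have "poly (pderiv p) z = 0" unfolding q power2_eq_square mult.assoc der by simp
    thus "\<exists>z. poly p z = 0 \<and> poly (pderiv p) z = 0" using z by blast
  qed
  finally show ?thesis .
qed

lemma disc_eq_0_iff:
  assumes "odd n"
  shows "disc n l u v = 0 \<longleftrightarrow> card {B. poly (frobP n l u v) B = 0} \<noteq> (n + 1) div 2"
  using resultant_pderiv_eq_0_iff[of "frobP n l u v"] degree_frobP[OF assms] odd_pos[OF assms]
  by (simp add: disc_def)

lemma coeff_frobP_scale:
  assumes "odd n" "m \<noteq> 0" "i \<le> (n + 1) div 2"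
  shows "coeff (frobP n l (m\<^sup>2 * u) (m ^ 3 * v)) i = m ^ ((n + 1) div 2 - i) * coeff (frobP n l u v) i"
proof -
  define d where "d = (n + 1) div 2"
  have "poly (pcompose (frobP n l (m\<^sup>2 * u) (m ^ 3 * v)) [:0, m:]) = poly (smult (m ^ d) (frobP n l u v))"
  proof
    fix x
    show "poly (pcompose (frobP n l (m\<^sup>2 * u) (m ^ 3 * v)) [:0, m:]) x = poly (smult (m ^ d) (frobP n l u v)) x"
      using frobP_scale[OF assms(1), of l m u v x] by (simp add: poly_pcompose d_def mult.commute[of x m])
  qed
  hence "pcompose (frobP n l (m\<^sup>2 * u) (m ^ 3 * v)) [:0, m:] = smult (m ^ d) (frobP n l u v)"
    by (simp only: poly_eq_poly_eq_iff)
  hence "coeff (pcompose (frobP n l (m\<^sup>2 * u) (m ^ 3 * v)) [:0, m:]) i = coeff (smult (m ^ d) (frobP n l u v)) i"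
    by simp
  hence "m ^ i * coeff (frobP n l (m\<^sup>2 * u) (m ^ 3 * v)) i = m ^ d * coeff (frobP n l u v) i"
    by (simp add: coeff_pcompose_linear)
  also have "m ^ d = m ^ i * m ^ (d - i)" using assms(3) by (simp add: d_def flip: power_add)
  finally show ?thesis using assms(2) by (simp add: d_def)
qed

text \<open>Coefficient \<open>i\<close> of the polynomial has weight \<open>d - i\<close>.
  Multiplying row \<open>i\<close> of the scaled Sylvester matrix by \<open>m ^ r i\<close> has the
  same effect as multiplying column \<open>j\<close> of the original one by \<open>m ^ j\<close>;
  the total exponents of columns and rows differ by \<open>d * (d - 1)\<close>.\<close>

lemma disc_scale:
  assumes "odd n" "m \<noteq> 0"
  defines "d \<equiv> (n + 1) div 2"
  shows "disc n l (m\<^sup>2 * u) (m ^ 3 * v) = m ^ (d * (d - 1)) * disc n l u v"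
proof -
  have d: "d > 0" using odd_pos[OF assms(1)] by (simp add: d_def)
  define N where "N = d + (d - 1)"
  \<comment> \<open>Position of a row within its block: the Sylvester matrix has
    \<open>d - 1\<close> rows for the polynomial, followed by \<open>d\<close> rows for its
    derivative.\<close>
  define r where "r i = (if i < d - 1 then i else i - (d - 1))" for i
  define p where "p = frobP n l u v"
  define p' where "p' = frobP n l (m\<^sup>2 * u) (m ^ 3 * v)"
  have deg: "degree p = d" "degree p' = d" "degree (pderiv p) = d - 1" "degree (pderiv p') = d - 1"
    using degree_frobP[OF assms(1)] by (simp_all add: p_def p'_def d_def degree_pderiv)
  have cp: "coeff p' i = m ^ (d - i) * coeff p i" if "i \<le> d" for i
    using coeff_frobP_scale[OF assms(1,2)] that by (simp add: p_def p'_def d_def)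
  define M where "M = sylvester_mat p (pderiv p)"
  define M' where "M' = sylvester_mat p' (pderiv p')"
  have entry: "m ^ r i * index_mat M' (i, j) = m ^ j * index_mat M (i, j)" if "i < N" "j < N" for i j
  proof (cases "i < d - 1")
    case True
    have "m ^ i * coeff p' (d + i - j) = m ^ j * coeff p (d + i - j)" if ij: "i \<le> j" "j - i \<le> d"
    proof -
      have "d - (d + i - j) = j - i" using ij by simp
      hence "coeff p' (d + i - j) = m ^ (j - i) * coeff p (d + i - j)" using cp[of "d + i - j"] ij by simp
      moreover have "m ^ j = m ^ i * m ^ (j - i)" using ij by (simp flip: power_add)
      ultimately show ?thesis by simp
    qed
    thus ?thesis unfolding M_def M'_def using that True
      by (simp add: sylvester_index_mat deg N_def r_def)
  next
    case False
    have "m ^ (i - (d - 1)) * m ^ (d - Suc (i - j)) = m ^ j" if "i - (d - 1) \<le> j" "j \<le> i" "Suc (i - j) \<le> d"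
      using that False by (simp flip: power_add)
    thus ?thesis unfolding M_def M'_def using that False
      by (auto simp: sylvester_index_mat deg N_def r_def cp coeff_pderiv)
  qed
  have sr: "(\<Sum>i = 0..<N. i) = (\<Sum>i = 0..<N. r i) + d * (d - 1)"
  proof -
    have "(\<Sum>i = 0..<N. i) = (\<Sum>i = 0..<N. r i + (if i < d - 1 then 0 else d - 1))"
      by (intro sum.cong) (auto simp: r_def)
    also have "\<dots> = (\<Sum>i = 0..<N. r i) + (\<Sum>i = 0..<N. if i < d - 1 then 0 else d - 1)"
      by (rule sum.distrib)
    also have "(\<Sum>i = 0..<N. if i < d - 1 then 0 else d - 1) = (\<Sum>i = d - 1..<N. d - 1)"
      by (rule sum.mono_neutral_cong_right) auto
    also have "\<dots> = d * (d - 1)" using d by (simp add: N_def)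
    finally show ?thesis .
  qed
  have car: "M \<in> carrier_mat N N" "M' \<in> carrier_mat N N"
    using sylvester_carrier_mat[of p "pderiv p"] sylvester_carrier_mat[of p' "pderiv p'"]
    by (simp_all add: M_def M'_def deg N_def)
  have "m ^ (\<Sum>i = 0..<N. r i) * Determinant.det M' =
      (\<Sum>q | q permutes {0..<N}. signof q * (\<Prod>i = 0..<N. m ^ r i * index_mat M' (i, q i)))"
    unfolding Determinant.det_def'[OF car(2)] sum_distrib_left
    by (intro sum.cong) (simp_all add: prod.distrib power_sum mult_ac)
  also have "\<dots> = (\<Sum>q | q permutes {0..<N}. signof q * (\<Prod>i = 0..<N. m ^ q i * index_mat M (i, q i)))"
  proof (rule sum.cong)
    fix q assume "q \<in> {q. q permutes {0..<N}}"
    hence "q i < N" if "i < N" for i using that permutes_in_image[of q "{0..<N}" i] by simp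
    thus "signof q * (\<Prod>i = 0..<N. m ^ r i * index_mat M' (i, q i)) = signof q * (\<Prod>i = 0..<N. m ^ q i * index_mat M (i, q i))"
      using entry by (simp cong: prod.cong_simp)
  qed simp
  also have "\<dots> = (\<Sum>q | q permutes {0..<N}. m ^ (\<Sum>i = 0..<N. i) * (signof q * (\<Prod>i = 0..<N. index_mat M (i, q i))))"
  proof (rule sum.cong)
    fix q assume "q \<in> {q. q permutes {0..<N}}"
    hence "(\<Prod>i = 0..<N. m ^ q i) = (\<Prod>i = 0..<N. m ^ i)"
      using prod.permute[of q "{0..<N}" "\<lambda>i. m ^ i"] by (simp add: o_def)
    thus "signof q * (\<Prod>i = 0..<N. m ^ q i * index_mat M (i, q i)) = m ^ (\<Sum>i = 0..<N. i) * (signof q * (\<Prod>i = 0..<N. index_mat M (i, q i)))"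
      by (simp add: prod.distrib power_sum mult_ac)
  qed simp
  also have "\<dots> = m ^ (\<Sum>i = 0..<N. i) * Determinant.det M"
    unfolding Determinant.det_def'[OF car(1)] sum_distrib_left ..
  finally have "Determinant.det M' = m ^ (d * (d - 1)) * Determinant.det M"
    unfolding sr power_add using assms(2) by simp
  thus ?thesis unfolding disc_def resultant_def M_def M'_def p_def p'_def .
qed

text \<open>Polynomial dependence on one complex parameter, stated for functions: it passes through
  the recursions and the determinant by closure rules alone, without bivariate polynomials.\<close>

definition polyfun :: "(complex \<Rightarrow> complex) \<Rightarrow> bool" where
  "polyfun f \<longleftrightarrow> (\<exists>p. \<forall>x. f x = poly p x)"

lemma polyfun_const [simp, intro]: "polyfun (\<lambda>x. c)"
  unfolding polyfun_def by (rule exI[of _ "[:c:]"]) simp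

lemma polyfun_id [simp, intro]: "polyfun (\<lambda>x. x)"
  unfolding polyfun_def by (rule exI[of _ "[:0, 1:]"]) simp

lemma polyfun_add [intro]: "polyfun f \<Longrightarrow> polyfun g \<Longrightarrow> polyfun (\<lambda>x. f x + g x)"
  unfolding polyfun_def by (metis poly_add)

lemma polyfun_mult [intro]: "polyfun f \<Longrightarrow> polyfun g \<Longrightarrow> polyfun (\<lambda>x. f x * g x)"
  unfolding polyfun_def by (metis poly_mult)

lemma polyfun_if [intro]: "polyfun f \<Longrightarrow> polyfun g \<Longrightarrow> polyfun (\<lambda>x. if b then f x else g x)"
  by (cases b) simp_all

lemma polyfun_sum [intro]: "(\<And>i. i \<in> I \<Longrightarrow> polyfun (f i)) \<Longrightarrow> polyfun (\<lambda>x. \<Sum>i\<in>I. f i x)"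
  by (induction I rule: infinite_finite_induct) auto

lemma polyfun_prod [intro]: "(\<And>i. i \<in> I \<Longrightarrow> polyfun (f i)) \<Longrightarrow> polyfun (\<lambda>x. \<Prod>i\<in>I. f i x)"
  by (induction I rule: infinite_finite_induct) auto

lemma polyfun_wpc:
  assumes "polyfun f" "polyfun g"
  shows "polyfun (\<lambda>x. wpc (f x) (g x) k)"
proof (induction k rule: less_induct)
  case (less k)
  consider "k = 0" | "k = 1" | "k = 2" | "k > 2" by linarith
  thus ?case
  proof cases
    case 4
    define c where "c = 6 / (of_nat (2 * k) * (of_nat (2 * k) - 1) - 12 :: complex)"
    have "polyfun (\<lambda>x. c * (\<Sum>i<k. wpc (f x) (g x) i * wpc (f x) (g x) (k - 1 - i)))"
      by (intro polyfun_mult polyfun_sum polyfun_const less) (use 4 in auto)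
    moreover have "wpc (f x) (g x) k = c * (\<Sum>i<k. wpc (f x) (g x) i * wpc (f x) (g x) (k - 1 - i))" for x
      by (subst wpc.simps) (use 4 in \<open>simp add: c_def\<close>)
    ultimately show ?thesis by simp
  qed (use assms in \<open>simp_all add: wpc_2\<close>)
qed

lemma polyfun_coeff_frob_rhs:
  assumes "polyfun f" "polyfun g" "j > 0"
    and "\<And>i k. i < j \<Longrightarrow> polyfun (\<lambda>x. coeff (frobc n l (f x) (g x) i) k)"
  shows "polyfun (\<lambda>x. coeff (frob_rhs n l (f x) (g x) j) k)"
proof -
  define c where "c = (2 * of_nat j - of_nat (n + l) - 2 :: complex)"
  have "polyfun (\<lambda>x. (if k = 0 then 0 else c) * coeff (frobc n l (f x) (g x) (j - 1)) (k - 1)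
    + (\<Sum>i<j. (wpc (f x) (g x) (j - 1 - i) *
            (alpha n l * (2 * of_nat i - of_nat (n + l)) - 2 * of_nat (j - 1 - i) * beta n l)) *
           coeff (frobc n l (f x) (g x) i) k))"
    by (intro polyfun_add polyfun_mult polyfun_sum polyfun_const polyfun_wpc assms) (use assms(3) in auto)
  moreover have "coeff (frob_rhs n l (f x) (g x) j) k = (if k = 0 then 0 else c) * coeff (frobc n l (f x) (g x) (j - 1)) (k - 1)
    + (\<Sum>i<j. (wpc (f x) (g x) (j - 1 - i) *
            (alpha n l * (2 * of_nat i - of_nat (n + l)) - 2 * of_nat (j - 1 - i) * beta n l)) *
           coeff (frobc n l (f x) (g x) i) k)" for x
    unfolding frob_rhs_def c_def[symmetric] by (cases k) (simp_all add: coeff_sum)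
  ultimately show ?thesis by simp
qed

lemma polyfun_coeff_frobc:
  assumes "polyfun f" "polyfun g"
  shows "polyfun (\<lambda>x. coeff (frobc n l (f x) (g x) j) k)"
proof (induction j arbitrary: k rule: less_induct)
  case (less j)
  show ?case
  proof (cases "j = 0")
    case False
    have "polyfun (\<lambda>x. 1 / indicial n l (2 * of_nat j - of_nat (n + l)) * coeff (frob_rhs n l (f x) (g x) j) k)"
      using False less by (intro polyfun_mult polyfun_const polyfun_coeff_frob_rhs assms) auto
    thus ?thesis using False by (simp add: frobc_rec)
  qed simp
qed

text \<open>The degree of the polynomial does not depend on \<open>u\<close> and \<open>v\<close>,
  so the Sylvester matrix has a fixed size and its determinant is one polynomial expression in the
  entries.\<close>

lemma polyfun_disc:
  assumes "odd n" "polyfun f" "polyfun g"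
  shows "polyfun (\<lambda>x. disc n l (f x) (g x))"
proof -
  define d where "d = (n + 1) div 2"
  define N where "N = d + (d - 1)"
  define p where "p x = frobP n l (f x) (g x)" for x
  have deg: "degree (p x) = d" "degree (pderiv (p x)) = d - 1" for x
    using degree_frobP[OF assms(1)] by (simp_all add: p_def d_def degree_pderiv)
  have cp: "polyfun (\<lambda>x. coeff (p x) k)" for k
    unfolding p_def frobP_def using odd_pos[OF assms(1)]
    by (intro polyfun_coeff_frob_rhs polyfun_coeff_frobc assms) auto
  have e: "disc n l (f x) (g x) = (\<Sum>q | q permutes {0..<N}. signof q * (\<Prod>i = 0..<N.
      index_mat (sylvester_mat (p x) (pderiv (p x))) (i, q i)))" for x
    unfolding disc_def resultant_def p_def[symmetric]
    by (rule Determinant.det_def') (use sylvester_carrier_mat[of "p x" "pderiv (p x)"] in \<open>simp add: deg N_def\<close>)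
  show ?thesis unfolding e
  proof (intro polyfun_sum polyfun_mult polyfun_const polyfun_prod)
    fix q i assume q: "q \<in> {q. q permutes {0..<N}}" and i: "i \<in> {0..<N}"
    hence qi: "q i < N" using permutes_in_image[of q "{0..<N}" i] by simp
    show "polyfun (\<lambda>x. index_mat (sylvester_mat (p x) (pderiv (p x))) (i, q i))"
    proof -
      have "index_mat (sylvester_mat (p x) (pderiv (p x))) (i, q i) =
          (if i < d - 1 then if i \<le> q i \<and> q i - i \<le> d then coeff (p x) (d + i - q i) else 0
           else if i - (d - 1) \<le> q i \<and> q i \<le> i then of_nat (Suc (i - q i)) * coeff (p x) (Suc (i - q i)) else 0)" for x
        using i qi by (simp add: sylvester_index_mat deg N_def coeff_pderiv)
      thus ?thesis by (simp only:) (intro polyfun_if polyfun_mult polyfun_const cp)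
    qed
  qed
qed

text \<open>Coordinate on the weighted projective line of pairs \<open>(u, v)\<close>, equivalent
  for lattices to the j-invariant. \<open>None\<close> stands for the point
  \<open>u = 0\<close>.\<close>

definition jinv :: "complex \<Rightarrow> complex \<Rightarrow> complex option" where
  "jinv u v = (if u = 0 then None else Some (v\<^sup>2 / u ^ 3))"

text \<open>The restriction to \<open>u = 1\<close> is a polynomial \<open>S\<close> in
  \<open>v^2\<close> of degree \<open>D\<close>. Comparing it with the restriction to
  \<open>v = 1\<close> through the scaling gives \<open>6 * D \<le> e\<close> with
  \<open>e = (n^2 - 1) / 4\<close>. The point \<open>u = 0\<close> adds one zero only when
  \<open>6 * D < e\<close>, so in both cases the count stays below the ceiling of
  \<open>e / 6\<close>, or equals it.\<close>

lemma card_disc_zeros: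
  fixes n l :: nat
  assumes "odd n"
  defines "Z \<equiv> {jinv u v | u v. (u, v) \<noteq> (0, 0) \<and> disc n l u v = 0}"
  shows "finite Z" "int (card Z) \<le> \<lceil>((real n)\<^sup>2 - 1) / 24\<rceil>"
proof -
  define d where "d = (n + 1) div 2"
  have n: "n = 2 * d - 1" "d > 0" using assms(1) by (auto simp: d_def elim!: oddE)
  define e where "e = d * (d - 1)"
  have scale: "disc n l (m\<^sup>2 * u) (m ^ 3 * v) = m ^ e * disc n l u v" if "m \<noteq> 0" for m u v
    using disc_scale[OF assms(1) that] by (simp add: e_def d_def)
  obtain R where R: "\<And>t. disc n l 1 t = poly R t"
    using polyfun_disc[OF assms(1) polyfun_const polyfun_id] unfolding polyfun_def by blast
  obtain Q where Q: "\<And>t. disc n l t 1 = poly Q t"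
    using polyfun_disc[OF assms(1) polyfun_id polyfun_const] unfolding polyfun_def by blast
  have sq: "\<exists>m. m\<^sup>2 = u \<and> m \<noteq> 0" if "u \<noteq> 0" for u :: complex
    using that by (intro exI[of _ "csqrt u"]) auto
  have u1: "disc n l u v = m ^ e * poly R (v / m ^ 3)" if "m\<^sup>2 = u" "m \<noteq> 0" for m u v
    using scale[of m 1 "v / m ^ 3"] that by (simp add: R)
  \<comment> \<open>The pair \<open>(u, v)\<close> of the cosecant need not come from any lattice;
    its distinct explicit roots merely show that the discriminant is not identically zero.\<close>
  have R0: "R \<noteq> 0"
  proof -
    obtain u v where uv: "u \<noteq> 0"
      "\<And>i. i < (n + 1) div 2 \<Longrightarrow> poly (frobP n l u v) (alpha n l / 3 - (of_nat (l + 1 + 2 * i))\<^sup>2) = 0"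
      using frobP_degenerate[OF assms(1)] by blast
    define f where "f i = alpha n l / 3 - (of_nat (l + 1 + 2 * i))\<^sup>2" for i
    have inj: "inj_on f {..<d}"
    proof (rule inj_onI)
      fix i j assume "f i = f j"
      hence "(of_nat ((l + 1 + 2 * i)\<^sup>2) :: complex) = of_nat ((l + 1 + 2 * j)\<^sup>2)" by (simp add: f_def)
      hence "(l + 1 + 2 * i)\<^sup>2 = (l + 1 + 2 * j)\<^sup>2" by (simp only: of_nat_eq_iff)
      thus "i = j" by (simp add: power2_eq_iff_nonneg)
    qed
    have P0: "frobP n l u v \<noteq> 0" using degree_frobP[OF assms(1), of l u v] n(2) by (auto simp: d_def)
    have "d = card (f ` {..<d})" using inj by (simp add: card_image)
    also have "\<dots> \<le> card {B. poly (frobP n l u v) B = 0}"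
      using uv(2) P0 by (intro card_mono poly_roots_finite) (auto simp: f_def d_def)
    finally have "d \<le> card {B. poly (frobP n l u v) B = 0}" .
    moreover have "card {B. poly (frobP n l u v) B = 0} \<le> d"
      using card_poly_roots_bound[OF P0] degree_frobP[OF assms(1)] by (simp add: d_def)
    ultimately have "disc n l u v \<noteq> 0"
      using disc_eq_0_iff[OF assms(1), of l u v] by (simp add: d_def)
    thus ?thesis using sq[OF uv(1)] u1 by auto
  qed
  \<comment> \<open>Scaling by \<open>m = - 1\<close> fixes \<open>u\<close> and negates
    \<open>v\<close>; since the weight is even, the discriminant is an even function of
    \<open>v\<close>.\<close>
  have even_e: "even e" by (auto simp: e_def)
  have Reven: "poly R (-t) = poly R t" for t
    using scale[of "-1" 1 t] even_e by (simp add: R)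
  have Rodd: "coeff R k = 0" if "odd k" for k
  proof -
    have "poly (pcompose R [:0, -1:]) = poly R" using Reven by (auto simp: fun_eq_iff poly_pcompose)
    hence "pcompose R [:0, -1:] = R" by (simp only: poly_eq_poly_eq_iff)
    hence "coeff (pcompose R [:0, -1:]) k = coeff R k" by simp
    thus ?thesis using that by (simp add: coeff_pcompose_linear)
  qed
  define S where "S = (\<Sum>i\<le>degree R. monom (coeff R (2 * i)) i)"
  have S: "poly S (t\<^sup>2) = poly R t" for t
  proof -
    have "poly R t = (\<Sum>i\<le>2 * degree R. coeff R i * t ^ i)"
      unfolding poly_altdef by (rule sum.mono_neutral_left) (auto simp: coeff_eq_0)
    also have "\<dots> = (\<Sum>i\<le>degree R. coeff R (2 * i) * t ^ (2 * i))"
      by (rule sum_atMost_even) (simp add: Rodd)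
    also have "\<dots> = poly S (t\<^sup>2)" by (simp add: S_def poly_sum poly_monom power_mult)
    finally show ?thesis ..
  qed
  have S0: "S \<noteq> 0"
  proof
    assume "S = 0"
    hence "poly R = poly 0" using S by (auto simp: fun_eq_iff)
    thus False using R0 by (simp only: poly_eq_poly_eq_iff)
  qed
  define D where "D = degree S"
  \<comment> \<open>The value at \<open>(m^2, 1)\<close> is \<open>Q (m^2)\<close> and, by scaling,
    also \<open>m ^ e * S (1 / m ^ 6)\<close>. Multiplication by \<open>m ^ (6 * D)\<close> turns
    \<open>S\<close> into its reflection and both sides into polynomials.\<close>
  define G1 G2 where "G1 = monom 1 (6 * D) * pcompose Q (monom 1 2)"
    and "G2 = monom 1 e * pcompose (reflect_poly S) (monom 1 6)"
  have G: "poly G1 m = poly G2 m" if "m \<noteq> 0" for m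
  proof -
    have "poly Q (m\<^sup>2) = m ^ e * poly R (1 / m ^ 3)" using u1[OF refl that, of 1] by (simp only: Q)
    moreover have "(1 / m ^ 3)\<^sup>2 = inverse (m ^ 6)"
      by (simp add: power_divide inverse_eq_divide flip: power_mult)
    hence "poly R (1 / m ^ 3) = poly S (inverse (m ^ 6))" using S[of "1 / m ^ 3"] by (simp only:)
    moreover have "m ^ (6 * D) = (m ^ 6) ^ D" by (rule power_mult)
    moreover have "poly (reflect_poly S) (m ^ 6) = (m ^ 6) ^ D * poly S (inverse (m ^ 6))"
      unfolding D_def by (rule poly_reflect_poly_nz) (use that in simp)
    ultimately show ?thesis
      by (simp only: G1_def G2_def poly_mult poly_pcompose poly_monom mult_1 mult.left_commute)
  qed
  have "UNIV - {0} \<subseteq> {m. poly (G1 - G2) m = 0}" using G by auto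
  moreover have "infinite (UNIV - {0 :: complex})" by (simp add: infinite_UNIV_char_0)
  ultimately have "infinite {m. poly (G1 - G2) m = 0}" by (rule infinite_super)
  hence "G1 - G2 = 0" using poly_roots_finite by blast
  hence eq: "coeff (monom 1 (6 * D) * pcompose Q (monom 1 2)) k = coeff (monom 1 e * pcompose (reflect_poly S) (monom 1 6)) k" for k
    by (simp only: G1_def G2_def right_minus_eq)
  have c0: "coeff (pcompose p (monom 1 k)) 0 = coeff p 0" if "k > 0" for p :: "complex poly" and k
    using that by (simp add: poly_pcompose poly_monom zero_power flip: poly_0_coeff_0)
  \<comment> \<open>The coefficient at \<open>e\<close> on the right is the leading coefficient of
    \<open>S\<close>. So the left-hand side, a multiple of \<open>m ^ (6 * D)\<close>, has a nonzero
    coefficient at \<open>e\<close>.\<close>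
  have ce: "coeff (monom 1 e * pcompose (reflect_poly S) (monom 1 6)) e \<noteq> 0"
    using S0 by (simp add: coeff_monom_mult c0)
  have De: "6 * D \<le> e" using eq[of e] ce by (auto simp: coeff_monom_mult split: if_splits)
  have De': "6 * D < e" if "poly Q 0 = 0"
  proof -
    have "coeff (monom 1 (6 * D) * pcompose Q (monom 1 2)) (6 * D) = 0"
      using that by (simp add: coeff_monom_mult c0 poly_0_coeff_0)
    hence "6 * D \<noteq> e" using eq[of e] ce by metis
    thus ?thesis using De by simp
  qed
  define T where "T = {w. poly S w = 0}"
  have T: "finite T" "card T \<le> D"
    using poly_roots_finite[OF S0] card_poly_roots_bound[OF S0] by (simp_all add: T_def D_def)
  have sub: "Z \<subseteq> Some ` T \<union> (if poly Q 0 = 0 then {None} else {})"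
  proof
    fix z assume "z \<in> Z"
    then obtain u v where uv: "z = jinv u v" "(u, v) \<noteq> (0, 0)" "disc n l u v = 0" by (auto simp: Z_def)
    show "z \<in> Some ` T \<union> (if poly Q 0 = 0 then {None} else {})"
    proof (cases "u = 0")
      case True
      hence "v \<noteq> 0" using uv(2) by simp
      obtain m where m: "m ^ 3 = v"
        using exists_complex_root[of 3 v] by auto
      hence m0: "m \<noteq> 0" using \<open>v \<noteq> 0\<close> by auto
      have "m ^ e * poly Q 0 = 0" using scale[OF m0, of 0 1] uv(3) True m by (simp add: Q)
      thus ?thesis using m0 True uv(1) by (simp add: jinv_def)
    next
      case False
      then obtain m where m: "m\<^sup>2 = u" "m \<noteq> 0" using sq by blast
      have "poly S ((v / m ^ 3)\<^sup>2) = 0" using u1[OF m, of v] uv(3) m(2) by (simp add: S)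
      moreover have "(v / m ^ 3)\<^sup>2 = v\<^sup>2 / u ^ 3"
        by (simp add: power_divide m(1)[symmetric] flip: power_mult)
      ultimately show ?thesis using False uv(1) by (auto simp: jinv_def T_def)
    qed
  qed
  have fin: "finite (Some ` T \<union> (if poly Q 0 = 0 then {None} else {}))" using T by simp
  show "finite Z" using finite_subset[OF sub fin] .
  have "card Z \<le> card (Some ` T \<union> (if poly Q 0 = 0 then {None} else {}))"
    by (rule card_mono[OF fin sub])
  also have "\<dots> \<le> card (Some ` T) + card (if poly Q 0 = 0 then {None :: complex option} else {})"
    by (rule card_Un_le)
  also have "\<dots> \<le> D + (if poly Q 0 = 0 then 1 else 0)"
    using T by (simp add: card_image)
  finally have cZ: "card Z \<le> D + (if poly Q 0 = 0 then 1 else 0)" .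
  have en: "((real n)\<^sup>2 - 1) / 24 = real e / 6"
    using n(2) by (simp add: n(1) e_def of_nat_diff power2_eq_square algebra_simps)
  show "int (card Z) \<le> \<lceil>((real n)\<^sup>2 - 1) / 24\<rceil>"
  proof (cases "poly Q 0 = 0")
    case True
    have "real D < real e / 6" using De'[OF True] by simp
    hence "int D < \<lceil>real e / 6\<rceil>" by linarith
    thus ?thesis using cZ True unfolding en by simp
  next
    case False
    have "real D \<le> real e / 6" using De by simp
    hence "int D \<le> \<lceil>real e / 6\<rceil>" by linarith
    thus ?thesis using cZ False unfolding en by simp
  qed
qed

section \<open>Quasi-periodic functions on the complement of a lattice\<close>

text \<open>The Weierstrass M-test makes the finite partial sums converge uniformly on the closed
  disc; their derivatives then converge inside it.\<close>

lemma has_field_derivative_infsum_locally: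
  fixes f f' :: "'a \<Rightarrow> complex \<Rightarrow> complex"
  assumes der: "\<And>w z. w \<in> X \<Longrightarrow> z \<in> cball 0 R \<Longrightarrow> (f w has_field_derivative f' w z) (at z)"
    and bound: "\<And>w z. w \<in> X \<Longrightarrow> z \<in> cball 0 R \<Longrightarrow> norm (f w z) \<le> M w"
    and M: "M summable_on X" and z: "z \<in> ball 0 R"
  shows "(\<lambda>w. f w z) summable_on X" "(\<lambda>w. f' w z) summable_on X"
    "((\<lambda>z. \<Sum>\<^sub>\<infinity>w\<in>X. f w z) has_field_derivative (\<Sum>\<^sub>\<infinity>w\<in>X. f' w z)) (at z)"
proof -
  have R: "R > 0" using z by (auto intro: le_less_trans[OF norm_ge_zero])
  show "(\<lambda>w. f w z) summable_on X"
    by (rule abs_summable_summable, rule Infinite_Sum.abs_summable_on_comparison_test'[OF M])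
       (use bound z in auto)
  have ul: "uniform_limit (cball 0 R) (\<lambda>Y z. \<Sum>w\<in>Y. f w z) (\<lambda>z. \<Sum>\<^sub>\<infinity>w\<in>X. f w z) (finite_subsets_at_top X)"
    by (rule Weierstrass_m_test_general[OF bound M])
  have cont: "\<forall>\<^sub>F Y in finite_subsets_at_top X. continuous_on (cball 0 R) (\<lambda>z. \<Sum>w\<in>Y. f w z) \<and>
      (\<forall>z\<in>ball 0 R. ((\<lambda>z. \<Sum>w\<in>Y. f w z) has_field_derivative (\<Sum>w\<in>Y. f' w z)) (at z))"
  proof (rule eventually_finite_subsets_at_top_weakI)
    fix Y assume Y: "finite Y" "Y \<subseteq> X"
    have d: "((\<lambda>z. \<Sum>w\<in>Y. f w z) has_field_derivative (\<Sum>w\<in>Y. f' w z)) (at z)" if "z \<in> cball 0 R" for z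
      using Y der that by (intro DERIV_sum) auto
    have "continuous_on (cball 0 R) (\<lambda>z. \<Sum>w\<in>Y. f w z)"
      using d by (intro continuous_at_imp_continuous_on ballI DERIV_isCont)
    thus "continuous_on (cball 0 R) (\<lambda>z. \<Sum>w\<in>Y. f w z) \<and>
      (\<forall>z\<in>ball 0 R. ((\<lambda>z. \<Sum>w\<in>Y. f w z) has_field_derivative (\<Sum>w\<in>Y. f' w z)) (at z))"
      using d by auto
  qed
  obtain g' where g': "\<And>w. w \<in> ball 0 R \<Longrightarrow>
      ((\<lambda>z. \<Sum>\<^sub>\<infinity>w\<in>X. f w z) has_field_derivative g' w) (at w) \<and>
      ((\<lambda>Y. \<Sum>v\<in>Y. f' v w) \<longlongrightarrow> g' w) (finite_subsets_at_top X)"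
    using has_complex_derivative_uniform_limit[OF cont ul _ R] by auto
  hence s: "((\<lambda>w. f' w z) has_sum g' z) X" using z by (simp add: has_sum_def)
  thus "(\<lambda>w. f' w z) summable_on X" by (auto simp: summable_on_def)
  show "((\<lambda>z. \<Sum>\<^sub>\<infinity>w\<in>X. f w z) has_field_derivative (\<Sum>\<^sub>\<infinity>w\<in>X. f' w z)) (at z)"
    using g'[OF z] infsumI[OF s] by simp
qed

text \<open>Finitely many terms may have poles in the disc. They are split off, and of them a
  derivative is needed at \<open>z\<close> only.\<close>

lemma has_field_derivative_infsum:
  fixes f f' :: "'a \<Rightarrow> complex \<Rightarrow> complex"
  assumes F: "finite F" "F \<subseteq> X"
    and der: "\<And>w z. w \<in> X - F \<Longrightarrow> z \<in> cball 0 R \<Longrightarrow> (f w has_field_derivative f' w z) (at z)"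
    and bound: "\<And>w z. w \<in> X - F \<Longrightarrow> z \<in> cball 0 R \<Longrightarrow> norm (f w z) \<le> M w"
    and M: "M summable_on (X - F)" and z: "z \<in> ball 0 R"
    and derF: "\<And>w. w \<in> F \<Longrightarrow> (f w has_field_derivative f' w z) (at z)"
  shows "(\<lambda>w. f w z) summable_on X" "(\<lambda>w. f' w z) summable_on X"
    "((\<lambda>z. \<Sum>\<^sub>\<infinity>w\<in>X. f w z) has_field_derivative (\<Sum>\<^sub>\<infinity>w\<in>X. f' w z)) (at z)"
proof -
  note * = has_field_derivative_infsum_locally[OF der bound M]
  have X: "X = F \<union> (X - F)" using F by auto
  have s: "g summable_on X" if "g summable_on (X - F)" for g :: "'a \<Rightarrow> complex"
    by (subst X, rule summable_on_Un_disjoint) (use F that in auto)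
  have e: "infsum g X = sum g F + infsum g (X - F)" if "g summable_on (X - F)" for g :: "'a \<Rightarrow> complex"
    by (subst X, subst infsum_Un_disjoint) (use F that in auto)
  show "(\<lambda>w. f w z) summable_on X" "(\<lambda>w. f' w z) summable_on X"
    by (auto intro!: s *(1,2)[OF _ _ _ _ z])
  have "((\<lambda>z. (\<Sum>w\<in>F. f w z) + (\<Sum>\<^sub>\<infinity>w\<in>X - F. f w z)) has_field_derivative
      (\<Sum>w\<in>F. f' w z) + (\<Sum>\<^sub>\<infinity>w\<in>X - F. f' w z)) (at z)"
    by (intro DERIV_add DERIV_sum derF *(3)[OF _ _ _ _ z])
  also have "(\<Sum>w\<in>F. f' w z) + (\<Sum>\<^sub>\<infinity>w\<in>X - F. f' w z) = (\<Sum>\<^sub>\<infinity>w\<in>X. f' w z)"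
    by (rule e[symmetric], rule *(2)[OF _ _ _ _ z])
  finally show "((\<lambda>z. \<Sum>\<^sub>\<infinity>w\<in>X. f w z) has_field_derivative (\<Sum>\<^sub>\<infinity>w\<in>X. f' w z)) (at z)"
  proof (rule DERIV_cong_ev[THEN iffD1, rotated 3])
    have "\<forall>\<^sub>F x in nhds z. x \<in> ball 0 R" by (rule eventually_nhds_in_open) (use z in auto)
    thus "\<forall>\<^sub>F x in nhds z. (\<Sum>w\<in>F. f w x) + (\<Sum>\<^sub>\<infinity>w\<in>X - F. f w x) = (\<Sum>\<^sub>\<infinity>w\<in>X. f w x)"
      by eventually_elim (rule e[symmetric], rule *(1))
  qed auto
qed

text \<open>The exponent is half of -3, so that the product over the two lattice coordinates
  dominates, up to a constant, the inverse cube of the norm.\<close>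

lemma summable_on_int_powr:
  "(\<lambda>k :: int. (1 + \<bar>real_of_int k\<bar>) powr (-3/2)) summable_on UNIV"
proof -
  have "summable (\<lambda>n. real n powr (-3/2))" by (simp add: summable_real_powr_iff)
  hence "summable (\<lambda>n. real (Suc n) powr (-3/2))" by (subst summable_Suc_iff)
  hence 1: "(\<lambda>n. (1 + real n) powr (-3/2)) summable_on UNIV"
    by (subst summable_on_UNIV_nonneg_real_iff) (auto simp: add_ac)
  have a: "(\<lambda>k :: int. (1 + \<bar>real_of_int k\<bar>) powr (-3/2)) summable_on range int"
    by (subst summable_on_reindex) (use 1 in \<open>auto simp: o_def\<close>)
  have b: "(\<lambda>k :: int. (1 + \<bar>real_of_int k\<bar>) powr (-3/2)) summable_on range (\<lambda>n. - int n)"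
    by (subst summable_on_reindex) (use 1 in \<open>auto simp: o_def inj_on_def\<close>)
  have "UNIV = range int \<union> range (\<lambda>n. - int n)"
  proof -
    have "k \<in> range int \<union> range (\<lambda>n. - int n)" for k :: int
      by (cases "k \<ge> 0") (auto intro: rev_image_eqI[of "nat k"] rev_image_eqI[of "nat (-k)"])
    thus ?thesis by blast
  qed
  moreover have "(\<lambda>k :: int. (1 + \<bar>real_of_int k\<bar>) powr (-3/2)) summable_on (range int \<union> (range (\<lambda>n. - int n) - range int))"
    by (intro summable_on_Un_disjoint a summable_on_subset_banach[OF b]) auto
  ultimately show ?thesis by simp
qed

section \<open>Lattice points: coordinates, estimates, summability\<close>

locale weierstrass_lattice =
  fixes \<tau> :: complex
  assumes Im_pos: "Im \<tau> > 0"
begin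

abbreviation L :: "complex set" where "L \<equiv> lattice \<tau>"

lemma lattice_iff: "w \<in> L \<longleftrightarrow> (\<exists>a b. w = of_int a + of_int b * \<tau>)"
  by (auto simp: lattice_def)

lemma lattice_of_int: "of_int a + of_int b * \<tau> \<in> L"
  by (auto simp: lattice_iff)

lemma lattice_0 [simp]: "0 \<in> L" and lattice_1 [simp]: "1 \<in> L" and lattice_tau [simp]: "\<tau> \<in> L"
  using lattice_of_int[of 0 0] lattice_of_int[of 1 0] lattice_of_int[of 0 1] by simp_all

lemma lattice_add [intro]: "v \<in> L \<Longrightarrow> w \<in> L \<Longrightarrow> v + w \<in> L"
proof -
  assume "v \<in> L" "w \<in> L"
  then obtain a b c d where "v = of_int a + of_int b * \<tau>" "w = of_int c + of_int d * \<tau>"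
    unfolding lattice_iff by blast
  hence "v + w = of_int (a + c) + of_int (b + d) * \<tau>" by (simp add: algebra_simps)
  thus ?thesis unfolding lattice_iff by blast
qed

lemma lattice_uminus_iff [simp]: "- w \<in> L \<longleftrightarrow> w \<in> L"
proof -
  have "- w \<in> L" if w: "w \<in> L" for w
  proof -
    obtain a b where "w = of_int a + of_int b * \<tau>" using w unfolding lattice_iff by blast
    hence "- w = of_int (- a) + of_int (- b) * \<tau>" by simp
    thus ?thesis unfolding lattice_iff by blast
  qed
  from this[of w] this[of "- w"] show ?thesis by auto
qed

lemma lattice_diff [intro]: "v \<in> L \<Longrightarrow> w \<in> L \<Longrightarrow> v - w \<in> L"
  using lattice_add[of v "- w"] by simp

lemma lattice_shift_iff [simp]:
  "w \<in> L \<Longrightarrow> z + w \<in> L \<longleftrightarrow> z \<in> L" "w \<in> L \<Longrightarrow> w + z \<in> L \<longleftrightarrow> z \<in> L" "w \<in> L \<Longrightarrow> z - w \<in> L \<longleftrightarrow> z \<in> L"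
proof -
  assume w: "w \<in> L"
  show "z + w \<in> L \<longleftrightarrow> z \<in> L"
    using lattice_add[of z w] lattice_diff[of "z + w" w] w by auto
  thus "w + z \<in> L \<longleftrightarrow> z \<in> L" by (simp only: add.commute)
  show "z - w \<in> L \<longleftrightarrow> z \<in> L"
    using lattice_diff[of z w] lattice_add[of "z - w" w] w by auto
qed

lemma lattice_eq_iff:
  "of_int a + of_int b * \<tau> = of_int c + of_int d * \<tau> \<longleftrightarrow> a = c \<and> b = d"
proof
  assume *: "of_int a + of_int b * \<tau> = of_int c + of_int d * \<tau>"
  hence "Im (of_int a + of_int b * \<tau>) = Im (of_int c + of_int d * \<tau>)" by simp
  hence "b = d" using Im_pos by simp
  with * show "a = c \<and> b = d" by simp
qed auto

lemma tau_half_not_lattice: "\<tau> / 2 \<notin> L"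
proof
  assume "\<tau> / 2 \<in> L"
  then obtain a b where "\<tau> / 2 = of_int a + of_int b * \<tau>" unfolding lattice_iff by blast
  hence "of_int 0 + of_int 1 * \<tau> = of_int (2 * a) + of_int (2 * b) * \<tau>" by (simp add: field_simps)
  thus False unfolding lattice_eq_iff by presburger
qed

lemma one_half_not_lattice: "1 / 2 \<notin> L"
proof
  assume "1 / 2 \<in> L"
  then obtain a b where "1 / 2 = of_int a + of_int b * \<tau>" unfolding lattice_iff by blast
  hence "of_int 1 + of_int 0 * \<tau> = of_int (2 * a) + of_int (2 * b) * \<tau>" by (simp add: field_simps)
  thus False unfolding lattice_eq_iff by presburger
qed

lemma lattice_norm_bound:
  obtains K where "K > 0" "\<And>a b :: int. max \<bar>real_of_int a\<bar> \<bar>real_of_int b\<bar> \<le> K * norm (of_int a + of_int b * \<tau>)"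
proof -
  define K where "K = 1 / Im \<tau> + 1 + norm \<tau> / Im \<tau>"
  have K0: "1 / Im \<tau> > 0" "norm \<tau> / Im \<tau> \<ge> 0" using Im_pos by simp_all
  have "max \<bar>real_of_int a\<bar> \<bar>real_of_int b\<bar> \<le> K * norm (of_int a + of_int b * \<tau>)" for a b :: int
  proof -
    define w where "w = of_int a + of_int b * \<tau>"
    have "\<bar>real_of_int b\<bar> * Im \<tau> = \<bar>Im w\<bar>" using Im_pos by (simp add: w_def abs_mult)
    also have "\<dots> \<le> norm w" by (rule abs_Im_le_cmod)
    finally have b: "\<bar>real_of_int b\<bar> \<le> 1 / Im \<tau> * norm w" using Im_pos by (simp add: field_simps)
    have "\<bar>real_of_int a\<bar> = norm (w - of_int b * \<tau>)" by (simp add: w_def)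
    also have "\<dots> \<le> norm w + norm (of_int b * \<tau>)" by (rule norm_triangle_ineq4)
    also have "norm (of_int b * \<tau>) \<le> (1 / Im \<tau> * norm w) * norm \<tau>"
      using b by (simp only: norm_mult norm_of_int mult_right_mono norm_ge_zero)
    finally have a: "\<bar>real_of_int a\<bar> \<le> (1 + norm \<tau> / Im \<tau>) * norm w" by (simp add: algebra_simps)
    have "1 / Im \<tau> * norm w \<le> K * norm w" "(1 + norm \<tau> / Im \<tau>) * norm w \<le> K * norm w"
      by (rule mult_right_mono; use K0 in \<open>simp add: K_def\<close>)+
    with a b show ?thesis unfolding w_def by linarith
  qed
  moreover have "K > 0" using K0 unfolding K_def by linarith
  ultimately show thesis using that by blast
qed

lemma finite_lattice_cball: "finite (L \<inter> cball 0 R)"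
proof -
  obtain K where K: "K > 0"
    "\<And>a b :: int. max \<bar>real_of_int a\<bar> \<bar>real_of_int b\<bar> \<le> K * norm (of_int a + of_int b * \<tau>)"
    using lattice_norm_bound by blast
  define N where "N = \<lceil>K * R\<rceil>"
  have "L \<inter> cball 0 R \<subseteq> (\<lambda>(a, b). of_int a + of_int b * \<tau>) ` ({-N..N} \<times> {-N..N})"
  proof
    fix w assume "w \<in> L \<inter> cball 0 R"
    then obtain a b where w: "w = of_int a + of_int b * \<tau>" "norm w \<le> R" by (auto simp: lattice_iff)
    have "max \<bar>real_of_int a\<bar> \<bar>real_of_int b\<bar> \<le> K * R"
      using K(2)[of a b] mult_left_mono[of "norm w" R K] K(1) w(2) unfolding w(1)[symmetric] by linarith
    hence "\<bar>real_of_int a\<bar> \<le> of_int N" "\<bar>real_of_int b\<bar> \<le> of_int N"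
      using le_of_int_ceiling[of "K * R"] unfolding N_def by linarith+
    hence "a \<in> {-N..N}" "b \<in> {-N..N}" by auto
    thus "w \<in> (\<lambda>(a, b). of_int a + of_int b * \<tau>) ` ({-N..N} \<times> {-N..N})" using w by auto
  qed
  thus ?thesis by (rule finite_subset) auto
qed

lemma countable_lattice: "countable L"
proof -
  have "L \<subseteq> (\<lambda>ab. of_int (fst ab) + of_int (snd ab) * \<tau>) ` (UNIV :: (int \<times> int) set)"
  proof
    fix w assume "w \<in> L"
    then obtain a b where "w = of_int (fst (a, b)) + of_int (snd (a, b)) * \<tau>" unfolding lattice_iff by auto
    thus "w \<in> (\<lambda>ab. of_int (fst ab) + of_int (snd ab) * \<tau>) ` (UNIV :: (int \<times> int) set)" by blast
  qed
  thus ?thesis by (rule countable_subset) simp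
qed

lemma open_compl_lattice_Un: "open (- (L - A))"
proof (subst open_subopen, rule ballI)
  fix z assume z: "z \<in> - (L - A)"
  define S where "S = (L - A) \<inter> cball 0 (norm z + 1)"
  have "S \<subseteq> L \<inter> cball 0 (norm z + 1)" by (auto simp: S_def)
  hence "finite S" using finite_lattice_cball by (rule finite_subset)
  hence "open (ball z 1 - S)" by (intro open_Diff finite_imp_closed) auto
  moreover have "z \<in> ball z 1 - S" using z by (auto simp: S_def)
  moreover have "ball z 1 - S \<subseteq> - (L - A)"
  proof
    fix x assume x: "x \<in> ball z 1 - S"
    have "norm x \<le> norm z + norm (x - z)" using norm_triangle_sub[of x z] by simp
    also have "\<dots> \<le> norm z + 1" using x by (simp add: dist_norm norm_minus_commute)
    finally show "x \<in> - (L - A)" using x by (auto simp: S_def)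
  qed
  ultimately show "\<exists>T. open T \<and> z \<in> T \<and> T \<subseteq> - (L - A)" by blast
qed

lemma open_compl_lattice [simp]: "open (- L)"
  using open_compl_lattice_Un[of "{}"] by simp

lemma connected_compl_lattice: "connected (- L)"
  using connected_open_diff_countable[of "UNIV :: complex set" L] countable_lattice
  by (simp add: Compl_eq_Diff_UNIV connected_UNIV)

lemma lattice_gap: obtains r where "r > 0" "ball 0 r \<inter> L = {0}"
proof -
  have "open (- (L - {0}))" by (rule open_compl_lattice_Un)
  moreover have "0 \<in> - (L - {0})" by simp
  ultimately obtain r where "r > 0" "ball 0 r \<subseteq> - (L - {0})" by (meson open_contains_ball)
  hence "ball 0 r \<inter> L = {0}" by auto
  thus thesis using that \<open>r > 0\<close> by blast
qed

text \<open>The norm is comparable to the maximum of the two coordinates, and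
  \<open>(1 + max)^(-3)\<close> is at most the product of the powers \<open>-3/2\<close> taken in
  each coordinate, which sums as a product.\<close>

lemma summable_lattice: "(\<lambda>w. 1 / norm w ^ 3) summable_on (L - {0})"
proof -
  obtain K where K: "K > 0"
    "\<And>a b :: int. max \<bar>real_of_int a\<bar> \<bar>real_of_int b\<bar> \<le> K * norm (of_int a + of_int b * \<tau>)"
    using lattice_norm_bound by blast
  define \<phi> where "\<phi> k = (1 + \<bar>real_of_int k\<bar>) powr (-3/2)" for k :: int
  define h where "h = (\<lambda>(a, b). of_int a + of_int b * \<tau>)"
  have inj: "inj_on h X" for X by (auto simp: h_def inj_on_def lattice_eq_iff)
  have h0: "h (a, b) = 0 \<longleftrightarrow> a = 0 \<and> b = 0" for a b
    using lattice_eq_iff[of a b 0 0] by (simp add: h_def)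
  have L: "L - {0} = h ` (UNIV - {(0, 0)})"
  proof (intro equalityI subsetI)
    fix w assume w: "w \<in> L - {0}"
    hence "w \<in> L" by simp
    then obtain a b where "w = of_int a + of_int b * \<tau>" unfolding lattice_iff by blast
    hence ab: "w = h (a, b)" by (simp add: h_def)
    hence "(a, b) \<in> UNIV - {(0, 0)}" using w h0[of a b] by auto
    thus "w \<in> h ` (UNIV - {(0, 0)})" using ab by blast
  next
    fix w assume "w \<in> h ` (UNIV - {(0, 0)})"
    then obtain a b where ab: "w = h (a, b)" "(a, b) \<noteq> (0, 0)" by auto
    thus "w \<in> L - {0}" using h0[of a b] lattice_of_int[of a b] by (simp add: h_def)
  qed
  have \<phi>: "\<phi> summable_on UNIV" using summable_on_int_powr by (simp add: \<phi>_def[abs_def])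
  have "(\<lambda>(a, b). \<phi> a * \<phi> b) summable_on (UNIV \<times> UNIV)"
  proof (rule summable_on_SigmaI)
    show "((\<lambda>b. case (a, b) of (a, b) \<Rightarrow> \<phi> a * \<phi> b) has_sum (\<phi> a * infsum \<phi> UNIV)) UNIV" for a
      using has_sum_cmult_right[OF has_sum_infsum[OF \<phi>], of "\<phi> a"] by simp
    show "(\<lambda>a. \<phi> a * infsum \<phi> UNIV) summable_on UNIV"
      using \<phi> by (rule summable_on_cmult_left)
  qed (simp add: \<phi>_def)
  hence "(\<lambda>(a, b). \<phi> a * \<phi> b) summable_on UNIV - {(0, 0)}"
    by (rule summable_on_subset_banach) auto
  hence s: "(\<lambda>ab. (2 * K) ^ 3 * (case ab of (a, b) \<Rightarrow> \<phi> a * \<phi> b)) summable_on UNIV - {(0, 0)}"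
    by (rule summable_on_cmult_right)
  have "(\<lambda>ab. 1 / norm (h ab) ^ 3) summable_on UNIV - {(0, 0)}"
  proof (rule summable_on_comparison_test[OF s])
    fix ab :: "int \<times> int" assume ab: "ab \<in> UNIV - {(0, 0)}"
    obtain a b where [simp]: "ab = (a, b)" by (cases ab)
    define m where "m = max \<bar>real_of_int a\<bar> \<bar>real_of_int b\<bar>"
    have m1: "m \<ge> 1" using ab by (auto simp: m_def max_def)
    have mK: "m \<le> K * norm (h ab)" using K(2)[of a b] by (simp add: m_def h_def)
    have "norm (h ab) \<noteq> 0" using m1 mK by auto
    hence pos: "norm (h ab) > 0" by simp
    have "1 + m \<le> 2 * K * norm (h ab)" using m1 mK by linarith
    hence "(1 + m) ^ 3 \<le> (2 * K * norm (h ab)) ^ 3" using m1 by (intro power_mono) auto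
    hence c: "(1 + m) ^ 3 \<le> (2 * K) ^ 3 * norm (h ab) ^ 3" by (simp only: power_mult_distrib)
    have p: "(1 + m) powr (-3/2) * (1 + m) powr (-3/2) = 1 / (1 + m) ^ 3"
    proof -
      have "(1 + m) powr (-3/2) * (1 + m) powr (-3/2) = (1 + m) powr (-3)" by (simp flip: powr_add)
      also have "\<dots> = 1 / (1 + m) powr (real 3)" by (simp add: powr_minus_divide)
      also have "(1 + m) powr (real 3) = (1 + m) ^ 3" using m1 by (intro powr_realpow) simp
      finally show ?thesis .
    qed
    have "1 / norm (h ab) ^ 3 \<le> (2 * K) ^ 3 * (1 / (1 + m) ^ 3)"
    proof -
      have "(1 + m) ^ 3 > 0" "norm (h ab) ^ 3 > 0" using m1 pos by simp_all
      thus ?thesis using c by (simp only: divide_simps mult_1) auto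
    qed
    also have "1 / (1 + m) ^ 3 \<le> \<phi> a * \<phi> b"
      unfolding p[symmetric] \<phi>_def by (intro mult_mono powr_mono2') (auto simp: m_def)
    hence "(2 * K) ^ 3 * (1 / (1 + m) ^ 3) \<le> (2 * K) ^ 3 * (\<phi> a * \<phi> b)"
      by (rule mult_left_mono) (use K(1) in simp)
    finally show "1 / norm (h ab) ^ 3 \<le> (2 * K) ^ 3 * (case ab of (a, b) \<Rightarrow> \<phi> a * \<phi> b)" by simp
  qed auto
  thus ?thesis unfolding L by (subst summable_on_reindex[OF inj]) (simp add: o_def)
qed

end

section \<open>Weierstrass functions twisted by a sign character\<close>

locale lattice_character = weierstrass_lattice +
  fixes ch :: "complex \<Rightarrow> complex"
  assumes chi_pm: "w \<in> L \<Longrightarrow> ch w = 1 \<or> ch w = -1"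
    and chi_add: "v \<in> L \<Longrightarrow> w \<in> L \<Longrightarrow> ch (v + w) = ch v * ch w"
begin

lemma chi_0: "ch 0 = 1"
  using chi_pm[of 0] chi_add[of 0 0] by auto

lemma chi_uminus: "w \<in> L \<Longrightarrow> ch (- w) = ch w"
  using chi_add[of w "-w"] chi_pm[of w] chi_pm[of "-w"] chi_0 by auto

lemma norm_chi: "w \<in> L \<Longrightarrow> norm (ch w) = 1"
  using chi_pm[of w] by auto

text \<open>\<open>zs\<close>, \<open>hs\<close> and \<open>gs\<close> are the parts regular at the
  origin of the twisted zeta function, of its negative derivative (the twisted
  \<open>\<wp>\<close>), and of minus one half of the derivative of the latter.\<close>

definition zs :: "complex \<Rightarrow> complex" where
  "zs z = (\<Sum>\<^sub>\<infinity>w\<in>L - {0}. ch w * (1 / (z - w) + 1 / w + z / w\<^sup>2))"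

definition hs :: "complex \<Rightarrow> complex" where
  "hs z = (\<Sum>\<^sub>\<infinity>w\<in>L - {0}. ch w * (1 / (z - w)\<^sup>2 - 1 / w\<^sup>2))"

definition gs :: "complex \<Rightarrow> complex" where
  "gs z = (\<Sum>\<^sub>\<infinity>w\<in>L - {0}. ch w * (1 / (z - w) ^ 3))"

text \<open>The subtracted terms leave cubic decay in \<open>w\<close>. The constants come from
  \<open>norm (z - w) \<ge> norm w / 2\<close>, valid for lattice points of norm at least
  \<open>2 * R\<close>.\<close>

lemma term_bounds:
  fixes z w :: complex
  assumes "norm z \<le> R" "2 * R \<le> norm w" "R > 0"
  shows "norm (1 / (z - w) + 1 / w + z / w\<^sup>2) \<le> 2 * R\<^sup>2 * (1 / norm w ^ 3)"
    "norm (1 / (z - w)\<^sup>2 - 1 / w\<^sup>2) \<le> 10 * R * (1 / norm w ^ 3)" "z \<noteq> w"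
proof -
  have w0: "norm w > 0" using assms by linarith
  have "norm w \<le> norm (z - w) + norm z" using norm_triangle_sub[of w z] by (simp add: norm_minus_commute)
  hence zw: "norm w / 2 \<le> norm (z - w)" using assms by linarith
  hence zw0: "norm (z - w) > 0" using w0 by linarith
  thus "z \<noteq> w" by auto
  have nz: "z - w \<noteq> 0" "w \<noteq> 0" using zw0 w0 by auto
  have "1 / (z - w) = w\<^sup>2 / (w\<^sup>2 * (z - w))" "1 / w = w * (z - w) / (w\<^sup>2 * (z - w))" "z / w\<^sup>2 = z * (z - w) / (w\<^sup>2 * (z - w))"
    using nz by (simp_all add: power2_eq_square)
  hence "1 / (z - w) + 1 / w + z / w\<^sup>2 = (w\<^sup>2 + w * (z - w) + z * (z - w)) / (w\<^sup>2 * (z - w))"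
    by (simp only: add_divide_distrib)
  also have "w\<^sup>2 + w * (z - w) + z * (z - w) = z\<^sup>2" by (simp add: power2_eq_square right_diff_distrib mult.commute)
  finally have "1 / (z - w) + 1 / w + z / w\<^sup>2 = z\<^sup>2 / (w\<^sup>2 * (z - w))" .
  hence "norm (1 / (z - w) + 1 / w + z / w\<^sup>2) = (norm z)\<^sup>2 / ((norm w)\<^sup>2 * norm (z - w))"
    by (simp add: norm_divide norm_mult norm_power)
  also have "\<dots> \<le> R\<^sup>2 / ((norm w)\<^sup>2 * (norm w / 2))"
    using assms zw w0 by (intro frac_le power_mono mult_left_mono mult_pos_pos) auto
  also have "\<dots> = 2 * R\<^sup>2 * (1 / norm w ^ 3)" using w0 by (simp add: power2_eq_square power3_eq_cube)
  finally show "norm (1 / (z - w) + 1 / w + z / w\<^sup>2) \<le> 2 * R\<^sup>2 * (1 / norm w ^ 3)" .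
  have nz2: "(z - w)\<^sup>2 \<noteq> 0" "w\<^sup>2 \<noteq> 0" using nz by simp_all
  have "1 * w\<^sup>2 - 1 * (z - w)\<^sup>2 = z * (2 * w - z)" by (simp add: power2_eq_square algebra_simps)
  hence "1 / (z - w)\<^sup>2 - 1 / w\<^sup>2 = z * (2 * w - z) / ((z - w)\<^sup>2 * w\<^sup>2)"
    unfolding diff_frac_eq[OF nz2] by simp
  hence "norm (1 / (z - w)\<^sup>2 - 1 / w\<^sup>2) = norm z * norm (2 * w - z) / ((norm (z - w))\<^sup>2 * (norm w)\<^sup>2)"
    by (simp add: norm_divide norm_mult norm_power)
  also have "\<dots> \<le> R * (5 / 2 * norm w) / ((norm w / 2)\<^sup>2 * (norm w)\<^sup>2)"
  proof (intro frac_le mult_mono power_mono mult_right_mono mult_pos_pos)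
    have "norm (2 * w - z) \<le> norm (2 * w) + norm z" by (rule norm_triangle_ineq4)
    also have "\<dots> = 2 * norm w + norm z" by (simp add: norm_mult)
    finally show "norm (2 * w - z) \<le> 5 / 2 * norm w" using assms by linarith
  qed (use assms zw w0 in auto)
  also have "\<dots> = 10 * R * (1 / norm w ^ 3)" using w0 by (simp add: power2_eq_square power3_eq_cube)
  finally show "norm (1 / (z - w)\<^sup>2 - 1 / w\<^sup>2) \<le> 10 * R * (1 / norm w ^ 3)" .
qed

lemma deriv_zs_hs:
  assumes z: "z \<notin> L - {0}"
  shows "(zs has_field_derivative - hs z) (at z)" "(hs has_field_derivative - 2 * gs z) (at z)"
    "(\<lambda>w. ch w * (1 / (z - w) ^ 3)) summable_on (L - {0})"
proof -
  define R where "R = norm z + 1"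
  \<comment> \<open>The finitely many lattice points too close for \<open>term_bounds\<close>;
    \<open>z\<close> is none of them, so their terms are differentiable at \<open>z\<close>.\<close>
  define F where "F = {w \<in> L - {0}. norm w < 2 * R}"
  have R: "R > 0" "z \<in> ball 0 R" by (simp_all add: R_def add_pos_nonneg add.commute)
  have "F \<subseteq> L \<inter> cball 0 (2 * R)" by (auto simp: F_def)
  hence fin: "finite F" using finite_lattice_cball by (rule finite_subset)
  have sub: "F \<subseteq> L - {0}" by (auto simp: F_def)
  have w: "2 * R \<le> norm w" "w \<in> L" "w \<noteq> 0" if "w \<in> L - {0} - F" for w
    using that by (auto simp: F_def)
  have S: "(\<lambda>w. 1 / norm w ^ 3) summable_on (L - {0} - F)"
    by (rule summable_on_subset_banach[OF summable_lattice]) auto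
  have i1: "((\<lambda>z. 1 / (z - w)) has_field_derivative - (1 / (z - w)\<^sup>2)) (at z)" if "z \<noteq> w" for z w :: complex
    using that by (auto intro!: derivative_eq_intros simp: power2_eq_square)
  have d1: "((\<lambda>z. ch w * (1 / (z - w) + 1 / w + z / w\<^sup>2)) has_field_derivative - (ch w * (1 / (z - w)\<^sup>2 - 1 / w\<^sup>2))) (at z)"
    if "z \<noteq> w" for z w
    by (rule DERIV_cong[OF DERIV_cmult[OF DERIV_add[OF DERIV_add[OF i1[OF that] DERIV_const] DERIV_cdivide[OF DERIV_ident]]]])
       (simp add: algebra_simps)
  have d2: "((\<lambda>z. ch w * (1 / (z - w)\<^sup>2 - 1 / w\<^sup>2)) has_field_derivative - 2 * (ch w * (1 / (z - w) ^ 3))) (at z)"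
    if "z \<noteq> w" for z w
  proof -
    have "((\<lambda>z. 1 / (z - w) * (1 / (z - w))) has_field_derivative - 2 * (1 / (z - w) ^ 3)) (at z)"
      by (rule DERIV_cong[OF DERIV_mult[OF i1[OF that] i1[OF that]]]) (simp add: power2_eq_square power3_eq_cube)
    hence "((\<lambda>z. 1 / (z - w)\<^sup>2) has_field_derivative - 2 * (1 / (z - w) ^ 3)) (at z)"
      by (simp add: power2_eq_square)
    from DERIV_cmult[OF DERIV_diff[OF this DERIV_const], of "ch w" "1 / w\<^sup>2"]
    show ?thesis by (simp only: mult.left_commute diff_0_right)
  qed
  have zF: "z \<noteq> w" if "w \<in> F" for w using z that sub by auto
  have Rw: "z' \<noteq> w" "norm (ch w * (1 / (z' - w) + 1 / w + z' / w\<^sup>2)) \<le> 2 * R\<^sup>2 * (1 / norm w ^ 3)"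
    "norm (ch w * (1 / (z' - w)\<^sup>2 - 1 / w\<^sup>2)) \<le> 10 * R * (1 / norm w ^ 3)"
    if "w \<in> L - {0} - F" "z' \<in> cball 0 R" for z' w
  proof -
    have z': "norm z' \<le> R" using that(2) by simp
    note b = term_bounds[OF z' w(1)[OF that(1)] R(1)]
    show "z' \<noteq> w" by (rule b(3))
    show "norm (ch w * (1 / (z' - w) + 1 / w + z' / w\<^sup>2)) \<le> 2 * R\<^sup>2 * (1 / norm w ^ 3)"
      "norm (ch w * (1 / (z' - w)\<^sup>2 - 1 / w\<^sup>2)) \<le> 10 * R * (1 / norm w ^ 3)"
      using b(1,2) norm_chi[OF w(2)[OF that(1)]] by (simp_all only: norm_mult mult_1)
  qed
  have "((\<lambda>z. \<Sum>\<^sub>\<infinity>w\<in>L - {0}. ch w * (1 / (z - w) + 1 / w + z / w\<^sup>2)) has_field_derivative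
      (\<Sum>\<^sub>\<infinity>w\<in>L - {0}. - (ch w * (1 / (z - w)\<^sup>2 - 1 / w\<^sup>2)))) (at z)"
    by (rule has_field_derivative_infsum(3)[where M = "\<lambda>w. 2 * R\<^sup>2 * (1 / norm w ^ 3)" and F = F and R = R])
      (fact fin, fact sub, rule d1, rule Rw(1), assumption+, rule Rw(2), assumption+,
       rule summable_on_cmult_right[OF S], fact R(2), rule d1, rule zF, assumption)
  thus "(zs has_field_derivative - hs z) (at z)"
    unfolding zs_def[abs_def] hs_def infsum_uminus .
  have H: "((\<lambda>z. \<Sum>\<^sub>\<infinity>w\<in>L - {0}. ch w * (1 / (z - w)\<^sup>2 - 1 / w\<^sup>2)) has_field_derivative
      (\<Sum>\<^sub>\<infinity>w\<in>L - {0}. - 2 * (ch w * (1 / (z - w) ^ 3)))) (at z)"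
    by (rule has_field_derivative_infsum(3)[where M = "\<lambda>w. 10 * R * (1 / norm w ^ 3)" and F = F and R = R])
      (fact fin, fact sub, rule d2, rule Rw(1), assumption+, rule Rw(3), assumption+,
       rule summable_on_cmult_right[OF S], fact R(2), rule d2, rule zF, assumption)
  thus "(hs has_field_derivative - 2 * gs z) (at z)"
    unfolding hs_def[abs_def] gs_def infsum_cmult_right' .
  have "(\<lambda>w. - 2 * (ch w * (1 / (z - w) ^ 3))) summable_on (L - {0})"
    by (rule has_field_derivative_infsum(2)[where M = "\<lambda>w. 10 * R * (1 / norm w ^ 3)" and F = F and R = R
          and f = "\<lambda>w z. ch w * (1 / (z - w)\<^sup>2 - 1 / w\<^sup>2)"])
      (fact fin, fact sub, rule d2, rule Rw(1), assumption+, rule Rw(3), assumption+,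
       rule summable_on_cmult_right[OF S], fact R(2), rule d2, rule zF, assumption)
  hence "(\<lambda>w. (-1/2) * (- 2 * (ch w * (1 / (z - w) ^ 3)))) summable_on (L - {0})"
    by (rule summable_on_cmult_right)
  thus "(\<lambda>w. ch w * (1 / (z - w) ^ 3)) summable_on (L - {0})" by simp
qed

lemma lattice_minus_uminus: "infsum f (L - {0}) = (\<Sum>\<^sub>\<infinity>w\<in>L - {0}. f (- w))" for f :: "complex \<Rightarrow> complex"
  by (rule infsum_reindex_bij_witness[of _ uminus uminus]) auto

lemma zs_uminus: "zs (- z) = - zs z"
proof -
  have "zs (- z) = (\<Sum>\<^sub>\<infinity>w\<in>L - {0}. ch (- w) * (1 / (- z - (- w)) + 1 / (- w) + (- z) / (- w)\<^sup>2))"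
    unfolding zs_def by (subst lattice_minus_uminus) rule
  also have "\<dots> = (\<Sum>\<^sub>\<infinity>w\<in>L - {0}. - (ch w * (1 / (z - w) + 1 / w + z / w\<^sup>2)))"
  proof (rule infsum_cong)
    fix w assume w: "w \<in> L - {0}"
    have "1 / (- z - (- w)) = - (1 / (z - w))" by (metis minus_diff_minus divide_minus_right)
    thus "ch (- w) * (1 / (- z - (- w)) + 1 / (- w) + (- z) / (- w)\<^sup>2) = - (ch w * (1 / (z - w) + 1 / w + z / w\<^sup>2))"
      using w by (simp add: chi_uminus algebra_simps)
  qed
  finally show ?thesis unfolding zs_def infsum_uminus .
qed

lemma hs_uminus: "hs (- z) = hs z"
proof -
  have "hs (- z) = (\<Sum>\<^sub>\<infinity>w\<in>L - {0}. ch (- w) * (1 / (- z - (- w))\<^sup>2 - 1 / (- w)\<^sup>2))"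
    unfolding hs_def by (subst lattice_minus_uminus) rule
  also have "\<dots> = hs z"
    unfolding hs_def
  proof (rule infsum_cong)
    fix w assume w: "w \<in> L - {0}"
    have "(- z - (- w))\<^sup>2 = (z - w)\<^sup>2" by (simp add: power2_eq_square algebra_simps)
    thus "ch (- w) * (1 / (- z - (- w))\<^sup>2 - 1 / (- w)\<^sup>2) = ch w * (1 / (z - w)\<^sup>2 - 1 / w\<^sup>2)"
      using w by (simp add: chi_uminus)
  qed
  finally show ?thesis .
qed

definition wzeta :: "complex \<Rightarrow> complex" where "wzeta z = 1 / z + zs z"
definition wph :: "complex \<Rightarrow> complex" where "wph z = 1 / z\<^sup>2 + hs z"
definition wg :: "complex \<Rightarrow> complex" where "wg z = 1 / z ^ 3 + gs z"

lemma DERIV_wzeta: "z \<notin> L \<Longrightarrow> (wzeta has_field_derivative - wph z) (at z)"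
  and DERIV_wph: "z \<notin> L \<Longrightarrow> (wph has_field_derivative - 2 * wg z) (at z)"
proof -
  assume z: "z \<notin> L"
  hence z0: "z \<noteq> 0" by auto
  have 1: "((\<lambda>z. 1 / z) has_field_derivative - (1 / z\<^sup>2)) (at z)"
    using z0 by (auto intro!: derivative_eq_intros simp: power2_eq_square)
  have "((\<lambda>z. inverse (z\<^sup>2)) has_field_derivative - (2 * z) * inverse (z\<^sup>2 * z\<^sup>2)) (at z)"
    using z0 by (auto intro!: derivative_eq_intros simp: power2_eq_square)
  moreover have "- (2 * z) * inverse (z\<^sup>2 * z\<^sup>2) = - 2 * (1 / z ^ 3)"
    using z0 by (simp add: power2_eq_square power3_eq_cube divide_simps)
  ultimately have 2: "((\<lambda>z. 1 / z\<^sup>2) has_field_derivative - 2 * (1 / z ^ 3)) (at z)"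
    by (simp add: inverse_eq_divide)
  have zL: "z \<notin> L - {0}" using z by simp
  show "(wzeta has_field_derivative - wph z) (at z)"
    using DERIV_add[OF 1 deriv_zs_hs(1)[OF zL]] unfolding wzeta_def[abs_def] wph_def by simp
  show "(wph has_field_derivative - 2 * wg z) (at z)"
    using DERIV_add[OF 2 deriv_zs_hs(2)[OF zL]] unfolding wph_def[abs_def] wg_def distrib_left .
qed

lemma wzeta_uminus: "wzeta (- z) = - wzeta z"
  by (simp add: wzeta_def zs_uminus)

lemma wph_uminus: "wph (- z) = wph z"
  by (simp add: wph_def hs_uminus)

lemma wg_altdef:
  assumes "z \<notin> L"
  shows "wg z = (\<Sum>\<^sub>\<infinity>w\<in>L. ch w * (1 / (z - w) ^ 3))"
proof -
  have "L = {0} \<union> (L - {0})" by auto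
  hence "(\<Sum>\<^sub>\<infinity>w\<in>L. ch w * (1 / (z - w) ^ 3)) = (\<Sum>\<^sub>\<infinity>w\<in>{0} \<union> (L - {0}). ch w * (1 / (z - w) ^ 3))" by simp
  also have "\<dots> = (\<Sum>\<^sub>\<infinity>w\<in>{0}. ch w * (1 / (z - w) ^ 3)) + (\<Sum>\<^sub>\<infinity>w\<in>L - {0}. ch w * (1 / (z - w) ^ 3))"
    by (rule infsum_Un_disjoint) (use deriv_zs_hs(3)[of z] assms in auto)
  also have "\<dots> = wg z" by (simp add: wg_def gs_def chi_0)
  finally show ?thesis ..
qed

text \<open>The cubic series needs no correction terms, so a lattice shift merely permutes it, up to
  the character. The functions \<open>wph\<close> and \<open>wzeta\<close> inherit their behaviour
  by integration, at the price of constants.\<close>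

lemma wg_shift:
  assumes "z \<notin> L" "v \<in> L"
  shows "wg (z + v) = ch v * wg z"
proof -
  have "wg (z + v) = (\<Sum>\<^sub>\<infinity>w\<in>L. ch w * (1 / (z + v - w) ^ 3))"
    using assms by (intro wg_altdef) simp
  also have "\<dots> = (\<Sum>\<^sub>\<infinity>w\<in>L. ch v * (ch w * (1 / (z - w) ^ 3)))"
  proof (rule infsum_reindex_bij_witness[of _ "\<lambda>w. w + v" "\<lambda>w. w - v"])
    fix w assume w: "w \<in> L"
    have "ch w = ch (w - v) * ch v" using chi_add[of "w - v" v] w assms by simp
    moreover have "z - (w - v) = z + v - w" by simp
    ultimately show "ch v * (ch (w - v) * (1 / (z - (w - v)) ^ 3)) = ch w * (1 / (z + v - w) ^ 3)"
      by (simp only: mult_ac)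
  qed (use assms in auto)
  also have "\<dots> = ch v * wg z" by (simp only: infsum_cmult_right' wg_altdef[OF assms(1)])
  finally show ?thesis .
qed

lemma const_on_compl_lattice:
  assumes "\<And>z. z \<notin> L \<Longrightarrow> (f has_field_derivative 0) (at z)"
  obtains c where "\<And>z. z \<notin> L \<Longrightarrow> f z = c"
proof -
  have "\<exists>c. \<forall>z\<in>- L. f z = c"
    using has_field_derivative_0_imp_constant_on[OF _ connected_compl_lattice open_compl_lattice, of f] assms
    by (auto simp: constant_on_def)
  thus thesis using that by blast
qed

lemma DERIV_shift': "(f has_field_derivative D) (at (z + v)) \<Longrightarrow> ((\<lambda>z. f (z + v)) has_field_derivative D) (at z)"
  for f :: "complex \<Rightarrow> complex"
  by (simp add: DERIV_shift)

lemma wph_quasiperiod: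
  assumes v: "v \<in> L"
  obtains c where "\<And>z. z \<notin> L \<Longrightarrow> wph (z + v) = ch v * wph z + c"
proof -
  have "((\<lambda>z. wph (z + v) - ch v * wph z) has_field_derivative 0) (at z)" if z: "z \<notin> L" for z
  proof -
    have "((\<lambda>z. wph (z + v) - ch v * wph z) has_field_derivative (- 2 * wg (z + v) - ch v * (- 2 * wg z))) (at z)"
      using z v by (intro DERIV_diff DERIV_cmult DERIV_shift' DERIV_wph) auto
    thus ?thesis using wg_shift[OF z v] by simp
  qed
  from const_on_compl_lattice[OF this] obtain c where "\<And>z. z \<notin> L \<Longrightarrow> wph (z + v) - ch v * wph z = c" by blast
  thus thesis using that[of c] by (metis diff_eq_eq add.commute)
qed

end

section \<open>Periodicity and Liouville's theorem\<close>

context weierstrass_lattice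
begin

lemma lattice_periodic:
  assumes 1: "\<And>z. z \<notin> L \<Longrightarrow> f (z + 1) = f z" and t: "\<And>z. z \<notin> L \<Longrightarrow> f (z + \<tau>) = f z"
    and z: "z \<notin> L" and w: "w \<in> L"
  shows "f (z + w) = f z"
proof -
  have mult: "f (z + of_int a * v) = f z"
    if v: "v \<in> L" and per: "\<And>z. z \<notin> L \<Longrightarrow> f (z + v) = f z" and z: "z \<notin> L" for a v z
  proof -
    have nat: "f (z + of_nat k * v) = f z \<and> of_nat k * v \<in> L" for k :: nat
    proof (induction k)
      case (Suc k)
      have "f ((z + of_nat k * v) + v) = f (z + of_nat k * v)"
        by (rule per) (use Suc z in simp)
      moreover have "of_nat k * v + v \<in> L" using Suc v by blast
      ultimately show ?case using Suc by (simp add: algebra_simps)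
    qed simp
    show ?thesis
    proof (cases "a \<ge> 0")
      case True
      thus ?thesis using nat[of "nat a"] by simp
    next
      case False
      define k where "k = nat (- a)"
      have a: "of_int a = - (of_nat k :: complex)" using False by (simp add: k_def)
      have kv: "of_nat k * v \<in> L" using nat[of k] by simp
      have zk: "z - of_nat k * v \<notin> L" using z kv by simp
      have "f (z - of_nat k * v + of_nat k * v) = f (z - of_nat k * v)"
      proof -
        have nat': "f (y + of_nat j * v) = f y" if y: "y \<notin> L" for y j
        proof (induction j)
          case (Suc j)
          have jv: "of_nat j * v \<in> L" using nat[of j] by simp
          have "f ((y + of_nat j * v) + v) = f (y + of_nat j * v)"
            by (rule per) (use y jv in simp)
          thus ?case using Suc by (simp add: algebra_simps)
        qed simp
        show ?thesis by (rule nat'[OF zk])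
      qed
      thus ?thesis by (simp add: a)
    qed
  qed
  obtain a b where ab: "w = of_int a + of_int b * \<tau>" using w unfolding lattice_iff by blast
  have "of_int a \<in> L" using lattice_of_int[of a 0] by simp
  hence "f (z + of_int a * 1 + of_int b * \<tau>) = f (z + of_int a * 1)"
    by (intro mult t) (use z in auto)
  also have "\<dots> = f z" by (intro mult 1 z) auto
  finally show ?thesis by (simp add: ab add.assoc)
qed

lemma fundamental_parallelogram:
  obtains x y w where "0 \<le> x" "x \<le> 1" "0 \<le> y" "y \<le> (1 :: real)" "w \<in> L" "z = of_real x + of_real y * \<tau> + w"
proof -
  define y where "y = Im z / Im \<tau>"
  define x where "x = Re z - y * Re \<tau>"
  have z: "z = of_real x + of_real y * \<tau>"
    using Im_pos by (simp add: complex_eq_iff x_def y_def)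
  have "z = of_real (frac x) + of_real (frac y) * \<tau> + (of_int \<lfloor>x\<rfloor> + of_int \<lfloor>y\<rfloor> * \<tau>)"
    unfolding z by (simp add: frac_def algebra_simps)
  thus thesis
    by (rule that[rotated -1]) (auto simp: lattice_of_int frac_lt_1 less_imp_le)
qed

text \<open>Periodicity is required of the modulus only, so that functions multiplied by signs are
  covered. It carries the bound near the origin to every lattice point, where the singularity is
  therefore removable, and the bound on one cell to the whole plane.\<close>

lemma lattice_liouville:
  assumes hol: "f holomorphic_on - L"
    and 1: "\<And>z. z \<notin> L \<Longrightarrow> norm (f (z + 1)) = norm (f z)" and t: "\<And>z. z \<notin> L \<Longrightarrow> norm (f (z + \<tau>)) = norm (f z)"
    and F: "f has_laurent_expansion F" "\<And>k. k < 0 \<Longrightarrow> F $$ k = 0"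
  obtains c where "\<And>z. z \<notin> L \<Longrightarrow> f z = c"
proof -
  have per: "norm (f (z + w)) = norm (f z)" if "z \<notin> L" "w \<in> L" for z w
    by (rule lattice_periodic[of "\<lambda>z. norm (f z)", OF 1 t that])
  obtain r where r: "r > 0" "ball 0 r \<inter> L = {0}" using lattice_gap by blast
  have "fls_subdegree F \<ge> 0" using F(2) fls_subdegree_ge0I by blast
  hence "f \<midarrow>0\<rightarrow> F $$ 0" using has_laurent_expansion_imp_tendsto_0[OF F(1)] by simp
  hence "\<forall>\<^sub>F z in at 0. norm (f z - F $$ 0) < 1"
    using tendstoD[of f "F $$ 0" "at 0" 1] by (simp add: dist_norm)
  then obtain e where e: "e > 0" "\<And>z. z \<noteq> 0 \<Longrightarrow> norm z < e \<Longrightarrow> norm (f z - F $$ 0) < 1"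
    unfolding eventually_at by auto
  define e' where "e' = min e r"
  have e': "e' > 0" using e r by (simp add: e'_def)
  have bd: "norm (f z) \<le> norm (F $$ 0) + 1" if "w \<in> L" "z \<in> ball w e' - {w}" for z w
  proof -
    have zw: "z - w \<noteq> 0" "norm (z - w) < e" "norm (z - w) < r"
      using that by (auto simp: e'_def dist_norm norm_minus_commute)
    hence "z - w \<in> ball 0 r" by simp
    hence zL: "z - w \<notin> L" using r zw by blast
    have "norm (f z) = norm (f (z - w))" using per[OF zL that(1)] by simp
    also have "\<dots> \<le> norm (F $$ 0) + norm (f (z - w) - F $$ 0)" by (rule norm_triangle_sub)
    also have "\<dots> \<le> norm (F $$ 0) + 1" using e(2)[OF zw(1,2)] by simp
    finally show ?thesis .
  qed
  define g where "g = remove_sings f"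
  have ana: "g analytic_on {z}" for z
  proof (cases "z \<in> L")
    case False
    hence "f analytic_on {z}" using hol by (auto simp: analytic_on_open[symmetric] elim: analytic_on_subset)
    thus ?thesis unfolding g_def by (rule remove_sings_analytic_on)
  next
    case True
    have sub: "ball z e' - {z} \<subseteq> - L"
    proof
      fix y assume y: "y \<in> ball z e' - {z}"
      hence "y - z \<in> ball 0 r" "y - z \<noteq> 0" by (auto simp: e'_def dist_norm norm_minus_commute)
      hence "y - z \<notin> L" using r by blast
      thus "y \<in> - L" using True by simp
    qed
    hence hf: "f holomorphic_on ball z e' - {z}" using hol by (rule holomorphic_on_subset[rotated])
    have "\<forall>\<^sub>F y in at z. norm (f y) \<le> norm (F $$ 0) + 1"
      using eventually_at_ball'[OF e', of z UNIV] by eventually_elim (use bd[OF True] in auto)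
    then obtain h where h: "h holomorphic_on ball z e'" "\<And>y. y \<in> ball z e' - {z} \<Longrightarrow> h y = f y"
      using holomorphic_on_extend_bounded[OF hf] e' by auto
    have "h \<midarrow>z\<rightarrow> h z"
      using h(1) e' by (intro isContD) (auto intro: continuous_on_interior holomorphic_on_imp_continuous_on)
    hence lim: "f \<midarrow>z\<rightarrow> h z"
      by (rule Lim_transform_within[OF _ e']) (use h(2) in \<open>auto simp: dist_commute\<close>)
    have "isolated_singularity_at f z"
      unfolding isolated_singularity_at_def
      using e' hf analytic_on_open[of "ball z e' - {z}" f] by (intro exI[of _ e']) (auto simp: open_delete)
    thus ?thesis unfolding g_def using lim by (rule remove_sings_analytic_at)
  qed
  have ghol: "g holomorphic_on UNIV"
    using ana by (auto intro!: analytic_imp_holomorphic simp: analytic_on_def)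
  have gf: "g z = f z" if "z \<notin> L" for z
    unfolding g_def using hol that
    by (intro remove_sings_at_analytic) (auto simp: analytic_on_open[symmetric] elim: analytic_on_subset)
  have contg: "continuous_on UNIV g" using ghol by (rule holomorphic_on_imp_continuous_on)
  \<comment> \<open>The closed cell contains lattice points, so the bound is taken for
    \<open>g\<close>, whose singularities are already removed.\<close>
  define P where "P = (\<lambda>(x, y). of_real x + of_real y * \<tau>) ` ({0..1} \<times> {0..1 :: real})"
  have "compact P" unfolding P_def
    by (intro compact_continuous_image compact_Times) (auto intro!: continuous_intros simp: split_def)
  hence "compact (g ` P)" using contg by (intro compact_continuous_image) (auto intro: continuous_on_subset)
  then obtain B where B: "\<And>z. z \<in> P \<Longrightarrow> norm (g z) \<le> B"
    using compact_imp_bounded[of "g ` P"] by (auto simp: bounded_iff)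
  have b1: "norm (g z) \<le> B" if z: "z \<notin> L" for z
  proof -
    obtain x y w where xyw: "0 \<le> x" "x \<le> 1" "0 \<le> y" "y \<le> 1" "w \<in> L" "z = of_real x + of_real y * \<tau> + w"
      using fundamental_parallelogram[of z] by blast
    define p where "p = of_real x + of_real y * \<tau>"
    have pL: "p \<notin> L" using z xyw(5,6) by (simp add: p_def)
    have "p \<in> P" unfolding P_def p_def using xyw by (intro image_eqI[of _ _ "(x, y)"]) auto
    have "norm (g z) = norm (f (p + w))" using gf[OF z] xyw(6) by (simp add: p_def)
    also have "\<dots> = norm (g p)" using per[OF pL xyw(5)] gf[OF pL] by simp
    also have "\<dots> \<le> B" using B[OF \<open>p \<in> P\<close>] .
    finally show ?thesis .
  qed
  \<comment> \<open>A point with a larger value would have a whole ball of such points around it,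
    and that ball would lie in the countable lattice.\<close>
  have b2: "norm (g z) \<le> B" for z
  proof (rule ccontr)
    assume "\<not> ?thesis"
    moreover have "open {z. B < norm (g z)}"
      by (intro open_Collect_less continuous_intros contg)
    ultimately obtain d where d: "d > 0" "ball z d \<subseteq> {z. B < norm (g z)}"
      by (metis (no_types, lifting) mem_Collect_eq not_le open_contains_ball)
    have "ball z d \<subseteq> L" using d(2) b1 by (force simp: not_le[symmetric])
    hence "countable (ball z d)" using countable_lattice countable_subset by blast
    thus False using uncountable_ball[OF d(1), of z] by simp
  qed
  have "bounded (range g)" using b2 by (auto simp: bounded_iff)
  then obtain c where "\<And>z. g z = c" using Liouville_theorem[OF ghol] unfolding constant_on_def by auto
  thus thesis using that gf by metis
qed

end

context lattice_character
begin

lemma holomorphic_hs_zs: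
  "hs holomorphic_on - (L - {0})" "zs holomorphic_on - (L - {0})"
proof -
  have "hs field_differentiable at z" "zs field_differentiable at z" if "z \<in> - (L - {0})" for z
    using deriv_zs_hs[of z] that by (auto simp: field_differentiable_def)
  thus "hs holomorphic_on - (L - {0})" "zs holomorphic_on - (L - {0})"
    by (auto simp: holomorphic_on_def intro: field_differentiable_at_within)
qed

lemma fps_expansion_hs_zs:
  "hs has_fps_expansion fps_expansion hs 0" "zs has_fps_expansion fps_expansion zs 0"
  using holomorphic_hs_zs open_compl_lattice_Un[of "{0}"]
  by (auto intro!: has_fps_expansion_fps_expansion)

lemma wph_laurent: "wph has_laurent_expansion fls_X_inv\<^sup>2 + fps_to_fls (fps_expansion hs 0)"
  and wzeta_laurent: "wzeta has_laurent_expansion fls_X_inv + fps_to_fls (fps_expansion zs 0)"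
proof -
  have "inverse = (\<lambda>z :: complex. 1 / z)" by (simp add: fun_eq_iff inverse_eq_divide)
  hence inv: "(\<lambda>z. 1 / z :: complex) has_laurent_expansion fls_X_inv"
    using has_laurent_expansion_fls_X_inv by (simp only:)
  have "(\<lambda>z. (1 / z)\<^sup>2 + hs z) has_laurent_expansion fls_X_inv\<^sup>2 + fps_to_fls (fps_expansion hs 0)"
    by (rule has_laurent_expansion_add[OF has_laurent_expansion_power[OF inv] has_laurent_expansion_fps[OF fps_expansion_hs_zs(1)]])
  thus "wph has_laurent_expansion fls_X_inv\<^sup>2 + fps_to_fls (fps_expansion hs 0)"
    by (simp add: wph_def[abs_def] power_divide)
  have "(\<lambda>z. 1 / z + zs z) has_laurent_expansion fls_X_inv + fps_to_fls (fps_expansion zs 0)"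
    by (rule has_laurent_expansion_add[OF inv has_laurent_expansion_fps[OF fps_expansion_hs_zs(2)]])
  thus "wzeta has_laurent_expansion fls_X_inv + fps_to_fls (fps_expansion zs 0)"
    by (simp add: wzeta_def[abs_def])
qed

lemma holomorphic_wph: "wph holomorphic_on - L"
  and holomorphic_wzeta: "wzeta holomorphic_on - L"
  using DERIV_wph DERIV_wzeta by (auto simp: holomorphic_on_open)

end

section \<open>The Weierstrass function and its differential equation\<close>

context weierstrass_lattice
begin

sublocale triv: lattice_character \<tau> "\<lambda>_. 1"
  by unfold_locales auto

lemma triv_wph: "triv.wph = wp \<tau>"
  by (rule ext) (simp add: triv.wph_def triv.hs_def wp_def)

lemma wp_holomorphic: "wp \<tau> holomorphic_on - L"
  using triv.holomorphic_wph by (simp add: triv_wph)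

lemma wp_uminus: "wp \<tau> (- z) = wp \<tau> z"
  using triv.wph_uminus by (simp add: triv_wph)

text \<open>A shift by \<open>v\<close> adds a constant, and evaluating at \<open>- v / 2\<close>, a
  point off the lattice, shows by evenness that the constant is zero.\<close>

lemma wp_period:
  assumes "v \<in> L" "v / 2 \<notin> L" "z \<notin> L"
  shows "wp \<tau> (z + v) = wp \<tau> z"
proof -
  obtain c where c: "\<And>z. z \<notin> L \<Longrightarrow> wp \<tau> (z + v) = wp \<tau> z + c"
    using triv.wph_quasiperiod[OF assms(1)] by (auto simp: triv_wph)
  have "- v / 2 \<notin> L" using assms(2) lattice_uminus_iff[of "v / 2"] by simp
  from c[OF this] have "wp \<tau> (v / 2) = wp \<tau> (- (v / 2)) + c" by simp
  hence "c = 0" by (simp add: wp_uminus)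
  thus ?thesis using c[OF assms(3)] by simp
qed

lemma wp_1: "z \<notin> L \<Longrightarrow> wp \<tau> (z + 1) = wp \<tau> z"
  and wp_tau: "z \<notin> L \<Longrightarrow> wp \<tau> (z + \<tau>) = wp \<tau> z"
  using wp_period[of 1 z] wp_period[of \<tau> z] one_half_not_lattice tau_half_not_lattice by auto

lemma deriv_shift:
  assumes hol: "f holomorphic_on - L" and v: "v \<in> L"
    and per: "\<And>z. z \<notin> L \<Longrightarrow> f (z + v) = e * f z" and z: "z \<notin> L"
  shows "deriv f (z + v) = e * deriv f z"
proof -
  have d: "(f has_field_derivative deriv f z) (at z)" if "z \<notin> L" for z
    using hol that by (intro holomorphic_derivI[of f "- L"]) auto
  have "((\<lambda>z. f (z + v)) has_field_derivative deriv f (z + v)) (at z)"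
    by (rule triv.DERIV_shift', rule d) (use z v in simp)
  moreover have "((\<lambda>z. f (z + v)) has_field_derivative e * deriv f z) (at z)"
  proof (rule DERIV_cong_ev[THEN iffD2, OF refl _ refl DERIV_cmult[OF d[OF z]]])
    have "\<forall>\<^sub>F x in nhds z. x \<in> - L" by (rule eventually_nhds_in_open) (use z in auto)
    thus "\<forall>\<^sub>F x in nhds z. f (x + v) = e * f x" by eventually_elim (use per in auto)
  qed
  ultimately show ?thesis by (rule DERIV_unique)
qed

definition wpl :: "complex fls" where
  "wpl = fls_X_inv\<^sup>2 + fps_to_fls (fps_expansion triv.hs 0)"

lemma wp_laurent: "wp \<tau> has_laurent_expansion wpl"
  using triv.wph_laurent by (simp add: triv_wph wpl_def)

lemma wpl_lower: "wpl $$ (-2) = 1" "k < -2 \<Longrightarrow> wpl $$ k = 0" "k \<in> {-1, 0, 1} \<Longrightarrow> wpl $$ k = 0"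
proof -
  have h0: "fps_nth (fps_expansion triv.hs 0) 0 = 0"
    by (simp add: fps_expansion_def triv.hs_def)
  have "(triv.hs has_field_derivative - 2 * triv.gs 0) (at 0)" by (rule triv.deriv_zs_hs(2)) simp
  moreover have "(triv.hs has_field_derivative - (- 2 * triv.gs 0)) (at 0)"
  proof -
    have "((\<lambda>z. triv.hs (- z)) has_field_derivative (- 2 * triv.gs 0) * (- 1)) (at 0)"
      by (rule DERIV_chain'[where f = uminus and g = triv.hs])
         (use triv.deriv_zs_hs(2)[of 0] in \<open>auto intro!: derivative_eq_intros\<close>)
    thus ?thesis by (simp add: triv.hs_uminus)
  qed
  ultimately have "triv.gs 0 = 0" using DERIV_unique by fastforce
  hence "deriv triv.hs 0 = 0" using triv.deriv_zs_hs(2)[of 0] by (auto intro: DERIV_imp_deriv)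
  hence h1: "fps_nth (fps_expansion triv.hs 0) (Suc 0) = 0" by (simp add: fps_expansion_def)
  show "wpl $$ (-2) = 1" "k < -2 \<Longrightarrow> wpl $$ k = 0" by (simp_all add: wpl_def)
  show "k \<in> {-1, 0, 1} \<Longrightarrow> wpl $$ k = 0" using h0 h1 by (auto simp: wpl_def)
qed

text \<open>The fourth-order poles of \<open>\<wp>''\<close> and \<open>6 * \<wp>^2\<close> cancel,
  and the mixed term \<open>12 * H / z^2\<close> is regular because \<open>H\<close> starts at order
  two. Liouville's theorem turns the difference into a constant, whose value is irrelevant.\<close>

lemma wpl_ode: obtains c where "fls_deriv (fls_deriv wpl) = 6 * wpl\<^sup>2 - fls_const c"
proof -
  define f where "f z = deriv (deriv (wp \<tau>)) z - 6 * (wp \<tau> z)\<^sup>2" for z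
  define F where "F = fls_deriv (fls_deriv wpl) - 6 * wpl\<^sup>2"
  have F: "f has_laurent_expansion F"
    unfolding f_def F_def by (intro laurent_expansion_intros wp_laurent)
  have holp: "deriv (wp \<tau>) holomorphic_on - L" "deriv (deriv (wp \<tau>)) holomorphic_on - L"
    using wp_holomorphic by (auto intro!: holomorphic_deriv)
  have hol: "f holomorphic_on - L"
    unfolding f_def[abs_def] by (intro holomorphic_intros holp wp_holomorphic)
  have per: "f (z + v) = f z" if v: "v \<in> L" "\<And>z. z \<notin> L \<Longrightarrow> wp \<tau> (z + v) = wp \<tau> z" and z: "z \<notin> L" for z v
  proof -
    have "deriv (wp \<tau>) (z + v) = 1 * deriv (wp \<tau>) z" if "z \<notin> L" for z
      by (rule deriv_shift[OF wp_holomorphic v(1) _ that]) (simp add: v(2))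
    hence "deriv (deriv (wp \<tau>)) (z + v) = 1 * deriv (deriv (wp \<tau>)) z"
      by (intro deriv_shift[OF holp(1) v(1) _ z]) simp
    thus ?thesis using v(2)[OF z] by (simp add: f_def)
  qed
  define H where "H = fps_expansion triv.hs 0"
  have H0: "fps_nth H 0 = 0" "fps_nth H 1 = 0"
    using wpl_lower(3)[of 0] wpl_lower(3)[of 1] by (simp_all add: wpl_def H_def)
  have F_alt: "F = fps_to_fls (fps_deriv (fps_deriv H)) - 12 * (fls_X_inv\<^sup>2 * fps_to_fls H) - 6 * fps_to_fls (H\<^sup>2)"
  proof -
    have "fls_deriv (fls_deriv (fls_X_inv\<^sup>2 :: complex fls)) = 6 * fls_X_inv ^ 4"
      by (simp add: power2_eq_square power4_eq_xxxx algebra_simps)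
    moreover have "(fls_X_inv\<^sup>2)\<^sup>2 = (fls_X_inv ^ 4 :: complex fls)" by (simp flip: power_mult)
    ultimately show ?thesis
      unfolding F_def wpl_def H_def[symmetric]
      by (simp add: power2_sum fls_deriv_fps_to_fls fps_to_fls_power algebra_simps)
  qed
  have neg: "F $$ k = 0" if "k < 0" for k
  proof -
    have X: "(fls_X_inv\<^sup>2 * fps_to_fls H) $$ k = fps_to_fls H $$ (k + 2)"
      by (subst fls_X_inv_power_times_nth) simp
    have "fps_to_fls H $$ (k + 2) = 0" using that H0
      by (cases "k = -1"; cases "k = -2") auto
    thus ?thesis using that unfolding F_alt by (simp add: X)
  qed
  obtain c where c: "\<And>z. z \<notin> L \<Longrightarrow> f z = c"
    by (rule lattice_liouville[OF hol _ _ F neg])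
       (use per[OF lattice_1 wp_1] per[OF lattice_tau wp_tau] in auto)
  obtain r where r: "r > 0" "ball 0 r \<inter> L = {0}" using lattice_gap by blast
  have "f has_laurent_expansion fls_const c"
  proof (rule has_laurent_expansion_cong[THEN iffD1, OF _ refl has_laurent_expansion_const])
    have "\<forall>\<^sub>F z in at 0. z \<in> ball 0 r - {0}" using r(1) by (intro eventually_at_in_open) auto
    moreover have "z \<notin> L" if "z \<in> ball 0 r - {0}" for z using r(2) that by blast
    ultimately show "\<forall>\<^sub>F z in at 0. c = f z" by (auto elim!: eventually_mono simp: c)
  qed
  hence "F = fls_const c" using F by (rule has_laurent_expansion_unique[rotated])
  moreover have "fls_const (- c) = - fls_const c" by (simp add: fls_eq_iff)
  ultimately have "fls_deriv (fls_deriv wpl) = 6 * wpl\<^sup>2 - fls_const (- c)"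
    by (simp add: F_def algebra_simps)
  thus thesis by (rule that)
qed

text \<open>Up to numerical factors the classical invariants: \<open>g2 = 20 * wu\<close> and
  \<open>g3 = 28 * wv\<close>.\<close>

definition wu :: complex where "wu = wpl $$ 2"
definition wv :: complex where "wv = wpl $$ 4"

lemma wpl_eq: "wpl = wpF wu wv"
proof -
  obtain c where c: "fls_deriv (fls_deriv wpl) = 6 * wpl\<^sup>2 - fls_const c" using wpl_ode by blast
  show ?thesis unfolding wu_def wv_def
    by (rule wpF_unique(1)[OF _ wpl_lower(1) c]) (rule wpl_lower(2))
qed

lemma wp_laurent': "wp \<tau> has_laurent_expansion wpF wu wv"
  using wp_laurent wpl_eq by simp

end

context lattice_character
begin

text \<open>A twisted zeta function with a linear correction. Commuting the shift by
  \<open>v\<close> with the shift by \<open>v0\<close> forces the additive constant of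
  \<open>wph\<close> to be \<open>k - ch v * k\<close>; hence \<open>k - wph\<close> is multiplied
  exactly by the character, and its odd primitive up to a constant, which oddness removes. For the
  trivial character no such function exists, as an elliptic function cannot have a single simple
  pole per cell.\<close>

lemma odd_quasiperiodic:
  assumes v0: "v0 \<in> {1, \<tau>}" "ch v0 = -1"
  obtains \<phi> H where "\<phi> holomorphic_on - L" "\<And>z. \<phi> (- z) = - \<phi> z"
    "\<And>z v. z \<notin> L \<Longrightarrow> v \<in> {1, \<tau>} \<Longrightarrow> \<phi> (z + v) = ch v * \<phi> z"
    "\<phi> has_laurent_expansion fls_X_inv + fps_to_fls H"
proof -
  have vL: "v \<in> L" "v / 2 \<notin> L" if "v \<in> {1, \<tau>}" for v
    using that one_half_not_lattice tau_half_not_lattice by auto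
  have "\<exists>c. \<forall>v\<in>{1, \<tau>}. \<forall>z. z \<notin> L \<longrightarrow> wph (z + v) = ch v * wph z + c v"
  proof -
    have "\<exists>c. \<forall>z. z \<notin> L \<longrightarrow> wph (z + v) = ch v * wph z + c" if "v \<in> {1, \<tau>}" for v
      using wph_quasiperiod[OF vL(1)[OF that]] by metis
    thus ?thesis by (intro bchoice) blast
  qed
  then obtain c where c: "\<And>v z. v \<in> {1, \<tau>} \<Longrightarrow> z \<notin> L \<Longrightarrow> wph (z + v) = ch v * wph z + c v" by blast
  have pt: "1 / 2 \<notin> L" by (rule one_half_not_lattice)
  have comm: "ch v * c v' + c v = ch v' * c v + c v'" if "v \<in> {1, \<tau>}" "v' \<in> {1, \<tau>}" for v v'
  proof -
    have n: "1 / 2 + v \<notin> L" "1 / 2 + v' \<notin> L" using pt vL that by auto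
    have "wph (1 / 2 + v + v') = ch v' * (ch v * wph (1 / 2) + c v) + c v'"
      using c[OF that(2) n(1)] c[OF that(1) pt] by simp
    moreover have "wph (1 / 2 + v + v') = ch v * (ch v' * wph (1 / 2) + c v') + c v"
      using c[OF that(1) n(2)] c[OF that(2) pt] by (simp add: add_ac)
    ultimately show ?thesis by (simp add: algebra_simps)
  qed
  define k where "k = c v0 / 2"
  have ck: "c v = k - ch v * k" if "v \<in> {1, \<tau>}" for v
    using comm[OF that v0(1)] chi_pm[OF vL(1)[OF that]] v0(2) by (auto simp: k_def)
  define \<phi> where "\<phi> z = wzeta z + k * z" for z
  have hol: "\<phi> holomorphic_on - L"
    unfolding \<phi>_def[abs_def] by (intro holomorphic_intros holomorphic_wzeta)
  have odd: "\<phi> (- z) = - \<phi> z" for z by (simp add: \<phi>_def wzeta_uminus)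
  have d: "(\<phi> has_field_derivative (k - wph z)) (at z)" if "z \<notin> L" for z
    unfolding \<phi>_def[abs_def] using DERIV_add[OF DERIV_wzeta[OF that] DERIV_cmult[OF DERIV_ident, of k]] by simp
  have "\<exists>a. \<forall>z. z \<notin> L \<longrightarrow> \<phi> (z + v) - ch v * \<phi> z = a" if v: "v \<in> {1, \<tau>}" for v
  proof -
    have "((\<lambda>z. \<phi> (z + v) - ch v * \<phi> z) has_field_derivative 0) (at z)" if z: "z \<notin> L" for z
    proof (rule DERIV_cong[OF DERIV_diff[OF DERIV_shift'[OF d] DERIV_cmult[OF d[OF z]]]])
      show "z + v \<notin> L" using z vL[OF v] by simp
      show "k - wph (z + v) - ch v * (k - wph z) = 0"
        using c[OF v z] ck[OF v] by (simp add: algebra_simps)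
    qed
    then obtain a where "\<And>z. z \<notin> L \<Longrightarrow> \<phi> (z + v) - ch v * \<phi> z = a"
      using const_on_compl_lattice by blast
    thus ?thesis by blast
  qed
  hence "\<exists>a. \<forall>v\<in>{1, \<tau>}. \<forall>z. z \<notin> L \<longrightarrow> \<phi> (z + v) - ch v * \<phi> z = a v"
    by (intro bchoice ballI)
  then obtain a where a: "\<And>v z. v \<in> {1, \<tau>} \<Longrightarrow> z \<notin> L \<Longrightarrow> \<phi> (z + v) - ch v * \<phi> z = a v" by blast
  have neg: "a v = 0" if v: "v \<in> {1, \<tau>}" "ch v = -1" for v
  proof -
    have "- v / 2 \<notin> L" using vL(2)[OF v(1)] lattice_uminus_iff[of "v / 2"] by simp
    from a[OF v(1) this] have "\<phi> (v / 2) + \<phi> (- (v / 2)) = a v" using v(2) by simp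
    thus ?thesis by (simp add: odd)
  qed
  \<comment> \<open>When \<open>ch v = 1\<close>, evaluating at \<open>- v / 2\<close> gives no
    information. Instead the shift by \<open>v0\<close> negates the function, so the constant equals
    its own negative.\<close>
  have a0: "a v = 0" if v: "v \<in> {1, \<tau>}" for v
  proof (cases "ch v = -1")
    case False
    hence chv: "ch v = 1" using chi_pm vL(1)[OF v] by blast
    have n: "1 / 2 + v \<notin> L" "1 / 2 + v0 \<notin> L" using pt vL v v0 by auto
    have e1: "\<phi> (1 / 2 + v + v0) + \<phi> (1 / 2 + v) = 0" using a[OF v0(1) n(1)] neg[OF v0] v0(2) by simp
    have e2: "\<phi> (1 / 2 + v) - \<phi> (1 / 2) = a v" using a[OF v pt] chv by simp
    have e3: "\<phi> (1 / 2 + v + v0) - \<phi> (1 / 2 + v0) = a v"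
      using a[OF v n(2)] chv by (simp add: add.assoc add.commute[of v v0])
    have e4: "\<phi> (1 / 2 + v0) + \<phi> (1 / 2) = 0" using a[OF v0(1) pt] neg[OF v0] v0(2) by simp
    have "2 * a v = (\<phi> (1 / 2 + v + v0) - \<phi> (1 / 2 + v0)) + (\<phi> (1 / 2 + v) - \<phi> (1 / 2))"
      by (simp add: e2 e3)
    also have "\<dots> = (\<phi> (1 / 2 + v + v0) + \<phi> (1 / 2 + v)) - (\<phi> (1 / 2 + v0) + \<phi> (1 / 2))" by simp
    also have "\<dots> = 0" by (simp only: e1 e4 diff_self)
    finally show ?thesis by simp
  qed (use neg v in blast)
  have "(\<lambda>z. wzeta z + k * z) has_laurent_expansion
      (fls_X_inv + fps_to_fls (fps_expansion zs 0)) + fls_const k * fls_X"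
    by (intro laurent_expansion_intros wzeta_laurent)
  hence lau: "\<phi> has_laurent_expansion fls_X_inv + fps_to_fls (fps_expansion zs 0 + fps_const k * fps_X)"
    by (simp add: \<phi>_def[abs_def] fls_times_fps_to_fls add.assoc)
  show thesis
  proof (rule that[OF hol odd _ lau])
    fix z v assume "z \<notin> L" "v \<in> {1, \<tau>}"
    thus "\<phi> (z + v) = ch v * \<phi> z" using a[of v z] a0[of v] by simp
  qed
qed

end

section \<open>Lattices up to homothety\<close>

context weierstrass_lattice
begin

lemma hs_fps: "triv.hs has_fps_expansion Abs_fps (\<lambda>m. if even m then wpc wu wv (m div 2) else 0)"
proof -
  have "fls_X_inv\<^sup>2 + fps_to_fls (fps_expansion triv.hs 0) =
      fls_X_inv\<^sup>2 + fps_to_fls (Abs_fps (\<lambda>m. if even m then wpc wu wv (m div 2) else 0))"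
    using wpl_eq unfolding wpl_def wpF_def .
  hence "fps_expansion triv.hs 0 = Abs_fps (\<lambda>m. if even m then wpc wu wv (m div 2) else 0)" by simp
  thus ?thesis using triv.fps_expansion_hs_zs(1) by simp
qed

lemma wp_pole: assumes "w \<in> L" shows "is_pole (wp \<tau>) w"
proof -
  have "is_pole (wp \<tau>) 0"
  proof (rule has_laurent_expansion_imp_is_pole_0[OF wp_laurent])
    have "wpl $$ (-2) \<noteq> 0" by (simp add: wpl_lower)
    hence "fls_subdegree wpl \<le> -2" by (rule fls_subdegree_leI)
    thus "fls_subdegree wpl < 0" by simp
  qed
  hence "is_pole (\<lambda>z. wp \<tau> (z - w)) w"
    using is_pole_shift_0'[of w "\<lambda>z. wp \<tau> (z - w)"] by simp
  moreover have "\<forall>\<^sub>F z in at w. wp \<tau> (z - w) = wp \<tau> z"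
  proof -
    obtain r where r: "r > 0" "ball 0 r \<inter> L = {0}" using lattice_gap by blast
    have "\<forall>\<^sub>F z in at w. z \<in> ball w r - {w}" using r(1) by (intro eventually_at_in_open) auto
    thus ?thesis
    proof eventually_elim
      case (elim z)
      hence "z - w \<in> ball 0 r" "z - w \<noteq> 0" by (auto simp: dist_norm norm_minus_commute)
      hence "z - w \<notin> L" using r(2) by blast
      from lattice_periodic[of "wp \<tau>", OF wp_1 wp_tau this assms] show ?case by simp
    qed
  qed
  ultimately show ?thesis using is_pole_cong[of "\<lambda>z. wp \<tau> (z - w)" "wp \<tau>" w w] by simp
qed

lemma wp_isCont: "z \<notin> L \<Longrightarrow> isCont (wp \<tau>) z"
  using wp_holomorphic by (metis ComplI continuous_on_eq_continuous_at holomorphic_on_imp_continuous_on open_compl_lattice)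

end

text \<open>By \<open>wpc_scale\<close>, applied with \<open>m^2\<close>, the functions
  \<open>wp \<tau>'\<close> and \<open>m^2 * wp \<tau> (m * z)\<close> have the same expansion at
  the origin. They agree on the complement of both lattices, which is connected as the complement of
  a countable set, so a pole of the first at \<open>w\<close> must be a pole of the second.\<close>

lemma lattice_homothety:
  assumes "Im \<tau> > 0" "Im \<tau>' > 0" and m: "m \<noteq> 0"
    and u: "weierstrass_lattice.wu \<tau>' = m ^ 4 * weierstrass_lattice.wu \<tau>"
    and v: "weierstrass_lattice.wv \<tau>' = m ^ 6 * weierstrass_lattice.wv \<tau>"
    and w: "w \<in> lattice \<tau>'"
  shows "m * w \<in> lattice \<tau>"
proof (rule ccontr)
  interpret A: weierstrass_lattice \<tau> by unfold_locales fact
  interpret B: weierstrass_lattice \<tau>' by unfold_locales fact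
  assume mw: "m * w \<notin> lattice \<tau>"
  define H where "H = Abs_fps (\<lambda>k. if even k then wpc A.wu A.wv (k div 2) else 0)"
  define H' where "H' = Abs_fps (\<lambda>k. if even k then wpc B.wu B.wv (k div 2) else 0)"
  have H: "A.triv.hs has_fps_expansion H" unfolding H_def by (rule A.hs_fps)
  have H': "B.triv.hs has_fps_expansion H'" unfolding H'_def by (rule B.hs_fps)
  have HH: "fps_nth H' k = m ^ (k + 2) * fps_nth H k" for k
  proof (cases "even k")
    case True
    have "wpc B.wu B.wv (k div 2) = wpc ((m\<^sup>2)\<^sup>2 * A.wu) ((m\<^sup>2) ^ 3 * A.wv) (k div 2)"
      by (simp add: u v flip: power_mult)
    also have "\<dots> = (m\<^sup>2) ^ (k div 2 + 1) * wpc A.wu A.wv (k div 2)" by (rule wpc_scale)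
    also have "(m\<^sup>2) ^ (k div 2 + 1) = m ^ (k + 2)"
    proof -
      have "2 * (k div 2 + 1) = k + 2" using True by simp
      thus ?thesis by (simp only: power_mult[symmetric])
    qed
    finally show ?thesis using True by (simp add: H_def H'_def)
  qed (simp add: H_def H'_def)
  have "isCont (\<lambda>z. m * z) 0" by (intro continuous_intros)
  hence lim0: "((\<lambda>z. m * z) \<longlongrightarrow> 0) (nhds 0)"
    using tendsto_at_iff_tendsto_nhds[of "\<lambda>z. m * z" 0] by (simp add: isCont_def)
  have ev0: "\<forall>\<^sub>F z in nhds 0. B.triv.hs z = m\<^sup>2 * A.triv.hs (m * z)"
  proof -
    have "\<forall>\<^sub>F z in nhds 0. eval_fps H' z = B.triv.hs z" using H' by (simp add: has_fps_expansion_def)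
    moreover have "\<forall>\<^sub>F z in nhds 0. eval_fps H (m * z) = A.triv.hs (m * z)"
      using H unfolding has_fps_expansion_def by (intro eventually_compose_filterlim[OF _ lim0]) auto
    moreover have "\<forall>\<^sub>F z in nhds 0. m * z \<in> eball 0 (fps_conv_radius H)"
      by (rule topological_tendstoD[OF lim0 open_eball]) (use H in \<open>auto simp: has_fps_expansion_def zero_ereal_def\<close>)
    ultimately show ?thesis
    proof eventually_elim
      case (elim z)
      have s: "summable (\<lambda>k. fps_nth H k * (m * z) ^ k)"
        by (rule summable_fps) (use elim(3) in \<open>simp add: in_eball_iff\<close>)
      have "B.triv.hs z = (\<Sum>k. fps_nth H' k * z ^ k)" using elim(1) by (simp add: eval_fps_def)
      also have "\<dots> = (\<Sum>k. m\<^sup>2 * (fps_nth H k * (m * z) ^ k))"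
        by (simp add: HH power_add power_mult_distrib mult_ac power2_eq_square)
      also have "\<dots> = m\<^sup>2 * (\<Sum>k. fps_nth H k * (m * z) ^ k)" by (rule suminf_mult[OF s])
      also have "\<dots> = m\<^sup>2 * A.triv.hs (m * z)" using elim(2) by (simp add: eval_fps_def)
      finally show ?case .
    qed
  qed
  define D where "D = - (B.L \<union> (\<lambda>z. z / m) ` A.L)"
  have inD: "z \<in> D \<longleftrightarrow> z \<notin> B.L \<and> m * z \<notin> A.L" for z
  proof -
    have "z \<in> (\<lambda>z. z / m) ` A.L \<longleftrightarrow> m * z \<in> A.L"
      using m by (auto simp: image_iff intro!: bexI[of _ "m * z"])
    thus ?thesis by (auto simp: D_def)
  qed
  have openD: "open D"
  proof -
    have "D = - B.L \<inter> (\<lambda>z. m * z) -` (- A.L)" by (auto simp: inD)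
    moreover have "open ((\<lambda>z. m * z) -` (- A.L))"
      by (rule open_vimage) (auto intro!: continuous_intros)
    ultimately show ?thesis by auto
  qed
  have connD: "connected D"
    using connected_open_diff_countable[of "UNIV :: complex set" "B.L \<union> (\<lambda>z. z / m) ` A.L"]
      A.countable_lattice B.countable_lattice
    by (simp add: D_def Compl_eq_Diff_UNIV connected_UNIV)
  define g where "g z = m\<^sup>2 * wp \<tau> (m * z)" for z
  have holg: "g holomorphic_on D"
  proof -
    have "(wp \<tau> \<circ> (\<lambda>z. m * z)) holomorphic_on D"
      by (rule holomorphic_on_compose_gen[OF _ A.wp_holomorphic]) (auto intro!: holomorphic_intros simp: inD)
    thus ?thesis unfolding g_def[abs_def] by (auto intro!: holomorphic_intros simp: o_def)
  qed
  have holf: "wp \<tau>' holomorphic_on D"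
    by (rule holomorphic_on_subset[OF B.wp_holomorphic]) (auto simp: inD)
  obtain e where e: "e > 0" "\<And>z. z \<in> ball 0 e \<Longrightarrow> B.triv.hs z = m\<^sup>2 * A.triv.hs (m * z)"
    using ev0 unfolding eventually_nhds_metric by (auto simp: dist_norm)
  obtain r1 where r1: "r1 > 0" "ball 0 r1 \<inter> A.L = {0}" using A.lattice_gap by blast
  obtain r2 where r2: "r2 > 0" "ball 0 r2 \<inter> B.L = {0}" using B.lattice_gap by blast
  define r where "r = min e (min (r1 / norm m) r2)"
  have r: "r > 0" using e r1 r2 m by (simp add: r_def)
  have small: "z \<in> D" "wp \<tau>' z = g z" if z: "z \<in> ball 0 r - {0}" for z
  proof -
    have zz: "z \<in> ball 0 e" "z \<in> ball 0 r2" "norm z < r1 / norm m" "z \<noteq> 0" using z by (auto simp: r_def)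
    hence "m * z \<in> ball 0 r1" "m * z \<noteq> 0" using m by (auto simp: norm_mult field_simps)
    thus "z \<in> D" unfolding inD using r1(2) r2(2) zz by blast
    have "wp \<tau>' z = 1 / z\<^sup>2 + B.triv.hs z" by (simp flip: B.triv_wph add: B.triv.wph_def)
    moreover have "wp \<tau> (m * z) = 1 / (m * z)\<^sup>2 + A.triv.hs (m * z)" by (simp flip: A.triv_wph add: A.triv.wph_def)
    ultimately show "wp \<tau>' z = g z"
      using e(2)[OF zz(1)] m by (simp add: g_def distrib_left power_mult_distrib)
  qed
  have "of_real (r / 2) \<in> ball 0 r - {0 :: complex}" using r by simp
  hence ne: "ball 0 r - {0 :: complex} \<noteq> {}" by blast
  have eq: "wp \<tau>' z = g z" if "z \<in> D" for z
  proof (rule analytic_continuation_open[OF _ openD ne connD _ holf holg small(2) that])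
    show "ball 0 r - {0} \<subseteq> D" using small(1) by blast
  qed (auto simp: open_delete)
  have "isCont g w"
    unfolding g_def[abs_def] using mw by (intro continuous_intros isCont_o2[OF _ A.wp_isCont])
  hence lim: "g \<midarrow>w\<rightarrow> g w" by (rule isContD)
  have "\<forall>\<^sub>F z in at w. z \<in> D"
  proof -
    have "open (- (B.L - {w}))" by (rule B.open_compl_lattice_Un)
    moreover have "open ((\<lambda>z. m * z) -` (- A.L))"
      by (rule open_vimage) (auto intro!: continuous_intros)
    ultimately have "open (- (B.L - {w}) \<inter> (\<lambda>z. m * z) -` (- A.L))" by (rule open_Int)
    hence "\<forall>\<^sub>F z in at w. z \<in> (- (B.L - {w}) \<inter> (\<lambda>z. m * z) -` (- A.L)) - {w}"
      by (rule eventually_at_in_open) (use mw in auto)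
    thus ?thesis by eventually_elim (auto simp: inD)
  qed
  hence "\<forall>\<^sub>F z in at w. wp \<tau>' z = g z" by eventually_elim (rule eq)
  hence "is_pole g w" using B.wp_pole[OF w] is_pole_cong[of "wp \<tau>'" g w w] by blast
  thus False using lim at_neq_bot not_tendsto_and_filterlim_at_infinity unfolding is_pole_def by blast
qed

text \<open>If both invariants were zero, every homothety would satisfy the hypotheses of
  \<open>lattice_homothety\<close>; the factor 1/2 would then put \<open>1 / 2\<close> into the
  lattice.\<close>

lemma wu_wv_nonzero:
  assumes "Im \<tau> > 0"
  shows "(weierstrass_lattice.wu \<tau>, weierstrass_lattice.wv \<tau>) \<noteq> (0, 0)"
proof
  interpret weierstrass_lattice \<tau> by unfold_locales fact
  assume "(wu, wv) = (0, 0)"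
  hence "(1 / 2) * 1 \<in> L" by (intro lattice_homothety[OF assms assms]) auto
  thus False using one_half_not_lattice by simp
qed

text \<open>Multiplication by \<open>m\<close> and by its inverse map the two lattices into each
  other, so the bases are related by an integer matrix with integer inverse.\<close>

lemma SL2Z_equiv_if_homothetic:
  assumes t: "Im \<tau> > 0" "Im \<tau>' > 0" and m: "m \<noteq> 0"
    and u: "weierstrass_lattice.wu \<tau>' = m ^ 4 * weierstrass_lattice.wu \<tau>"
    and v: "weierstrass_lattice.wv \<tau>' = m ^ 6 * weierstrass_lattice.wv \<tau>"
  shows "(\<tau>, \<tau>') \<in> SL2Z_equiv"
proof -
  interpret A: weierstrass_lattice \<tau> by unfold_locales fact
  interpret B: weierstrass_lattice \<tau>' by unfold_locales fact
  note AB = lattice_homothety[OF t m u v]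
  have BA: "inverse m * w \<in> lattice \<tau>'" if "w \<in> lattice \<tau>" for w
    by (rule lattice_homothety[OF t(2,1) _ _ _ that]) (use m in \<open>simp_all add: u v field_simps\<close>)
  obtain d c where dc: "m * 1 = of_int d + of_int c * \<tau>"
    using AB[OF B.lattice_1] unfolding A.lattice_iff by blast
  obtain b a where ba: "m * \<tau>' = of_int b + of_int a * \<tau>"
    using AB[OF B.lattice_tau] unfolding A.lattice_iff by blast
  obtain p q where pq: "inverse m * 1 = of_int p + of_int q * \<tau>'"
    using BA[OF A.lattice_1] unfolding B.lattice_iff by blast
  obtain r s where rs: "inverse m * \<tau> = of_int r + of_int s * \<tau>'"
    using BA[OF A.lattice_tau] unfolding B.lattice_iff by blast
  have "of_int 1 + of_int 0 * \<tau> = m * (inverse m * 1)" using m by simp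
  also have "\<dots> = of_int p * (m * 1) + of_int q * (m * \<tau>')" by (simp only: pq) (simp add: algebra_simps)
  also have "\<dots> = of_int (p * d + q * b) + of_int (p * c + q * a) * \<tau>"
    by (simp only: dc ba) (simp add: algebra_simps)
  finally have e1: "1 = p * d + q * b" "0 = p * c + q * a" unfolding A.lattice_eq_iff by auto
  have "of_int 0 + of_int 1 * \<tau> = m * (inverse m * \<tau>)" using m by simp
  also have "\<dots> = of_int r * (m * 1) + of_int s * (m * \<tau>')" by (simp only: rs) (simp add: algebra_simps)
  also have "\<dots> = of_int (r * d + s * b) + of_int (r * c + s * a) * \<tau>"
    by (simp only: dc ba) (simp add: algebra_simps)
  finally have e2: "0 = r * d + s * b" "1 = r * c + s * a" unfolding A.lattice_eq_iff by auto
  \<comment> \<open>Multiplicativity of the determinant, written out for the two base changes, which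
    are inverse to each other.\<close>
  have "(p * s - q * r) * (a * d - b * c) = (p * d + q * b) * (r * c + s * a) - (p * c + q * a) * (r * d + s * b)"
    by (simp add: algebra_simps)
  also have "\<dots> = 1" using e1 e2 by simp
  finally have unit: "(p * s - q * r) * (a * d - b * c) = 1" .
  have cd: "of_int c * \<tau> + of_int d \<noteq> 0" using dc m by (simp add: add.commute)
  have tau': "\<tau>' = (of_int a * \<tau> + of_int b) / (of_int c * \<tau> + of_int d)"
    using ba dc m cd by (simp add: field_simps)
  \<comment> \<open>The determinant is a unit; since both periods lie in the upper half-plane,
    comparing imaginary parts makes it positive.\<close>
  have "Im \<tau>' * (norm (of_int c * \<tau> + of_int d))\<^sup>2 = of_int (a * d - b * c) * Im \<tau>"
  proof -
    have "\<tau>' * (of_int c * \<tau> + of_int d) = of_int a * \<tau> + of_int b" using tau' cd by simp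
    hence "\<tau>' * ((of_int c * \<tau> + of_int d) * cnj (of_int c * \<tau> + of_int d)) =
        (of_int a * \<tau> + of_int b) * cnj (of_int c * \<tau> + of_int d)" by (simp only: mult.assoc[symmetric])
    hence "\<tau>' * of_real ((norm (of_int c * \<tau> + of_int d))\<^sup>2) = (of_int a * \<tau> + of_int b) * cnj (of_int c * \<tau> + of_int d)"
      by (simp only: complex_norm_square)
    hence "Im (\<tau>' * of_real ((norm (of_int c * \<tau> + of_int d))\<^sup>2)) = Im ((of_int a * \<tau> + of_int b) * cnj (of_int c * \<tau> + of_int d))"
      by (rule arg_cong)
    thus ?thesis by (simp add: algebra_simps)
  qed
  moreover have "Im \<tau>' * (norm (of_int c * \<tau> + of_int d))\<^sup>2 > 0" using t cd by simp
  ultimately have "real_of_int (a * d - b * c) > 0" using t by (simp add: zero_less_mult_iff)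
  hence "a * d - b * c > 0" by (simp only: of_int_0_less_iff)
  hence "a * d - b * c = 1" using unit pos_zmult_eq_1_iff_lemma[of "a * d - b * c" "p * s - q * r"] by (simp add: mult.commute)
  thus ?thesis unfolding SL2Z_equiv_def using t tau' by blast
qed

text \<open>Equal invariants give a weighted scaling \<open>k\<close> between the pairs: a cube root
  if \<open>u = 0\<close>, otherwise a square root whose sign is adjusted to match \<open>v\<close>.
  A square root of \<open>k\<close> is then the homothety factor.\<close>

lemma SL2Z_equiv_if_jinv_eq:
  assumes t: "Im \<tau> > 0" "Im \<tau>' > 0"
    and j: "jinv (weierstrass_lattice.wu \<tau>) (weierstrass_lattice.wv \<tau>) = jinv (weierstrass_lattice.wu \<tau>') (weierstrass_lattice.wv \<tau>')"
  shows "(\<tau>, \<tau>') \<in> SL2Z_equiv"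
proof -
  define u v where "u = weierstrass_lattice.wu \<tau>" and "v = weierstrass_lattice.wv \<tau>"
  define u' v' where "u' = weierstrass_lattice.wu \<tau>'" and "v' = weierstrass_lattice.wv \<tau>'"
  have nz: "(u, v) \<noteq> (0, 0)" "(u', v') \<noteq> (0, 0)"
    using wu_wv_nonzero t unfolding u_def v_def u'_def v'_def by blast+
  have j: "jinv u v = jinv u' v'" using j by (simp add: u_def v_def u'_def v'_def)
  have "\<exists>k. k \<noteq> 0 \<and> u' = k\<^sup>2 * u \<and> v' = k ^ 3 * v"
  proof (cases "u = 0")
    case True
    have u': "u' = 0"
    proof (rule ccontr)
      assume "u' \<noteq> 0"
      thus False using j True by (simp add: jinv_def)
    qed
    have v: "v \<noteq> 0" "v' \<noteq> 0" using nz True u' by simp_all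
    obtain k where k: "v' / v = k ^ 3" using exists_complex_root[of 3 "v' / v"] by auto
    have "k \<noteq> 0"
    proof
      assume "k = 0"
      thus False using k v by simp
    qed
    moreover have "v' = k ^ 3 * v" using k v(1) by (metis nonzero_divide_eq_eq)
    moreover have "u' = k\<^sup>2 * u" using True u' by simp
    ultimately show ?thesis by blast
  next
    case False
    have u': "u' \<noteq> 0"
    proof
      assume "u' = 0"
      thus False using j False by (simp add: jinv_def)
    qed
    have vv: "v\<^sup>2 / u ^ 3 = v'\<^sup>2 / u' ^ 3" using j False u' by (simp add: jinv_def)
    define k where "k = csqrt (u' / u)"
    have k2: "k\<^sup>2 = u' / u" by (simp add: k_def)
    have k0: "k \<noteq> 0" using k2 False u' by auto
    have uk: "u' = k\<^sup>2 * u" using k2 False by simp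
    have "v'\<^sup>2 = v\<^sup>2 * (u' ^ 3 / u ^ 3)" using vv False u' by (simp add: field_simps)
    also have "u' ^ 3 / u ^ 3 = (k\<^sup>2) ^ 3" unfolding k2 by (rule power_divide[symmetric])
    also have "\<dots> = (k ^ 3)\<^sup>2" by (simp flip: power_mult)
    finally have "v'\<^sup>2 = (k ^ 3 * v)\<^sup>2" by (simp add: power_mult_distrib mult.commute)
    hence "v' = k ^ 3 * v \<or> v' = - (k ^ 3 * v)" by (simp add: power2_eq_iff)
    thus ?thesis
    proof
      assume "v' = k ^ 3 * v"
      thus ?thesis using k0 uk by blast
    next
      assume "v' = - (k ^ 3 * v)"
      hence "- k \<noteq> 0 \<and> u' = (- k)\<^sup>2 * u \<and> v' = (- k) ^ 3 * v" using k0 uk by (simp add: power3_eq_cube)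
      thus ?thesis by blast
    qed
  qed
  then obtain k where k: "k \<noteq> 0" "u' = k\<^sup>2 * u" "v' = k ^ 3 * v" by blast
  define m where "m = csqrt k"
  have m: "m\<^sup>2 = k" by (simp add: m_def)
  show ?thesis
  proof (rule SL2Z_equiv_if_homothetic[OF t])
    show "m \<noteq> 0" using m k by auto
    show "weierstrass_lattice.wu \<tau>' = m ^ 4 * weierstrass_lattice.wu \<tau>"
      using k(2) unfolding u_def u'_def m[symmetric] by (simp flip: power_mult)
    show "weierstrass_lattice.wv \<tau>' = m ^ 6 * weierstrass_lattice.wv \<tau>"
      using k(3) unfolding v_def v'_def m[symmetric] by (simp flip: power_mult)
  qed
qed

lemma SL2Z_equiv_sym: "(x, y) \<in> SL2Z_equiv \<Longrightarrow> (y, x) \<in> SL2Z_equiv"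
proof -
  assume "(x, y) \<in> SL2Z_equiv"
  then obtain a b c d :: int where *: "Im x > 0" "Im y > 0" "a * d - b * c = 1"
    "y = (of_int a * x + of_int b) / (of_int c * x + of_int d)" by (auto simp: SL2Z_equiv_def)
  define q where "q = of_int c * x + of_int d"
  have q: "q \<noteq> 0" using * by (auto simp: q_def)
  have det: "of_int a * of_int d - of_int b * of_int c = (1 :: complex)"
    using *(3) by (metis of_int_1 of_int_diff of_int_mult)
  have yq: "y * q = of_int a * x + of_int b" using *(4) q by (simp add: q_def)
  have "(of_int (- c) * y + of_int a) * q = of_int a * q - of_int c * (y * q)"
    by (simp add: left_diff_distrib distrib_right)
  also have "\<dots> = of_int a * of_int d - of_int b * of_int c"
    unfolding yq unfolding q_def by (simp add: algebra_simps)
  finally have 1: "(of_int (- c) * y + of_int a) * q = 1" using det by simp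
  have "(of_int d * y + of_int (- b)) * q = of_int d * (y * q) - of_int b * q"
    by (simp add: left_diff_distrib distrib_right)
  also have "\<dots> = x * (of_int a * of_int d - of_int b * of_int c)"
    unfolding yq unfolding q_def by (simp add: algebra_simps)
  finally have 2: "(of_int d * y + of_int (- b)) * q = x" unfolding det by simp
  have "x * (of_int (- c) * y + of_int a) = (of_int d * y + of_int (- b)) * ((of_int (- c) * y + of_int a) * q)"
    by (subst 2[symmetric]) (simp only: mult_ac)
  hence "x * (of_int (- c) * y + of_int a) = of_int d * y + of_int (- b)" unfolding 1 by simp
  moreover have "of_int (- c) * y + of_int a \<noteq> 0" using 1 by auto
  ultimately have "x = (of_int d * y + of_int (- b)) / (of_int (- c) * y + of_int a)"
    by (simp only: nonzero_eq_divide_eq not_False_eq_True)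
  moreover have "d * a - (- b) * (- c) = 1" using *(3) by (simp add: mult.commute)
  ultimately show ?thesis using *(1,2) unfolding SL2Z_equiv_def by blast
qed

lemma SL2Z_equiv_trans:
  assumes "(x, y) \<in> SL2Z_equiv" "(y, z) \<in> SL2Z_equiv"
  shows "(x, z) \<in> SL2Z_equiv"
proof -
  obtain a b c d :: int where 1: "Im x > 0" "Im y > 0" "a * d - b * c = 1"
    "y = (of_int a * x + of_int b) / (of_int c * x + of_int d)" using assms(1) by (auto simp: SL2Z_equiv_def)
  obtain a' b' c' d' :: int where 2: "Im z > 0" "a' * d' - b' * c' = 1"
    "z = (of_int a' * y + of_int b') / (of_int c' * y + of_int d')" using assms(2) by (auto simp: SL2Z_equiv_def)
  define q where "q = of_int c * x + of_int d"
  have q: "q \<noteq> 0" using 1 by (auto simp: q_def)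
  have yq: "y * q = of_int a * x + of_int b" using 1(4) q by (simp add: q_def)
  have "z = ((of_int a' * y + of_int b') * q) / ((of_int c' * y + of_int d') * q)" using 2(3) q by simp
  also have "(of_int a' * y + of_int b') * q = of_int (a' * a + b' * c) * x + of_int (a' * b + b' * d)"
    using yq by (simp add: distrib_right mult.assoc) (simp add: q_def algebra_simps)
  also have "(of_int c' * y + of_int d') * q = of_int (c' * a + d' * c) * x + of_int (c' * b + d' * d)"
    using yq by (simp add: distrib_right mult.assoc) (simp add: q_def algebra_simps)
  finally have "z = (of_int (a' * a + b' * c) * x + of_int (a' * b + b' * d)) / (of_int (c' * a + d' * c) * x + of_int (c' * b + d' * d))" .
  moreover have "(a' * a + b' * c) * (c' * b + d' * d) - (a' * b + b' * d) * (c' * a + d' * c) = (a' * d' - b' * c') * (a * d - b * c)"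
    by (simp add: algebra_simps)
  hence "(a' * a + b' * c) * (c' * b + d' * d) - (a' * b + b' * d) * (c' * a + d' * c) = 1" using 1 2 by simp
  ultimately show ?thesis using 1 2 unfolding SL2Z_equiv_def by blast
qed

lemma card_disc_classes:
  fixes n l :: nat
  assumes "odd n"
  defines "E \<equiv> {\<tau>. Im \<tau> > 0 \<and> disc n l (weierstrass_lattice.wu \<tau>) (weierstrass_lattice.wv \<tau>) = 0}"
  shows "finite (E // SL2Z_equiv)" "int (card (E // SL2Z_equiv)) \<le> \<lceil>((real n)\<^sup>2 - 1) / 24\<rceil>"
proof -
  define J where "J \<tau> = jinv (weierstrass_lattice.wu \<tau>) (weierstrass_lattice.wv \<tau>)" for \<tau>
  define Z where "Z = {jinv u v | u v. (u, v) \<noteq> (0, 0) \<and> disc n l u v = 0}"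
  have Z: "finite Z" "int (card Z) \<le> \<lceil>((real n)\<^sup>2 - 1) / 24\<rceil>"
    unfolding Z_def by (rule card_disc_zeros[OF assms(1)])+
  have JZ: "J \<tau> \<in> Z" if "\<tau> \<in> E" for \<tau>
    using that wu_wv_nonzero[of \<tau>] unfolding J_def Z_def E_def by blast
  \<comment> \<open>A class is recovered from its invariant through any representative with that
    invariant, so there are at most as many classes as invariants.\<close>
  define f where "f z = SL2Z_equiv `` {SOME \<tau>. \<tau> \<in> E \<and> J \<tau> = z}" for z
  have sub: "E // SL2Z_equiv \<subseteq> f ` Z"
  proof
    fix X assume "X \<in> E // SL2Z_equiv"
    then obtain \<tau> where t: "\<tau> \<in> E" "X = SL2Z_equiv `` {\<tau>}" by (auto elim: quotientE)
    define s where "s = (SOME s. s \<in> E \<and> J s = J \<tau>)"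
    have s: "s \<in> E" "J s = J \<tau>" using someI[of "\<lambda>s. s \<in> E \<and> J s = J \<tau>" \<tau>] t(1) by (auto simp: s_def)
    have "(s, \<tau>) \<in> SL2Z_equiv"
      by (rule SL2Z_equiv_if_jinv_eq) (use s t(1) in \<open>auto simp: E_def J_def\<close>)
    hence "SL2Z_equiv `` {s} = X" unfolding t(2) using SL2Z_equiv_sym SL2Z_equiv_trans by blast
    hence "X = f (J \<tau>)" by (simp add: f_def s_def)
    thus "X \<in> f ` Z" using JZ[OF t(1)] by blast
  qed
  show "finite (E // SL2Z_equiv)" using finite_subset[OF sub] Z(1) by simp
  have "card (E // SL2Z_equiv) \<le> card (f ` Z)" using Z(1) by (intro card_mono[OF _ sub]) simp
  also have "\<dots> \<le> card Z" using Z(1) by (rule card_image_le)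
  finally show "int (card (E // SL2Z_equiv)) \<le> \<lceil>((real n)\<^sup>2 - 1) / 24\<rceil>" using Z(2) by linarith
qed

section \<open>Solutions of the differential equation\<close>

lemma solution_on_iff:
  "solution_on \<tau> n l B S y \<longleftrightarrow> y holomorphic_on S \<and>
     (\<forall>z\<in>S. deriv (deriv (deriv y)) z = (alpha n l * wp \<tau> z + B) * deriv y z - beta n l * deriv (wp \<tau>) z * y z)"
  unfolding solution_on_def by (auto simp: numeral_3_eq_3 algebra_simps)

lemma solution_on_subset:
  "solution_on \<tau> n l B S y \<Longrightarrow> T \<subseteq> S \<Longrightarrow> solution_on \<tau> n l B T y"
  unfolding solution_on_def by (auto intro: holomorphic_on_subset)

lemma solution_on_cong:
  assumes "open S" "\<And>z. z \<in> S \<Longrightarrow> f z = g z" "solution_on \<tau> n l B S f"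
  shows "solution_on \<tau> n l B S g"
proof -
  have "(deriv ^^ k) f z = (deriv ^^ k) g z" if "z \<in> S" for k z
  proof (rule higher_deriv_cong_ev)
    show "\<forall>\<^sub>F x in nhds z. f x = g x"
      using eventually_nhds_in_open[OF assms(1) that] by eventually_elim (rule assms(2))
  qed simp
  from this[of _ 3] this[of _ 1] have "(deriv ^^ 3) f z = (deriv ^^ 3) g z" "deriv f z = deriv g z"
    if "z \<in> S" for z using that by auto
  moreover have "g holomorphic_on S" using assms(2,3) by (auto simp: solution_on_def cong: holomorphic_cong)
  ultimately show ?thesis using assms(2,3) unfolding solution_on_def by auto
qed

lemma solution_on_add:
  assumes "open S" "solution_on \<tau> n l B S f" "solution_on \<tau> n l B S g"
  shows "solution_on \<tau> n l B S (\<lambda>z. f z + g z)"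
proof -
  have h: "f holomorphic_on S" "g holomorphic_on S" using assms by (auto simp: solution_on_def)
  have d: "(deriv ^^ k) (\<lambda>z. f z + g z) z = (deriv ^^ k) f z + (deriv ^^ k) g z" if "z \<in> S" for k z
    by (rule higher_deriv_add[OF h assms(1) that])
  have d1: "deriv (\<lambda>z. f z + g z) z = deriv f z + deriv g z" if "z \<in> S" for z
    using d[OF that, of 1] by simp
  show ?thesis unfolding solution_on_def
  proof (intro conjI ballI)
    fix z assume z: "z \<in> S"
    have "(deriv ^^ 3) f z - (alpha n l * wp \<tau> z + B) * deriv f z + beta n l * deriv (wp \<tau>) z * f z = 0"
      "(deriv ^^ 3) g z - (alpha n l * wp \<tau> z + B) * deriv g z + beta n l * deriv (wp \<tau>) z * g z = 0"
      using assms(2,3) z by (auto simp: solution_on_def)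
    thus "(deriv ^^ 3) (\<lambda>z. f z + g z) z - (alpha n l * wp \<tau> z + B) * deriv (\<lambda>z. f z + g z) z
        + beta n l * deriv (wp \<tau>) z * (f z + g z) = 0"
      unfolding d[OF z] d1[OF z] by (simp add: algebra_simps)
  qed (intro holomorphic_intros h)
qed

lemma solution_on_cmult:
  assumes "open S" "solution_on \<tau> n l B S f"
  shows "solution_on \<tau> n l B S (\<lambda>z. c * f z)"
proof -
  have h: "f holomorphic_on S" using assms by (auto simp: solution_on_def)
  have d: "(deriv ^^ k) (\<lambda>z. c * f z) z = c * (deriv ^^ k) f z" if "z \<in> S" for k z
    by (rule higher_deriv_cmult[OF h that assms(1)])
  have d1: "deriv (\<lambda>z. c * f z) z = c * deriv f z" if "z \<in> S" for z
    using d[OF that, of 1] by simp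
  show ?thesis unfolding solution_on_def
  proof (intro conjI ballI)
    fix z assume z: "z \<in> S"
    have "(deriv ^^ 3) f z - (alpha n l * wp \<tau> z + B) * deriv f z + beta n l * deriv (wp \<tau>) z * f z = 0"
      using assms(2) z by (auto simp: solution_on_def)
    hence "c * ((deriv ^^ 3) f z - (alpha n l * wp \<tau> z + B) * deriv f z + beta n l * deriv (wp \<tau>) z * f z) = 0"
      by simp
    thus "(deriv ^^ 3) (\<lambda>z. c * f z) z - (alpha n l * wp \<tau> z + B) * deriv (\<lambda>z. c * f z) z
        + beta n l * deriv (wp \<tau>) z * (c * f z) = 0"
      unfolding d[OF z] d1[OF z] by (simp add: algebra_simps)
  qed (intro holomorphic_intros h)
qed

lemma solution_on_0: "solution_on \<tau> n l B S (\<lambda>z. 0)"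
  by (auto simp: solution_on_def)

lemma solution_on_sum:
  assumes "open S" "\<And>k. k \<in> I \<Longrightarrow> solution_on \<tau> n l B S (f k)"
  shows "solution_on \<tau> n l B S (\<lambda>z. \<Sum>k\<in>I. c k * f k z)"
  using assms(2)
  by (induction I rule: infinite_finite_induct)
     (auto intro!: solution_on_0 solution_on_add solution_on_cmult assms(1))

lemma global_solution_sum:
  assumes "\<And>k. k \<in> I \<Longrightarrow> global_solution \<tau> n l B (f k)" "open (- lattice \<tau>)"
  shows "global_solution \<tau> n l B (\<lambda>z. \<Sum>k\<in>I. c k * f k z)"
  using assms unfolding global_solution_def
  by (auto intro!: solution_on_sum meromorphic_intros)

lemma solution_on_compose_shift:
  assumes S: "open S" "\<And>z. z \<in> S \<Longrightarrow> z + v \<in> T" and T: "open T" "solution_on \<tau> n l B T y"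
    and wp: "\<And>z. z \<in> S \<Longrightarrow> wp \<tau> (z + v) = wp \<tau> z"
  shows "solution_on \<tau> n l B S (\<lambda>z. y (z + v))"
proof -
  have sh: "deriv (\<lambda>z. f (z + v)) z = deriv f (z + v)" for f :: "complex \<Rightarrow> complex" and z
    unfolding deriv_def by (simp add: DERIV_shift)
  have hy: "y holomorphic_on T" using T(2) by (simp add: solution_on_iff)
  have "(y \<circ> (\<lambda>z. z + v)) holomorphic_on S"
    by (rule holomorphic_on_compose_gen[OF _ hy]) (use S(2) in \<open>auto intro!: holomorphic_intros\<close>)
  hence "(\<lambda>z. y (z + v)) holomorphic_on S" by (simp add: o_def)
  moreover have "deriv (wp \<tau>) (z + v) = deriv (wp \<tau>) z" if z: "z \<in> S" for z
  proof -
    have "deriv (wp \<tau>) (z + v) = deriv (\<lambda>z. wp \<tau> (z + v)) z" by (rule sh[symmetric])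
    also have "\<dots> = deriv (wp \<tau>) z"
      by (rule deriv_cong_ev[OF _ refl]) (use eventually_nhds_in_open[OF S(1) z] wp in \<open>auto elim: eventually_mono\<close>)
    finally show ?thesis .
  qed
  moreover have "deriv (deriv (deriv y)) (z + v) = (alpha n l * wp \<tau> (z + v) + B) * deriv y (z + v) - beta n l * deriv (wp \<tau>) (z + v) * y (z + v)"
    if z: "z \<in> S" for z
    using S(2)[OF z] T(2) unfolding solution_on_iff by blast
  ultimately show ?thesis using wp unfolding solution_on_iff sh by simp
qed

lemma solution_on_compose_uminus:
  assumes S: "open S" "\<And>z. z \<in> S \<Longrightarrow> - z \<in> S" and y: "solution_on \<tau> n l B S y"
    and wp: "\<And>z. wp \<tau> (- z) = wp \<tau> z" and hwp: "wp \<tau> holomorphic_on S"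
  shows "solution_on \<tau> n l B S (\<lambda>z. y (- z))"
proof -
  have sh: "deriv (\<lambda>z. c * f (- z)) z = - c * deriv f (- z)" if "f holomorphic_on S" "z \<in> S" for f z c
  proof (rule DERIV_imp_deriv)
    have "(f has_field_derivative deriv f (- z)) (at (- z))"
      using that S by (intro holomorphic_derivI[of f S]) auto
    hence "((\<lambda>z. f (- z)) has_field_derivative deriv f (- z) * (- 1)) (at z)"
      by (intro DERIV_chain'[where f = uminus and g = f]) (auto intro!: derivative_eq_intros)
    from DERIV_cmult[OF this, of c] show "((\<lambda>z. c * f (- z)) has_field_derivative - c * deriv f (- z)) (at z)" by simp
  qed
  have hy: "y holomorphic_on S" using y by (simp add: solution_on_iff)
  have hd: "deriv y holomorphic_on S" "deriv (deriv y) holomorphic_on S"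
    using hy S(1) by (auto intro!: holomorphic_deriv)
  have d1: "deriv (\<lambda>z. y (- z)) z = - deriv y (- z)" if "z \<in> S" for z
    using sh[OF hy that, of 1] by simp
  have d2: "deriv (deriv (\<lambda>z. y (- z))) z = deriv (deriv y) (- z)" if z: "z \<in> S" for z
  proof -
    have "deriv (deriv (\<lambda>z. y (- z))) z = deriv (\<lambda>z. - 1 * deriv y (- z)) z"
      by (rule deriv_cong_ev[OF _ refl]) (use eventually_nhds_in_open[OF S(1) z] d1 in \<open>auto elim: eventually_mono\<close>)
    thus ?thesis using sh[OF hd(1) z, of "- 1"] by simp
  qed
  have d3: "deriv (deriv (deriv (\<lambda>z. y (- z)))) z = - deriv (deriv (deriv y)) (- z)" if z: "z \<in> S" for z
  proof -
    have "deriv (deriv (deriv (\<lambda>z. y (- z)))) z = deriv (\<lambda>z. 1 * deriv (deriv y) (- z)) z"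
      by (rule deriv_cong_ev[OF _ refl]) (use eventually_nhds_in_open[OF S(1) z] d2 in \<open>auto elim: eventually_mono\<close>)
    thus ?thesis using sh[OF hd(2) z, of 1] by simp
  qed
  have w: "deriv (wp \<tau>) z = - deriv (wp \<tau>) (- z)" if z: "z \<in> S" for z
  proof -
    have "deriv (wp \<tau>) z = deriv (\<lambda>z. 1 * wp \<tau> (- z)) z" by (simp add: wp)
    thus ?thesis using sh[OF hwp z, of 1] by simp
  qed
  show ?thesis unfolding solution_on_iff
  proof (intro conjI ballI)
    have "(y \<circ> uminus) holomorphic_on S"
      by (rule holomorphic_on_compose_gen[OF _ hy]) (use S(2) in \<open>auto intro!: holomorphic_intros\<close>)
    thus "(\<lambda>z. y (- z)) holomorphic_on S" by (simp add: o_def)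
    fix z assume z: "z \<in> S"
    have "deriv (deriv (deriv y)) (- z) = (alpha n l * wp \<tau> (- z) + B) * deriv y (- z) - beta n l * deriv (wp \<tau>) (- z) * y (- z)"
      using y S(2)[OF z] by (simp add: solution_on_iff)
    thus "deriv (deriv (deriv (\<lambda>z. y (- z)))) z = (alpha n l * wp \<tau> z + B) * deriv (\<lambda>z. y (- z)) z - beta n l * deriv (wp \<tau>) z * y (- z)"
      unfolding d3[OF z] d1[OF z] w[OF z] wp by (simp add: algebra_simps)
  qed
qed

lemma higher_deriv_mult_eq_0:
  assumes "f holomorphic_on S" "g holomorphic_on S" "open S" "z \<in> S"
    and "\<And>i. i \<le> k \<Longrightarrow> (deriv ^^ i) g z = 0"
  shows "(deriv ^^ k) (\<lambda>w. f w * g w) z = 0"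
  unfolding higher_deriv_mult[OF assms(1-4)] by (rule sum.neutral) (use assms(5) in auto)

text \<open>Differentiating the equation expresses each higher derivative at \<open>z0\<close>
  through lower ones, so all of them vanish, and the function is zero by analyticity.\<close>

lemma solution_unique:
  assumes S: "open S" "connected S" and wp: "wp \<tau> holomorphic_on S"
    and y: "solution_on \<tau> n l B S y"
    and z0: "z0 \<in> S" "y z0 = 0" "deriv y z0 = 0" "deriv (deriv y) z0 = 0" and z: "z \<in> S"
  shows "y z = 0"
proof -
  have hy: "y holomorphic_on S" using y by (simp add: solution_on_iff)
  have hd: "deriv y holomorphic_on S" using hy S(1) by (rule holomorphic_deriv)
  have ha: "(\<lambda>z. alpha n l * wp \<tau> z + B) holomorphic_on S" "(\<lambda>z. - beta n l * deriv (wp \<tau>) z) holomorphic_on S"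
    using wp S(1) by (auto intro!: holomorphic_intros)
  have "(deriv ^^ k) y z0 = 0" for k
  proof (induction k rule: less_induct)
    case (less k)
    have "k = 0 \<or> k = 1 \<or> k = 2 \<or> (\<exists>j. k = j + 3)" by presburger
    then consider "k = 0" | "k = 1" | "k = 2" | j where "k = j + 3" by blast
    thus ?case
    proof cases
      case 4
      have "(deriv ^^ k) y z0 = (deriv ^^ j) ((deriv ^^ 3) y) z0" by (simp only: 4 funpow_add o_apply)
      also have "\<dots> = (deriv ^^ j) (\<lambda>z. (alpha n l * wp \<tau> z + B) * deriv y z + (- beta n l * deriv (wp \<tau>) z) * y z) z0"
      proof (rule higher_deriv_cong_ev)
        have "(deriv ^^ 3) y x = (alpha n l * wp \<tau> x + B) * deriv y x + (- beta n l * deriv (wp \<tau>) x) * y x" if "x \<in> S" for x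
          using y that unfolding solution_on_iff by (simp add: numeral_3_eq_3)
        thus "\<forall>\<^sub>F x in nhds z0. (deriv ^^ 3) y x = (alpha n l * wp \<tau> x + B) * deriv y x + (- beta n l * deriv (wp \<tau>) x) * y x"
          using eventually_nhds_in_open[OF S(1) z0(1)] by (auto elim: eventually_mono)
      qed simp
      also have "\<dots> = (deriv ^^ j) (\<lambda>z. (alpha n l * wp \<tau> z + B) * deriv y z) z0
          + (deriv ^^ j) (\<lambda>z. (- beta n l * deriv (wp \<tau>) z) * y z) z0"
        by (rule higher_deriv_add[OF _ _ S(1) z0(1)]) (intro holomorphic_on_mult ha hd hy)+
      also have "(deriv ^^ j) (\<lambda>z. (alpha n l * wp \<tau> z + B) * deriv y z) z0 = 0"
      proof (rule higher_deriv_mult_eq_0[OF ha(1) hd S(1) z0(1)])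
        fix i assume "i \<le> j"
        hence "(deriv ^^ (Suc i)) y z0 = 0" by (intro less.IH) (simp add: 4)
        thus "(deriv ^^ i) (deriv y) z0 = 0" by (simp only: funpow_Suc_right o_apply)
      qed
      also have "(deriv ^^ j) (\<lambda>z. (- beta n l * deriv (wp \<tau>) z) * y z) z0 = 0"
        by (rule higher_deriv_mult_eq_0[OF ha(2) hy S(1) z0(1)]) (rule less.IH, simp add: 4)
      finally show ?thesis by simp
    qed (use z0 in \<open>simp_all add: numeral_2_eq_2\<close>)
  qed
  thus ?thesis using holomorphic_fun_eq_0_on_connected[OF hy S _ z0(1) z] by blast
qed

text \<open>By uniqueness, a combination with zero 2-jet at a point is zero. Independence therefore
  makes the 3 by 3 matrix of initial values injective, hence invertible, and any 2-jet can be
  matched.\<close>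

lemma solutions_span:
  fixes y :: "3 \<Rightarrow> complex \<Rightarrow> complex"
  assumes S: "open S" "connected S" "S \<noteq> {}" and wp: "wp \<tau> holomorphic_on S"
    and y: "\<And>k. solution_on \<tau> n l B S (y k)"
    and indep: "\<And>c. \<forall>z\<in>S. (\<Sum>k\<in>UNIV. c k * y k z) = 0 \<Longrightarrow> \<forall>k. c k = 0"
    and f: "solution_on \<tau> n l B S f"
  shows "\<exists>c. \<forall>z\<in>S. f z = (\<Sum>k\<in>UNIV. c k * y k z)"
proof -
  obtain z0 where z0: "z0 \<in> S" using S(3) by blast
  define J where "J g = (vector [g z0, deriv g z0, deriv (deriv g) z0] :: complex^3)" for g :: "complex \<Rightarrow> complex"
  define M where "M = (\<chi> i k. J (y k) $h i)"
  have hol: "g holomorphic_on S" if "solution_on \<tau> n l B S g" for g using that by (simp add: solution_on_iff)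
  have Jsum: "J (\<lambda>z. \<Sum>k\<in>UNIV. c $h k * y k z) = M *v c" for c
  proof -
    have d: "(deriv ^^ j) (\<lambda>z. \<Sum>k\<in>I. c $h k * y k z) z0 = (\<Sum>k\<in>I. c $h k * (deriv ^^ j) (y k) z0)" for j and I :: "3 set"
    proof (induction I rule: infinite_finite_induct)
      case (insert k I)
      have "(deriv ^^ j) (\<lambda>z. \<Sum>k\<in>insert k I. c $h k * y k z) z0 = (deriv ^^ j) (\<lambda>z. c $h k * y k z + (\<Sum>k\<in>I. c $h k * y k z)) z0"
        using insert by simp
      also have "\<dots> = (deriv ^^ j) (\<lambda>z. c $h k * y k z) z0 + (deriv ^^ j) (\<lambda>z. \<Sum>k\<in>I. c $h k * y k z) z0"
        by (rule higher_deriv_add[OF _ _ S(1) z0]) (intro holomorphic_intros hol y)+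
      also have "(deriv ^^ j) (\<lambda>z. c $h k * y k z) z0 = c $h k * (deriv ^^ j) (y k) z0"
        by (rule higher_deriv_cmult[OF hol[OF y] z0 S(1)])
      finally show ?case using insert by simp
    qed (simp_all)
    have e: "deriv (\<lambda>z. \<Sum>k\<in>UNIV. c $h k * y k z) z0 = (\<Sum>k\<in>UNIV. c $h k * deriv (y k) z0)"
      "deriv (deriv (\<lambda>z. \<Sum>k\<in>UNIV. c $h k * y k z)) z0 = (\<Sum>k\<in>UNIV. c $h k * deriv (deriv (y k)) z0)"
      using d[of 1 UNIV] d[of 2 UNIV] by (simp_all add: numeral_2_eq_2)
    have "J (\<lambda>z. \<Sum>k\<in>UNIV. c $h k * y k z) $h i = (M *v c) $h i" for i
      using exhaust_3[of i] by (elim disjE)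
        (simp_all add: J_def M_def matrix_vector_mult_def e mult.commute)
    thus ?thesis by (simp add: Finite_Cartesian_Product.vec_eq_iff)
  qed
  have inj: "c = 0" if "M *v c = 0" for c
  proof -
    have J0: "J (\<lambda>z. \<Sum>k\<in>UNIV. c $h k * y k z) = 0" using Jsum that by simp
    define g where "g = (\<lambda>z. \<Sum>k\<in>UNIV. c $h k * y k z)"
    have gs: "solution_on \<tau> n l B S g" unfolding g_def by (rule solution_on_sum[OF S(1) y])
    have "J g = 0" using J0 by (simp only: g_def)
    hence "J g $h 1 = 0" "J g $h 2 = 0" "J g $h 3 = 0" by simp_all
    hence g0: "g z0 = 0" "deriv g z0 = 0" "deriv (deriv g) z0 = 0" by (simp_all add: J_def)
    have "\<forall>z\<in>S. g z = 0" using solution_unique[OF S(1,2) wp gs z0 g0] by blast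
    hence "\<forall>z\<in>S. (\<Sum>k\<in>UNIV. c $h k * y k z) = 0" by (simp only: g_def)
    hence "\<forall>k. c $h k = 0" by (rule indep)
    thus ?thesis by (simp add: Finite_Cartesian_Product.vec_eq_iff)
  qed
  hence "\<exists>M'. M' ** M = Finite_Cartesian_Product.mat 1" by (simp add: matrix_left_invertible_ker)
  then obtain M' where "M ** M' = Finite_Cartesian_Product.mat 1" using matrix_left_right_inverse by blast
  hence c: "M *v (M' *v J f) = J f" by (simp add: matrix_vector_mul_assoc)
  define c where "c = M' *v J f"
  define g where "g z = f z + (- 1) * (\<Sum>k\<in>UNIV. c $h k * y k z)" for z
  have gs: "solution_on \<tau> n l B S g"
    unfolding g_def[abs_def] by (intro solution_on_add solution_on_cmult solution_on_sum S(1) y f)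
  have hs: "(\<lambda>z. (- 1) * (\<Sum>k\<in>UNIV. c $h k * y k z)) holomorphic_on S" by (intro holomorphic_intros hol y)
  have "(deriv ^^ j) g z0 = (deriv ^^ j) f z0 - (deriv ^^ j) (\<lambda>z. \<Sum>k\<in>UNIV. c $h k * y k z) z0" for j
  proof -
    have "(deriv ^^ j) g z0 = (deriv ^^ j) f z0 + (deriv ^^ j) (\<lambda>z. (- 1) * (\<Sum>k\<in>UNIV. c $h k * y k z)) z0"
      unfolding g_def[abs_def] by (rule higher_deriv_add[OF hol[OF f] hs S(1) z0])
    also have "(deriv ^^ j) (\<lambda>z. (- 1) * (\<Sum>k\<in>UNIV. c $h k * y k z)) z0 = (- 1) * (deriv ^^ j) (\<lambda>z. \<Sum>k\<in>UNIV. c $h k * y k z) z0"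
      by (rule higher_deriv_cmult[OF _ z0 S(1)]) (intro holomorphic_intros hol y)
    finally show ?thesis by simp
  qed
  from this[of 0] this[of 1] this[of 2] have Jg: "g z0 = f z0 - (\<Sum>k\<in>UNIV. c $h k * y k z0)"
    "deriv g z0 = deriv f z0 - deriv (\<lambda>z. \<Sum>k\<in>UNIV. c $h k * y k z) z0"
    "deriv (deriv g) z0 = deriv (deriv f) z0 - deriv (deriv (\<lambda>z. \<Sum>k\<in>UNIV. c $h k * y k z)) z0"
    by (simp_all add: numeral_2_eq_2)
  have Jc: "J (\<lambda>z. \<Sum>k\<in>UNIV. c $h k * y k z) = J f" using Jsum c by (simp add: c_def)
  have J123: "J h $h 1 = h z0" "J h $h 2 = deriv h z0" "J h $h 3 = deriv (deriv h) z0" for h by (simp_all add: J_def)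
  have "g z0 = 0" "deriv g z0 = 0" "deriv (deriv g) z0 = 0"
    using Jg J123[of f] J123[of "\<lambda>z. \<Sum>k\<in>UNIV. c $h k * y k z"] unfolding Jc by simp_all
  hence "g z = 0" if "z \<in> S" for z
    using solution_unique[OF S(1,2) wp gs z0 _ _ _ that] by blast
  hence "\<forall>z\<in>S. f z = (\<Sum>k\<in>UNIV. c $h k * y k z)" by (simp add: g_def)
  thus ?thesis by (rule exI[where x = "\<lambda>k. c $h k"])
qed

text \<open>One integration along a segment gains a power of the distance and a step of the
  factorial; iterated, this is what makes the Picard series converge.\<close>

lemma primitive_bound:
  fixes g f :: "complex \<Rightarrow> complex"
  assumes g: "\<And>x. x \<in> closed_segment a z \<Longrightarrow> (g has_field_derivative f x) (at x)" and ga: "g a = 0"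
    and f: "\<And>x. x \<in> closed_segment a z \<Longrightarrow> norm (f x) \<le> A * norm (x - a) ^ k / fact k"
  shows "norm (g z) \<le> A * norm (z - a) ^ (k + 1) / fact (k + 1)"
proof -
  define \<phi> where "\<phi> t = g (a + of_real t * (z - a))" for t :: real
  define \<psi> where "\<psi> t = A * norm (z - a) ^ (k + 1) / fact (k + 1) * t ^ (k + 1)" for t :: real
  define \<phi>' where "\<phi>' t = f (a + of_real t * (z - a)) * (z - a)" for t :: real
  define \<psi>' where "\<psi>' t = A * norm (z - a) ^ (k + 1) / fact k * t ^ k" for t :: real
  have seg: "a + of_real t * (z - a) \<in> closed_segment a z" if "t \<in> {0..1}" for t
    using that by (auto simp: closed_segment_def scaleR_conv_of_real algebra_simps intro!: exI[of _ t])
  have d\<phi>: "(\<phi> has_vector_derivative \<phi>' t) (at t)" if "t \<in> {0..1}" for t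
  proof -
    have "((\<lambda>t. a + of_real t * (z - a)) has_vector_derivative (z - a)) (at t)"
      by (auto intro!: derivative_eq_intros)
    from field_vector_diff_chain_at[OF this g[OF seg[OF that]]]
    show ?thesis by (simp add: \<phi>_def[abs_def] \<phi>'_def o_def mult.commute)
  qed
  have d\<psi>: "(\<psi> has_vector_derivative \<psi>' t) (at t)" for t
  proof -
    have "(\<psi> has_real_derivative A * norm (z - a) ^ (k + 1) / fact (k + 1) * (of_nat (k + 1) * t ^ k)) (at t)"
      unfolding \<psi>_def[abs_def] by (intro DERIV_cmult) (use DERIV_pow[of "k + 1" t] in simp)
    moreover have "A * norm (z - a) ^ (k + 1) / fact (k + 1) * (of_nat (k + 1) * t ^ k) = \<psi>' t"
      unfolding \<psi>'_def by (simp add: field_simps del: of_nat_Suc)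
    ultimately show ?thesis by (simp add: has_real_derivative_iff_has_vector_derivative)
  qed
  have "norm (\<phi> 1 - \<phi> 0) \<le> \<psi> 1 - \<psi> 0"
  proof (rule differentiable_bound_general)
    show "continuous_on {0..1} \<phi>"
      using d\<phi> by (intro continuous_at_imp_continuous_on ballI has_vector_derivative_continuous) auto
    show "continuous_on {0..1} \<psi>"
      using d\<psi> by (intro continuous_at_imp_continuous_on ballI has_vector_derivative_continuous) auto
    fix t :: real assume t: "0 < t" "t < 1"
    have "norm (a + of_real t * (z - a) - a) = t * norm (z - a)" using t by (simp add: norm_mult)
    hence "norm (f (a + of_real t * (z - a))) \<le> A * (t * norm (z - a)) ^ k / fact k"
      using f[OF seg[of t]] t by simp
    hence "norm (\<phi>' t) \<le> A * (t * norm (z - a)) ^ k / fact k * norm (z - a)"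
      unfolding \<phi>'_def norm_mult by (rule mult_right_mono) simp
    also have "\<dots> = \<psi>' t" by (simp add: \<psi>'_def power_mult_distrib)
    finally show "norm (\<phi>' t) \<le> \<psi>' t" .
    show "(\<phi> has_vector_derivative \<phi>' t) (at t)" by (rule d\<phi>) (use t in auto)
    show "(\<psi> has_vector_derivative \<psi>' t) (at t)" by (rule d\<psi>)
  qed auto
  thus ?thesis by (simp add: \<phi>_def \<psi>_def ga)
qed

lemma higher_derivs_eqI:
  assumes "open S" "z \<in> S"
    and 1: "\<And>z. z \<in> S \<Longrightarrow> (f has_field_derivative f1 z) (at z)"
    and 2: "\<And>z. z \<in> S \<Longrightarrow> (f1 has_field_derivative f2 z) (at z)"
    and 3: "\<And>z. z \<in> S \<Longrightarrow> (f2 has_field_derivative f3 z) (at z)"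
  shows "(deriv ^^ 1) f z = f1 z" "(deriv ^^ 2) f z = f2 z" "(deriv ^^ 3) f z = f3 z"
proof -
  have d1: "deriv f z = f1 z" if "z \<in> S" for z using 1[OF that] by (rule DERIV_imp_deriv)
  have d2: "deriv (deriv f) z = f2 z" if z: "z \<in> S" for z
  proof -
    have "deriv (deriv f) z = deriv f1 z"
      by (rule deriv_cong_ev[OF _ refl]) (use eventually_nhds_in_open[OF assms(1) z] d1 in \<open>auto elim: eventually_mono\<close>)
    also have "\<dots> = f2 z" using 2[OF z] by (rule DERIV_imp_deriv)
    finally show ?thesis .
  qed
  have d3: "deriv (deriv (deriv f)) z = f3 z" if z: "z \<in> S" for z
  proof -
    have "deriv (deriv (deriv f)) z = deriv f2 z"
      by (rule deriv_cong_ev[OF _ refl]) (use eventually_nhds_in_open[OF assms(1) z] d2 in \<open>auto elim: eventually_mono\<close>)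
    also have "\<dots> = f3 z" using 3[OF z] by (rule DERIV_imp_deriv)
    finally show ?thesis .
  qed
  show "(deriv ^^ 1) f z = f1 z" "(deriv ^^ 2) f z = f2 z" "(deriv ^^ 3) f z = f3 z"
    using d1[OF assms(2)] d2[OF assms(2)] d3[OF assms(2)] by (simp_all add: numeral_2_eq_2 numeral_3_eq_3)
qed

text \<open>Picard iteration; the factorial bounds give locally uniform convergence on the whole starlike set.\<close>
lemma linear_ode3_exists:
  fixes p q :: "complex \<Rightarrow> complex"
  assumes S: "open S" "a \<in> S" and star: "\<And>z. z \<in> S \<Longrightarrow> closed_segment a z \<subseteq> S"
    and p: "p holomorphic_on S" and q: "q holomorphic_on S"
  obtains y where "y holomorphic_on S" "\<And>z. z \<in> S \<Longrightarrow> (deriv ^^ 3) y z = p z * deriv y z + q z * y z"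
    "y a = c0" "deriv y a = c1" "deriv (deriv y) a = c2"
proof -
  \<comment> \<open>The primitive vanishing at \<open>a\<close>; for holomorphic \<open>f\<close> it
    exists because the domain is starlike.\<close>
  define K where "K f = (SOME g. (\<forall>x\<in>S. (g has_field_derivative f x) (at x)) \<and> g a = 0)" for f :: "complex \<Rightarrow> complex"
  have K: "(\<forall>x\<in>S. (K f has_field_derivative f x) (at x)) \<and> K f a = 0" if hf: "f holomorphic_on S" for f
  proof -
    have "starlike S" using S(2) star unfolding starlike_def by blast
    moreover have "continuous_on S f" by (rule holomorphic_on_imp_continuous_on[OF hf])
    moreover have "f field_differentiable at x" if "x \<in> S - {}" for x
      using holomorphic_on_imp_differentiable_at[OF hf S(1)] that by simp
    ultimately obtain g where g: "\<And>x. x \<in> S \<Longrightarrow> (g has_field_derivative f x) (at x)"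
      using holomorphic_starlike_primitive[of S f "{}"] S(1) by blast
    have "(\<forall>x\<in>S. ((\<lambda>z. g z - g a) has_field_derivative f x) (at x)) \<and> g a - g a = 0"
      using g by (auto intro!: derivative_eq_intros)
    thus ?thesis unfolding K_def
      by (rule someI[of "\<lambda>g. (\<forall>x\<in>S. (g has_field_derivative f x) (at x)) \<and> g a = 0"])
  qed
  have holI: "g holomorphic_on S" if "\<And>x. x \<in> S \<Longrightarrow> (g has_field_derivative f x) (at x)" for g f
    using that S(1) by (auto simp: holomorphic_on_open)
  have Khol: "K f holomorphic_on S" if "f holomorphic_on S" for f
    using K[OF that] by (intro holI[of _ f]) auto
  define W where "W y = (\<lambda>z. p z * deriv y z + q z * y z)" for y
  have Whol: "W y holomorphic_on S" if "y holomorphic_on S" for y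
    unfolding W_def using that S(1) p q by (intro holomorphic_intros)
  \<comment> \<open>The quadratic polynomial carries the initial values. Every later correction is a
    triple primitive and vanishes at \<open>a\<close> together with its first two
    derivatives.\<close>
  define u0 where "u0 z = c0 + c1 * (z - a) + c2 / 2 * (z - a)\<^sup>2" for z
  define u where "u = rec_nat u0 (\<lambda>_ y. K (K (K (W y))))"
  have u: "u 0 = u0" "u (Suc k) = K (K (K (W (u k))))" for k by (simp_all add: u_def)
  have u0d: "(u0 has_field_derivative c1 + c2 * (z - a)) (at z)" "((\<lambda>z. c1 + c2 * (z - a)) has_field_derivative c2) (at z)" for z
    unfolding u0_def[abs_def] by (auto intro!: derivative_eq_intros)
  have u0hol: "u0 holomorphic_on S" unfolding u0_def[abs_def] by (intro holomorphic_intros)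
  have uhol: "u k holomorphic_on S" for k
    by (induction k) (simp_all only: u u0hol Khol Whol)
  define w where "w k = W (u k)" for k
  have whol: "w k holomorphic_on S" for k unfolding w_def by (rule Whol[OF uhol])
  have x: "\<And>z. z \<in> S \<Longrightarrow> (K (w k) has_field_derivative w k z) (at z)" "K (w k) a = 0" for k
    using K[OF whol] by auto
  have v: "\<And>z. z \<in> S \<Longrightarrow> (K (K (w k)) has_field_derivative K (w k) z) (at z)" "K (K (w k)) a = 0" for k
    using K[OF Khol[OF whol]] by auto
  have us: "\<And>z. z \<in> S \<Longrightarrow> (u (Suc k) has_field_derivative K (K (w k)) z) (at z)" "u (Suc k) a = 0" for k
    using K[OF Khol[OF Khol[OF whol]]] by (auto simp: u w_def)
  have wSuc: "w (Suc k) z = p z * K (K (w k)) z + q z * u (Suc k) z" if "z \<in> S" for k z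
    using DERIV_imp_deriv[OF us(1)[OF that]] by (simp add: w_def W_def)
  define s where "s N z = u0 z + (\<Sum>k<N. u (Suc k) z)" for N z
  have sd: "(deriv ^^ 1) (s N) z = c1 + c2 * (z - a) + (\<Sum>k<N. K (K (w k)) z)"
    "(deriv ^^ 2) (s N) z = c2 + (\<Sum>k<N. K (w k) z)" "(deriv ^^ 3) (s N) z = (\<Sum>k<N. w k z)" if "z \<in> S" for N z
  proof -
    have "(s N has_field_derivative c1 + c2 * (z - a) + (\<Sum>k<N. K (K (w k)) z)) (at z)" if "z \<in> S" for z
      unfolding s_def[abs_def] using that by (intro DERIV_add u0d DERIV_sum us)
    moreover have "((\<lambda>z. c1 + c2 * (z - a) + (\<Sum>k<N. K (K (w k)) z)) has_field_derivative c2 + (\<Sum>k<N. K (w k) z)) (at z)"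
      if "z \<in> S" for z using that by (intro DERIV_add u0d DERIV_sum v)
    moreover have "((\<lambda>z. c2 + (\<Sum>k<N. K (w k) z)) has_field_derivative (\<Sum>k<N. w k z)) (at z)"
      if "z \<in> S" for z
    proof -
      have "((\<lambda>z. c2 + (\<Sum>k<N. K (w k) z)) has_field_derivative 0 + (\<Sum>k<N. w k z)) (at z)"
        using that by (intro DERIV_add DERIV_const DERIV_sum x)
      thus ?thesis by simp
    qed
    ultimately show "(deriv ^^ 1) (s N) z = c1 + c2 * (z - a) + (\<Sum>k<N. K (K (w k)) z)"
      "(deriv ^^ 2) (s N) z = c2 + (\<Sum>k<N. K (w k) z)" "(deriv ^^ 3) (s N) z = (\<Sum>k<N. w k z)"
      using higher_derivs_eqI[OF S(1) \<open>z \<in> S\<close>, of "s N" "\<lambda>z. c1 + c2 * (z - a) + (\<Sum>k<N. K (K (w k)) z)"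
        "\<lambda>z. c2 + (\<Sum>k<N. K (w k) z)" "\<lambda>z. \<Sum>k<N. w k z"] by auto
  qed
  have shol: "s N holomorphic_on S" for N
    unfolding s_def[abs_def] by (intro holomorphic_intros u0hol uhol)
  \<comment> \<open>Each partial sum solves the equation with the preceding partial sum on the
    right, so the limit solves it exactly.\<close>
  have s3: "(deriv ^^ 3) (s (Suc N)) z = p z * deriv (s N) z + q z * s N z" if z: "z \<in> S" for N z
  proof -
    have "(\<Sum>k<N. w (Suc k) z) = p z * (\<Sum>k<N. K (K (w k)) z) + q z * (\<Sum>k<N. u (Suc k) z)"
      by (simp add: wSuc[OF z] sum.distrib sum_distrib_left)
    moreover have "w 0 z = p z * (c1 + c2 * (z - a)) + q z * u0 z"
      using DERIV_imp_deriv[OF u0d(1)[of z]] by (simp add: w_def W_def u)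
    moreover have "(deriv ^^ 3) (s (Suc N)) z = w 0 z + (\<Sum>k<N. w (Suc k) z)"
      unfolding sd(3)[OF z] by (rule sum.lessThan_Suc_shift)
    ultimately have "(deriv ^^ 3) (s (Suc N)) z = p z * (c1 + c2 * (z - a) + (\<Sum>k<N. K (K (w k)) z)) + q z * (u0 z + (\<Sum>k<N. u (Suc k) z))"
      by (simp only: distrib_left add.assoc add.left_commute)
    moreover have "deriv (s N) z = c1 + c2 * (z - a) + (\<Sum>k<N. K (K (w k)) z)" using sd(1)[OF z, of N] by simp
    ultimately show ?thesis unfolding s_def[of N z] by simp
  qed
  have ul: "\<exists>e>0. ball z e \<subseteq> S \<and> uniform_limit (ball z e) s (\<lambda>z. u0 z + (\<Sum>k. u (Suc k) z)) sequentially"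
    if z: "z \<in> S" for z
  proof -
    obtain e where e: "e > 0" "cball z e \<subseteq> S" using S(1) z open_contains_cball by blast
    \<comment> \<open>The union of the segments from \<open>a\<close> to a closed ball around
      \<open>z\<close> is compact and again starlike about \<open>a\<close>, so suprema over it
      control every integral involved.\<close>
    define C where "C = (\<lambda>(t, x). a + of_real t * (x - a)) ` ({0..1 :: real} \<times> cball z e)"
    have "compact C" unfolding C_def
      by (intro compact_continuous_image compact_Times) (auto intro!: continuous_intros simp: split_def)
    have CS: "C \<subseteq> S"
    proof
      fix x assume "x \<in> C"
      then obtain t y where ty: "t \<in> {0..1}" "y \<in> cball z e" "x = a + of_real t * (y - a)" by (auto simp: C_def)
      have "x \<in> closed_segment a y" using ty
        by (auto simp: closed_segment_def scaleR_conv_of_real algebra_simps intro!: exI[of _ t])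
      thus "x \<in> S" using star[of y] e(2) ty(2) by blast
    qed
    have Cstar: "closed_segment a x \<subseteq> C" if "x \<in> C" for x
    proof
      fix y assume "y \<in> closed_segment a x"
      then obtain r where r: "r \<in> {0..1}" "y = a + of_real r * (x - a)"
        by (auto simp: closed_segment_def scaleR_conv_of_real algebra_simps)
      obtain t y' where ty: "t \<in> {0..1}" "y' \<in> cball z e" "x = a + of_real t * (y' - a)" using \<open>x \<in> C\<close> by (auto simp: C_def)
      have "y = a + of_real (r * t) * (y' - a)" using r ty by simp
      moreover have "r * t \<in> {0..1}" using r ty by (auto intro: mult_le_one)
      ultimately show "y \<in> C" unfolding C_def using ty(2) by (intro image_eqI[of _ _ "(r * t, y')"]) auto
    qed
    have zC: "cball z e \<subseteq> C" unfolding C_def by (auto intro!: image_eqI[of _ _ "(1, _)"])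
    have bdd: "\<exists>M. \<forall>x\<in>C. norm (h x) \<le> M" if "continuous_on C h" for h :: "complex \<Rightarrow> complex"
      using compact_imp_bounded[OF compact_continuous_image[OF that \<open>compact C\<close>]] by (auto simp: bounded_iff)
    have contC: "continuous_on C h" if "h holomorphic_on S" for h
      using that CS holomorphic_on_imp_continuous_on continuous_on_subset by blast
    obtain Mp where Mp: "\<And>x. x \<in> C \<Longrightarrow> norm (p x) \<le> Mp" using bdd[OF contC[OF p]] by blast
    obtain Mq where Mq: "\<And>x. x \<in> C \<Longrightarrow> norm (q x) \<le> Mq" using bdd[OF contC[OF q]] by blast
    obtain A where A: "\<And>x. x \<in> C \<Longrightarrow> norm (w 0 x) \<le> A" using bdd[OF contC[OF whol]] by blast
    obtain R0 where R0: "\<And>x. x \<in> C \<Longrightarrow> norm (x - a) \<le> R0" 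
      using bdd[of "\<lambda>x. x - a"] continuous_on_diff[OF continuous_on_id continuous_on_const] by blast
    have zinC: "z \<in> C" using zC e(1) by auto
    define R where "R = max R0 1"
    have R: "R \<ge> 1" "\<And>x. x \<in> C \<Longrightarrow> norm (x - a) \<le> R" using R0 by (auto simp: R_def le_max_iff_disj)
    have pos: "Mp \<ge> 0" "Mq \<ge> 0" "A \<ge> 0"
      using Mp[OF zinC] Mq[OF zinC] A[OF zinC] norm_ge_zero order_trans by blast+
    \<comment> \<open>Growth factor of one round: \<open>p\<close> meets a double primitive,
      \<open>q\<close> a triple one. Of the powers gained, all but one are bounded by
      \<open>R\<close>, and only one step of the factorial is kept.\<close>
    define Q where "Q = Mp * R + Mq * R\<^sup>2"
    have Q: "Q \<ge> 0" using pos R(1) by (simp add: Q_def)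
    have wb: "norm (w k x) \<le> A * Q ^ k * norm (x - a) ^ k / fact k" and
      vb: "norm (K (K (w k)) x) \<le> A * Q ^ k * norm (x - a) ^ (k + 2) / fact (k + 2)" and
      ub: "norm (u (Suc k) x) \<le> A * Q ^ k * norm (x - a) ^ (k + 3) / fact (k + 3)" if "x \<in> C" for k x
    proof -
      have step: "norm (g x) \<le> A' * norm (x - a) ^ (j + 1) / fact (j + 1)"
        if x: "x \<in> C" and g: "\<And>z. z \<in> S \<Longrightarrow> (g has_field_derivative f z) (at z)" "g a = 0"
          and f: "\<And>y. y \<in> C \<Longrightarrow> norm (f y) \<le> A' * norm (y - a) ^ j / fact j" for g f A' j x
      proof (rule primitive_bound[where a = a and z = x and g = g and f = f and k = j and A = A'])
        fix y assume y: "y \<in> closed_segment a x"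
        show "(g has_field_derivative f y) (at y)" by (rule g(1)) (use y Cstar[OF x] CS in blast)
        show "norm (f y) \<le> A' * norm (y - a) ^ j / fact j" by (rule f) (use y Cstar[OF x] in blast)
      qed (rule g(2))
      have chain: "norm (K (K (w k)) x) \<le> A * Q ^ k * norm (x - a) ^ (k + 1 + 1) / fact (k + 1 + 1) \<and>
          norm (u (Suc k) x) \<le> A * Q ^ k * norm (x - a) ^ (k + 1 + 1 + 1) / fact (k + 1 + 1 + 1)"
        if wk: "\<And>y. y \<in> C \<Longrightarrow> norm (w k y) \<le> A * Q ^ k * norm (y - a) ^ k / fact k" and xC: "x \<in> C" for k x
      proof -
        note xx = x
        have x1: "norm (K (w k) y) \<le> A * Q ^ k * norm (y - a) ^ (k + 1) / fact (k + 1)" if "y \<in> C" for y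
          using that xx wk by (intro step[where f = "w k" and g = "K (w k)"]) auto
        have x2: "norm (K (K (w k)) y) \<le> A * Q ^ k * norm (y - a) ^ (k + 1 + 1) / fact (k + 1 + 1)" if "y \<in> C" for y
          using that v x1 by (intro step[where f = "K (w k)" and g = "K (K (w k))"]) auto
        have "norm (u (Suc k) x) \<le> A * Q ^ k * norm (x - a) ^ (k + 1 + 1 + 1) / fact (k + 1 + 1 + 1)"
          using xC us x2 by (intro step[where f = "K (K (w k))" and g = "u (Suc k)"]) auto
        thus ?thesis using x2[OF xC] by blast
      qed
      have w': "norm (w k y) \<le> A * Q ^ k * norm (y - a) ^ k / fact k" if "y \<in> C" for y k
        using that
      proof (induction k arbitrary: y)
        case 0
        thus ?case using A by simp
      next
        case (Suc k)
        define r where "r = norm (y - a)"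
        have r: "0 \<le> r" "r \<le> R" using R(2)[OF Suc.prems] by (simp_all add: r_def)
        define E where "E = A * Q ^ k * r ^ (k + 1) / fact (k + 1)"
        have E0: "E \<ge> 0" using pos Q r by (simp add: E_def)
        note ch = chain[OF Suc.IH Suc.prems]
        have f2: "(1 :: real) / fact (k + 1 + 1) \<le> 1 / fact (k + 1)" "(1 :: real) / fact (k + 1 + 1 + 1) \<le> 1 / fact (k + 1)"
          by (intro divide_left_mono fact_mono mult_pos_pos; simp)+
        have a2: "A * Q ^ k * r ^ (k + 1 + 1) / fact (k + 1 + 1) \<le> E * R"
        proof -
          have "A * Q ^ k * r ^ (k + 1 + 1) / fact (k + 1 + 1) = (A * Q ^ k * r ^ (k + 1)) * r * (1 / fact (k + 1 + 1))" by simp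
          also have "\<dots> \<le> (A * Q ^ k * r ^ (k + 1)) * R * (1 / fact (k + 1))"
            using pos Q r R f2(1) by (intro mult_mono) auto
          finally show ?thesis by (simp add: E_def mult_ac)
        qed
        have a3: "A * Q ^ k * r ^ (k + 1 + 1 + 1) / fact (k + 1 + 1 + 1) \<le> E * R\<^sup>2"
        proof -
          have "A * Q ^ k * r ^ (k + 1 + 1 + 1) / fact (k + 1 + 1 + 1) = (A * Q ^ k * r ^ (k + 1)) * r\<^sup>2 * (1 / fact (k + 1 + 1 + 1))"
            by (simp add: power2_eq_square)
          also have "\<dots> \<le> (A * Q ^ k * r ^ (k + 1)) * R\<^sup>2 * (1 / fact (k + 1))"
            using pos Q r R f2(2) by (intro mult_mono power_mono) auto
          finally show ?thesis by (simp add: E_def mult_ac)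
        qed
        have yS: "y \<in> S" using Suc.prems CS by blast
        have "norm (w (Suc k) y) \<le> norm (p y) * norm (K (K (w k)) y) + norm (q y) * norm (u (Suc k) y)"
          unfolding wSuc[OF yS] by (rule order_trans[OF norm_triangle_ineq]) (simp add: norm_mult)
        also have "\<dots> \<le> Mp * (E * R) + Mq * (E * R\<^sup>2)"
          using ch a2 a3 Mp[OF Suc.prems] Mq[OF Suc.prems] pos unfolding r_def[symmetric]
          by (intro add_mono mult_mono) auto
        also have "\<dots> = Q * E" by (simp add: Q_def algebra_simps)
        also have "\<dots> = A * Q ^ Suc k * r ^ Suc k / fact (Suc k)" by (simp add: E_def)
        finally show ?case unfolding r_def .
      qed
      show "norm (w k x) \<le> A * Q ^ k * norm (x - a) ^ k / fact k" by (rule w'[OF that])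
      show "norm (K (K (w k)) x) \<le> A * Q ^ k * norm (x - a) ^ (k + 2) / fact (k + 2)"
        "norm (u (Suc k) x) \<le> A * Q ^ k * norm (x - a) ^ (k + 3) / fact (k + 3)"
        using chain[OF w' that] by (simp_all add: numeral_2_eq_2 numeral_3_eq_3)
    qed
    have bound: "norm (u (Suc k) x) \<le> A * R ^ 3 * ((Q * R) ^ k / fact k)" if "x \<in> ball z e" for k x
    proof -
      have xC: "x \<in> C" using that zC by auto
      have "norm (u (Suc k) x) \<le> (A * Q ^ k) * norm (x - a) ^ (k + 3) * (1 / fact (k + 3))" using ub[OF xC, of k] by simp
      also have "\<dots> \<le> (A * Q ^ k) * R ^ (k + 3) * (1 / fact k)"
      proof -
        have "(1 :: real) / fact (k + 3) \<le> 1 / fact k" by (intro divide_left_mono fact_mono mult_pos_pos) simp_all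
        thus ?thesis using pos Q R(2)[OF xC] R(1) by (intro mult_mono power_mono) auto
      qed
      also have "\<dots> = A * R ^ 3 * ((Q * R) ^ k / fact k)" by (simp add: power_add power_mult_distrib)
      finally show ?thesis .
    qed
    have "summable (\<lambda>k. A * R ^ 3 * ((Q * R) ^ k / fact k))"
      by (intro summable_mult) (use summable_exp[of "Q * R"] in \<open>simp add: field_simps\<close>)
    hence "uniform_limit (ball z e) (\<lambda>N x. \<Sum>k<N. u (Suc k) x) (\<lambda>x. \<Sum>k. u (Suc k) x) sequentially"
      using bound by (intro Weierstrass_m_test)
    hence "uniform_limit (ball z e) s (\<lambda>z. u0 z + (\<Sum>k. u (Suc k) z)) sequentially"
      unfolding s_def[abs_def] by (intro uniform_limit_intros)
    moreover have "ball z e \<subseteq> S" using e(2) by auto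
    ultimately show ?thesis using e(1) by blast
  qed
  define y where "y z = u0 z + (\<Sum>k. u (Suc k) z)" for z
  have lim: "(\<lambda>N. (deriv ^^ m) (s N) z) \<longlonglongrightarrow> (deriv ^^ m) y z" "y field_differentiable at z" if z: "z \<in> S" for m z
  proof -
    obtain e where e: "e > 0" "ball z e \<subseteq> S" "uniform_limit (ball z e) s y sequentially"
      using ul[OF z] unfolding y_def[abs_def] by blast
    have h: "s N holomorphic_on ball z e" for N using shol e(2) holomorphic_on_subset by blast
    show "(\<lambda>N. (deriv ^^ m) (s N) z) \<longlonglongrightarrow> (deriv ^^ m) y z"
      by (rule higher_deriv_complex_uniform_limit[OF e(3)]) (use h e(1) in auto)
    have "y holomorphic_on ball z e"
    proof (rule holomorphic_uniform_sequence[OF open_ball h])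
      fix x assume "x \<in> ball z e"
      then obtain d where "d > 0" "cball x d \<subseteq> ball z e" using open_contains_cball[of "ball z e"] open_ball by blast
      thus "\<exists>d>0. cball x d \<subseteq> ball z e \<and> uniform_limit (cball x d) s y sequentially"
        using uniform_limit_on_subset[OF e(3)] by blast
    qed
    thus "y field_differentiable at z" using e(1) by (auto simp: holomorphic_on_open field_differentiable_def)
  qed
  have yhol: "y holomorphic_on S"
    using lim(2) by (auto simp: holomorphic_on_def intro: field_differentiable_at_within)
  show thesis
  proof (rule that[OF yhol])
    fix z assume z: "z \<in> S"
    have "(\<lambda>N. (deriv ^^ 3) (s (Suc N)) z) \<longlonglongrightarrow> (deriv ^^ 3) y z"
      using lim(1)[OF z] by (rule LIMSEQ_Suc)
    moreover have "(\<lambda>N. (deriv ^^ 3) (s (Suc N)) z) \<longlonglongrightarrow> p z * deriv y z + q z * y z"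
      unfolding s3[OF z] using lim(1)[OF z, of 0] lim(1)[OF z, of 1] by (intro tendsto_intros) simp_all
    ultimately show "(deriv ^^ 3) y z = p z * deriv y z + q z * y z" by (rule LIMSEQ_unique)
  next
    have "s N a = c0" "(deriv ^^ 1) (s N) a = c1" "(deriv ^^ 2) (s N) a = c2" for N
      using sd(1,2)[OF S(2), of N] us(2) v(2) x(2) by (simp_all add: s_def u0_def)
    hence "(deriv ^^ 0) y a = c0" "(deriv ^^ 1) y a = c1" "(deriv ^^ 2) y a = c2"
      using lim(1)[OF S(2), of 0] lim(1)[OF S(2), of 1] lim(1)[OF S(2), of 2]
      by (simp_all add: LIMSEQ_const_iff)
    thus "y a = c0" "deriv y a = c1" "deriv (deriv y) a = c2" by (simp_all add: numeral_2_eq_2)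
  qed
qed

text \<open>Gaussian elimination of one row with a pivot column. Rows and columns have arbitrary
  index sets because pole orders and exponents serve as indices later.\<close>

lemma homogeneous_system_nontrivial:
  fixes a :: "'i \<Rightarrow> 'j \<Rightarrow> 'a :: field"
  assumes "finite I" "finite J" "card I < card J"
  shows "\<exists>c. (\<exists>j\<in>J. c j \<noteq> 0) \<and> (\<forall>i\<in>I. (\<Sum>j\<in>J. a i j * c j) = 0)"
  using assms
proof (induction I arbitrary: J a rule: finite_induct)
  case empty
  hence "J \<noteq> {}" by auto
  thus ?case by (intro exI[of _ "\<lambda>_. 1"]) auto
next
  case (insert i0 I)
  show ?case
  proof (cases "\<forall>j\<in>J. a i0 j = 0")
    case True
    obtain c where "\<exists>j\<in>J. c j \<noteq> 0" "\<forall>i\<in>I. (\<Sum>j\<in>J. a i j * c j) = 0"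
      using insert.IH[of J a] insert.prems insert.hyps by auto
    thus ?thesis using True by (intro exI[of _ c]) auto
  next
    case False
    then obtain p where p: "p \<in> J" "a i0 p \<noteq> 0" by blast
    have "card I < card (J - {p})" using insert.prems insert.hyps p by (simp add: card_Diff_singleton)
    then obtain c where c: "\<exists>j\<in>J - {p}. c j \<noteq> 0"
      "\<forall>i\<in>I. (\<Sum>j\<in>J - {p}. (a i j - a i p * a i0 j / a i0 p) * c j) = 0"
      using insert.IH[of "J - {p}" "\<lambda>i j. a i j - a i p * a i0 j / a i0 p"] insert.prems by blast
    define S where "S i = (\<Sum>j\<in>J - {p}. a i j * c j)" for i
    define c' where "c' j = (if j = p then - S i0 / a i0 p else c j)" for j
    have s: "(\<Sum>j\<in>J. a i j * c' j) = S i - a i p * (S i0 / a i0 p)" for i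
    proof -
      have "(\<Sum>j\<in>J. a i j * c' j) = a i p * c' p + (\<Sum>j\<in>J - {p}. a i j * c' j)"
        by (rule sum.remove) (use insert.prems p in auto)
      also have "(\<Sum>j\<in>J - {p}. a i j * c' j) = S i" unfolding S_def by (rule sum.cong) (auto simp: c'_def)
      finally show ?thesis by (simp add: c'_def)
    qed
    have "S i - a i p * (S i0 / a i0 p) = 0" if "i \<in> I" for i
    proof -
      have "(\<Sum>j\<in>J - {p}. (a i j - a i p * a i0 j / a i0 p) * c j)
          = (\<Sum>j\<in>J - {p}. a i j * c j - a i p / a i0 p * (a i0 j * c j))"
        by (rule sum.cong) (simp_all add: left_diff_distrib)
      also have "\<dots> = S i - a i p / a i0 p * S i0" by (simp only: sum_subtractf sum_distrib_left[symmetric] S_def)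
      finally show ?thesis using c(2) that by simp
    qed
    moreover have "S i0 - a i0 p * (S i0 / a i0 p) = 0" using p by simp
    moreover have "\<exists>j\<in>J. c' j \<noteq> 0" using c(1) by (auto simp: c'_def)
    ultimately show ?thesis by (intro exI[of _ c']) (auto simp: s)
  qed
qed

lemma higher_deriv_sum_cmult:
  assumes "open S" "z \<in> S" "\<And>i. i \<in> I \<Longrightarrow> f i holomorphic_on S"
  shows "(deriv ^^ j) (\<lambda>w. \<Sum>i\<in>I. c i * f i w) z = (\<Sum>i\<in>I. c i * (deriv ^^ j) (f i) z)"
  using assms(3)
proof (induction I rule: infinite_finite_induct)
  case (insert k I)
  have "(deriv ^^ j) (\<lambda>w. c k * f k w + (\<Sum>i\<in>I. c i * f i w)) z
      = (deriv ^^ j) (\<lambda>w. c k * f k w) z + (deriv ^^ j) (\<lambda>w. \<Sum>i\<in>I. c i * f i w) z"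
    by (rule higher_deriv_add[OF _ _ assms(1,2)]) (intro holomorphic_intros insert.prems, simp_all)+
  also have "(deriv ^^ j) (\<lambda>w. c k * f k w) z = c k * (deriv ^^ j) (f k) z"
    by (rule higher_deriv_cmult[OF _ assms(2,1)]) (use insert.prems in auto)
  finally show ?case using insert by simp
qed simp_all

lemma open_slit_ball: "open (ball 0 r - \<real>\<^sub>\<le>\<^sub>0 :: complex set)"
  using closed_nonpos_Reals_complex by (intro open_Diff) auto

lemma of_real_in_slit_ball: "0 < x \<Longrightarrow> x < r \<Longrightarrow> of_real x \<in> ball 0 r - (\<real>\<^sub>\<le>\<^sub>0 :: complex set)"
  by (auto simp: complex_nonpos_Reals_iff)

lemma slit_ball_star:
  assumes "0 < x" "x < r" "z \<in> ball 0 r - (\<real>\<^sub>\<le>\<^sub>0 :: complex set)"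
  shows "closed_segment (of_real x) z \<subseteq> ball 0 r - \<real>\<^sub>\<le>\<^sub>0"
proof
  fix w assume w: "w \<in> closed_segment (of_real x) z"
  have "closed_segment (of_real x) z \<subseteq> ball 0 r"
    by (rule closed_segment_subset) (use assms in auto)
  moreover have "w \<notin> \<real>\<^sub>\<le>\<^sub>0"
  proof
    assume a: "w \<in> \<real>\<^sub>\<le>\<^sub>0"
    obtain t where t: "0 \<le> t" "t \<le> 1" "w = (1 - t) *\<^sub>R of_real x + t *\<^sub>R z" using w by (auto simp: closed_segment_def)
    have i: "t * Im z = 0" "(1 - t) * x + t * Re z \<le> 0"
      using a by (simp_all add: t complex_nonpos_Reals_iff)
    have nz: "\<not> (Re z \<le> 0 \<and> Im z = 0)" using assms(3) by (simp add: complex_nonpos_Reals_iff)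
    show False
    proof (cases "t = 0")
      case True
      thus False using i assms(1) by simp
    next
      case False
      hence "Im z = 0" "t > 0" using i t by auto
      hence "t * Re z > 0" "(1 - t) * x \<ge> 0" using nz t assms(1) by auto
      thus False using i by linarith
    qed
  qed
  ultimately show "w \<in> ball 0 r - \<real>\<^sub>\<le>\<^sub>0" using w by blast
qed

lemma connected_slit_ball: "r > 0 \<Longrightarrow> connected (ball 0 r - (\<real>\<^sub>\<le>\<^sub>0 :: complex set))"
proof (rule starlike_imp_connected)
  assume r: "r > 0"
  have "\<forall>z\<in>ball 0 r - \<real>\<^sub>\<le>\<^sub>0. closed_segment (of_real (r / 2)) z \<subseteq> ball 0 r - (\<real>\<^sub>\<le>\<^sub>0 :: complex set)"
    using r by (intro ballI slit_ball_star) auto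
  moreover have "of_real (r / 2) \<in> ball 0 r - (\<real>\<^sub>\<le>\<^sub>0 :: complex set)" by (rule of_real_in_slit_ball) (use r in auto)
  ultimately show "starlike (ball 0 r - (\<real>\<^sub>\<le>\<^sub>0 :: complex set))" unfolding starlike_def by blast
qed

text \<open>The slit disc is not a punctured neighbourhood of the origin, but it contains a positive
  interval, and an identity along that interval already determines a Laurent expansion.\<close>

lemma frequently_at_0I_positive:
  assumes "d > 0" "\<And>x. 0 < x \<Longrightarrow> x < d \<Longrightarrow> P (complex_of_real x)"
  shows "\<exists>\<^sub>F z in at 0. P z"
  unfolding frequently_def eventually_at
proof
  assume "\<exists>e>0. \<forall>z\<in>UNIV. z \<noteq> 0 \<and> dist z 0 < e \<longrightarrow> \<not> P z"
  then obtain e where e: "e > 0" "\<And>z. z \<noteq> 0 \<Longrightarrow> dist z 0 < e \<Longrightarrow> \<not> P z" by blast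
  have "\<not> P (of_real (min d e / 2))" using e(1) assms(1) by (intro e(2)) auto
  moreover have "P (of_real (min d e / 2))" using e(1) assms(1) by (intro assms(2)) auto
  ultimately show False by blast
qed

section \<open>From apparentness to a root of the polynomial\<close>

context weierstrass_lattice
begin

lemma Dop_laurent:
  assumes "y has_laurent_expansion Y"
  shows "(\<lambda>z. deriv (deriv (deriv y)) z - (alpha n l * wp \<tau> z + B) * deriv y z + beta n l * deriv (wp \<tau>) z * y z)
    has_laurent_expansion Dop n l B (wpF wu wv) Y"
  unfolding Dop_def by (intro laurent_expansion_intros wp_laurent' assms)

lemma Dop_eq_0:
  assumes y: "y has_laurent_expansion Y" and S: "solution_on \<tau> n l B S y" "d > 0" "\<And>x. 0 < x \<Longrightarrow> x < d \<Longrightarrow> complex_of_real x \<in> S"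
  shows "Dop n l B (wpF wu wv) Y = 0"
proof -
  have "\<exists>\<^sub>F z in at 0. deriv (deriv (deriv y)) z - (alpha n l * wp \<tau> z + B) * deriv y z + beta n l * deriv (wp \<tau>) z * y z = 0"
    using S(1) by (intro frequently_at_0I_positive[OF S(2)]) (auto simp: solution_on_iff S(3))
  moreover have "(\<lambda>w. deriv (deriv (deriv y)) (0 + w) - (alpha n l * wp \<tau> (0 + w) + B) * deriv y (0 + w) + beta n l * deriv (wp \<tau>) (0 + w) * y (0 + w))
      has_laurent_expansion Dop n l B (wpF wu wv) Y" using Dop_laurent[OF y] by simp
  from has_laurent_expansion_frequently_zero_iff[OF this] calculation show ?thesis by blast
qed

lemma slit_ball_subset:
  assumes "ball 0 r \<inter> L = {0}"
  shows "ball 0 r - \<real>\<^sub>\<le>\<^sub>0 \<subseteq> - L"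
proof
  fix z assume z: "z \<in> ball 0 r - (\<real>\<^sub>\<le>\<^sub>0 :: complex set)"
  hence "z \<noteq> 0" by auto
  thus "z \<in> - L" using z assms by blast
qed

text \<open>The three solutions with unit initial values are meromorphic. If none of them had a term
  at \<open>- n - l\<close>, the two remaining exponents would impose only two conditions on a
  combination of three, and a nontrivial combination would vanish. So some solution starts at
  \<open>- n - l\<close>, and the resonance condition applies to it.\<close>

lemma apparent_imp_root:
  assumes "apparent \<tau> n l B" "odd n"
  shows "poly (frobP n l wu wv) B = 0"
proof -
  obtain r where r: "r > 0" "ball 0 r \<inter> L = {0}" and
    ap: "\<And>y. solution_on \<tau> n l B (ball 0 r - \<real>\<^sub>\<le>\<^sub>0) y \<Longrightarrow> \<exists>f. f meromorphic_on ball 0 r \<and> (\<forall>z\<in>ball 0 r - \<real>\<^sub>\<le>\<^sub>0. f z = y z)"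
    using assms(1) unfolding apparent_def by blast
  define S where "S = ball 0 r - (\<real>\<^sub>\<le>\<^sub>0 :: complex set)"
  define a where "a = complex_of_real (r / 2)"
  have S: "open S" "connected S" "a \<in> S" unfolding S_def a_def
    by (rule open_slit_ball, rule connected_slit_ball[OF r(1)], rule of_real_in_slit_ball) (use r in auto)
  have SL: "S \<subseteq> - L" unfolding S_def by (rule slit_ball_subset[OF r(2)])
  have hw: "wp \<tau> holomorphic_on S" using wp_holomorphic SL by (rule holomorphic_on_subset)
  have star: "closed_segment a z \<subseteq> S" if "z \<in> S" for z
    using that unfolding S_def a_def by (intro slit_ball_star) (use r in auto)
  have "\<exists>y. solution_on \<tau> n l B S y \<and> (\<forall>j<3. (deriv ^^ j) y a = (if j = i then 1 else 0))" for i
  proof -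
    have "(\<lambda>z. alpha n l * wp \<tau> z + B) holomorphic_on S" "(\<lambda>z. - (beta n l * deriv (wp \<tau>) z)) holomorphic_on S"
      using hw S(1) by (auto intro!: holomorphic_intros holomorphic_deriv)
    from linear_ode3_exists[OF S(1,3) star this, of "if 0 = i then 1 else 0" "if 1 = i then 1 else 0" "if 2 = i then 1 else 0"]
    obtain y where y: "y holomorphic_on S"
      "\<And>z. z \<in> S \<Longrightarrow> (deriv ^^ 3) y z = (alpha n l * wp \<tau> z + B) * deriv y z + - (beta n l * deriv (wp \<tau>) z) * y z"
      "y a = (if 0 = i then 1 else 0)" "deriv y a = (if 1 = i then 1 else 0)" "deriv (deriv y) a = (if 2 = i then 1 else 0)"
      by blast
    have "solution_on \<tau> n l B S y" unfolding solution_on_iff using y(1,2) by (simp add: numeral_3_eq_3)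
    moreover have "(deriv ^^ j) y a = (if j = i then 1 else 0)" if "j < 3" for j
    proof -
      have "j = 0 \<or> j = 1 \<or> j = 2" using that by linarith
      thus ?thesis using y(3-5) by (elim disjE) (simp_all add: numeral_2_eq_2)
    qed
    ultimately show ?thesis by blast
  qed
  then obtain y where y: "\<And>i. solution_on \<tau> n l B S (y i)" "\<And>i j. j < 3 \<Longrightarrow> (deriv ^^ j) (y i) a = (if j = i then 1 else 0)" by metis
  have "\<exists>f. f meromorphic_on ball 0 r \<and> (\<forall>z\<in>S. f z = y i z)" for i
    using ap[of "y i"] y(1)[of i] unfolding S_def by blast
  then obtain f where f: "\<And>i. f i meromorphic_on ball 0 r" "\<And>i z. z \<in> S \<Longrightarrow> f i z = y i z" by metis
  define F where "F i = laurent_expansion (f i) 0" for i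
  have F: "f i has_laurent_expansion F i" for i
  proof -
    have "0 \<in> ball (0 :: complex) r" using r by simp
    hence "(\<lambda>w. f i (0 + w)) has_laurent_expansion laurent_expansion (f i) 0"
      using f(1)[of i] unfolding meromorphic_on_def' by blast
    thus ?thesis by (simp add: F_def)
  qed
  have Sp: "complex_of_real x \<in> S" if "0 < x" "x < r" for x
    unfolding S_def by (rule of_real_in_slit_ball[OF that])
  have fs: "solution_on \<tau> n l B S (f i)" for i
    by (rule solution_on_cong[OF S(1) _ y(1)[of i]]) (use f(2) in auto)
  have D: "Dop n l B (wpF wu wv) (F i) = 0" for i
    by (rule Dop_eq_0[OF F fs r(1) Sp])
  \<comment> \<open>A vanishing combination of expansions vanishes near the origin, hence on the
    slit disc, and the unit initial values at \<open>a\<close> recover its coefficients.\<close>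
  have indep: "c i = 0" if c0: "(\<Sum>i<3. fls_const (c i) * F i) = 0" and i: "i < 3" for c :: "nat \<Rightarrow> complex" and i
  proof -
    define g where "g z = (\<Sum>i<3. c i * f i z)" for z
    have "g has_laurent_expansion (\<Sum>i<3. fls_const (c i) * F i)"
      unfolding g_def[abs_def] by (intro laurent_expansion_intros F)
    hence "\<forall>\<^sub>F z in at 0. g z = 0" using c0 has_laurent_expansion_eventually_zero_iff[of g 0 0] by simp
    then obtain d where d: "d > 0" "\<And>z. z \<noteq> 0 \<Longrightarrow> dist z 0 < d \<Longrightarrow> g z = 0" unfolding eventually_at by blast
    have hf: "f i holomorphic_on S" for i using fs[of i] by (simp add: solution_on_iff)
    have hg: "g holomorphic_on S" unfolding g_def[abs_def] by (intro holomorphic_intros hf)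
    have g0: "g z = 0" if "z \<in> S" for z
    proof (rule analytic_continuation_open[of "S \<inter> ball 0 d" S g "\<lambda>_. 0"])
      have "complex_of_real (min d r / 2) \<in> S \<inter> ball 0 d" using Sp[of "min d r / 2"] d(1) r(1) by auto
      thus "S \<inter> ball 0 d \<noteq> {}" by blast
      show "g w = 0" if "w \<in> S \<inter> ball 0 d" for w
        using that by (intro d(2)) (auto simp: S_def)
    qed (use S that hg in auto)
    have "(deriv ^^ i) g a = (deriv ^^ i) (\<lambda>_. 0) a"
      by (rule higher_deriv_cong_ev) (use eventually_nhds_in_open[OF S(1,3)] g0 in \<open>auto elim: eventually_mono\<close>)
    also have "\<dots> = 0" by simp
    finally have "0 = (\<Sum>k<3. c k * (deriv ^^ i) (f k) a)"
      unfolding g_def[abs_def] by (subst (asm) higher_deriv_sum_cmult[OF S(1,3) hf]) simp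
    also have "(deriv ^^ i) (f k) a = (if i = k then 1 else 0)" for k
    proof -
      have "(deriv ^^ i) (f k) a = (deriv ^^ i) (y k) a"
        by (rule higher_deriv_cong_ev) (use eventually_nhds_in_open[OF S(1,3)] f(2) in \<open>auto elim: eventually_mono\<close>)
      thus ?thesis using y(2)[OF i] by simp
    qed
    hence "(\<Sum>k<3. c k * (deriv ^^ i) (f k) a) = (\<Sum>k<3. if k = i then c k else 0)"
      by (intro sum.cong) auto
    also have "\<dots> = c i" using i by simp
    finally show ?thesis by simp
  qed
  have "\<exists>i<3. F i $$ (- int (n + l)) \<noteq> 0"
  proof (rule ccontr)
    assume "\<not> ?thesis"
    hence z: "F i $$ (- int (n + l)) = 0" if "i < 3" for i using that by blast
    define e where "e k = (if k = 0 then 1 - int l else int (n + 2 * l + 2))" for k :: nat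
    obtain c where c: "\<exists>j\<in>{..<3 :: nat}. c j \<noteq> 0" "\<forall>k\<in>{..<2 :: nat}. (\<Sum>j<3. F j $$ e k * c j) = 0"
      using homogeneous_system_nontrivial[of "{..<2 :: nat}" "{..<3 :: nat}" "\<lambda>k j. F j $$ e k"] by auto
    define G where "G = (\<Sum>i<3. fls_const (c i) * F i)"
    have "Dop n l B (wpF wu wv) G = 0" unfolding G_def Dop_sum D by simp
    note G = solution_eq_0I[OF this]
    have Gk: "G $$ k = (\<Sum>i<3. F i $$ k * c i)" for k
      by (simp add: G_def fls_nth_sum mult.commute)
    have "G $$ (- int (n + l)) = 0" unfolding Gk by (rule sum.neutral) (use z in simp)
    moreover have "G $$ (1 - int l) = 0" using bspec[OF c(2), of 0] by (simp add: Gk e_def)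
    moreover have "G $$ int (n + 2 * l + 2) = 0" using bspec[OF c(2), of 1] by (simp add: Gk e_def)
    ultimately have "G = 0" by (rule G)
    thus False using indep[of c] c(1) unfolding G_def by blast
  qed
  then obtain i where i: "F i $$ (- int (n + l)) \<noteq> 0" by blast
  have "F i \<noteq> 0" using i by auto
  from exponent_of_solution[OF D this]
  have "fls_subdegree (F i) = - int (n + l) \<or> fls_subdegree (F i) = 1 - int l \<or> fls_subdegree (F i) = int (n + 2 * l + 2)"
    by blast
  hence "fls_subdegree (F i) \<ge> - int (n + l)" by linarith
  hence "\<forall>k < - int (n + l). F i $$ k = 0" using fls_zero_below_subdegree[of _ "F i"] by force
  thus ?thesis by (rule frobenius_necessary[OF _ i refl assms(2) D])
qed

end

section \<open>Quasi-periodic solutions\<close>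

lemma laurent_parity:
  assumes f: "f has_laurent_expansion F" and par: "\<forall>\<^sub>F z in at 0. f (- z) = (-1) ^ m * f z"
    and k: "odd (k + int m)"
  shows "F $$ k = 0"
proof -
  have X: "fps_to_fls (fps_const (- 1) * fps_X) = - (fls_X :: complex fls)"
    by (simp add: fls_times_fps_to_fls)
  have "(uminus :: complex \<Rightarrow> complex) has_laurent_expansion fps_to_fls (fps_const (- 1) * fps_X)"
    unfolding X using has_laurent_expansion_minus[OF has_laurent_expansion_fps_X] by simp
  from has_laurent_expansion_compose[OF f this]
  have "(f \<circ> uminus) has_laurent_expansion fls_compose_fps F (fps_const (- 1) * fps_X)" by simp
  moreover have "(f \<circ> uminus) has_laurent_expansion fls_const ((- 1) ^ m) * F \<longleftrightarrow>
      (\<lambda>z. (- 1) ^ m * f z) has_laurent_expansion fls_const ((- 1) ^ m) * F"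
    by (rule has_laurent_expansion_cong) (use par in simp_all)
  moreover have "(\<lambda>z. (- 1) ^ m * f z) has_laurent_expansion fls_const ((- 1) ^ m) * F"
    by (intro laurent_expansion_intros f)
  ultimately have "fls_compose_fps F (fps_const (- 1) * fps_X) = fls_const ((- 1) ^ m) * F"
    using has_laurent_expansion_unique by blast
  hence "fls_compose_fps F (fps_const (- 1) * fps_X) $$ k = (fls_const ((- 1) ^ m) * F) $$ k" by (rule arg_cong)
  hence "F $$ k * (- 1) powi k = (- 1) ^ m * F $$ k"
    by (subst (asm) fls_nth_fls_compose_fps_linear) simp_all
  moreover have "(- 1 :: complex) powi k = (if even k then 1 else - 1)" by (simp add: power_int_minus_left)
  moreover have "(- 1 :: complex) ^ m = (if even m then 1 else - 1)" by simp
  ultimately show ?thesis using k by (auto split: if_splits)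
qed

text \<open>\<open>a\<close> and \<open>b\<close> are the multipliers for the two periods,
  \<open>e\<close> is the parity. One expansion at the origin suffices because the periods carry it
  to all lattice points.\<close>

definition quasi_elliptic :: "complex \<Rightarrow> complex \<Rightarrow> complex \<Rightarrow> complex \<Rightarrow> (complex \<Rightarrow> complex) \<Rightarrow> complex fls \<Rightarrow> bool" where
  "quasi_elliptic \<tau> a b e y Y \<longleftrightarrow> y holomorphic_on - lattice \<tau> \<and> y has_laurent_expansion Y \<and>
     (\<forall>z. z \<notin> lattice \<tau> \<longrightarrow> y (- z) = e * y z \<and> y (z + 1) = a * y z \<and> y (z + \<tau>) = b * y z)"

text \<open>Only the negative coefficients and the one at \<open>- p\<close> are fixed. For
  \<open>p = 0\<close> this means no pole and constant term 1, which admits the constant function as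
  a member of the family.\<close>

definition pole_form :: "nat \<Rightarrow> complex fls \<Rightarrow> bool" where
  "pole_form p F \<longleftrightarrow> F $$ (- int p) = 1 \<and> (\<forall>k<0. k \<noteq> - int p \<longrightarrow> F $$ k = 0)"

text \<open>The factor \<open>- 1 / p\<close> normalises the leading coefficient, and no simple pole
  arises because a derivative has no residue.\<close>

lemma pole_form_deriv:
  assumes "pole_form p F" "p > 0"
  shows "pole_form (Suc p) (fls_const (- 1 / of_nat p) * fls_deriv F)"
  unfolding pole_form_def
proof (intro conjI allI impI)
  have "fls_deriv F $$ (- int (Suc p)) = of_int (- int p) * F $$ (- int p)" by (simp add: fls_deriv_nth)
  thus "(fls_const (- 1 / of_nat p) * fls_deriv F) $$ (- int (Suc p)) = 1"
    using assms by (simp add: pole_form_def)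
next
  fix k :: int assume k: "k < 0" "k \<noteq> - int (Suc p)"
  have "k = - 1 \<or> F $$ (k + 1) = 0" 
  proof (cases "k = - 1")
    case False
    hence "k + 1 < 0" "k + 1 \<noteq> - int p" using k by linarith+
    thus ?thesis using assms(1) by (simp add: pole_form_def)
  qed simp
  thus "(fls_const (- 1 / of_nat p) * fls_deriv F) $$ k = 0" by (auto simp: fls_deriv_nth)
qed

context weierstrass_lattice
begin

lemma eventually_not_lattice: "\<forall>\<^sub>F z in at 0. z \<notin> L"
proof -
  have "\<forall>\<^sub>F z in at 0. z \<in> - L \<union> {0}"
    using open_compl_lattice_Un[of 0] by (intro eventually_at_in_open') auto
  moreover have "\<forall>\<^sub>F z in at 0. z \<noteq> (0 :: complex)" by (simp add: eventually_at_filter)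
  ultimately show ?thesis by eventually_elim auto
qed

lemma quasi_parity:
  assumes "quasi_elliptic \<tau> a b ((-1) ^ m) y Y" "odd (k + int m)"
  shows "Y $$ k = 0"
proof (rule laurent_parity[OF _ _ assms(2)])
  show "y has_laurent_expansion Y" using assms(1) by (simp add: quasi_elliptic_def)
  show "\<forall>\<^sub>F z in at 0. y (- z) = (- 1) ^ m * y z"
    using eventually_not_lattice by eventually_elim (use assms(1) in \<open>simp add: quasi_elliptic_def\<close>)
qed

lemma quasi_sum:
  assumes "\<And>j. j \<in> J \<Longrightarrow> quasi_elliptic \<tau> a b e (u j) (U j)"
  shows "quasi_elliptic \<tau> a b e (\<lambda>z. \<Sum>j\<in>J. c j * u j z) (\<Sum>j\<in>J. fls_const (c j) * U j)"
proof -
  have h: "u j holomorphic_on - L" "u j has_laurent_expansion U j"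
    "\<And>z. z \<notin> L \<Longrightarrow> u j (- z) = e * u j z \<and> u j (z + 1) = a * u j z \<and> u j (z + \<tau>) = b * u j z" if "j \<in> J" for j
    using assms[OF that] by (simp_all add: quasi_elliptic_def)
  show ?thesis unfolding quasi_elliptic_def
  proof (intro conjI allI impI)
    show "(\<lambda>z. \<Sum>j\<in>J. c j * u j z) holomorphic_on - L" by (intro holomorphic_intros h)
    show "(\<lambda>z. \<Sum>j\<in>J. c j * u j z) has_laurent_expansion (\<Sum>j\<in>J. fls_const (c j) * U j)"
      by (intro laurent_expansion_intros h)
    fix z assume z: "z \<notin> L"
    show "(\<Sum>j\<in>J. c j * u j (- z)) = e * (\<Sum>j\<in>J. c j * u j z)"
      "(\<Sum>j\<in>J. c j * u j (z + 1)) = a * (\<Sum>j\<in>J. c j * u j z)"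
      "(\<Sum>j\<in>J. c j * u j (z + \<tau>)) = b * (\<Sum>j\<in>J. c j * u j z)"
      unfolding sum_distrib_left by (rule sum.cong; use h(3)[OF _ z] in simp)+
  qed
qed

lemma quasi_cmult:
  assumes "quasi_elliptic \<tau> a b e u U"
  shows "quasi_elliptic \<tau> a b e (\<lambda>z. c * u z) (fls_const c * U)"
  using quasi_sum[of "{()}" a b e "\<lambda>_. u" "\<lambda>_. U" "\<lambda>_. c"] assms by simp

lemma deriv_uminus:
  assumes hol: "f holomorphic_on - L" and par: "\<And>z. z \<notin> L \<Longrightarrow> f (- z) = e * f z" and z: "z \<notin> L"
  shows "deriv f (- z) = - e * deriv f z"
proof -
  have d: "(f has_field_derivative deriv f z) (at z)" if "z \<notin> L" for z
    using hol that by (intro holomorphic_derivI[of f "- L"]) auto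
  have "((\<lambda>z. f (- z)) has_field_derivative deriv f (- z) * (- 1)) (at z)"
    by (rule DERIV_chain'[where f = uminus and g = f]) (use d z in \<open>auto intro!: derivative_eq_intros\<close>)
  moreover have "((\<lambda>z. f (- z)) has_field_derivative e * deriv f z) (at z)"
  proof (rule DERIV_cong_ev[THEN iffD2, OF refl _ refl DERIV_cmult[OF d[OF z]]])
    have "\<forall>\<^sub>F x in nhds z. x \<in> - L" by (rule eventually_nhds_in_open) (use z in auto)
    thus "\<forall>\<^sub>F x in nhds z. f (- x) = e * f x" by eventually_elim (use par in auto)
  qed
  ultimately have "deriv f (- z) * (- 1) = e * deriv f z" by (rule DERIV_unique)
  hence "- (deriv f (- z) * (- 1)) = - (e * deriv f z)" by (rule arg_cong)
  thus ?thesis by simp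
qed

lemma quasi_deriv:
  assumes "quasi_elliptic \<tau> a b e y Y"
  shows "quasi_elliptic \<tau> a b (- e) (deriv y) (fls_deriv Y)"
proof -
  have h: "y holomorphic_on - L" "y has_laurent_expansion Y"
    "\<And>z. z \<notin> L \<Longrightarrow> y (- z) = e * y z" "\<And>z. z \<notin> L \<Longrightarrow> y (z + 1) = a * y z" "\<And>z. z \<notin> L \<Longrightarrow> y (z + \<tau>) = b * y z"
    using assms by (simp_all add: quasi_elliptic_def)
  show ?thesis unfolding quasi_elliptic_def
    using holomorphic_deriv[OF h(1)] has_laurent_expansion_deriv[OF h(2)] deriv_uminus[OF h(1,3)]
      deriv_shift[OF h(1) _ h(4)] deriv_shift[OF h(1) _ h(5)] by simp
qed

lemma quasi_wp: "quasi_elliptic \<tau> 1 1 1 (wp \<tau>) (wpF wu wv)"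
  using wp_holomorphic wp_laurent' wp_uminus wp_1 wp_tau by (simp add: quasi_elliptic_def)

lemma quasi_Dop:
  assumes "quasi_elliptic \<tau> a b e y Y"
  shows "quasi_elliptic \<tau> a b (- e)
    (\<lambda>z. deriv (deriv (deriv y)) z - (alpha n l * wp \<tau> z + B) * deriv y z + beta n l * deriv (wp \<tau>) z * y z)
    (Dop n l B (wpF wu wv) Y)"
proof -
  note q = assms quasi_deriv[OF assms] quasi_deriv[OF quasi_deriv[OF quasi_deriv[OF assms]]] quasi_wp quasi_deriv[OF quasi_wp]
  have eqs: "deriv y (- z) = - e * deriv y z" "deriv (deriv (deriv y)) (- z) = - e * deriv (deriv (deriv y)) z"
    "wp \<tau> (- z) = wp \<tau> z" "deriv (wp \<tau>) (- z) = - deriv (wp \<tau>) z" "y (- z) = e * y z"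
    "deriv y (z + 1) = a * deriv y z" "deriv (deriv (deriv y)) (z + 1) = a * deriv (deriv (deriv y)) z"
    "wp \<tau> (z + 1) = wp \<tau> z" "deriv (wp \<tau>) (z + 1) = deriv (wp \<tau>) z" "y (z + 1) = a * y z"
    "deriv y (z + \<tau>) = b * deriv y z" "deriv (deriv (deriv y)) (z + \<tau>) = b * deriv (deriv (deriv y)) z"
    "wp \<tau> (z + \<tau>) = wp \<tau> z" "deriv (wp \<tau>) (z + \<tau>) = deriv (wp \<tau>) z" "y (z + \<tau>) = b * y z" if "z \<notin> L" for z
    using q that by (simp_all add: quasi_elliptic_def)
  have hol: "y holomorphic_on - L" "deriv y holomorphic_on - L" "deriv (deriv (deriv y)) holomorphic_on - L"
    "wp \<tau> holomorphic_on - L" "deriv (wp \<tau>) holomorphic_on - L" "y has_laurent_expansion Y"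
    using q by (simp_all add: quasi_elliptic_def)
  show ?thesis unfolding quasi_elliptic_def
  proof (intro conjI allI impI)
    show "(\<lambda>z. deriv (deriv (deriv y)) z - (alpha n l * wp \<tau> z + B) * deriv y z + beta n l * deriv (wp \<tau>) z * y z) holomorphic_on - L"
      by (intro holomorphic_intros hol)
    show "(\<lambda>z. deriv (deriv (deriv y)) z - (alpha n l * wp \<tau> z + B) * deriv y z + beta n l * deriv (wp \<tau>) z * y z)
        has_laurent_expansion Dop n l B (wpF wu wv) Y"
      by (rule Dop_laurent[OF hol(6)])
  next
    fix z assume "z \<notin> L"
    note e = eqs[OF this]
    show "deriv (deriv (deriv y)) (- z) - (alpha n l * wp \<tau> (- z) + B) * deriv y (- z) + beta n l * deriv (wp \<tau>) (- z) * y (- z)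
      = - e * (deriv (deriv (deriv y)) z - (alpha n l * wp \<tau> z + B) * deriv y z + beta n l * deriv (wp \<tau>) z * y z)"
      unfolding e by (simp add: algebra_simps)
    show "deriv (deriv (deriv y)) (z + 1) - (alpha n l * wp \<tau> (z + 1) + B) * deriv y (z + 1) + beta n l * deriv (wp \<tau>) (z + 1) * y (z + 1)
      = a * (deriv (deriv (deriv y)) z - (alpha n l * wp \<tau> z + B) * deriv y z + beta n l * deriv (wp \<tau>) z * y z)"
      unfolding e by (simp add: algebra_simps)
    show "deriv (deriv (deriv y)) (z + \<tau>) - (alpha n l * wp \<tau> (z + \<tau>) + B) * deriv y (z + \<tau>) + beta n l * deriv (wp \<tau>) (z + \<tau>) * y (z + \<tau>)
      = b * (deriv (deriv (deriv y)) z - (alpha n l * wp \<tau> z + B) * deriv y z + beta n l * deriv (wp \<tau>) z * y z)"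
      unfolding e by (simp add: algebra_simps)
  qed
qed

text \<open>Meromorphy at an arbitrary lattice point needs a multiplier for every lattice vector,
  while \<open>quasi_elliptic\<close> records those of the two generators only.\<close>

lemma quasi_lattice_shift:
  assumes q: "quasi_elliptic \<tau> a b e y Y" and ab: "a \<noteq> 0" "b \<noteq> 0" and w: "w \<in> L"
  shows "\<exists>c. \<forall>z. z \<notin> L \<longrightarrow> y (z + w) = c * y z"
proof -
  define W where "W w \<longleftrightarrow> (\<exists>c. \<forall>z. z \<notin> L \<longrightarrow> y (z + w) = c * y z)" for w
  have add: "W (v + w)" if vw: "W v" "W w" and v: "v \<in> L" for v w
  proof -
    obtain c d where c: "\<And>z. z \<notin> L \<Longrightarrow> y (z + v) = c * y z" and d: "\<And>z. z \<notin> L \<Longrightarrow> y (z + w) = d * y z"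
      using vw unfolding W_def by metis
    have "y (z + (v + w)) = (d * c) * y z" if "z \<notin> L" for z
      using d[of "z + v"] c[OF that] that v by (simp add: add.assoc)
    thus ?thesis unfolding W_def by blast
  qed
  have mult: "W (of_int k * v)" if "v \<in> L" "e0 \<noteq> 0" "\<And>z. z \<notin> L \<Longrightarrow> y (z + v) = e0 * y z" for k v e0
  proof -
    have 1: "W v" using that(3) unfolding W_def by blast
    have "y (z + (- v)) = (1 / e0) * y z" if "z \<notin> L" for z
    proof -
      have "z - v \<notin> L" using that \<open>v \<in> L\<close> lattice_add[of "z - v" v] by auto
      thus ?thesis using \<open>e0 \<noteq> 0\<close> \<open>\<And>z. z \<notin> L \<Longrightarrow> y (z + v) = e0 * y z\<close>[of "z - v"] by simp
    qed
    hence 2: "W (- v)" unfolding W_def by blast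
    show ?thesis
    proof (induction k rule: int_induct[where k = 0])
      case base
      have "\<forall>z. z \<notin> L \<longrightarrow> y (z + of_int 0 * v) = 1 * y z" by simp
      thus ?case unfolding W_def by blast
    next
      case (step1 i)
      have "W (v + of_int i * v)" by (rule add[OF 1 step1(2) that(1)])
      thus ?case by (simp add: algebra_simps)
    next
      case (step2 i)
      have "W (- v + of_int i * v)" by (rule add[OF 2 step2(2)]) (use that(1) in simp)
      thus ?case by (simp add: algebra_simps)
    qed
  qed
  obtain i j where ij: "w = of_int i + of_int j * \<tau>" using w unfolding lattice_def by blast
  have "W (of_int i * 1 + of_int j * \<tau>)"
    by (rule add[OF mult[of 1 a] mult[of \<tau> b]]) (use q ab lattice_of_int[of i 0] in \<open>auto simp: quasi_elliptic_def\<close>)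
  thus ?thesis unfolding W_def ij by simp
qed

lemma quasi_meromorphic:
  assumes q: "quasi_elliptic \<tau> a b e y Y" and ab: "a \<noteq> 0" "b \<noteq> 0"
  shows "y meromorphic_on UNIV"
proof -
  have "y meromorphic_on {w}" for w
  proof (cases "w \<in> L")
    case True
    obtain c where c: "\<And>z. z \<notin> L \<Longrightarrow> y (z + w) = c * y z" using quasi_lattice_shift[OF q ab True] by blast
    have "(\<lambda>z. c * y z) has_laurent_expansion fls_const c * Y"
      using q by (intro laurent_expansion_intros) (simp add: quasi_elliptic_def)
    moreover have "(\<lambda>z. y (w + z)) has_laurent_expansion fls_const c * Y \<longleftrightarrow> (\<lambda>z. c * y z) has_laurent_expansion fls_const c * Y"
    proof (rule has_laurent_expansion_cong)
      show "\<forall>\<^sub>F z in at 0. y (w + z) = c * y z"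
        using eventually_not_lattice by eventually_elim (use c in \<open>simp add: add.commute\<close>)
    qed simp
    ultimately show ?thesis unfolding meromorphic_on_def by blast
  next
    case False
    have "y analytic_on - L" using q by (simp add: quasi_elliptic_def analytic_on_open)
    hence "y analytic_on {w}" using False by (auto elim: analytic_on_subset)
    thus ?thesis by (rule analytic_on_imp_meromorphic_on)
  qed
  thus ?thesis using meromorphic_on_meromorphic_at by blast
qed

text \<open>The left-hand side of the equation is entire once its negative Laurent coefficients vanish, hence constant
  by Liouville, and a nontrivial character or oddness forces the constant to be zero.\<close>
lemma quasi_solution:
  assumes q: "quasi_elliptic \<tau> a b ((- 1) ^ m) y Y" and ab: "a \<in> {1, - 1}" "b \<in> {1, - 1}"
    and s: "a = - 1 \<or> b = - 1 \<or> even m" and D: "\<And>k. k < 0 \<Longrightarrow> Dop n l B (wpF wu wv) Y $$ k = 0"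
  shows "global_solution \<tau> n l B y" "Dop n l B (wpF wu wv) Y = 0"
proof -
  define f where "f z = deriv (deriv (deriv y)) z - (alpha n l * wp \<tau> z + B) * deriv y z + beta n l * deriv (wp \<tau>) z * y z" for z
  have f: "quasi_elliptic \<tau> a b (- ((- 1) ^ m)) f (Dop n l B (wpF wu wv) Y)"
    unfolding f_def[abs_def] by (rule quasi_Dop[OF q])
  obtain c where c: "\<And>z. z \<notin> L \<Longrightarrow> f z = c"
  proof (rule lattice_liouville[of f])
    show "f holomorphic_on - L" "f has_laurent_expansion Dop n l B (wpF wu wv) Y" using f by (simp_all add: quasi_elliptic_def)
    show "norm (f (z + 1)) = norm (f z)" "norm (f (z + \<tau>)) = norm (f z)" if "z \<notin> L" for z
      using f ab that by (auto simp: quasi_elliptic_def)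
  qed (use D in auto)
  obtain z0 where z0: "z0 \<notin> L" using one_half_not_lattice by blast
  hence z1: "z0 + 1 \<notin> L" "z0 + \<tau> \<notin> L" "- z0 \<notin> L" by simp_all
  have "f (z0 + 1) = a * f z0" "f (z0 + \<tau>) = b * f z0" "f (- z0) = - ((- 1) ^ m) * f z0"
    using f z0 by (simp_all add: quasi_elliptic_def)
  hence "c = a * c" "c = b * c" "c = - ((- 1) ^ m) * c" by (simp_all only: c[OF z0] c[OF z1(1)] c[OF z1(2)] c[OF z1(3)])
  hence c0: "c = 0" using s by auto
  hence f0: "f z = 0" if "z \<notin> L" for z using c[OF that] by simp
  have "y holomorphic_on - L" using q by (simp add: quasi_elliptic_def)
  hence sol: "solution_on \<tau> n l B (- L) y" unfolding solution_on_iff using f0 by (auto simp: f_def algebra_simps)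
  have "y meromorphic_on UNIV" by (rule quasi_meromorphic[OF q]) (use ab in auto)
  thus "global_solution \<tau> n l B y" using sol by (simp add: global_solution_def)
  have "\<forall>\<^sub>F z in at 0. f z = 0" using eventually_not_lattice by eventually_elim (rule f0)
  thus "Dop n l B (wpF wu wv) Y = 0"
    using f has_laurent_expansion_eventually_zero_iff[of f 0] by (simp add: quasi_elliptic_def)
qed

text \<open>Each normalised derivative raises the pole order by one and flips the parity, so a
  single function of order \<open>m\<close> yields a member for every larger order.\<close>

lemma pole_sequence:
  assumes f: "quasi_elliptic \<tau> a b ((- 1) ^ m) f F" "pole_form m F" and m: "m > 0"
  obtains g G where "G m = F"
    "\<And>p. p \<ge> m \<Longrightarrow> quasi_elliptic \<tau> a b ((- 1) ^ p) (g p) (G p)" "\<And>p. p \<ge> m \<Longrightarrow> pole_form p (G p)"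
    "\<And>p. p \<ge> m \<Longrightarrow> G (Suc p) = fls_const (- 1 / of_nat p) * fls_deriv (G p)"
proof -
  define g where "g = rec_nat f (\<lambda>k y z. - 1 / of_nat (m + k) * deriv y z)"
  define G where "G = rec_nat F (\<lambda>k Y. fls_const (- 1 / of_nat (m + k)) * fls_deriv Y)"
  have 0: "g 0 = f" "G 0 = F" and Suc: "g (Suc k) = (\<lambda>z. - 1 / of_nat (m + k) * deriv (g k) z)"
    "G (Suc k) = fls_const (- 1 / of_nat (m + k)) * fls_deriv (G k)" for k
    by (simp_all add: g_def G_def)
  have *: "quasi_elliptic \<tau> a b ((- 1) ^ (m + k)) (g k) (G k) \<and> pole_form (m + k) (G k)" for k
  proof (induction k)
    case 0
    thus ?case using f by (simp add: \<open>g 0 = f\<close> \<open>G 0 = F\<close>)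
  next
    case (Suc k)
    have "quasi_elliptic \<tau> a b (- ((- 1) ^ (m + k))) (g (Suc k)) (G (Suc k))"
      unfolding \<open>\<And>k. g (Suc k) = _ k\<close> \<open>\<And>k. G (Suc k) = _ k\<close> by (intro quasi_cmult quasi_deriv) (use Suc in blast)
    moreover have "pole_form (Suc (m + k)) (G (Suc k))"
      unfolding \<open>\<And>k. G (Suc k) = _ k\<close> by (rule pole_form_deriv) (use Suc m in auto)
    ultimately show ?case by simp
  qed
  show thesis
  proof (rule that[of "\<lambda>p. G (p - m)" "\<lambda>p. g (p - m)"])
    fix p assume p: "p \<ge> m"
    show "quasi_elliptic \<tau> a b ((- 1) ^ p) (g (p - m)) (G (p - m))" "pole_form p (G (p - m))"
      using *[of "p - m"] p by simp_all
    show "G (Suc p - m) = fls_const (- 1 / of_nat p) * fls_deriv (G (p - m))"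
      using Suc(2)[of "p - m"] p by (simp add: Suc_diff_le)
  qed (simp add: 0)
qed

text \<open>\<open>I\<close> lists the pole coefficients of the left-hand side that do not vanish by
  themselves, \<open>J\<close> the unknowns. More unknowns than equations leave a nontrivial
  combination whose left-hand side has no pole, and \<open>quasi_solution\<close> applies.\<close>

lemma solution_of_system:
  assumes J: "finite J" "finite I" "card I < card J"
    and v: "\<And>j. j \<in> J \<Longrightarrow> quasi_elliptic \<tau> a b ((- 1) ^ m) (v j) (V j)"
    and D: "\<And>j k. j \<in> J \<Longrightarrow> k < 0 \<Longrightarrow> k \<notin> I \<Longrightarrow> Dop n l B (wpF wu wv) (V j) $$ k = 0"
    and ab: "a \<in> {1, - 1}" "b \<in> {1, - 1}" and s: "a = - 1 \<or> b = - 1 \<or> even m"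
  shows "\<exists>c. (\<exists>j\<in>J. c j \<noteq> 0) \<and> global_solution \<tau> n l B (\<lambda>z. \<Sum>j\<in>J. c j * v j z) \<and>
    Dop n l B (wpF wu wv) (\<Sum>j\<in>J. fls_const (c j) * V j) = 0"
proof -
  obtain c where c: "\<exists>j\<in>J. c j \<noteq> 0" "\<forall>i\<in>I. (\<Sum>j\<in>J. Dop n l B (wpF wu wv) (V j) $$ i * c j) = 0"
    using homogeneous_system_nontrivial[OF J(2,1,3), of "\<lambda>i j. Dop n l B (wpF wu wv) (V j) $$ i"] by blast
  have "Dop n l B (wpF wu wv) (\<Sum>j\<in>J. fls_const (c j) * V j) $$ k = 0" if k: "k < 0" for k
  proof -
    have "Dop n l B (wpF wu wv) (\<Sum>j\<in>J. fls_const (c j) * V j) $$ k = (\<Sum>j\<in>J. Dop n l B (wpF wu wv) (V j) $$ k * c j)"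
      unfolding Dop_sum by (simp add: fls_nth_sum mult.commute)
    also have "\<dots> = 0"
    proof (cases "k \<in> I")
      case False
      thus ?thesis using D k by (intro sum.neutral) simp
    qed (use c in blast)
    finally show ?thesis .
  qed
  from quasi_solution[OF quasi_sum[where c = c, OF v] ab s this] c(1) show ?thesis by blast
qed

lemma lattice_character_exists:
  assumes ab: "a \<in> {1, - 1}" "b \<in> {1, - 1 :: complex}"
  shows "\<exists>ch. lattice_character \<tau> ch \<and> ch 1 = a \<and> ch \<tau> = b"
proof -
  \<comment> \<open>On lattice points the floors return the integer coordinates exactly; the values
    elsewhere are never looked at.\<close>
  define jj where "jj w = \<lfloor>Im w / Im \<tau>\<rfloor>" for w
  define ii where "ii w = \<lfloor>Re w - of_int (jj w) * Re \<tau>\<rfloor>" for w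
  define ch where "ch w = a powi (ii w) * b powi (jj w)" for w
  have ij: "jj (of_int i + of_int j * \<tau>) = j" "ii (of_int i + of_int j * \<tau>) = i" for i j
    using Im_pos by (simp_all add: jj_def ii_def)
  have ch: "ch (of_int i + of_int j * \<tau>) = a powi i * b powi j" for i j by (simp add: ch_def ij)
  have "(- 1 :: complex) powi i = 1 \<or> (- 1 :: complex) powi i = - 1" for i
    by (cases "even i") (simp_all add: power_int_minus_left)
  hence pm: "a powi i = 1 \<or> a powi i = - 1" "b powi i = 1 \<or> b powi i = - 1" for i
    using ab by auto
  have "lattice_character \<tau> ch"
  proof
    fix w assume "w \<in> L"
    then obtain i j where "w = of_int i + of_int j * \<tau>" unfolding lattice_def by blast
    thus "ch w = 1 \<or> ch w = - 1" using pm[of i] pm[of j] ch[of i j] by auto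
  next
    fix v w assume "v \<in> L" "w \<in> L"
    then obtain i j i' j' where vw: "v = of_int i + of_int j * \<tau>" "w = of_int i' + of_int j' * \<tau>" unfolding lattice_def by blast
    have "v + w = of_int (i + i') + of_int (j + j') * \<tau>" by (simp add: vw algebra_simps)
    hence "ch (v + w) = a powi (i + i') * b powi (j + j')" by (simp only: ch)
    moreover have "a \<noteq> 0" "b \<noteq> 0" using ab by auto
    ultimately show "ch (v + w) = ch v * ch w" by (simp add: vw ch power_int_add)
  qed
  thus ?thesis using ch[of 1 0] ch[of 0 1] by (intro exI[of _ ch]) simp
qed

end

lemma fls_residue_deriv_mult:
  fixes F G :: "complex fls"
  shows "(fls_deriv F * G) $$ (- 1) = - ((F * fls_deriv G) $$ (- 1))"
proof -
  have "F * fls_deriv G + fls_deriv F * G = fls_deriv (F * G)" by simp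
  hence "(F * fls_deriv G + fls_deriv F * G) $$ (- 1) = of_int (- 1 + 1) * (F * G) $$ (- 1 + 1)"
    by (simp only: fls_deriv_nth)
  hence "(fls_deriv F * G) $$ (- 1) + (F * fls_deriv G) $$ (- 1) = 0" by (simp add: add.commute)
  thus ?thesis by (simp only: eq_neg_iff_add_eq_0)
qed

text \<open>Moving derivatives across the product by partial integration leads to the orders
  \<open>j + 1\<close> and \<open>j\<close>, where symmetry makes the residue its own negative. For
  odd \<open>l\<close> this disposes of the simple pole of the left-hand side, without spending an
  unknown.\<close>

lemma fls_residue_higher_deriv:
  fixes A :: "complex fls"
  shows "(fls_deriv A * (fls_deriv ^^ (2 * j)) A) $$ (- 1) = 0"
proof -
  define R where "R a b = ((fls_deriv ^^ a) A * (fls_deriv ^^ b) A) $$ (- 1)" for a b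
  have step: "R (Suc a) b = - R a (Suc b)" for a b unfolding R_def by (simp add: fls_residue_deriv_mult)
  have shift: "R (a + i) b = (- 1) ^ i * R a (b + i)" for a b i
  proof (induction i arbitrary: a b)
    case (Suc i)
    have "R (a + Suc i) b = - R (a + i) (Suc b)" using step[of "a + i" b] by simp
    also have "\<dots> = - ((- 1) ^ i * R a (Suc b + i))" by (simp only: Suc)
    finally show ?case by simp
  qed simp
  have "R (Suc j) j = - R j (Suc j)" by (rule step)
  also have "R j (Suc j) = R (Suc j) j" by (simp add: R_def mult.commute)
  finally have "R (Suc j) j = 0" by simp
  hence "R (1 + j) j = 0" by simp
  hence "(- 1) ^ j * R 1 (j + j) = 0" unfolding shift .
  hence "R 1 (j + j) = 0" by simp
  thus ?thesis by (simp add: R_def mult_2)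
qed

text \<open>Only the two products of \<open>A\<close> and \<open>Y\<close> can have a residue, and
  partial integration reduces one to the other.\<close>

lemma Dop_residue:
  assumes "(fls_deriv A * Y) $$ (- 1) = 0"
  shows "Dop n l B A Y $$ (- 1) = 0"
proof -
  have "(A * fls_deriv Y) $$ (- 1) = 0" using assms fls_residue_deriv_mult[of A Y] by simp
  moreover have "fls_deriv (fls_deriv (fls_deriv Y)) $$ (- 1) = 0" "fls_deriv Y $$ (- 1) = 0" by (simp_all add: fls_deriv_nth)
  moreover have "Dop n l B A Y = fls_deriv (fls_deriv (fls_deriv Y)) - fls_const (alpha n l) * (A * fls_deriv Y)
     - fls_const B * fls_deriv Y + fls_const (beta n l) * (fls_deriv A * Y)"
    unfolding Dop_def by (simp add: algebra_simps)
  ultimately show ?thesis using assms by simp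
qed

section \<open>Counting unknowns against poles\<close>

context weierstrass_lattice
begin

lemma Dop_parity:
  assumes "quasi_elliptic \<tau> a b ((- 1) ^ m) y Y" "even (k + int m)"
  shows "Dop n l B (wpF wu wv) Y $$ k = 0"
proof -
  have "quasi_elliptic \<tau> a b ((- 1) ^ Suc m)
    (\<lambda>z. deriv (deriv (deriv y)) z - (alpha n l * wp \<tau> z + B) * deriv y z + beta n l * deriv (wp \<tau>) z * y z)
    (Dop n l B (wpF wu wv) Y)" using quasi_Dop[OF assms(1)] by simp
  thus ?thesis by (rule quasi_parity) (use assms(2) in simp)
qed

text \<open>Poles of the left-hand side at orders of the wrong parity vanish by parity, and those of
  order above \<open>l\<close> by the Frobenius recursion. The set \<open>I\<close> collects those
  of order at most \<open>l\<close> that remain. The final disjunction tells whether the Frobenius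
  part occurs in the solution; this separates the two solutions needed for odd
  \<open>l\<close>.\<close>

lemma solution_from_family:
  assumes "odd n" and P: "poly (frobP n l wu wv) B = 0"
    and fam: "\<And>p. odd (p + l) \<Longrightarrow> quasi_elliptic \<tau> a b ((- 1) ^ p) (g p) (G p)" "\<And>p. odd (p + l) \<Longrightarrow> pole_form p (G p)"
    and ab: "a \<in> {1, - 1}" "b \<in> {1, - 1}" and s: "a = - 1 \<or> b = - 1 \<or> odd l"
    and J: "finite J" "\<And>p. p \<in> J \<Longrightarrow> odd (p + l) \<and> (p < l \<or> p = n + l)" "finite I" "card I < card J"
    and res: "\<And>p k. odd (p + l) \<Longrightarrow> even (k + int l) \<Longrightarrow> - int l \<le> k \<Longrightarrow> k < 0 \<Longrightarrow> k \<notin> I \<Longrightarrow> Dop n l B (wpF wu wv) (G p) $$ k = 0"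
  shows "\<exists>y Y. global_solution \<tau> n l B y \<and> quasi_elliptic \<tau> a b ((- 1) ^ (l + 1)) y Y \<and> Dop n l B (wpF wu wv) Y = 0 \<and> Y \<noteq> 0 \<and>
    (n + l \<in> J \<and> Y $$ (- int (n + l)) \<noteq> 0 \<or> J - {n + l} \<noteq> {} \<and> (\<forall>k<0. - k \<notin> int ` (J - {n + l}) \<longrightarrow> Y $$ k = 0))"
proof -
  define d where "d = (n + 1) div 2"
  obtain h where h: "n = 2 * h + 1" using \<open>odd n\<close> by (rule oddE)
  have dh: "d = h + 1" by (simp add: d_def h)
  \<comment> \<open>Pole orders \<open>n + l\<close>, \<open>n + l - 2\<close>, ...,
    \<open>l + 1\<close> of the Frobenius principal part.\<close>
  define q where "q i = n + l - 2 * i" for i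
  have q: "odd (q i + l)" "q i > l" "int (q i) = int (n + l) - 2 * int i" if "i < d" for i
  proof -
    have "i \<le> h" using that dh by simp
    then obtain r where "h = i + r" using le_Suc_ex by blast
    hence qq: "q i = 2 * r + 1 + l" by (simp add: q_def h)
    show "odd (q i + l)" "q i > l" using qq by simp_all
    show "int (q i) = int (n + l) - 2 * int i" using qq h \<open>h = i + r\<close> by simp
  qed
  define e where "e i = poly (frobc n l wu wv i) B" for i
  define Vs where "Vs = (\<Sum>i<d. fls_const (e i) * G (q i))"
  define vs where "vs z = (\<Sum>i<d. e i * g (q i) z)" for z
  \<comment> \<open>The index \<open>n + l\<close> stands for the whole Frobenius principal part;
    every other index is a single member of the family.\<close>
  define V where "V j = (if j = n + l then Vs else G j)" for j
  define v where "v j = (if j = n + l then vs else g j)" for j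
  have sgn: "(- 1 :: complex) ^ p = (- 1) ^ (l + 1)" if "odd (p + l)" for p
    using that by (cases "even p") simp_all
  have fam': "quasi_elliptic \<tau> a b ((- 1) ^ (l + 1)) (g p) (G p)" if "odd (p + l)" for p
    using fam(1)[OF that] sgn[OF that] by simp
  have vsV: "quasi_elliptic \<tau> a b ((- 1) ^ (l + 1)) vs Vs"
    unfolding vs_def[abs_def] Vs_def by (rule quasi_sum) (use fam' q(1) in auto)
  have vV: "quasi_elliptic \<tau> a b ((- 1) ^ (l + 1)) (v j) (V j)" if "j \<in> J" for j
    using vsV fam' J(2)[OF that] by (simp add: v_def V_def)
  have Gneg: "G p $$ k = (if k = - int p then 1 else 0)" if "odd (p + l)" "k < 0" for p k
    using fam(2)[OF that(1)] that(2) by (auto simp: pole_form_def)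
  have Vs_nth: "Vs $$ k = (\<Sum>i<d. e i * (if k = - int (q i) then 1 else 0))" if "k < 0" for k
    unfolding Vs_def fls_nth_sum by (rule sum.cong) (use Gneg[OF q(1) that] in auto)
  have Vs_e: "Vs $$ (- int (n + l) + 2 * int i) = e i" if i: "i < d" for i
  proof -
    have k: "- int (n + l) + 2 * int i = - int (q i)" using q(3)[OF i] by simp
    have "Vs $$ (- int (q i)) = (\<Sum>i'<d. e i' * (if - int (q i) = - int (q i') then 1 else 0))"
      by (rule Vs_nth) (use q(2)[OF i] in simp)
    also have "\<dots> = (\<Sum>i'<d. if i' = i then e i' else 0)"
      by (rule sum.cong) (use q(3)[OF i] q(3) in auto)
    also have "\<dots> = e i" using i by simp
    finally show ?thesis unfolding k .
  qed
  have Vs_0: "Vs $$ k = 0" if "k < 0" "\<And>i. i < d \<Longrightarrow> k \<noteq> - int (q i)" for k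
    unfolding Vs_nth[OF that(1)] by (rule sum.neutral) (use that(2) in auto)
  have D: "Dop n l B (wpF wu wv) (V j) $$ k = 0" if j: "j \<in> J" and k: "k < 0" "k \<notin> I" for j k
  proof (cases "even (k + int l)")
    case False
    show ?thesis by (rule Dop_parity[OF vV[OF j]]) (use False in simp)
  next
    case True
    show ?thesis
    proof (cases "- int l \<le> k")
      case le: True
      note r = res[OF _ True le k]
      have "Dop n l B (wpF wu wv) Vs $$ k = 0"
        unfolding Vs_def Dop_sum fls_nth_sum by (rule sum.neutral) (use r q(1) in auto)
      thus ?thesis using r J(2)[OF j] by (simp add: V_def)
    next
      case False
      \<comment> \<open>By parity the pole orders above \<open>l\<close> that matter start at
        \<open>l + 2\<close>.\<close>
      with True have kl: "k \<le> - int l - 2" by presburger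
      show ?thesis
      proof (cases "j = n + l")
        case jn: True
        have z: "\<forall>k'< - int (n + l). Vs $$ k' = 0"
        proof (intro allI impI Vs_0)
          fix k' :: int and i assume "k' < - int (n + l)" "i < d"
          thus "k' \<noteq> - int (q i)" using q(3)[of i] by linarith
        qed auto
        show ?thesis
        proof (cases "k < - int (n + l) - 3")
          case True
          thus ?thesis using Dop_nth_eq_0[OF z True] jn by (simp add: V_def)
        next
          case False
          define i where "i = nat ((k + 3 + int (n + l)) div 2)"
          have "even (k + 3 + int (n + l))" using True h by simp
          hence ki: "k = - int (n + l) + 2 * int i - 3" using False unfolding i_def by auto
          have "i \<le> (n + 1) div 2" using ki kl h by simp
          have "Dop n l B (wpF wu wv) Vs $$ (- int (n + l) + 2 * int i - 3) = 0"
            by (rule frobenius_sufficient[OF z refl \<open>odd n\<close> _ P \<open>i \<le> (n + 1) div 2\<close>])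
               (use Vs_e in \<open>simp add: d_def e_def\<close>)
          thus ?thesis using jn ki by (simp add: V_def)
        qed
      next
        case jn: False
        hence jl: "j < l" "odd (j + l)" using J(2)[OF j] by auto
        have z: "\<forall>k'< - int j. G j $$ k' = 0" using Gneg[OF jl(2)] by auto
        show ?thesis
        proof (cases "k < - int j - 3")
          case True
          thus ?thesis using Dop_nth_eq_0[OF z True] jn by (simp add: V_def)
        next
          case False
          have "int j \<le> int l - 1" using jl by linarith
          \<comment> \<open>Among the members of order below \<open>l\<close> only order
            \<open>l - 1\<close> reaches this far, and its leading contribution carries
            \<open>indicial\<close> at the exponent \<open>1 - l\<close>, which is zero.\<close>
          hence jk: "- int j = 1 - int l" "k = (1 - int l) - 3" using False kl by linarith+
          have "indicial n l (of_int (1 - int l)) = 0" unfolding indicial_eq_0_iff by simp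
          thus ?thesis using Dop_nth_leading[OF z[unfolded jk(1)], of n l B wu wv] jn jk(2) by (simp add: V_def)
        qed
      qed
    qed
  qed
  have "a = - 1 \<or> b = - 1 \<or> even (l + 1)" using s by auto
  note sgn2 = this
  have "\<exists>c. (\<exists>j\<in>J. c j \<noteq> 0) \<and> global_solution \<tau> n l B (\<lambda>z. \<Sum>j\<in>J. c j * v j z) \<and>
    Dop n l B (wpF wu wv) (\<Sum>j\<in>J. fls_const (c j) * V j) = 0"
    by (rule solution_of_system[where I = I and m = "l + 1" and v = v and V = V]) (fact J(1) J(3) J(4) vV D ab sgn2)+
  then obtain c where c: "\<exists>j\<in>J. c j \<noteq> 0" "global_solution \<tau> n l B (\<lambda>z. \<Sum>j\<in>J. c j * v j z)"
    "Dop n l B (wpF wu wv) (\<Sum>j\<in>J. fls_const (c j) * V j) = 0" by blast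
  define Y where "Y = (\<Sum>j\<in>J. fls_const (c j) * V j)"
  have qY: "quasi_elliptic \<tau> a b ((- 1) ^ (l + 1)) (\<lambda>z. \<Sum>j\<in>J. c j * v j z) Y"
    unfolding Y_def by (rule quasi_sum[OF vV])
  have Yn: "Y $$ k = (\<Sum>j\<in>J. c j * V j $$ k)" for k by (simp add: Y_def fls_nth_sum)
  have delta: "V j $$ (- int p) = (if j = p then 1 else 0)" if "p \<in> J" "j \<in> J" "p > 0" for j p
  proof (cases "j = n + l")
    case True
    show ?thesis
    proof (cases "p = n + l")
      case True
      thus ?thesis using Vs_e[of 0] \<open>j = n + l\<close> by (simp add: V_def e_def dh)
    next
      case False
      hence "p < l" using J(2)[OF that(1)] by blast
      have "Vs $$ (- int p) = 0"
      proof (rule Vs_0)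
        fix i assume "i < d"
        thus "- int p \<noteq> - int (q i)" using q(2)[of i] \<open>p < l\<close> by simp
      qed (use that in simp)
      thus ?thesis using True False by (simp add: V_def)
    qed
  next
    case False
    thus ?thesis using Gneg[of j "- int p"] J(2)[OF that(2)] that(3) by (simp add: V_def)
  qed
  have Yp: "Y $$ (- int p) = c p" if "p \<in> J" "p > 0" for p
  proof -
    have "Y $$ (- int p) = (\<Sum>j\<in>J. if j = p then c j else 0)"
      unfolding Yn by (rule sum.cong) (use delta[OF that(1) _ that(2)] in auto)
    thus ?thesis using that J(1) by simp
  qed
  have "Y \<noteq> 0"
  proof
    assume Y0: "Y = 0"
    have cp: "c p = 0" if "p \<in> J" "p > 0" for p using Yp[OF that] Y0 by simp
    \<comment> \<open>The member with \<open>p = 0\<close> leaves no trace in the principal part, so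
      its coefficient is detected in the constant term.\<close>
    with c(1) have c0: "0 \<in> J" "c 0 \<noteq> 0" by (metis gr0I)+
    have "Y $$ 0 = (\<Sum>j\<in>J. if j = 0 then c 0 * V 0 $$ 0 else 0)"
      unfolding Yn by (rule sum.cong) (use cp in auto)
    also have "\<dots> = c 0 * V 0 $$ 0" using c0 J(1) by simp
    also have "V 0 $$ 0 = 1" using fam(2)[of 0] J(2)[OF c0(1)] h by (simp add: V_def pole_form_def)
    finally show False using Y0 c0 by simp
  qed
  moreover have "n + l \<in> J \<and> Y $$ (- int (n + l)) \<noteq> 0 \<or> J - {n + l} \<noteq> {} \<and> (\<forall>k<0. - k \<notin> int ` (J - {n + l}) \<longrightarrow> Y $$ k = 0)"
  proof (cases "n + l \<in> J \<and> c (n + l) \<noteq> 0")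
    case True
    thus ?thesis using Yp[of "n + l"] h by simp
  next
    case False
    have "Y $$ k = 0" if "k < 0" "- k \<notin> int ` (J - {n + l})" for k
      unfolding Yn
    proof (rule sum.neutral, rule ballI)
      fix j assume j: "j \<in> J"
      show "c j * V j $$ k = 0"
      proof (cases "j = n + l")
        case True
        thus ?thesis using False j by simp
      next
        case jn: False
        hence "- k \<noteq> int j" using that(2) j by blast
        hence "k \<noteq> - int j" by auto
        thus ?thesis using Gneg[of j k] J(2)[OF j] that(1) jn by (simp add: V_def)
      qed
    qed
    moreover have "J - {n + l} \<noteq> {}" using c(1) False by auto
    ultimately show ?thesis by blast
  qed
  ultimately show ?thesis using qY c(2,3) unfolding Y_def[symmetric] by blast
qed

text \<open>The remaining pole orders 2, 4, ..., \<open>l\<close> are matched one by one by the free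
  orders 1, 3, ..., \<open>l - 1\<close>, and the Frobenius part is the additional unknown. The
  family comes from the odd function with a simple pole, which requires a nontrivial
  character.\<close>

lemma solution_even_l:
  assumes "odd n" "even l" and P: "poly (frobP n l wu wv) B = 0"
    and ab: "a \<in> {1, - 1}" "b \<in> {1, - 1}" "a = - 1 \<or> b = - 1"
  shows "\<exists>y Y. global_solution \<tau> n l B y \<and> quasi_elliptic \<tau> a b (- 1) y Y \<and> Y \<noteq> 0"
proof -
  obtain ch where ch: "lattice_character \<tau> ch" "ch 1 = a" "ch \<tau> = b"
    using lattice_character_exists[OF ab(1,2)] by blast
  interpret lc: lattice_character \<tau> ch by (rule ch(1))
  obtain v0 where v0: "v0 \<in> {1, \<tau>}" "ch v0 = - 1" using ab(3) ch by blast
  obtain \<phi> H where \<phi>: "\<phi> holomorphic_on - L" "\<And>z. \<phi> (- z) = - \<phi> z"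
    "\<And>z v. z \<notin> L \<Longrightarrow> v \<in> {1, \<tau>} \<Longrightarrow> \<phi> (z + v) = ch v * \<phi> z"
    "\<phi> has_laurent_expansion fls_X_inv + fps_to_fls H"
    by (rule lc.odd_quasiperiodic[OF v0]) blast
  have q: "quasi_elliptic \<tau> a b ((- 1) ^ 1) \<phi> (fls_X_inv + fps_to_fls H)"
    using \<phi> ch(2,3) by (simp add: quasi_elliptic_def)
  have pf: "pole_form 1 (fls_X_inv + fps_to_fls H)" by (simp add: pole_form_def)
  obtain g G where gG: "\<And>p. p \<ge> 1 \<Longrightarrow> quasi_elliptic \<tau> a b ((- 1) ^ p) (g p) (G p)" "\<And>p. p \<ge> 1 \<Longrightarrow> pole_form p (G p)"
    by (rule pole_sequence[OF q pf]) auto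
  define K where "K = {p. p < l \<and> odd p}"
  define I where "I = (\<lambda>p. - int (p + 1)) ` K"
  have K: "finite K" "n + l \<notin> K" by (simp_all add: K_def)
  have "card I = card K" unfolding I_def by (rule card_image) (simp add: inj_on_def)
  have p1: "p \<ge> 1" if "odd (p + l)" for p using that \<open>even l\<close> by (cases p) auto
  have "\<exists>y Y. global_solution \<tau> n l B y \<and> quasi_elliptic \<tau> a b ((- 1) ^ (l + 1)) y Y \<and> Dop n l B (wpF wu wv) Y = 0 \<and> Y \<noteq> 0 \<and>
    (n + l \<in> insert (n + l) K \<and> Y $$ (- int (n + l)) \<noteq> 0 \<or> insert (n + l) K - {n + l} \<noteq> {} \<and> (\<forall>k<0. - k \<notin> int ` (insert (n + l) K - {n + l}) \<longrightarrow> Y $$ k = 0))"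
  proof (rule solution_from_family[where g = g and G = G and I = I])
    show "quasi_elliptic \<tau> a b ((- 1) ^ p) (g p) (G p)" "pole_form p (G p)" if "odd (p + l)" for p
      using gG p1[OF that] by simp_all
    show "card I < card (insert (n + l) K)" using K \<open>card I = card K\<close> by simp
    show "odd (p + l) \<and> (p < l \<or> p = n + l)" if "p \<in> insert (n + l) K" for p
      using that assms by (auto simp: K_def)
    fix p :: nat and k :: int assume k: "even (k + int l)" "- int l \<le> k" "k < 0" "k \<notin> I"
    define p where "p = nat (- k - 1)"
    have "int p = - k - 1" using k(3) by (simp add: p_def)
    moreover from this have "p < l" using k by linarith
    moreover have "odd p" using \<open>int p = - k - 1\<close> k(1) \<open>even l\<close> by presburger
    ultimately have "k \<in> I" unfolding I_def K_def by (intro image_eqI[of _ _ p]) auto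
    thus "Dop n l B (wpF wu wv) (G p') $$ k = 0" for p' using k(4) by blast
  qed (use assms K in \<open>auto simp: I_def\<close>)
  moreover have "(- 1 :: complex) ^ (l + 1) = - 1" using \<open>even l\<close> by simp
  ultimately show ?thesis by metis
qed

text \<open>With the trivial character the family consists of the constant 1, \<open>\<wp>\<close>
  and its derivatives of even order. The simple pole of the left-hand side vanishes by the residue
  lemma, which leaves room for two independent even solutions with different exponents.\<close>

lemma solutions_odd_l:
  assumes "odd n" "odd l" and P: "poly (frobP n l wu wv) B = 0"
  shows "\<exists>y0 Y0 y1 Y1. global_solution \<tau> n l B y0 \<and> quasi_elliptic \<tau> 1 1 1 y0 Y0 \<and> Y0 \<noteq> 0 \<and> fls_subdegree Y0 = - int (n + l) \<and>
     global_solution \<tau> n l B y1 \<and> quasi_elliptic \<tau> 1 1 1 y1 Y1 \<and> Y1 \<noteq> 0 \<and> fls_subdegree Y1 = 1 - int l"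
proof -
  have q: "quasi_elliptic \<tau> 1 1 ((- 1) ^ 2) (wp \<tau>) (wpF wu wv)" using quasi_wp by simp
  have pf: "pole_form 2 (wpF wu wv)" unfolding pole_form_def wpl_eq[symmetric]
    using wpl_lower by (auto simp: not_less) (smt (verit, best) insertCI)
  obtain g0 G0 where gG: "G0 2 = wpF wu wv" "\<And>p. p \<ge> 2 \<Longrightarrow> quasi_elliptic \<tau> 1 1 ((- 1) ^ p) (g0 p) (G0 p)"
    "\<And>p. p \<ge> 2 \<Longrightarrow> pole_form p (G0 p)" "\<And>p. p \<ge> 2 \<Longrightarrow> G0 (Suc p) = fls_const (- 1 / of_nat p) * fls_deriv (G0 p)"
    by (rule pole_sequence[OF q pf]) auto
  define g where "g p = (if p = 0 then (\<lambda>_. 1) else g0 p)" for p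
  define G where "G p = (if p = 0 then 1 else G0 p)" for p
  have G0: "\<exists>c. G0 (2 + k) = fls_const c * (fls_deriv ^^ k) (wpF wu wv)" for k
  proof (induction k)
    case 0
    show ?case using gG(1) by (intro exI[of _ 1]) simp
  next
    case (Suc k)
    then obtain c where "G0 (2 + k) = fls_const c * (fls_deriv ^^ k) (wpF wu wv)" by blast
    hence "G0 (Suc (2 + k)) = fls_const (- 1 / of_nat (2 + k)) * (fls_const c * (fls_deriv ^^ Suc k) (wpF wu wv))"
      using gG(4)[of "2 + k"] by simp
    also have "\<dots> = fls_const (- 1 / of_nat (2 + k) * c) * (fls_deriv ^^ Suc k) (wpF wu wv)"
      by (simp only: fls_const_mult_const[symmetric] mult.assoc)
    finally show ?case by (metis add_Suc_right)
  qed
  have fam: "quasi_elliptic \<tau> 1 1 ((- 1) ^ p) (g p) (G p)" "pole_form p (G p)" "Dop n l B (wpF wu wv) (G p) $$ (- 1) = 0"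
    if "odd (p + l)" for p
  proof -
    have "even p" using that \<open>odd l\<close> by simp
    hence "p = 0 \<or> p \<ge> 2" by (cases "p = 1") auto
    hence "quasi_elliptic \<tau> 1 1 ((- 1) ^ p) (g p) (G p) \<and> pole_form p (G p) \<and> (fls_deriv (wpF wu wv) * G p) $$ (- 1) = 0"
    proof
      assume "p = 0"
      thus ?thesis by (simp add: g_def G_def quasi_elliptic_def pole_form_def fls_deriv_nth)
    next
      assume p: "p \<ge> 2"
      obtain j where j: "p = 2 + 2 * j" using \<open>even p\<close> p by (metis evenE dvd_diff_nat even_numeral le_add_diff_inverse)
      obtain c where "G0 (2 + 2 * j) = fls_const c * (fls_deriv ^^ (2 * j)) (wpF wu wv)" using G0 by blast
      hence "G p = fls_const c * (fls_deriv ^^ (2 * j)) (wpF wu wv)" by (simp add: G_def j)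
      hence eq: "fls_deriv (wpF wu wv) * G p = fls_const c * (fls_deriv (wpF wu wv) * (fls_deriv ^^ (2 * j)) (wpF wu wv))"
        by (metis mult.left_commute)
      have "(fls_deriv (wpF wu wv) * G p) $$ (- 1) = 0" unfolding eq by (simp add: fls_residue_higher_deriv)
      thus ?thesis using gG(2,3)[OF p] p by (simp add: g_def G_def)
    qed
    thus "quasi_elliptic \<tau> 1 1 ((- 1) ^ p) (g p) (G p)" "pole_form p (G p)" "Dop n l B (wpF wu wv) (G p) $$ (- 1) = 0"
      using Dop_residue by blast+
  qed
  \<comment> \<open>Each \<open>p\<close> in \<open>K\<close> is paired with the pole order
    \<open>p + 3\<close> in \<open>I\<close>, which covers 3, 5, ..., \<open>l\<close>. Adjoining
    one index, \<open>n + l\<close> for the first solution and \<open>l - 1\<close> for the second,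
    makes the system underdetermined each time.\<close>
  define K where "K = {p. p + 3 \<le> l \<and> even p}"
  define I where "I = (\<lambda>p. - int (p + 3)) ` K"
  have K: "finite K" "n + l \<notin> K" "l - 1 \<notin> K"
    by (rule finite_subset[of _ "{..l}"]) (use \<open>odd l\<close> in \<open>auto simp: K_def\<close>)
  have cI: "card I = card K" unfolding I_def by (rule card_image) (simp add: inj_on_def)
  have res: "Dop n l B (wpF wu wv) (G p) $$ k = 0"
    if p: "odd (p + l)" and k: "even (k + int l)" "- int l \<le> k" "k < 0" "k \<notin> I" for p k
  proof (cases "k = - 1")
    case True
    thus ?thesis using fam(3)[OF p] by simp
  next
    case False
    define j where "j = nat (- k - 3)"
    have "odd k" using k(1) \<open>odd l\<close> by simp
    hence "k \<noteq> - 2" by auto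
    hence j: "int j = - k - 3" using k(3) False by (simp add: j_def)
    have "even j" using j \<open>odd k\<close> by presburger
    hence "j \<in> K" using j k(2) by (simp add: K_def)
    hence "k \<in> I" unfolding I_def using j by (intro image_eqI[of _ _ j]) auto
    thus ?thesis using k(4) by blast
  qed
  obtain lh where lh: "l = 2 * lh + 1" using \<open>odd l\<close> by (rule oddE)
  have one: "(- 1 :: complex) ^ (l + 1) = 1" using \<open>odd l\<close> by simp
  have ev: "even (fls_subdegree Y)" if "quasi_elliptic \<tau> 1 1 1 y Y" "Y \<noteq> 0" for y Y
    using quasi_parity[of 1 1 0 y Y "fls_subdegree Y"] that by auto
  \<comment> \<open>The third exponent \<open>n + 2 * l + 2\<close> is odd here, so an even solution
    cannot start there.\<close>
  have ex: "fls_subdegree Y = - int (n + l) \<or> fls_subdegree Y = 1 - int l"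
    if "quasi_elliptic \<tau> 1 1 1 y Y" "Y \<noteq> 0" "Dop n l B (wpF wu wv) Y = 0" for y Y
    using exponent_of_solution[OF that(3,2)] ev[OF that(1,2)] \<open>odd n\<close> by auto
  have "\<exists>y Y. global_solution \<tau> n l B y \<and> quasi_elliptic \<tau> 1 1 ((- 1) ^ (l + 1)) y Y \<and> Dop n l B (wpF wu wv) Y = 0 \<and> Y \<noteq> 0 \<and>
    (n + l \<in> insert (n + l) K \<and> Y $$ (- int (n + l)) \<noteq> 0 \<or> insert (n + l) K - {n + l} \<noteq> {} \<and> (\<forall>k<0. - k \<notin> int ` (insert (n + l) K - {n + l}) \<longrightarrow> Y $$ k = 0))"
  proof (rule solution_from_family[where g = g and G = G and I = I])
    show "odd (p + l) \<and> (p < l \<or> p = n + l)" if "p \<in> insert (n + l) K" for p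
      using that assms by (auto simp: K_def)
    show "card I < card (insert (n + l) K)" using K cI by simp
  qed (use assms K fam res in \<open>auto simp: I_def\<close>)
  then obtain y0 Y0 where Y0: "global_solution \<tau> n l B y0" "quasi_elliptic \<tau> 1 1 1 y0 Y0" "Dop n l B (wpF wu wv) Y0 = 0" "Y0 \<noteq> 0"
    "Y0 $$ (- int (n + l)) \<noteq> 0 \<or> insert (n + l) K - {n + l} \<noteq> {} \<and> (\<forall>k<0. - k \<notin> int ` (insert (n + l) K - {n + l}) \<longrightarrow> Y0 $$ k = 0)"
    unfolding one by blast
  have lb: "fls_subdegree Y \<ge> s" if "\<forall>k<s. Y $$ k = 0" "Y \<noteq> 0" for Y :: "complex fls" and s
  proof (rule ccontr)
    assume "\<not> ?thesis"
    hence "Y $$ fls_subdegree Y = 0" using that(1) by simp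
    thus False using that(2) by simp
  qed
  \<comment> \<open>Without the Frobenius part only poles of order at most \<open>l - 3\<close>
    would be left, too low for the exponent \<open>1 - l\<close>.\<close>
  have s0: "fls_subdegree Y0 = - int (n + l)"
  proof (rule ccontr)
    assume ne: "fls_subdegree Y0 \<noteq> - int (n + l)"
    with ex[OF Y0(2,4,3)] have s: "fls_subdegree Y0 = 1 - int l" by blast
    hence z: "Y0 $$ (- int (n + l)) = 0" by (intro fls_zero_below_subdegree) simp
    with Y0(5) have Kz: "K \<noteq> {}" "\<And>k. k < 0 \<Longrightarrow> - k \<notin> int ` K \<Longrightarrow> Y0 $$ k = 0" using K(2) by auto
    then obtain p where "p \<in> K" by blast
    hence l3: "l \<ge> 3" by (simp add: K_def)
    have "\<forall>k<3 - int l. Y0 $$ k = 0"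
      by (intro allI impI Kz(2)) (use l3 in \<open>auto simp: K_def\<close>)
    thus False using lb[of "3 - int l" Y0] Y0(4) s by simp
  qed
  have "\<exists>y Y. global_solution \<tau> n l B y \<and> quasi_elliptic \<tau> 1 1 ((- 1) ^ (l + 1)) y Y \<and> Dop n l B (wpF wu wv) Y = 0 \<and> Y \<noteq> 0 \<and>
    (n + l \<in> insert (l - 1) K \<and> Y $$ (- int (n + l)) \<noteq> 0 \<or>
      insert (l - 1) K - {n + l} \<noteq> {} \<and> (\<forall>k<0. - k \<notin> int ` (insert (l - 1) K - {n + l}) \<longrightarrow> Y $$ k = 0))"
  proof (rule solution_from_family[where g = g and G = G and I = I])
    show "odd (p + l) \<and> (p < l \<or> p = n + l)" if "p \<in> insert (l - 1) K" for p
      using that lh by (auto simp: K_def)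
    show "card I < card (insert (l - 1) K)" using K cI by simp
  qed (use assms K fam res in \<open>auto simp: I_def\<close>)
  moreover have nl: "n + l \<notin> insert (l - 1) K" using K(2) odd_pos[OF \<open>odd n\<close>] by auto
  ultimately obtain y1 Y1 where Y1: "global_solution \<tau> n l B y1" "quasi_elliptic \<tau> 1 1 1 y1 Y1" "Dop n l B (wpF wu wv) Y1 = 0" "Y1 \<noteq> 0"
    "\<And>k. k < 0 \<Longrightarrow> - k \<notin> int ` insert (l - 1) K \<Longrightarrow> Y1 $$ k = 0"
    unfolding one by auto
  have "\<forall>k<1 - int l. Y1 $$ k = 0"
  proof (intro allI impI Y1(5))
    fix k assume k: "k < 1 - int l"
    thus "k < 0" using lh by simp
    show "- k \<notin> int ` insert (l - 1) K"
    proof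
      assume "- k \<in> int ` insert (l - 1) K"
      then obtain p where "- k = int p" "p = l - 1 \<or> p + 3 \<le> l" by (auto simp: K_def)
      thus False using k lh by linarith
    qed
  qed
  hence "fls_subdegree Y1 \<ge> 1 - int l" using lb Y1(4) by blast
  hence "fls_subdegree Y1 = 1 - int l" using ex[OF Y1(2,4,3)] by linarith
  thus ?thesis using Y0 Y1 s0 by blast
qed

end

section \<open>Monodromy\<close>

lemma (in group) generate_involutions:
  assumes xy: "x \<in> carrier G" "y \<in> carrier G" and xx: "x \<otimes> x = \<one>" and yy: "y \<otimes> y = \<one>" and c: "x \<otimes> y = y \<otimes> x"
  shows "generate G {x, y} = {\<one>, x, y, x \<otimes> y}"
proof
  have a: "x \<otimes> (x \<otimes> y) = y" "y \<otimes> (x \<otimes> y) = x"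
    using xy xx yy c by (simp_all add: m_assoc[symmetric], simp_all add: m_assoc)
  have "(x \<otimes> y) \<otimes> x = y" using xy xx by (simp add: c m_assoc)
  moreover have "(x \<otimes> y) \<otimes> y = x" using xy yy by (simp add: m_assoc)
  moreover have "(x \<otimes> y) \<otimes> (x \<otimes> y) = \<one>" using xy xx a by (simp add: m_assoc)
  ultimately have b: "(x \<otimes> y) \<otimes> x = y" "(x \<otimes> y) \<otimes> y = x" "(x \<otimes> y) \<otimes> (x \<otimes> y) = \<one>" by blast+
  show "generate G {x, y} \<subseteq> {\<one>, x, y, x \<otimes> y}"
  proof
    fix z assume "z \<in> generate G {x, y}"
    thus "z \<in> {\<one>, x, y, x \<otimes> y}"
    proof (induction rule: generate.induct)
      case (inv h)
      thus ?case using inv_equality[OF xx] inv_equality[OF yy] xy by auto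
    next
      case (eng h1 h2)
      thus ?case using a b xx yy xy c[symmetric] by (elim insertE emptyE) simp_all
    qed auto
  qed
  show "{\<one>, x, y, x \<otimes> y} \<subseteq> generate G {x, y}"
    by (auto intro: generate.one generate.incl generate.eng)
qed

lemma (in group) generate_involutions_iso_K4:
  assumes xy: "x \<in> carrier G" "y \<in> carrier G" and xx: "x \<otimes> x = \<one>" and yy: "y \<otimes> y = \<one>" and c: "x \<otimes> y = y \<otimes> x"
    and ne: "x \<noteq> \<one>" "y \<noteq> \<one>" "x \<noteq> y"
  shows "G\<lparr>carrier := generate G {x, y}\<rparr> \<cong> K4"
proof -
  note gen = generate_involutions[OF xy xx yy c]
  have a: "x \<otimes> (x \<otimes> y) = y" "y \<otimes> (x \<otimes> y) = x"
    using xy xx yy c by (simp_all add: m_assoc[symmetric], simp_all add: m_assoc)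
  have "(x \<otimes> y) \<otimes> x = y" using xy xx by (simp add: c m_assoc)
  moreover have "(x \<otimes> y) \<otimes> y = x" using xy yy by (simp add: m_assoc)
  moreover have "(x \<otimes> y) \<otimes> (x \<otimes> y) = \<one>" using xy xx a by (simp add: m_assoc)
  ultimately have b: "(x \<otimes> y) \<otimes> x = y" "(x \<otimes> y) \<otimes> y = x" "(x \<otimes> y) \<otimes> (x \<otimes> y) = \<one>" by blast+
  have ne': "x \<otimes> y \<noteq> \<one>" "x \<otimes> y \<noteq> x" "x \<otimes> y \<noteq> y" using a xx yy xy ne b by auto
  have car: "carrier K4 = {(0, 0), (1, 0), (0, 1), (1, 1)}"
    unfolding K4_def by (auto simp: DirProd_def carrier_integer_mod_group)
  have "group K4" unfolding K4_def by (intro DirProd_group group_integer_mod_group)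
  define f where "f = (\<lambda>(i :: int, j :: int). (if i = 0 then \<one> else x) \<otimes> (if j = 0 then \<one> else y))"
  have f: "f (0, 0) = \<one>" "f (1, 0) = x" "f (0, 1) = y" "f (1, 1) = x \<otimes> y" using xy by (simp_all add: f_def)
  have "f \<in> iso K4 (G\<lparr>carrier := generate G {x, y}\<rparr>)"
  proof (rule isoI)
    show "f \<in> hom K4 (G\<lparr>carrier := generate G {x, y}\<rparr>)"
    proof (rule homI)
      fix u assume "u \<in> carrier K4"
      thus "f u \<in> carrier (G\<lparr>carrier := generate G {x, y}\<rparr>)" unfolding car gen using f by auto
    next
      fix u v assume "u \<in> carrier K4" "v \<in> carrier K4"
      thus "f (u \<otimes>\<^bsub>K4\<^esub> v) = f u \<otimes>\<^bsub>G\<lparr>carrier := generate G {x, y}\<rparr>\<^esub> f v" unfolding car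
        by (elim insertE emptyE) (simp_all add: K4_def f a b xx yy xy c[symmetric])
    qed
    show "bij_betw f (carrier K4) (carrier (G\<lparr>carrier := generate G {x, y}\<rparr>))"
      unfolding car gen bij_betw_def using f ne ne' by (auto simp: inj_on_def)
  qed
  hence "K4 \<cong> G\<lparr>carrier := generate G {x, y}\<rparr>" by (rule is_isoI)
  thus ?thesis by (rule group.iso_sym[OF \<open>group K4\<close>])
qed

lemma group_SL3: "group SL3"
proof (rule groupI)
  fix A :: "complex^3^3" assume "A \<in> carrier SL3"
  hence A: "det A = 1" by (simp add: SL3_def)
  hence "invertible A" by (simp add: invertible_det_nz)
  then obtain A' where A': "A' ** A = Finite_Cartesian_Product.mat 1" unfolding invertible_def by blast
  have "det A' * det A = 1" unfolding det_mul[symmetric] A' by simp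
  hence "det A' = 1" using A by simp
  thus "\<exists>A'\<in>carrier SL3. A' \<otimes>\<^bsub>SL3\<^esub> A = \<one>\<^bsub>SL3\<^esub>" using A' by (auto simp: SL3_def)
qed (auto simp: SL3_def det_mul matrix_mul_assoc)

definition diagm :: "(3 \<Rightarrow> complex) \<Rightarrow> complex^3^3" where
  "diagm v = (\<chi> i j. if i = j then v i else 0)"

lemma diagm_mult: "diagm v ** diagm w = diagm (\<lambda>i. v i * w i)"
  by (simp add: diagm_def matrix_matrix_mult_def Finite_Cartesian_Product.vec_eq_iff forall_3 sum_3)

lemma det_diagm: "det (diagm v) = v 1 * v 2 * v 3"
  by (simp add: diagm_def det_3)

lemma diagm_1: "diagm (\<lambda>_. 1) = Finite_Cartesian_Product.mat 1"
  by (simp add: diagm_def Finite_Cartesian_Product.mat_def)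

lemma diagm_eq_iff: "diagm v = diagm w \<longleftrightarrow> v = w"
proof
  assume "diagm v = diagm w"
  hence "diagm v $h i $h i = diagm w $h i $h i" for i by simp
  thus "v = w" by (auto simp: diagm_def)
qed simp

lemma vector_mult_diagm: "(\<chi> k. y k) v* diagm a = (\<chi> k. a k * y k)"
  by (simp add: diagm_def vector_matrix_mult_def Finite_Cartesian_Product.vec_eq_iff forall_3 sum_3)

lemma diagm_in_SU3:
  assumes "\<And>i. v i \<in> {1, - 1}" "v 1 * v 2 * v 3 = 1"
  shows "diagm v \<in> SU3"
proof -
  have "cnj (v i) * v i = 1" for i using assms(1)[of i] by auto
  hence "(\<chi> i j. cnj (diagm v $h j $h i)) ** diagm v = Finite_Cartesian_Product.mat 1"
    by (simp add: diagm_def matrix_matrix_mult_def Finite_Cartesian_Product.vec_eq_iff forall_3 sum_3 Finite_Cartesian_Product.mat_def)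
  thus ?thesis using assms(2) by (simp add: SU3_def det_diagm)
qed

text \<open>The pairs \<open>(sgn1 k, sgn2 k)\<close> run through the three nontrivial sign
  characters of the lattice. The entries of each function multiply to 1, which puts the diagonal
  matrices into the special linear group.\<close>

definition sgn1 :: "3 \<Rightarrow> complex" where "sgn1 k = (if k = 1 then 1 else - 1)"
definition sgn2 :: "3 \<Rightarrow> complex" where "sgn2 k = (if k = 2 then 1 else - 1)"

lemma sgn_relations:
  "(\<lambda>i. sgn1 i * sgn1 i) = (\<lambda>_. 1)" "(\<lambda>i. sgn2 i * sgn2 i) = (\<lambda>_. 1)" "sgn1 1 * sgn1 2 * sgn1 3 = 1" "sgn2 1 * sgn2 2 * sgn2 3 = 1"
  "sgn1 \<noteq> (\<lambda>_. 1)" "sgn2 \<noteq> (\<lambda>_. 1)" "sgn1 \<noteq> sgn2" "(\<lambda>i. sgn1 i * sgn2 i) = (\<lambda>i. sgn2 i * sgn1 i)"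
  "sgn1 i \<in> {1, - 1}" "sgn2 i \<in> {1, - 1}"
  by (auto simp: sgn1_def sgn2_def fun_eq_iff forall_3)

section \<open>Bases of solutions and their monodromy matrices\<close>

context weierstrass_lattice
begin

lemma vanish_if_eventually:
  assumes f: "f holomorphic_on - L" "\<forall>\<^sub>F z in at 0. f z = 0" and z: "z \<notin> L"
  shows "f z = 0"
proof -
  obtain d where d: "d > 0" "\<And>z. z \<noteq> 0 \<Longrightarrow> dist z 0 < d \<Longrightarrow> f z = 0" using f(2) unfolding eventually_at by blast
  obtain r where r: "r > 0" "ball 0 r \<inter> L = {0}" using lattice_gap by blast
  show ?thesis
  proof (rule analytic_continuation_open[of "- L \<inter> ball 0 d" "- L" f "\<lambda>_. 0"])
    define p where "p = complex_of_real (min d r / 2)"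
    have p: "p \<noteq> 0" "norm p < d" "norm p < r" using d(1) r(1) by (auto simp: p_def)
    hence "p \<notin> L" using r(2) by (auto simp: set_eq_iff)
    thus "- L \<inter> ball 0 d \<noteq> {}" using p by auto
    show "f w = 0" if "w \<in> - L \<inter> ball 0 d" for w
      using that by (intro d(2)) auto
  qed (use f z open_compl_lattice connected_compl_lattice in auto)
qed

lemma vanish_on_compl_lattice:
  assumes S: "open S" "S \<noteq> {}" "S \<subseteq> - L" and f: "f holomorphic_on - L" "\<And>z. z \<in> S \<Longrightarrow> f z = 0" and z: "z \<notin> L"
  shows "f z = 0"
  by (rule analytic_continuation_open[of S "- L" f "\<lambda>_. 0"])
    (use assms open_compl_lattice connected_compl_lattice in auto)

lemma global_solution_holomorphic: "global_solution \<tau> n l B f \<Longrightarrow> f holomorphic_on - L"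
  by (simp add: global_solution_def solution_on_def)

lemma solution_basisI:
  assumes y: "\<And>k. global_solution \<tau> n l B (y k)"
    and indep: "\<And>c. \<forall>z\<in>- L. (\<Sum>k\<in>UNIV. c k * y k z) = 0 \<Longrightarrow> \<forall>k. c k = 0"
  shows "solution_basis \<tau> n l B y"
  unfolding solution_basis_def
proof (intro conjI allI impI)
  show "global_solution \<tau> n l B (y k)" for k by (rule y)
  show "c k = 0" if "\<forall>z\<in>- L. (\<Sum>k\<in>UNIV. c k * y k z) = 0" for c k using indep[OF that] by blast
  show "\<exists>c. \<forall>z\<in>- L. f z = (\<Sum>k\<in>UNIV. c k * y k z)" if "global_solution \<tau> n l B f" for f
  proof -
    have ne: "- L \<noteq> {}" using one_half_not_lattice by blast
    have ys: "solution_on \<tau> n l B (- L) (y k)" for k using y[of k] by (simp add: global_solution_def)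
    have fs: "solution_on \<tau> n l B (- L) f" using that by (simp add: global_solution_def)
    show ?thesis by (rule solutions_span[OF open_compl_lattice connected_compl_lattice ne wp_holomorphic ys indep fs])
  qed
qed

text \<open>Independence survives restriction to the slit disc by analytic continuation. So every
  local solution is a combination of the global ones and extends meromorphically, whatever happens
  at the third exponent.\<close>

lemma solution_basis_imp_apparent:
  assumes "solution_basis \<tau> n l B y"
  shows "apparent \<tau> n l B"
proof -
  obtain r where r: "r > 0" "ball 0 r \<inter> L = {0}" using lattice_gap by blast
  define S where "S = ball 0 r - (\<real>\<^sub>\<le>\<^sub>0 :: complex set)"
  have S: "open S" "connected S" "S \<subseteq> - L" unfolding S_def
    by (rule open_slit_ball, rule connected_slit_ball[OF r(1)], rule slit_ball_subset[OF r(2)])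
  have "of_real (r / 2) \<in> S" unfolding S_def by (rule of_real_in_slit_ball) (use r in auto)
  hence S0: "S \<noteq> {}" by blast
  have y: "\<And>k. global_solution \<tau> n l B (y k)" "\<And>c. \<forall>z\<in>- L. (\<Sum>k\<in>UNIV. c k * y k z) = 0 \<Longrightarrow> \<forall>k. c k = 0"
    using assms unfolding solution_basis_def by blast+
  have ys: "solution_on \<tau> n l B S (y k)" for k
    using y(1) S(3) by (auto simp: global_solution_def intro: solution_on_subset)
  have "\<exists>f. f meromorphic_on ball 0 r \<and> (\<forall>z\<in>S. f z = u z)" if u: "solution_on \<tau> n l B S u" for u
  proof -
    have ind: "\<forall>k. c k = 0" if "\<forall>z\<in>S. (\<Sum>k\<in>UNIV. c k * y k z) = 0" for c
    proof (rule y(2), rule ballI)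
      fix z assume "z \<in> - L"
      show "(\<Sum>k\<in>UNIV. c k * y k z) = 0"
      proof (rule vanish_on_compl_lattice[OF S(1) S0 S(3), where f = "\<lambda>z. \<Sum>k\<in>UNIV. c k * y k z" and z = z])
        show "(\<lambda>z. \<Sum>k\<in>UNIV. c k * y k z) holomorphic_on - L"
          by (intro holomorphic_intros global_solution_holomorphic[OF y(1)])
      qed (use that \<open>z \<in> - L\<close> in auto)
    qed
    obtain c where c: "\<forall>z\<in>S. u z = (\<Sum>k\<in>UNIV. c k * y k z)"
      using solutions_span[where y = y and f = u, OF S(1,2) S0 holomorphic_on_subset[OF wp_holomorphic S(3)] ys ind u] by blast
    have "y k meromorphic_on ball 0 r" for k
      using y(1)[of k] unfolding global_solution_def by (auto intro: meromorphic_on_subset)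
    hence "(\<lambda>z. \<Sum>k\<in>UNIV. c k * y k z) meromorphic_on ball 0 r" by (intro meromorphic_intros)
    thus ?thesis using c by force
  qed
  thus ?thesis unfolding apparent_def using r unfolding S_def by blast
qed

lemma quasi_nonzero:
  assumes "quasi_elliptic \<tau> a b e y Y" "Y \<noteq> 0"
  shows "\<exists>z. z \<notin> L \<and> y z \<noteq> 0"
proof (rule ccontr)
  assume "\<not> ?thesis"
  hence "\<forall>\<^sub>F z in at 0. y z = 0" using eventually_not_lattice by (auto elim: eventually_mono)
  thus False using assms has_laurent_expansion_eventually_zero_iff[of y 0 Y] by (simp add: quasi_elliptic_def)
qed

text \<open>Functions with different characters are independent: a linear relation, combined with
  its shifts by the two periods, isolates each term.\<close>

lemma solution_basis_even_l:
  assumes "odd n" "even l" "poly (frobP n l wu wv) B = 0"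
  obtains y where "solution_basis \<tau> n l B y"
    "\<And>k z. z \<notin> L \<Longrightarrow> y k (z + 1) = sgn1 k * y k z" "\<And>k z. z \<notin> L \<Longrightarrow> y k (z + \<tau>) = sgn2 k * y k z"
proof -
  have "\<exists>y Y. global_solution \<tau> n l B y \<and> quasi_elliptic \<tau> (sgn1 k) (sgn2 k) (- 1) y Y \<and> Y \<noteq> 0" for k
    by (rule solution_even_l[OF assms sgn_relations(9,10)]) (auto simp: sgn1_def sgn2_def)
  then obtain y Y where y: "\<And>k. global_solution \<tau> n l B (y k)" "\<And>k. quasi_elliptic \<tau> (sgn1 k) (sgn2 k) (- 1) (y k) (Y k)" "\<And>k. Y k \<noteq> 0"
    by metis
  have sh: "y k (z + 1) = sgn1 k * y k z" "y k (z + \<tau>) = sgn2 k * y k z" if "z \<notin> L" for k z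
    using y(2)[of k] that by (simp_all add: quasi_elliptic_def)
  have "solution_basis \<tau> n l B y"
  proof (rule solution_basisI[OF y(1)])
    fix c assume c: "\<forall>z\<in>- L. (\<Sum>k\<in>UNIV. c k * y k z) = 0"
    have "c 1 * y 1 z = 0 \<and> c 2 * y 2 z = 0 \<and> c 3 * y 3 z = 0" if z: "z \<notin> L" for z
    proof -
      have e: "c 1 * y 1 w + c 2 * y 2 w + c 3 * y 3 w = 0" if "w \<notin> L" for w
        using c that by (simp add: sum_3)
      have "c 1 * y 1 z - c 2 * y 2 z - c 3 * y 3 z = 0" "- (c 1 * y 1 z) + c 2 * y 2 z - c 3 * y 3 z = 0"
        using e[of "z + 1"] e[of "z + \<tau>"] z by (simp_all add: sh[OF z] sgn1_def sgn2_def)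
      with e[OF z] show ?thesis by (auto simp: add_eq_0_iff)
    qed
    note comb = this
    have nz: "\<exists>z. z \<notin> L \<and> y k z \<noteq> 0" for k by (rule quasi_nonzero[OF y(2,3)])
    have "c 1 = 0" using nz[of 1] comb by auto
    moreover have "c 2 = 0" using nz[of 2] comb by auto
    moreover have "c 3 = 0" using nz[of 3] comb by auto
    ultimately show "\<forall>k. c k = 0" by (simp add: forall_3)
  qed
  thus thesis using sh that by blast
qed

lemma solution_basis_row_eq:
  assumes y: "solution_basis \<tau> n l B y"
    and eq: "\<And>z. z \<notin> L \<Longrightarrow> (\<chi> k. y k z) v* M = (\<chi> k. y k z) v* M'"
  shows "M = M'"
proof -
  have "M $h k $h j = M' $h k $h j" for j k
  proof -
    have "(\<Sum>k\<in>UNIV. (M $h k $h j - M' $h k $h j) * y k z) = 0" if "z \<in> - L" for z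
    proof -
      have "((\<chi> k. y k z) v* M) $h j = ((\<chi> k. y k z) v* M') $h j" using eq[of z] that by simp
      hence "(\<Sum>k\<in>UNIV. y k z * M $h k $h j) = (\<Sum>k\<in>UNIV. y k z * M' $h k $h j)" by (simp add: vector_matrix_mult_def)
      moreover have "(\<Sum>k\<in>UNIV. (M $h k $h j - M' $h k $h j) * y k z)
          = (\<Sum>k\<in>UNIV. y k z * M $h k $h j) - (\<Sum>k\<in>UNIV. y k z * M' $h k $h j)"
        unfolding sum_subtractf[symmetric] by (rule sum.cong) (simp_all add: algebra_simps)
      ultimately show ?thesis by simp
    qed
    hence "\<forall>z\<in>- L. (\<Sum>k\<in>UNIV. (M $h k $h j - M' $h k $h j) * y k z) = 0" by blast
    hence "\<forall>k. M $h k $h j - M' $h k $h j = 0"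
      using y unfolding solution_basis_def by (elim conjE allE[of _ "\<lambda>k. M $h k $h j - M' $h k $h j"] impE) auto
    thus ?thesis by simp
  qed
  thus ?thesis by (simp add: Finite_Cartesian_Product.vec_eq_iff)
qed

lemma solution_basis_change:
  assumes \<eta>: "solution_basis \<tau> n l B \<eta>" and y: "solution_basis \<tau> n l B y"
  obtains C C' where "\<And>z. z \<notin> L \<Longrightarrow> (\<chi> k. y k z) = (\<chi> k. \<eta> k z) v* C"
    "C ** C' = Finite_Cartesian_Product.mat 1" "C' ** C = Finite_Cartesian_Product.mat 1"
proof -
  have ex: "\<exists>C. \<forall>z. z \<notin> L \<longrightarrow> (\<chi> k. y k z) = (\<chi> k. \<eta> k z) v* C"
    if \<eta>: "solution_basis \<tau> n l B \<eta>" and y: "solution_basis \<tau> n l B y" for \<eta> y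
  proof -
    have "\<exists>c. \<forall>z\<in>- L. y k z = (\<Sum>j\<in>UNIV. c j * \<eta> j z)" for k
      using y \<eta> unfolding solution_basis_def by blast
    then obtain c where c: "\<And>k z. z \<notin> L \<Longrightarrow> y k z = (\<Sum>j\<in>UNIV. c k j * \<eta> j z)" by (metis ComplI)
    show ?thesis
      by (rule exI[of _ "\<chi> j k. c k j"])
        (simp add: Finite_Cartesian_Product.vec_eq_iff vector_matrix_mult_def c mult.commute)
  qed
  obtain C where C: "\<And>z. z \<notin> L \<Longrightarrow> (\<chi> k. y k z) = (\<chi> k. \<eta> k z) v* C" using ex[OF \<eta> y] by blast
  obtain C' where C': "\<And>z. z \<notin> L \<Longrightarrow> (\<chi> k. \<eta> k z) = (\<chi> k. y k z) v* C'" using ex[OF y \<eta>] by blast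
  have "C ** C' = Finite_Cartesian_Product.mat 1"
    by (rule solution_basis_row_eq[OF \<eta>]) (simp add: vector_matrix_mul_assoc[symmetric] C[symmetric] C'[symmetric])
  moreover from this have "C' ** C = Finite_Cartesian_Product.mat 1" by (simp add: matrix_left_right_inverse)
  ultimately show thesis using that C by blast
qed

lemma monodromy_even_l:
  assumes "odd n" "even l" "poly (frobP n l wu wv) B = 0"
  shows "monodromy_group_is_K4 \<tau> n l B" "unitary_monodromy \<tau> n l B"
proof -
  interpret S: group SL3 by (rule group_SL3)
  obtain \<eta> where \<eta>: "solution_basis \<tau> n l B \<eta>"
    "\<And>k z. z \<notin> L \<Longrightarrow> \<eta> k (z + 1) = sgn1 k * \<eta> k z" "\<And>k z. z \<notin> L \<Longrightarrow> \<eta> k (z + \<tau>) = sgn2 k * \<eta> k z"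
  proof -
    assume *: "\<And>\<eta>. solution_basis \<tau> n l B \<eta> \<Longrightarrow> (\<And>k z. z \<notin> L \<Longrightarrow> \<eta> k (z + 1) = sgn1 k * \<eta> k z) \<Longrightarrow>
      (\<And>k z. z \<notin> L \<Longrightarrow> \<eta> k (z + \<tau>) = sgn2 k * \<eta> k z) \<Longrightarrow> thesis"
    show thesis by (rule solution_basis_even_l[OF assms]) (rule *)
  qed
  define D1 where "D1 = diagm sgn1"
  define D2 where "D2 = diagm sgn2"
  have D: "D1 ** D1 = Finite_Cartesian_Product.mat 1" "D2 ** D2 = Finite_Cartesian_Product.mat 1" "D1 ** D2 = D2 ** D1"
    "det D1 = 1" "det D2 = 1" "D1 \<noteq> Finite_Cartesian_Product.mat 1" "D2 \<noteq> Finite_Cartesian_Product.mat 1" "D1 \<noteq> D2"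
    unfolding D1_def D2_def diagm_mult det_diagm diagm_1[symmetric] diagm_eq_iff by (fact sgn_relations)+
  have mono: "monodromy_matrix \<tau> \<eta> 1 D1" "monodromy_matrix \<tau> \<eta> \<tau> D2"
    unfolding monodromy_matrix_def D1_def D2_def vector_mult_diagm using \<eta>(2,3) by simp_all
  have mm: "monodromy_matrices \<tau> n l B D1 D2"
    unfolding monodromy_matrices_def using solution_basis_imp_apparent[OF \<eta>(1)] \<eta>(1) mono by blast
  have "carrier (monodromy_group D1 D2) = {Finite_Cartesian_Product.mat 1, D1, D2, D1 ** D2}"
    unfolding monodromy_group_def using S.generate_involutions[of D1 D2] D by (simp add: SL3_def)
  also have "\<dots> \<subseteq> SU3"
  proof -
    have "diagm (\<lambda>_. 1) \<in> SU3" "diagm sgn1 \<in> SU3" "diagm sgn2 \<in> SU3"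
      by (rule diagm_in_SU3; use sgn_relations in auto)+
    moreover have "sgn1 i * sgn2 i \<in> {1, - 1}" for i using sgn_relations(9)[of i] sgn_relations(10)[of i] by auto
    hence "diagm (\<lambda>i. sgn1 i * sgn2 i) \<in> SU3" by (rule diagm_in_SU3) (simp add: sgn1_def sgn2_def)
    ultimately show ?thesis unfolding D1_def D2_def diagm_mult diagm_1[symmetric] by blast
  qed
  finally show "unitary_monodromy \<tau> n l B" unfolding unitary_monodromy_def using mm by blast
  have "{N1, N2} \<subseteq> carrier SL3 \<and> monodromy_group N1 N2 \<cong> K4" if N: "monodromy_matrices \<tau> n l B N1 N2" for N1 N2
  proof -
    obtain y where y: "solution_basis \<tau> n l B y" "monodromy_matrix \<tau> y 1 N1" "monodromy_matrix \<tau> y \<tau> N2"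
      using N unfolding monodromy_matrices_def by blast
    obtain C C' where C: "\<And>z. z \<notin> L \<Longrightarrow> (\<chi> k. y k z) = (\<chi> k. \<eta> k z) v* C"
      "C ** C' = Finite_Cartesian_Product.mat 1" "C' ** C = Finite_Cartesian_Product.mat 1"
      using solution_basis_change[OF \<eta>(1) y(1)] by blast
    \<comment> \<open>A change of basis conjugates the monodromy matrices, so the relations verified
      for the diagonal ones carry over to every choice of basis.\<close>
    have conj: "N = C' ** D ** C" if N: "monodromy_matrix \<tau> y v N" and D: "monodromy_matrix \<tau> \<eta> v D" and v: "v \<in> L" for N D v
    proof -
      have "D ** C = C ** N"
      proof (rule solution_basis_row_eq[OF \<eta>(1)])
        fix z assume z: "z \<notin> L"
        have "(\<chi> k. \<eta> k z) v* (C ** N) = (\<chi> k. y k (z + v))"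
          using N z by (simp add: vector_matrix_mul_assoc[symmetric] C(1)[symmetric] monodromy_matrix_def)
        also have "\<dots> = (\<chi> k. \<eta> k (z + v)) v* C" by (rule C(1)) (use z v in simp)
        also have "\<dots> = (\<chi> k. \<eta> k z) v* (D ** C)"
          using D z by (simp add: vector_matrix_mul_assoc[symmetric] monodromy_matrix_def)
        finally show "(\<chi> k. \<eta> k z) v* (D ** C) = (\<chi> k. \<eta> k z) v* (C ** N)" by simp
      qed
      hence "C' ** D ** C = (C' ** C) ** N" by (simp add: matrix_mul_assoc[symmetric])
      thus ?thesis using C(3) by simp
    qed
    have N12: "N1 = C' ** D1 ** C" "N2 = C' ** D2 ** C"
      using conj[OF y(2) mono(1)] conj[OF y(3) mono(2)] by simp_all
    have cm: "(C' ** X ** C) ** (C' ** X' ** C) = C' ** (X ** X') ** C" for X X'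
    proof -
      have "(C' ** X ** C) ** (C' ** X' ** C) = C' ** X ** (C ** C') ** X' ** C" by (simp only: matrix_mul_assoc)
      also have "\<dots> = C' ** (X ** X') ** C" unfolding C(2) by (simp add: matrix_mul_assoc)
      finally show ?thesis .
    qed
    have inj: "X = X'" if "C' ** X ** C = C' ** X' ** C" for X X'
    proof -
      have "C ** (C' ** X ** C) ** C' = C ** (C' ** X' ** C) ** C'" using that by simp
      moreover have "C ** (C' ** Z ** C) ** C' = (C ** C') ** Z ** (C ** C')" for Z by (simp only: matrix_mul_assoc)
      ultimately show ?thesis unfolding C(2) by simp
    qed
    have c1: "C' ** Finite_Cartesian_Product.mat 1 ** C = Finite_Cartesian_Product.mat 1" using C(3) by simp
    have "det C' * det C = 1" unfolding det_mul[symmetric] C(3) by simp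
    hence "det N1 = 1" "det N2 = 1" unfolding N12 by (simp_all add: det_mul D)
    hence carr: "N1 \<in> carrier SL3" "N2 \<in> carrier SL3" by (simp_all add: SL3_def)
    have "SL3\<lparr>carrier := generate SL3 {N1, N2}\<rparr> \<cong> K4"
    proof (rule S.generate_involutions_iso_K4[OF carr])
      show "N1 \<otimes>\<^bsub>SL3\<^esub> N1 = \<one>\<^bsub>SL3\<^esub>" "N2 \<otimes>\<^bsub>SL3\<^esub> N2 = \<one>\<^bsub>SL3\<^esub>" "N1 \<otimes>\<^bsub>SL3\<^esub> N2 = N2 \<otimes>\<^bsub>SL3\<^esub> N1"
        using c1 by (simp_all add: SL3_def N12 cm D)
      show "N1 \<noteq> \<one>\<^bsub>SL3\<^esub>" "N2 \<noteq> \<one>\<^bsub>SL3\<^esub>" "N1 \<noteq> N2"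
        using inj[of D1 "Finite_Cartesian_Product.mat 1"] inj[of D2 "Finite_Cartesian_Product.mat 1"] inj[of D1 D2] c1 D(6-8)
        by (auto simp: SL3_def N12)
    qed
    thus ?thesis using carr by (simp add: monodromy_group_def)
  qed
  thus "monodromy_group_is_K4 \<tau> n l B" unfolding monodromy_group_is_K4_def using mm by blast
qed

end

lemma holomorphic_extend_laurent:
  assumes "r > 0" and g: "g holomorphic_on ball 0 r - {0}" "g has_laurent_expansion G" and G: "fls_subdegree G \<ge> 0"
  obtains h where "h holomorphic_on ball 0 r" "\<And>z. z \<in> ball 0 r - {0} \<Longrightarrow> h z = g z"
proof -
  have "g \<midarrow>0\<rightarrow> G $$ 0" using has_laurent_expansion_imp_tendsto_0[OF g(2)] G by simp
  hence "\<forall>\<^sub>F z in at 0. norm (g z - G $$ 0) < 1"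
    using tendstoD[of g "G $$ 0" "at 0" 1] by (simp add: dist_norm)
  hence "\<forall>\<^sub>F z in at 0. norm (g z) \<le> norm (G $$ 0) + 1"
  proof eventually_elim
    case (elim z)
    have "norm (g z) \<le> norm (G $$ 0) + norm (g z - G $$ 0)" by (rule norm_triangle_sub)
    thus ?case using elim by simp
  qed
  thus thesis using holomorphic_on_extend_bounded[OF g(1)] assms(1) that by auto
qed

lemma fls_subdegree_divide:
  fixes f g :: "complex fls"
  assumes "f \<noteq> 0" "g \<noteq> 0"
  shows "fls_subdegree (f / g) = fls_subdegree f - fls_subdegree g"
proof -
  have "f / g \<noteq> 0" using assms by simp
  hence "fls_subdegree (f / g * g) = fls_subdegree (f / g) + fls_subdegree g" using assms(2) by (rule fls_subdegree_mult)
  moreover have "f / g * g = f" using assms(2) by simp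
  ultimately show ?thesis by simp
qed

text \<open>Abel's identity: the equation has no second-derivative term, so the Wronskian of three
  solutions has derivative zero. \<open>A\<close> and \<open>C\<close> stand for
  \<open>alpha * wp + B\<close> and \<open>beta * deriv wp\<close>; the arrangement of the terms is
  the one produced by the product rule.\<close>

lemma wronskian_identity:
  fixes A C a0 a1 a2 b0 b1 b2 u0 u1 u2 :: complex
  shows "(A * u1 - C * u0) * (a0 * b1 - a1 * b0) + (a1 * b1 + b2 * a0 - (a2 * b0 + b1 * a1)) * u2
    - (u2 * (a0 * b2 - a2 * b0) + (a1 * b2 + (A * b1 - C * b0) * a0 - ((A * a1 - C * a0) * b0 + b1 * a2)) * u1)
    + (u1 * (a1 * b2 - a2 * b1) + (a2 * b2 + (A * b1 - C * b0) * a1 - ((A * a1 - C * a0) * b1 + b2 * a2)) * u0) = 0"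
  by (simp add: algebra_simps)

lemma unitary_inner:
  fixes N :: "complex^3^3"
  assumes "(\<chi> i j. cnj (N $h j $h i)) ** N = Finite_Cartesian_Product.mat 1"
  shows "(\<Sum>i\<in>UNIV. cnj ((N *v x) $h i) * (N *v w) $h i) = (\<Sum>i\<in>UNIV. cnj (x $h i) * w $h i)"
proof -
  define M where "M = (\<chi> i j. cnj (N $h j $h i))"
  have "(\<Sum>i\<in>UNIV. cnj ((N *v x) $h i) * u $h i) = (\<Sum>i\<in>UNIV. cnj (x $h i) * (M *v u) $h i)" for u
    by (simp add: M_def matrix_vector_mult_def sum_3 algebra_simps)
  from this[of "N *v w"] have "(\<Sum>i\<in>UNIV. cnj ((N *v x) $h i) * (N *v w) $h i) = (\<Sum>i\<in>UNIV. cnj (x $h i) * (M *v (N *v w)) $h i)" .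
  moreover have "M *v (N *v w) = w" using assms unfolding M_def by (simp add: matrix_vector_mul_assoc)
  ultimately show ?thesis by simp
qed

text \<open>A unitary matrix has no nontrivial Jordan block: invariance of the inner product of
  \<open>d\<close> and \<open>c\<close> gives that of \<open>d\<close> with itself the value
  zero.\<close>

lemma unitary_unipotent:
  fixes N :: "complex^3^3"
  assumes N: "(\<chi> i j. cnj (N $h j $h i)) ** N = Finite_Cartesian_Product.mat 1"
    and c: "N *v c = c + d" and d: "N *v d = d"
  shows "d = 0"
proof -
  have "(\<Sum>i\<in>UNIV. cnj (d $h i) * (c + d) $h i) = (\<Sum>i\<in>UNIV. cnj (d $h i) * c $h i)"
    using unitary_inner[OF N, of d c] unfolding c d .
  hence "(\<Sum>i\<in>UNIV. cnj (d $h i) * d $h i) = 0" by (simp add: distrib_left sum.distrib)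
  moreover have "cnj w * w = of_real ((norm w)\<^sup>2)" for w :: complex
    by (subst mult.commute) (rule complex_norm_square[symmetric])
  ultimately have "complex_of_real (\<Sum>i\<in>UNIV. (norm (d $h i))\<^sup>2) = 0" by simp
  hence "(\<Sum>i\<in>UNIV. (norm (d $h i))\<^sup>2) = 0" by (simp only: of_real_eq_0_iff)
  hence "\<forall>i. d $h i = 0" by (subst (asm) sum_nonneg_eq_0_iff) auto
  thus ?thesis by (simp add: Finite_Cartesian_Product.vec_eq_iff)
qed

section \<open>Odd \<open>l\<close>: reduction to quadratures and failure of unitarity\<close>

context weierstrass_lattice
begin

lemma global_solution_lincomb:
  assumes "global_solution \<tau> n l B f" "global_solution \<tau> n l B g"
  shows "global_solution \<tau> n l B (\<lambda>z. a * f z + b * g z)"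
  using assms open_compl_lattice unfolding global_solution_def
  by (auto intro!: solution_on_add solution_on_cmult meromorphic_intros)

lemma global_solution_shift:
  assumes f: "global_solution \<tau> n l B f" and v: "v \<in> {1, \<tau>}"
  shows "global_solution \<tau> n l B (\<lambda>z. f (z + v))"
proof -
  have "(\<lambda>z. f (z + v)) meromorphic_on UNIV"
    by (rule meromorphic_on_compose[of f UNIV]) (use f in \<open>auto simp: global_solution_def intro!: analytic_intros\<close>)
  moreover have "solution_on \<tau> n l B (- L) (\<lambda>z. f (z + v))"
    by (rule solution_on_compose_shift[OF open_compl_lattice _ open_compl_lattice])
      (use f v wp_1 wp_tau in \<open>auto simp: global_solution_def\<close>)
  ultimately show ?thesis by (simp add: global_solution_def)
qed

lemma global_solution_uminus:
  assumes f: "global_solution \<tau> n l B f"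
  shows "global_solution \<tau> n l B (\<lambda>z. f (- z))"
proof -
  have "(\<lambda>z. f (- z)) meromorphic_on UNIV"
    by (rule meromorphic_on_compose[of f UNIV]) (use f in \<open>auto simp: global_solution_def intro!: analytic_intros\<close>)
  moreover have "solution_on \<tau> n l B (- L) (\<lambda>z. f (- z))"
    by (rule solution_on_compose_uminus[OF open_compl_lattice])
      (use f wp_uminus wp_holomorphic in \<open>auto simp: global_solution_def\<close>)
  ultimately show ?thesis by (simp add: global_solution_def)
qed

lemma global_solution_laurent:
  assumes "global_solution \<tau> n l B f"
  obtains F where "f has_laurent_expansion F" "Dop n l B (wpF wu wv) F = 0"
proof -
  have "(\<lambda>w. f (0 + w)) has_laurent_expansion laurent_expansion f 0"
    using assms unfolding global_solution_def meromorphic_on_def' by blast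
  hence F: "f has_laurent_expansion laurent_expansion f 0" by simp
  obtain r where r: "r > 0" "ball 0 r \<inter> L = {0}" using lattice_gap by blast
  have "Dop n l B (wpF wu wv) (laurent_expansion f 0) = 0"
  proof (rule Dop_eq_0[OF F _ r(1)])
    show "solution_on \<tau> n l B (- L) f" using assms by (simp add: global_solution_def)
    fix x :: real assume x: "0 < x" "x < r"
    hence "of_real x \<in> ball 0 r - (\<real>\<^sub>\<le>\<^sub>0 :: complex set)" by (rule of_real_in_slit_ball)
    thus "of_real x \<in> - L" using slit_ball_subset[OF r(2)] by blast
  qed
  with F that show thesis by blast
qed

lemma global_solution_eq_0:
  assumes f: "global_solution \<tau> n l B f" and F: "f has_laurent_expansion F"
    and c: "F $$ (- int (n + l)) = 0" "F $$ (1 - int l) = 0" "F $$ int (n + 2 * l + 2) = 0" and z: "z \<notin> L"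
  shows "f z = 0"
proof -
  obtain F' where F': "f has_laurent_expansion F'" "Dop n l B (wpF wu wv) F' = 0" using global_solution_laurent[OF f] .
  have "F' = F" using F F'(1) has_laurent_expansion_unique by blast
  hence "F = 0" using solution_eq_0I[OF _ c] F'(2) by blast
  hence "\<forall>\<^sub>F z in at 0. f z = 0" using F has_laurent_expansion_eventually_zero_iff[of f 0 F] by simp
  thus ?thesis by (rule vanish_if_eventually[OF global_solution_holomorphic[OF f] _ z])
qed

lemma laurent_parity_lattice:
  assumes "f has_laurent_expansion F" "\<And>z. z \<notin> L \<Longrightarrow> f (- z) = (- 1) ^ m * f z" "odd (k + int m)"
  shows "F $$ k = 0"
  by (rule laurent_parity[OF assms(1) _ assms(3)])
    (use eventually_not_lattice assms(2) in \<open>auto elim: eventually_mono\<close>)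

text \<open>Variation of constants: the two known solutions reduce the equation to quadratures, and the integrands
  extend holomorphically over the origin.\<close>
lemma apparent_odd_l:
  assumes "odd n" "odd l" "poly (frobP n l wu wv) B = 0"
  shows "apparent \<tau> n l B"
proof -
  obtain y0 Y0 y1 Y1 where y0: "global_solution \<tau> n l B y0" "quasi_elliptic \<tau> 1 1 1 y0 Y0" "Y0 \<noteq> 0" "fls_subdegree Y0 = - int (n + l)"
    and y1: "global_solution \<tau> n l B y1" "quasi_elliptic \<tau> 1 1 1 y1 Y1" "Y1 \<noteq> 0" "fls_subdegree Y1 = 1 - int l"
    using solutions_odd_l[OF assms] by blast
  have hol: "y0 holomorphic_on - L" "y1 holomorphic_on - L"
    using y0(1) y1(1) by (simp_all add: global_solution_holomorphic)
  have lau: "y0 has_laurent_expansion Y0" "y1 has_laurent_expansion Y1" using y0(2) y1(2) by (simp_all add: quasi_elliptic_def)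
  define W where "W z = y0 z * deriv y1 z - deriv y0 z * y1 z" for z
  define WF where "WF = Y0 * fls_deriv Y1 - fls_deriv Y0 * Y1"
  have W: "W has_laurent_expansion WF" unfolding W_def[abs_def] WF_def by (intro laurent_expansion_intros lau)
  \<comment> \<open>The Wronskian is \<open>Y0^2\<close> times the derivative of the quotient
    \<open>Q\<close>. The order \<open>n + 1\<close> of \<open>Q\<close> is nonzero, so the
    derivative has order exactly \<open>n\<close> and the order of the Wronskian is known.\<close>
  define Q where "Q = Y1 / Y0"
  have Q: "Y1 = Q * Y0" using y0(3) by (simp add: Q_def)
  have Qnz: "Q \<noteq> 0" using Q y1(3) by auto
  have "fls_subdegree Y1 = fls_subdegree Q + fls_subdegree Y0" unfolding Q using Qnz y0(3) by simp
  hence Qs: "fls_subdegree Q = int n + 1" using y0(4) y1(4) by simp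
  have "of_int (fls_subdegree Q) \<noteq> (0 :: complex)" unfolding Qs of_int_eq_0_iff by simp
  hence Qd: "fls_subdegree (fls_deriv Q) = int n" using fls_subdegree_deriv'[of Q] Qs by simp
  have Qdnz: "fls_deriv Q \<noteq> 0" using Qd odd_pos[OF assms(1)] by auto
  have WQ: "WF = (Y0 * Y0) * fls_deriv Q" unfolding WF_def Q by (simp add: algebra_simps)
  have Wnz: "WF \<noteq> 0" unfolding WQ using y0(3) Qdnz by simp
  have Ws: "fls_subdegree WF = - int n - 2 * int l" unfolding WQ using y0(3,4) Qdnz Qd by simp
  have WW: "WF * WF \<noteq> 0" using Wnz by simp
  have W2s: "fls_subdegree (WF * WF) = - 2 * int n - 4 * int l" unfolding fls_subdegree_mult[OF Wnz Wnz] Ws by simp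
  \<comment> \<open>The integrands of the two quadratures have orders \<open>n + 3 * l\<close> and
    \<open>1 + 2 * n + 3 * l\<close>, both nonnegative: no residue, hence no logarithm.\<close>
  have "fls_subdegree (Y0 / (WF * WF)) = int n + 3 * int l"
    unfolding fls_subdegree_divide[OF y0(3) WW] W2s y0(4) by simp
  hence sub0: "fls_subdegree (Y0 / (WF * WF)) \<ge> 0" by simp
  have "fls_subdegree (Y1 / (WF * WF)) = 1 + 2 * int n + 3 * int l"
    unfolding fls_subdegree_divide[OF y1(3) WW] W2s y1(4) by simp
  hence sub1: "fls_subdegree (Y1 / (WF * WF)) \<ge> 0" by simp
  have "\<forall>\<^sub>F z in at 0. W z \<noteq> 0" by (rule has_laurent_expansion_nonzero_imp_eventually_nonzero[OF W Wnz])
  then obtain d where d: "d > 0" "\<And>z. z \<noteq> 0 \<Longrightarrow> dist z 0 < d \<Longrightarrow> W z \<noteq> 0" unfolding eventually_at by blast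
  obtain r0 where r0: "r0 > 0" "ball 0 r0 \<inter> L = {0}" using lattice_gap by blast
  define r where "r = min d r0"
  have r0': "r > 0" using d(1) r0(1) by (simp add: r_def)
  have "ball 0 r \<subseteq> ball (0 :: complex) r0" by (rule subset_ball) (simp add: r_def)
  hence "ball 0 r \<inter> L = {0}" using r0(2) r0' lattice_0 centre_in_ball[of 0 r] by blast
  with r0' have r: "r > 0" "ball 0 r \<inter> L = {0}" by blast+
  have zL: "z \<notin> L" if "z \<in> ball 0 r - {0}" for z using that r(2) by blast
  have Wr: "W z \<noteq> 0" if "z \<in> ball 0 r - {0}" for z
  proof (rule d(2))
    show "z \<noteq> 0" using that by blast
    have "dist 0 z < r" using that by simp
    thus "dist z 0 < d" unfolding r_def by (simp add: dist_commute)
  qed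
  have pun: "ball 0 r - {0} \<subseteq> - L" using zL by blast
  have hp: "y0 holomorphic_on ball 0 r - {0}" "y1 holomorphic_on ball 0 r - {0}"
    using hol pun by (auto intro: holomorphic_on_subset)
  have ob: "open (ball 0 r - {0 :: complex})" by (simp add: open_delete)
  have hW: "W holomorphic_on ball 0 r - {0}"
    unfolding W_def[abs_def] by (intro holomorphic_intros hp holomorphic_deriv ob)
  obtain e0 where e0: "e0 holomorphic_on ball 0 r" "\<And>z. z \<in> ball 0 r - {0} \<Longrightarrow> e0 z = y0 z / (W z * W z)"
  proof (rule holomorphic_extend_laurent[OF r(1) _ _ sub0])
    show "(\<lambda>z. y0 z / (W z * W z)) holomorphic_on ball 0 r - {0}" by (intro holomorphic_intros hp hW) (use Wr in auto)
    show "(\<lambda>z. y0 z / (W z * W z)) has_laurent_expansion Y0 / (WF * WF)" by (intro laurent_expansion_intros lau W)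
  qed auto
  obtain e1 where e1: "e1 holomorphic_on ball 0 r" "\<And>z. z \<in> ball 0 r - {0} \<Longrightarrow> e1 z = y1 z / (W z * W z)"
  proof (rule holomorphic_extend_laurent[OF r(1) _ _ sub1])
    show "(\<lambda>z. y1 z / (W z * W z)) holomorphic_on ball 0 r - {0}" by (intro holomorphic_intros hp hW) (use Wr in auto)
    show "(\<lambda>z. y1 z / (W z * W z)) has_laurent_expansion Y1 / (WF * WF)" by (intro laurent_expansion_intros lau W)
  qed auto
  have prim: "\<exists>E. \<forall>z\<in>ball 0 r. (E has_field_derivative e z) (at z)" if "e holomorphic_on ball 0 r" for e
    using holomorphic_convex_primitive'[OF _ open_ball that] by (metis at_within_open convex_ball open_ball)
  obtain E0 where E0: "\<And>z. z \<in> ball 0 r \<Longrightarrow> (E0 has_field_derivative e0 z) (at z)" using prim[OF e0(1)] by blast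
  obtain E1 where E1: "\<And>z. z \<in> ball 0 r \<Longrightarrow> (E1 has_field_derivative e1 z) (at z)" using prim[OF e1(1)] by blast
  have Emero: "E0 meromorphic_on ball 0 r" "E1 meromorphic_on ball 0 r"
  proof -
    have "E0 holomorphic_on ball 0 r" "E1 holomorphic_on ball 0 r"
      unfolding holomorphic_on_open[OF open_ball] using E0 E1 by blast+
    thus "E0 meromorphic_on ball 0 r" "E1 meromorphic_on ball 0 r"
      by (simp_all add: analytic_on_imp_meromorphic_on analytic_on_open)
  qed
  have ymero: "y0 meromorphic_on ball 0 r" "y1 meromorphic_on ball 0 r"
    using y0(1) y1(1) unfolding global_solution_def by (auto intro: meromorphic_on_subset)
  define S where "S = ball 0 r - (\<real>\<^sub>\<le>\<^sub>0 :: complex set)"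
  have S: "open S" "connected S" "S \<subseteq> - L" unfolding S_def
    by (rule open_slit_ball, rule connected_slit_ball[OF r(1)], rule slit_ball_subset[OF r(2)])
  have Sb: "S \<subseteq> ball 0 r - {0}" unfolding S_def by auto
  have const: "\<exists>c. \<forall>z\<in>S. f z = c" if h0: "\<And>z. z \<in> S \<Longrightarrow> (f has_field_derivative 0) (at z)" for f :: "complex \<Rightarrow> complex"
  proof -
    have cont: "continuous_on S f" using h0 by (intro continuous_at_imp_continuous_on) (auto intro: DERIV_isCont)
    obtain c where "\<And>z. z \<in> S \<Longrightarrow> f z = c"
      by (rule DERIV_zero_connected_constant[OF S(2,1) finite.emptyI cont]) (use h0 in auto)
    thus ?thesis by blast
  qed
  have "\<exists>f. f meromorphic_on ball 0 r \<and> (\<forall>z\<in>S. f z = u z)" if u: "solution_on \<tau> n l B S u" for u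
  proof -
    have jets: "(v has_field_derivative deriv v z) (at z)" "(deriv v has_field_derivative deriv (deriv v) z) (at z)"
      "(deriv (deriv v) has_field_derivative (alpha n l * wp \<tau> z + B) * deriv v z - beta n l * deriv (wp \<tau>) z * v z) (at z)"
      if v: "solution_on \<tau> n l B S v" and z: "z \<in> S" for v z
    proof -
      have h: "v holomorphic_on S" using v by (simp add: solution_on_iff)
      hence h': "deriv v holomorphic_on S" "deriv (deriv v) holomorphic_on S" using S(1) by (auto intro!: holomorphic_deriv)
      show "(v has_field_derivative deriv v z) (at z)" "(deriv v has_field_derivative deriv (deriv v) z) (at z)"
        using holomorphic_derivI[OF h S(1) z] holomorphic_derivI[OF h'(1) S(1) z] by auto
      show "(deriv (deriv v) has_field_derivative (alpha n l * wp \<tau> z + B) * deriv v z - beta n l * deriv (wp \<tau>) z * v z) (at z)"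
        using holomorphic_derivI[OF h'(2) S(1) z] v z by (simp add: solution_on_iff)
    qed
    have s0: "solution_on \<tau> n l B S y0" and s1: "solution_on \<tau> n l B S y1"
      using y0(1) y1(1) S(3) by (auto simp: global_solution_def intro: solution_on_subset)
    \<comment> \<open>The Wronskian of \<open>u\<close>, \<open>y0\<close> and \<open>y1\<close>,
      which is constant. The functions \<open>p\<close> and \<open>q\<close> below are given by
      Cramer's rule: with them as coefficients, \<open>y0\<close> and \<open>y1\<close> reproduce
      both \<open>u\<close> and its derivative.\<close>
    define \<Delta> where "\<Delta> z = deriv (deriv u) z * (y0 z * deriv y1 z - deriv y0 z * y1 z)
        - deriv u z * (y0 z * deriv (deriv y1) z - deriv (deriv y0) z * y1 z)
        + u z * (deriv y0 z * deriv (deriv y1) z - deriv (deriv y0) z * deriv y1 z)" for z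
    define p where "p z = (u z * deriv y1 z - deriv u z * y1 z) / W z" for z
    define q where "q z = (deriv u z * y0 z - u z * deriv y0 z) / W z" for z
    have "(\<Delta> has_field_derivative 0) (at z)" if z: "z \<in> S" for z
    proof -
      note du = jets[OF u z] and d0 = jets[OF s0 z] and d1 = jets[OF s1 z]
      note D = DERIV_add[OF DERIV_diff[OF DERIV_mult[OF du(3) DERIV_diff[OF DERIV_mult[OF d0(1) d1(2)] DERIV_mult[OF d0(2) d1(1)]]]
          DERIV_mult[OF du(2) DERIV_diff[OF DERIV_mult[OF d0(1) d1(3)] DERIV_mult[OF d0(3) d1(1)]]]]
          DERIV_mult[OF du(1) DERIV_diff[OF DERIV_mult[OF d0(2) d1(3)] DERIV_mult[OF d0(3) d1(2)]]]]
      show ?thesis unfolding \<Delta>_def[abs_def] by (rule DERIV_cong[OF D]) (rule wronskian_identity)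
    qed
    then obtain \<delta> where \<delta>: "\<And>z. z \<in> S \<Longrightarrow> \<Delta> z = \<delta>" using const[of \<Delta>] by blast
    have dp: "(p has_field_derivative - \<delta> * e1 z) (at z)" and dq: "(q has_field_derivative \<delta> * e0 z) (at z)" if z: "z \<in> S" for z
    proof -
      note du = jets[OF u z] and d0 = jets[OF s0 z] and d1 = jets[OF s1 z]
      have zb: "z \<in> ball 0 r - {0}" using z Sb by blast
      have dW: "(W has_field_derivative (deriv y0 z * deriv y1 z + deriv (deriv y1) z * y0 z
          - (deriv (deriv y0) z * y1 z + deriv y1 z * deriv y0 z))) (at z)"
        unfolding W_def[abs_def] by (rule DERIV_diff[OF DERIV_mult[OF d0(1) d1(2)] DERIV_mult[OF d0(2) d1(1)]])
      have Wz: "W z \<noteq> 0" by (rule Wr[OF zb])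
      show "(p has_field_derivative - \<delta> * e1 z) (at z)"
        unfolding p_def[abs_def]
      proof (rule DERIV_cong[OF DERIV_divide[OF DERIV_diff[OF DERIV_mult[OF du(1) d1(2)] DERIV_mult[OF du(2) d1(1)]] dW Wz]])
        show "((deriv u z * deriv y1 z + deriv (deriv y1) z * u z - (deriv (deriv u) z * y1 z + deriv y1 z * deriv u z)) * W z
            - (u z * deriv y1 z - deriv u z * y1 z) * (deriv y0 z * deriv y1 z + deriv (deriv y1) z * y0 z
              - (deriv (deriv y0) z * y1 z + deriv y1 z * deriv y0 z))) / (W z * W z) = - \<delta> * e1 z"
          unfolding e1(2)[OF zb] \<delta>[OF z, symmetric] using Wz
          by (simp add: divide_simps) (unfold W_def \<Delta>_def, simp add: algebra_simps)
      qed
      show "(q has_field_derivative \<delta> * e0 z) (at z)"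
        unfolding q_def[abs_def]
      proof (rule DERIV_cong[OF DERIV_divide[OF DERIV_diff[OF DERIV_mult[OF du(2) d0(1)] DERIV_mult[OF du(1) d0(2)]] dW Wz]])
        show "((deriv (deriv u) z * y0 z + deriv y0 z * deriv u z - (deriv u z * deriv y0 z + deriv (deriv y0) z * u z)) * W z
            - (deriv u z * y0 z - u z * deriv y0 z) * (deriv y0 z * deriv y1 z + deriv (deriv y1) z * y0 z
              - (deriv (deriv y0) z * y1 z + deriv y1 z * deriv y0 z))) / (W z * W z) = \<delta> * e0 z"
          unfolding e0(2)[OF zb] \<delta>[OF z, symmetric] using Wz
          by (simp add: divide_simps) (unfold W_def \<Delta>_def, simp add: algebra_simps)
      qed
    qed
    have "((\<lambda>z. p z + \<delta> * E1 z) has_field_derivative 0) (at z)" "((\<lambda>z. q z - \<delta> * E0 z) has_field_derivative 0) (at z)" if z: "z \<in> S" for z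
    proof -
      have zb: "z \<in> ball 0 r" using z Sb by blast
      show "((\<lambda>z. p z + \<delta> * E1 z) has_field_derivative 0) (at z)"
        using DERIV_add[OF dp[OF z] DERIV_cmult[OF E1[OF zb], of \<delta>]] by simp
      show "((\<lambda>z. q z - \<delta> * E0 z) has_field_derivative 0) (at z)"
        using DERIV_diff[OF dq[OF z] DERIV_cmult[OF E0[OF zb], of \<delta>]] by simp
    qed
    then obtain cp cq where cpq: "\<And>z. z \<in> S \<Longrightarrow> p z + \<delta> * E1 z = cp" "\<And>z. z \<in> S \<Longrightarrow> q z - \<delta> * E0 z = cq"
      using const[of "\<lambda>z. p z + \<delta> * E1 z"] const[of "\<lambda>z. q z - \<delta> * E0 z"] by blast
    define f where "f z = (cp - \<delta> * E1 z) * y0 z + (cq + \<delta> * E0 z) * y1 z" for z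
    have "f meromorphic_on ball 0 r" unfolding f_def[abs_def] by (intro meromorphic_intros Emero ymero)
    moreover have "f z = u z" if z: "z \<in> S" for z
    proof -
      have Wz: "W z \<noteq> 0" using Wr z Sb by blast
      have "f z = p z * y0 z + q z * y1 z"
        unfolding f_def cpq(1)[OF z, symmetric] cpq(2)[OF z, symmetric] by simp
      also have "\<dots> = ((u z * deriv y1 z - deriv u z * y1 z) * y0 z + (deriv u z * y0 z - u z * deriv y0 z) * y1 z) / W z"
        by (simp add: p_def q_def add_divide_distrib)
      also have "(u z * deriv y1 z - deriv u z * y1 z) * y0 z + (deriv u z * y0 z - u z * deriv y0 z) * y1 z = u z * W z"
        unfolding W_def by (simp add: algebra_simps)
      finally show ?thesis using Wz by simp
    qed
    ultimately show ?thesis by blast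
  qed
  thus ?thesis unfolding apparent_def using r unfolding S_def by blast
qed

lemma solution_basis_coeff_eq:
  assumes y: "solution_basis \<tau> n l B y" and eq: "\<And>z. z \<notin> L \<Longrightarrow> (\<Sum>k\<in>UNIV. c $h k * y k z) = (\<Sum>k\<in>UNIV. d $h k * y k z)"
  shows "c = d"
proof -
  have "\<forall>z\<in>- L. (\<Sum>k\<in>UNIV. (c $h k - d $h k) * y k z) = 0"
    using eq by (simp add: left_diff_distrib sum_subtractf)
  hence "\<forall>k. c $h k - d $h k = 0"
    using y unfolding solution_basis_def by (elim conjE allE[of _ "\<lambda>k. c $h k - d $h k"] impE) auto
  thus ?thesis by (simp add: Finite_Cartesian_Product.vec_eq_iff)
qed

lemma solution_basis_shift:
  assumes y: "solution_basis \<tau> n l B y" and N: "monodromy_matrix \<tau> y v N"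
    and c: "\<And>z. z \<notin> L \<Longrightarrow> f z = (\<Sum>k\<in>UNIV. c $h k * y k z)" and z: "z \<notin> L" "z + v \<notin> L"
  shows "f (z + v) = (\<Sum>k\<in>UNIV. (N *v c) $h k * y k z)"
proof -
  have "y k (z + v) = (\<Sum>i\<in>UNIV. y i z * N $h i $h k)" for k
  proof -
    have "(\<chi> k. y k (z + v)) $h k = ((\<chi> k. y k z) v* N) $h k" using N z(1) by (simp add: monodromy_matrix_def)
    thus ?thesis by (simp add: vector_matrix_mult_def)
  qed
  thus ?thesis unfolding c[OF z(2)] by (simp add: matrix_vector_mult_def sum_3 algebra_simps)
qed

text \<open>The even solutions are elliptic. An odd solution is multiplied by a sign under each period, up to an elliptic
  summand that unitarity kills; its modulus is then doubly periodic, and it vanishes at the origin.\<close>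
lemma not_unitary_odd_l:
  assumes "odd n" "odd l" "poly (frobP n l wu wv) B = 0"
  shows "\<not> unitary_monodromy \<tau> n l B"
proof
  assume "unitary_monodromy \<tau> n l B"
  then obtain N1 N2 y where y: "solution_basis \<tau> n l B y" and N: "monodromy_matrix \<tau> y 1 N1" "monodromy_matrix \<tau> y \<tau> N2"
    and SU: "carrier (monodromy_group N1 N2) \<subseteq> SU3" unfolding unitary_monodromy_def monodromy_matrices_def by blast
  have "N1 \<in> SU3" "N2 \<in> SU3" using SU by (auto simp: monodromy_group_def intro: generate.incl)
  hence U: "(\<chi> i j. cnj (N1 $h j $h i)) ** N1 = Finite_Cartesian_Product.mat 1"
    "(\<chi> i j. cnj (N2 $h j $h i)) ** N2 = Finite_Cartesian_Product.mat 1" by (simp_all add: SU3_def)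
  obtain y0 Y0 y1 Y1 where y0: "global_solution \<tau> n l B y0" "quasi_elliptic \<tau> 1 1 1 y0 Y0" "Y0 \<noteq> 0" "fls_subdegree Y0 = - int (n + l)"
    and y1: "global_solution \<tau> n l B y1" "quasi_elliptic \<tau> 1 1 1 y1 Y1" "Y1 \<noteq> 0" "fls_subdegree Y1 = 1 - int l"
    using solutions_odd_l[OF assms] by blast
  define s0 where "s0 = - int (n + l)"
  define s1 where "s1 = 1 - int l"
  define s2 where "s2 = int (n + 2 * l + 2)"
  have par: "even s0" "even s1" "odd s2" using assms(1,2) by (simp_all add: s0_def s1_def s2_def)
  have lt: "s0 < s1" "s2 > 0" by (simp_all add: s0_def s1_def s2_def)
  have eq0: "f z = 0" if "global_solution \<tau> n l B f" "f has_laurent_expansion F" "F $$ s0 = 0" "F $$ s1 = 0" "F $$ s2 = 0" "z \<notin> L" for f F z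
    using global_solution_eq_0[OF that(1,2)] that(3-6) by (simp add: s0_def s1_def s2_def)
  \<comment> \<open>Subtracting multiples of \<open>y0\<close> and \<open>y1\<close> removes the
    coefficients at the two even exponents, and evenness removes the one at the odd exponent. So
    every even solution is a combination of two elliptic ones.\<close>
  have even_ell: "h (z + 1) = h z \<and> h (z + \<tau>) = h z"
    if h: "global_solution \<tau> n l B h" "\<And>z. z \<notin> L \<Longrightarrow> h (- z) = h z" and z: "z \<notin> L" for h z
  proof -
    obtain H where H: "h has_laurent_expansion H" using global_solution_laurent[OF h(1)] .
    have lead: "Y0 $$ s0 \<noteq> 0" "Y1 $$ s1 \<noteq> 0" "Y1 $$ s0 = 0"
      using y0(3,4) y1(3,4) lt(1) nth_fls_subdegree_zero_iff[of Y0] nth_fls_subdegree_zero_iff[of Y1]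
      by (simp_all add: s0_def s1_def)
    define c0 where "c0 = H $$ s0 / Y0 $$ s0"
    define c1 where "c1 = (H $$ s1 - c0 * Y0 $$ s1) / Y1 $$ s1"
    define g where "g z = 1 * h z + (- 1) * (c0 * y0 z + c1 * y1 z)" for z
    define G where "G = fls_const 1 * H + fls_const (- 1) * (fls_const c0 * Y0 + fls_const c1 * Y1)"
    have g: "global_solution \<tau> n l B g"
      unfolding g_def[abs_def] by (intro global_solution_lincomb h y0 y1)
    have lau: "y0 has_laurent_expansion Y0" "y1 has_laurent_expansion Y1" using y0(2) y1(2) by (simp_all add: quasi_elliptic_def)
    have G: "g has_laurent_expansion G"
      unfolding g_def[abs_def] G_def by (intro laurent_expansion_intros H lau)
    have "H $$ s2 = 0" by (rule laurent_parity_lattice[OF H, of 0]) (use h(2) par in auto)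
    moreover have "Y0 $$ s2 = 0" "Y1 $$ s2 = 0"
      using quasi_parity[of 1 1 0 y0 Y0 s2] quasi_parity[of 1 1 0 y1 Y1 s2] y0(2) y1(2) par by simp_all
    ultimately have "g w = 0" if "w \<notin> L" for w
      by (intro eq0[OF g G _ _ _ that]) (use lead in \<open>simp_all add: G_def c0_def c1_def\<close>)
    note g0 = this
    have hw: "h w = c0 * y0 w + c1 * y1 w" if "w \<notin> L" for w 
    proof -
      have "h w - (c0 * y0 w + c1 * y1 w) = g w" by (simp add: g_def)
      thus ?thesis unfolding g0[OF that] right_minus_eq .
    qed
    show ?thesis using z y0(2) y1(2) by (simp add: hw quasi_elliptic_def)
  qed
  \<comment> \<open>Were the whole basis even, every coefficient at the odd exponent would vanish,
    and the two even exponents would leave a nontrivial combination of the three functions that is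
    zero.\<close>
  obtain f zf where f: "global_solution \<tau> n l B f" "\<And>z. f (- z) = - f z" and zf: "zf \<notin> L" "f zf \<noteq> 0"
  proof -
    have "\<exists>k z. z \<notin> L \<and> y k (- z) \<noteq> y k z"
    proof (rule ccontr)
      assume "\<not> ?thesis"
      hence ev: "y k (- z) = y k z" if "z \<notin> L" for k z using that by blast
      have ysol: "global_solution \<tau> n l B (y k)" for k using y by (simp add: solution_basis_def)
      have "\<exists>Y. y k has_laurent_expansion Y" for k using global_solution_laurent[OF ysol[of k]] by blast
      then obtain Y where Y: "\<And>k. y k has_laurent_expansion Y k" by metis
      define e where "e i = (if i = 0 then s0 else s1)" for i :: nat
      obtain c where c: "\<exists>j\<in>(UNIV :: 3 set). c j \<noteq> 0" "\<forall>i\<in>{..<2 :: nat}. (\<Sum>j\<in>UNIV. Y j $$ e i * c j) = 0"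
        using homogeneous_system_nontrivial[of "{..<2 :: nat}" "UNIV :: 3 set" "\<lambda>i j. Y j $$ e i"] by auto
      define g where "g z = (\<Sum>k\<in>UNIV. c k * y k z)" for z
      define G where "G = (\<Sum>k\<in>UNIV. fls_const (c k) * Y k)"
      have g: "global_solution \<tau> n l B g" unfolding g_def[abs_def]
        by (rule global_solution_sum[OF ysol open_compl_lattice])
      have G: "g has_laurent_expansion G" unfolding g_def[abs_def] G_def by (intro laurent_expansion_intros Y)
      have Gk: "G $$ k = (\<Sum>j\<in>UNIV. Y j $$ k * c j)" for k by (simp add: G_def fls_nth_sum mult.commute)
      have "Y k $$ s2 = 0" for k by (rule laurent_parity_lattice[OF Y, of _ 0]) (use ev par in auto)
      hence "G $$ s2 = 0" by (simp add: Gk)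
      moreover have "G $$ s0 = 0" "G $$ s1 = 0"
        using bspec[OF c(2), of 0] bspec[OF c(2), of 1] by (simp_all add: Gk e_def)
      ultimately have "\<forall>z\<in>- L. g z = 0" using eq0[OF g G] by blast
      hence "\<forall>k. c k = 0" using y unfolding solution_basis_def g_def by blast
      thus False using c(1) by blast
    qed
    then obtain k z where kz: "z \<notin> L" "y k (- z) \<noteq> y k z" by blast
    have ysol: "global_solution \<tau> n l B (y k)" using y by (simp add: solution_basis_def)
    show thesis
      by (rule that[of "\<lambda>z. 1 * y k z + (- 1) * y k (- z)" z])
        (use kz global_solution_lincomb[OF ysol global_solution_uminus[OF ysol], of 1 "- 1"] in auto)
  qed
  obtain F where F: "f has_laurent_expansion F" "Dop n l B (wpF wu wv) F = 0" using global_solution_laurent[OF f(1)] .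
  have odd_zero: "G $$ s0 = 0" "G $$ s1 = 0" if "g has_laurent_expansion G" "\<And>z. z \<notin> L \<Longrightarrow> g (- z) = - g z" for g G
    by (rule laurent_parity_lattice[OF that(1), of 1]; use that(2) par in simp)+
  have Fs2: "F $$ s2 \<noteq> 0" using eq0[OF f(1) F(1) odd_zero[OF F(1) f(2)]] zf by blast
  have key: "norm (f (z + v)) = norm (f z)"
    if v: "v \<in> {1, \<tau>}" and Nv: "monodromy_matrix \<tau> y v Nv" "(\<chi> i j. cnj (Nv $h j $h i)) ** Nv = Finite_Cartesian_Product.mat 1"
      and z: "z \<notin> L" for v Nv z
  proof -
    have vL: "v \<in> L" using v by auto
    note fv = global_solution_shift[OF f(1) v]
    \<comment> \<open>Odd and even part of the shifted solution. The odd part is a multiple of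
      \<open>f\<close>, since an odd solution is determined by its coefficient at the third
      exponent; the even part is elliptic.\<close>
    define od where "od z = (1 / 2) * f (z + v) + (- 1 / 2) * f (- z + v)" for z
    define h where "h z = (1 / 2) * f (z + v) + (1 / 2) * f (- z + v)" for z
    have od: "global_solution \<tau> n l B od" and h: "global_solution \<tau> n l B h"
      unfolding od_def[abs_def] h_def[abs_def] by (intro global_solution_lincomb fv global_solution_uminus[OF fv])+
    have odd: "od (- z) = - od z" and ev: "h (- z) = h z" for z by (simp_all add: od_def h_def)
    obtain OD where OD: "od has_laurent_expansion OD" using global_solution_laurent[OF od] .
    define \<mu> where "\<mu> = OD $$ s2 / F $$ s2"
    have odf: "od w = \<mu> * f w" if "w \<notin> L" for w
    proof -
      have "1 * od w + (- \<mu>) * f w = 0"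
      proof (rule eq0[OF global_solution_lincomb[OF od f(1)] _ _ _ _ that])
        show "(\<lambda>w. 1 * od w + (- \<mu>) * f w) has_laurent_expansion fls_const 1 * OD + fls_const (- \<mu>) * F"
          by (intro laurent_expansion_intros OD F)
      qed (use odd_zero[OF OD odd] odd_zero[OF F(1) f(2)] Fs2 in \<open>simp_all add: \<mu>_def\<close>)
      thus ?thesis by simp
    qed
    have fh: "f (w + v) = \<mu> * f w + h w" if "w \<notin> L" for w
    proof -
      have "f (w + v) = od w + h w" by (simp add: od_def h_def field_simps)
      thus ?thesis using odf[OF that] by simp
    qed
    have hv: "h (w + v) = h w" if "w \<notin> L" for w using even_ell[OF h ev that] v by auto
    \<comment> \<open>The shift by \<open>v\<close> takes \<open>- (w + v)\<close> to
      \<open>- w\<close>, where oddness gives \<open>- f w\<close>. The resulting identity equates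
      an odd function with an even one, so both sides vanish and \<open>\<mu>\<close> is a
      sign.\<close>
    have rel: "(1 - \<mu>\<^sup>2) * f w = (\<mu> - 1) * h w" if w: "w \<notin> L" for w
    proof -
      have wv: "w + v \<notin> L" "- (w + v) \<notin> L" using w vL by simp_all
      have "f (- (w + v) + v) = \<mu> * f (- (w + v)) + h (- (w + v))" by (rule fh[OF wv(2)])
      hence "- f w = - \<mu> * f (w + v) + h w" using f(2)[of w] f(2)[of "w + v"] ev[of "w + v"] hv[OF w] by simp
      thus ?thesis unfolding fh[OF w] by (simp add: power2_eq_square algebra_simps)
    qed
    have "(1 - \<mu>\<^sup>2) * f zf = (\<mu> - 1) * h zf" by (rule rel[OF zf(1)])
    also have "\<dots> = - ((1 - \<mu>\<^sup>2) * f zf)" using rel[of "- zf"] zf(1) f(2)[of zf] ev[of zf] by simp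
    finally have "(1 - \<mu>\<^sup>2) * f zf + (1 - \<mu>\<^sup>2) * f zf = 0" by (simp only: eq_neg_iff_add_eq_0)
    hence "2 * ((1 - \<mu>\<^sup>2) * f zf) = 0" by (simp only: mult_2)
    hence mu: "\<mu>\<^sup>2 = 1" using zf(2) by simp
    hence mu1: "\<mu> = 1 \<or> \<mu> = - 1" by (simp add: power2_eq_1_iff)
    \<comment> \<open>For \<open>\<mu> = 1\<close> the shift sends \<open>f\<close> to
      \<open>f + h\<close> and fixes \<open>h\<close>, a unipotent block excluded by unitarity. For
      \<open>\<mu> = - 1\<close> the relation above already gives \<open>h = 0\<close>.\<close>
    have "h w = 0" if w: "w \<notin> L" for w
    proof (cases "\<mu> = 1")
      case True
      obtain c' where "\<forall>z\<in>- L. f z = (\<Sum>k\<in>UNIV. c' k * y k z)" using y f(1) unfolding solution_basis_def by blast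
      hence c: "\<And>z. z \<notin> L \<Longrightarrow> f z = (\<Sum>k\<in>UNIV. (\<chi> k. c' k) $h k * y k z)" by simp
      obtain d' where "\<forall>z\<in>- L. h z = (\<Sum>k\<in>UNIV. d' k * y k z)" using y h unfolding solution_basis_def by blast
      hence d: "\<And>z. z \<notin> L \<Longrightarrow> h z = (\<Sum>k\<in>UNIV. (\<chi> k. d' k) $h k * y k z)" by simp
      define c where "c = (\<chi> k. c' k)"
      define d where "d = (\<chi> k. d' k)"
      note c = c[folded c_def] and d = d[folded d_def]
      have "Nv *v c = c + d"
      proof (rule solution_basis_coeff_eq[OF y])
        fix z assume z: "z \<notin> L"
        have zv: "z + v \<notin> L" using z vL by simp
        have "(\<Sum>k\<in>UNIV. (Nv *v c) $h k * y k z) = f (z + v)"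
          by (rule solution_basis_shift[OF y Nv(1) c z zv, symmetric])
        also have "\<dots> = f z + h z" using fh[OF z] True by simp
        also have "\<dots> = (\<Sum>k\<in>UNIV. (c + d) $h k * y k z)" unfolding c[OF z] d[OF z] by (simp add: sum.distrib distrib_right)
        finally show "(\<Sum>k\<in>UNIV. (Nv *v c) $h k * y k z) = (\<Sum>k\<in>UNIV. (c + d) $h k * y k z)" .
      qed
      moreover have "Nv *v d = d"
      proof (rule solution_basis_coeff_eq[OF y])
        fix z assume z: "z \<notin> L"
        have zv: "z + v \<notin> L" using z vL by simp
        have "(\<Sum>k\<in>UNIV. (Nv *v d) $h k * y k z) = h (z + v)"
          by (rule solution_basis_shift[OF y Nv(1) d z zv, symmetric])
        thus "(\<Sum>k\<in>UNIV. (Nv *v d) $h k * y k z) = (\<Sum>k\<in>UNIV. d $h k * y k z)" using hv[OF z] d[OF z] by simp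
      qed
      ultimately have "d = 0" by (rule unitary_unipotent[OF Nv(2)])
      thus ?thesis using d[OF w] by simp
    next
      case False
      thus ?thesis using rel[OF w] mu by simp
    qed
    hence "f (z + v) = \<mu> * f z" using fh[OF z] z by simp
    thus ?thesis using mu1 by auto
  qed
  \<comment> \<open>Oddness rules out the two even exponents, so \<open>f\<close> starts at the
    positive third one and is regular at the origin.\<close>
  have Fneg: "F $$ k = 0" if "k < 0" for k
  proof -
    have Fnz: "F \<noteq> 0" using Fs2 by auto
    have "F $$ fls_subdegree F \<noteq> 0" using Fnz by simp
    hence "fls_subdegree F \<noteq> s0" "fls_subdegree F \<noteq> s1" using odd_zero[OF F(1) f(2)] by auto
    hence "fls_subdegree F = s2" using exponent_of_solution[OF F(2) Fnz] by (auto simp: s0_def s1_def s2_def)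
    thus ?thesis using that lt(2) by (intro fls_zero_below_subdegree) simp
  qed
  obtain c where c: "\<And>z. z \<notin> L \<Longrightarrow> f z = c"
    by (rule lattice_liouville[OF global_solution_holomorphic[OF f(1)] _ _ F(1) Fneg])
      (use key[of 1 N1] key[of \<tau> N2] N U in auto)
  have "c = - c" using c[OF zf(1)] c[of "- zf"] zf(1) f(2)[of zf] by simp
  thus False using c[OF zf(1)] zf(2) by simp
qed

end

theorem theorem1p3:
  fixes n l :: nat
  assumes "n \<ge> 1" and "odd n"
  shows "\<exists>P :: complex \<Rightarrow> complex poly.
    (\<forall>\<tau>. Im \<tau> > 0 \<longrightarrow>
       degree (P \<tau>) = (n + 1) div 2 \<and>
       (\<forall>B. apparent \<tau> n l B \<longleftrightarrow> poly (P \<tau>) B = 0) \<and>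
       (\<forall>B. poly (P \<tau>) B = 0 \<longrightarrow>
          (odd l \<longrightarrow> \<not> unitary_monodromy \<tau> n l B) \<and>
          (even l \<longrightarrow> monodromy_group_is_K4 \<tau> n l B \<and> unitary_monodromy \<tau> n l B))) \<and>
    (let E = {\<tau>. Im \<tau> > 0 \<and> card {B. poly (P \<tau>) B = 0} \<noteq> (n + 1) div 2} in
       finite (E // SL2Z_equiv) \<and>
       int (card (E // SL2Z_equiv)) \<le> \<lceil>((real n)\<^sup>2 - 1) / 24\<rceil>)"
proof -
  define P where "P \<tau> = frobP n l (weierstrass_lattice.wu \<tau>) (weierstrass_lattice.wv \<tau>)" for \<tau>
  show ?thesis
  proof (rule exI[of _ P], intro conjI allI impI)
    fix \<tau> B :: complex
    assume "Im \<tau> > 0"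
    then interpret weierstrass_lattice \<tau> by unfold_locales
    show "degree (P \<tau>) = (n + 1) div 2" unfolding P_def by (rule degree_frobP[OF assms(2)])
    show "apparent \<tau> n l B \<longleftrightarrow> poly (P \<tau>) B = 0"
    proof
      assume "poly (P \<tau>) B = 0"
      hence P: "poly (frobP n l wu wv) B = 0" by (simp only: P_def)
      show "apparent \<tau> n l B"
      proof (cases "even l")
        case True
        show ?thesis by (rule solution_basis_even_l[OF assms(2) True P]) (rule solution_basis_imp_apparent)
      qed (rule apparent_odd_l[OF assms(2) _ P])
    qed (simp add: P_def apparent_imp_root assms(2))
    assume "poly (P \<tau>) B = 0"
    hence P: "poly (frobP n l wu wv) B = 0" by (simp only: P_def)
    show "\<not> unitary_monodromy \<tau> n l B" if "odd l" by (rule not_unitary_odd_l[OF assms(2) that P])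
    show "monodromy_group_is_K4 \<tau> n l B" "unitary_monodromy \<tau> n l B" if "even l"
      using monodromy_even_l[OF assms(2) that P] by blast+
  next
    show "let E = {\<tau>. Im \<tau> > 0 \<and> card {B. poly (P \<tau>) B = 0} \<noteq> (n + 1) div 2} in
       finite (E // SL2Z_equiv) \<and> int (card (E // SL2Z_equiv)) \<le> \<lceil>((real n)\<^sup>2 - 1) / 24\<rceil>"
      using card_disc_classes[OF assms(2), of l] unfolding Let_def P_def disc_eq_0_iff[OF assms(2)] by blast
  qed
qed

end
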